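(* Let $a,c\in\mathbb{Z}$ with $\gcd(a,c)=1$, so that $\frac{a}{c}\in\mathbb{Q}\mathbb{P}^1$. Then there exists a matrix $A=\begin{pmatrix} a & b\\ c & d\end{pmatrix}$ (with $b,d\in\mathbb{Z}$) whose class in $\Gamma=\mathrm{PSL}_2(\mathbb{Z})$ lies in the derived subgroup $\Gamma'$; write its class in $\Gamma'/\Gamma''$ as $A\equiv X^mY^n \bmod \Gamma''$ with $m,n\in\mathbb{Z}$. Let $$C=\frac{2^{10/3}}{3^{3/4}}\,\frac{\pi^{5/2}}{\Gamma(1/3)^3},\qquad |\omega_0|=\frac{2\pi^{1/2}}{3^{1/4}}.$$ Then the improper integral $\int_{\infty}^{a/c} C\,\eta^4(z)\,dz$ (the limit of $\int_{i\infty}^{\tau} C\eta^4(z)\,dz$ as $\tau\in\mathbb{H}$ tends to $a/c$) and the series $$\frac{12C}{i\pi}\sum_{n=1}^{\infty}\frac{\psi(n)}{n}\exp\!\left(\frac{i\pi}{12}\,\frac{a}{c}\,n\right)$$ converge (the series conditionally), they are equal, and their common value $\partial\mathrm{hexp}(a/c)$ satisfies $$\partial\mathrm{hexp}\!\left(\tfrac{a}{c}\right)=|\omega_0|\left(m\,e^{-i\pi/6}+n\,e^{+i\pi/6}\right).$$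
   Context: $\mathbb{H}=\{z\in\mathbb{C}:\Im z>0\}$ and $\Gamma=\mathrm{PSL}_2(\mathbb{Z})$ acts on it by Möbius transformations. Let $L=\begin{pmatrix}1&0\\1&1\end{pmatrix}$, $R=\begin{pmatrix}1&1\\0&1\end{pmatrix}$, $X=LR=\begin{pmatrix}1&1\\1&2\end{pmatrix}$, $Y=RL=\begin{pmatrix}2&1\\1&1\end{pmatrix}$. The derived subgroup $\Gamma'=[\Gamma,\Gamma]$ is freely generated by $X$ and $Y$; $\Gamma''=[\Gamma',\Gamma']$ is its derived subgroup, so $\Gamma'/\Gamma''\cong\mathbb{Z}^2$ is free abelian on the classes of $X$ and $Y$. $\eta(\tau)=q^{1/24}\prod_{k\ge1}(1-q^k)$ with $q=e^{2\pi i\tau}$ is the Dedekind eta function, and the integers $\psi(n)$ are defined by the expansion $\eta^4(\tau)=\sum_{n\ge0}\psi(n)\,q^{n/24}$ (equivalently $\psi(n)=\sum\chi(abcd)$ over $(a,b,c,d)\in\mathbb{N}^4$ with $a^2+b^2+c^2+d^2=n$, where $\chi$ is the primitive Dirichlet character mod $12$). $\Gamma(1/3)$ denotes the Euler Gamma function at $1/3$. The map $\mathrm{hexp}(\tau)=\int_{\infty}^{\tau}C\eta^4(z)\,dz$ on $\mathbb{H}$ has expansion $\frac{12C}{i\pi}\sum_{n\ge1}\frac{\psi(n)}{n}q^{n/24}$.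
   Formalization: "τ tends to a/c" is taken in the horoball topology at the cusp (the unrestricted Euclidean limit does not exist); for c=0 the exponential terms of the series are read as 0, and non-absolute convergence is claimed only for c≠0. *)

theory Defs
  imports "HOL-Complex_Analysis.Complex_Analysis" "HOL-Algebra.Algebra"
begin

section \<open>The modular group, its derived subgroups, and the matrices \<open>X\<close>, \<open>Y\<close>\<close>

definition mat2 :: "int \<Rightarrow> int \<Rightarrow> int \<Rightarrow> int \<Rightarrow> int^2^2" where
  "mat2 a b c d = vector [vector [a, b], vector [c, d]]"

definition SL2Z :: "(int^2^2) monoid" where
  "SL2Z = \<lparr>carrier = {A. det A = 1}, mult = (**), one = mat 1\<rparr>"

definition PSL2Z :: "(int^2^2) set monoid" where
  "PSL2Z = SL2Z Mod {mat 1, - mat 1}"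

definition psl_class :: "int^2^2 \<Rightarrow> (int^2^2) set" where
  "psl_class A = {mat 1, - mat 1} #>\<^bsub>SL2Z\<^esub> A"

definition PSL2Z' :: "(int^2^2) set set" where
  "PSL2Z' = derived PSL2Z (carrier PSL2Z)"

definition PSL2Z'' :: "(int^2^2) set set" where
  "PSL2Z'' = derived PSL2Z PSL2Z'"

definition matL :: "int^2^2" where "matL = mat2 1 0 1 1"
definition matR :: "int^2^2" where "matR = mat2 1 1 0 1"
definition matX :: "int^2^2" where "matX = matL ** matR"
definition matY :: "int^2^2" where "matY = matR ** matL"

definition congruent_XY :: "int^2^2 \<Rightarrow> int \<Rightarrow> int \<Rightarrow> bool" where
  "congruent_XY A m n \<longleftrightarrow>
     PSL2Z'' #>\<^bsub>PSL2Z\<^esub> psl_class A =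
     PSL2Z'' #>\<^bsub>PSL2Z\<^esub>
       ((psl_class matX [^]\<^bsub>PSL2Z\<^esub> m) \<otimes>\<^bsub>PSL2Z\<^esub> (psl_class matY [^]\<^bsub>PSL2Z\<^esub> n))"


section \<open>The eta function and the coefficients of its fourth power\<close>

definition dedekind_eta :: "complex \<Rightarrow> complex" where
  "dedekind_eta \<tau> = exp (2 * of_real pi * \<i> * \<tau> / 24) *
     prodinf (\<lambda>k. 1 - exp (2 * of_real pi * \<i> * \<tau>) ^ Suc k)"

definition psi :: "nat \<Rightarrow> int" where
  "psi = (THE f. \<forall>\<tau>. Im \<tau> > 0 \<longrightarrow>
     (\<lambda>n. of_int (f n) * exp (2 * of_real pi * \<i> * \<tau> * of_nat n / 24)) sums
       (dedekind_eta \<tau> ^ 4))"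


section \<open>The constants\<close>

definition C_hexp :: real where
  "C_hexp = (2 powr (10/3) / 3 powr (3/4)) * (pi powr (5/2) / Gamma (1/3) ^ 3)"

definition abs_omega0 :: real where
  "abs_omega0 = 2 * pi powr (1/2) / 3 powr (1/4)"


section \<open>Cusps and the integral\<close>

text \<open>
  Neighbourhoods of the cusp \<open>a/c\<close> (with \<open>a\<close>, \<open>c\<close> coprime; \<open>c = 0\<close> is the cusp \<open>\<infinity>\<close>) in the
  usual topology of the extended upper half-plane: the horoballs
  \<open>Im (A\<^sup>-\<^sup>1 \<tau>) = Im \<tau> / |c \<tau> - a|\<^sup>2 > M\<close>, where \<open>A\<close> has first column \<open>(a, c)\<close>.
  For \<open>c \<noteq> 0\<close> every approach to the real number \<open>a/c\<close> inside a sector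
  \<open>|\<tau> - a/c| \<le> K * Im \<tau>\<close>, in particular the vertical one, converges along this filter.  The
  Euclidean filter \<open>at (a/c) within {\<tau>. Im \<tau> > 0}\<close> would be wrong: along a horocycle at \<open>a/c\<close>
  the integral of \<open>\<eta>\<^sup>4\<close> does not converge.
\<close>
definition at_cusp :: "int \<Rightarrow> int \<Rightarrow> complex filter" where
  "at_cusp a c =
     filtercomap (\<lambda>\<tau>. Im \<tau> / (cmod (of_int c * \<tau> - of_int a))\<^sup>2) at_top"

definition hexp_integrand :: "complex \<Rightarrow> complex" where
  "hexp_integrand z = of_real C_hexp * dedekind_eta z ^ 4"

definition hexp :: "complex \<Rightarrow> complex" where
  "hexp \<tau> = Lim (at_cusp 1 0) (\<lambda>z. contour_integral (linepath z \<tau>) hexp_integrand)"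

definition dhexp :: "int \<Rightarrow> int \<Rightarrow> complex" where
  "dhexp a c = Lim (at_cusp a c) hexp"

text \<open>
  The value of \<open>q^(n/24)\<close> at the cusp \<open>a/c\<close> for \<open>n \<ge> 1\<close>; at the cusp \<open>\<infinity>\<close> it is the limit \<open>0\<close>.
\<close>
definition q24_cusp :: "int \<Rightarrow> int \<Rightarrow> nat \<Rightarrow> complex" where
  "q24_cusp a c n =
     (if c = 0 then 0
      else exp (\<i> * of_real pi / 12 * (of_int a / of_int c) * of_nat n))"

text \<open>The terms are indexed from \<open>0\<close>, so the summation index of the series is \<open>Suc k\<close>.\<close>
definition dhexp_term :: "int \<Rightarrow> int \<Rightarrow> nat \<Rightarrow> complex" where
  "dhexp_term a c k =
     (12 * of_real C_hexp / (\<i> * of_real pi)) *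
     (of_int (psi (Suc k)) / of_nat (Suc k) * q24_cusp a c (Suc k))"

end

theory Submission
  imports Defs "HOL-Probability.Characteristic_Functions"
begin

text \<open>
  Let \<open>F\<close> be the power series of the statement on the upper half-plane (\<open>hexpF\<close>), so that
  \<open>F' = C \<eta>\<^sup>4\<close>.  All exponents occurring in \<open>F\<close> are congruent to \<open>4\<close> modulo \<open>24\<close>, hence
  \<open>F(\<tau> + 1) = \<zeta> F(\<tau>)\<close> with \<open>\<zeta> = e\<^sup>i\<^sup>\<pi>\<^sup>/\<^sup>3\<close>, and the inversion formula of \<open>\<eta>\<close> gives \<open>F(-1/\<tau>) = s - F(\<tau>)\<close>.
  So \<open>X\<close> and \<open>Y\<close> translate \<open>F\<close> by \<open>\<zeta> s\<close> and \<open>\<zeta>\<^sup>2 s\<close>, commutators of elements of \<open>\<Gamma>'\<close> leave it invariant,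
  and an element \<open>A \<equiv> X\<^sup>m Y\<^sup>n\<close> with first column \<open>(a, c)\<close> moves the cusp \<open>\<infinity>\<close>, where \<open>F\<close> vanishes, to \<open>a/c\<close>:
  the boundary value is \<open>m \<zeta> s + n \<zeta>\<^sup>2 s\<close>.

  The constant \<open>s\<close> is the value of \<open>F\<close> at the cusp \<open>0\<close>.  On the imaginary axis the modular function
  \<open>\<lambda>\<close> built from theta constants turns the integral of \<open>\<eta>\<^sup>4\<close> into the Beta integral \<open>B(1/3, 1/3)\<close>.

  At \<open>a/c\<close> the vertical limit of \<open>F\<close> is the Abel sum of the series.  By Tauber's second theorem the series
  converges once \<open>\<Sum>n\<le>N. \<psi>(n) w\<^sup>n = o(N)\<close> for roots of unity \<open>w\<close>.  The products for \<open>\<eta>\<close> and \<open>\<eta>\<^sup>3\<close> give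
  \<open>\<psi>(n) = \<Sum> \<chi>\<^sub>1\<^sub>2(x) \<chi>\<^sub>4(y) y\<close> over \<open>x\<^sup>2 + 3 y\<^sup>2 = n\<close>, and since \<open>\<chi>\<^sub>4(y) w^(3 y\<^sup>2)\<close> is odd and periodic, the bound
  reduces to the equidistribution of \<open>\<lfloor>\<surd>((N - x\<^sup>2)/3)\<rfloor>\<close> in residue classes, a consequence of
  van der Corput's estimate.
\<close>

section \<open>Theta series and products\<close>

text \<open>The form \<open>eta^4 dz\<close> is multiplied only by a sixth root of unity under
  \<Gamma>. On the commutator subgroup the primitive therefore changes by additive constants, that
  is, by a homomorphism to an abelian group; this is why the class modulo \<open>PSL2Z''\<close>
  determines the value. The identities for theta constants come from comparing \<open>q\<close> with
  \<open>q^2\<close>. A defect with \<open>E q = -2 * E (q^2)\<close>, or a quotient with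
  \<open>g (q^2) = g q\<close>, is determined by its behaviour at \<open>q = 0\<close>, to which the
  powers \<open>q^(2^n)\<close> lead. The coefficients \<open>psi n / n\<close> are not
  \<open>o(1/n)\<close>, so Tauber's first theorem does not apply directly; only averages of
  \<open>n\<close> times the coefficient vanish. After summation by parts in \<open>y\<close> there
  remain about \<open>sqrt N\<close> columns of size up to \<open>sqrt N\<close>. The trivial bound
  is thus already \<open>O(N)\<close>, and any saving suffices. It comes from the mean value zero of
  a periodic factor, since the heights of the columns are equidistributed in residue classes. Near
  \<open>x = sqrt N\<close> the curve is too steep, so a small proportion of the columns is cut off
  and bounded trivially.\<close>

definition tri :: "nat \<Rightarrow> nat" where "tri l = l * Suc l div 2"

lemma tri_0 [simp]: "tri 0 = 0"
  by (simp add: tri_def)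

lemma tri_Suc: "tri (Suc l) = tri l + Suc l"
  by (simp add: tri_def)

lemma two_tri: "2 * tri l = l * Suc l"
  by (simp add: tri_def)

text \<open>The q-Pochhammer symbol \<open>(Q; Q)_n\<close>. The field stays general because eta is
  complex, while the theta constants are later studied over the reals.\<close>

definition qpoch :: "'a::{real_normed_field,banach} \<Rightarrow> nat \<Rightarrow> 'a" where
  "qpoch Q n = (\<Prod>k<n. 1 - Q ^ Suc k)"

definition qinf :: "'a::{real_normed_field,banach} \<Rightarrow> 'a" where
  "qinf Q = prodinf (\<lambda>k. 1 - Q ^ Suc k)"

lemma qpoch_Suc: "qpoch Q (Suc n) = qpoch Q n * (1 - Q ^ Suc n)"
  by (simp add: qpoch_def)

lemma one_minus_power_nz:
  fixes Q :: "'a::real_normed_field"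
  assumes "norm Q < 1"
  shows "1 - Q ^ Suc k \<noteq> 0"
proof
  assume "1 - Q ^ Suc k = 0"
  then have "norm (Q ^ Suc k) = 1" by simp
  moreover have "norm (Q ^ Suc k) < 1"
    using assms unfolding norm_power by (cases "Q = 0") (auto intro!: power_Suc_less_one simp del: power_Suc)
  ultimately show False by simp
qed

lemma qpoch_nz: "norm Q < 1 \<Longrightarrow> qpoch Q n \<noteq> 0"
  using one_minus_power_nz[of Q] by (simp add: qpoch_def)

lemma summable_power_Suc: "norm (Q::'a::{real_normed_field,banach}) < 1 \<Longrightarrow> summable (\<lambda>k. norm (Q ^ Suc k))"
  unfolding summable_Suc_iff norm_power by (rule summable_geometric) simp

lemma abs_convergent_qprod:
  fixes Q x :: "'a::{real_normed_field,banach}"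
  assumes "norm Q < 1"
  shows "abs_convergent_prod (\<lambda>k. 1 - x * Q ^ Suc k)"
proof (rule summable_imp_abs_convergent_prod)
  have "summable (\<lambda>k. norm x * norm (Q ^ Suc k))"
    using summable_power_Suc[OF assms] by (rule summable_mult)
  then show "summable (\<lambda>k. norm (1 - x * Q ^ Suc k - 1))"
    by (simp add: norm_mult)
qed

lemma convergent_qprod:
  fixes Q x :: "'a::{real_normed_field,banach}"
  assumes "norm Q < 1"
  shows "convergent_prod (\<lambda>k. 1 - x * Q ^ Suc k)"
  using abs_convergent_qprod[OF assms] by (rule abs_convergent_prod_imp_convergent_prod)

lemma qprod_LIMSEQ:
  fixes Q x :: "'a::{real_normed_field,banach}"
  assumes "norm Q < 1"
  shows "(\<lambda>n. \<Prod>k<n. 1 - x * Q ^ Suc k) \<longlonglongrightarrow> prodinf (\<lambda>k. 1 - x * Q ^ Suc k)"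
  using has_prod_imp_tendsto'[OF convergent_prod_has_prod[OF convergent_qprod[OF assms]]] .

lemma qpoch_LIMSEQ: "norm Q < 1 \<Longrightarrow> qpoch Q \<longlonglongrightarrow> qinf Q"
  using qprod_LIMSEQ[of Q 1] by (simp add: qpoch_def [abs_def] qinf_def)

lemma qinf_nz: "norm Q < 1 \<Longrightarrow> qinf Q \<noteq> 0"
  unfolding qinf_def using one_minus_power_nz[of Q] convergent_qprod[of Q 1]
  by (intro prodinf_nonzero) auto

lemma qpoch_bounded: "norm Q < 1 \<Longrightarrow> \<exists>B>0. \<forall>n. norm (qpoch Q n) \<le> B"
  using qpoch_LIMSEQ[of Q] by (meson BseqE convergentI convergent_imp_Bseq)

lemma qpoch_inverse_bounded: "norm Q < 1 \<Longrightarrow> \<exists>B>0. \<forall>n. norm (inverse (qpoch Q n)) \<le> B"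
  using tendsto_inverse[OF qpoch_LIMSEQ qinf_nz, of Q] by (meson BseqE convergentI convergent_imp_Bseq)

section \<open>Gaussian binomial coefficients and the finite triple product\<close>

definition jcoef :: "'a::{real_normed_field,banach} \<Rightarrow> nat \<Rightarrow> nat \<Rightarrow> 'a" where
  "jcoef Q n l = (if l \<le> n then qpoch Q (2*n+1) / (qpoch Q (n-l) * qpoch Q (n+1+l)) else 0)"

lemma expand_fraction:
  fixes a b c d p :: "'a::field"
  assumes "c \<noteq> 0" "d \<noteq> 0"
  shows "p / (a * b) = p / ((a * c) * (b * d)) * (c * d)"
    and "p / (a * b) = p / ((a * c * d) * b) * (d * c)"
  using assms by auto

text \<open>The numbers are the Gaussian binomials \<open>[2n+1 choose n-l]\<close>. Every neighbour
  in \<open>n\<close> and \<open>l\<close> is a polynomial multiple of one quantity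
  \<open>A\<close>, so the recurrence becomes a polynomial identity. Writing
  \<open>Suc n = m + l\<close> replaces the subtraction \<open>n - l\<close>; at
  \<open>m = 0\<close> and \<open>m = 1\<close> the factors \<open>1 - Q^0\<close> reproduce the
  value 0 outside the range.\<close>

lemma jcoef_rec_aux:
  fixes Q :: "'a::{real_normed_field,banach}"
  assumes "norm Q < 1"
  defines "A \<equiv> \<lambda>m l. qpoch Q (2*(m+l)-1) / (qpoch Q m * qpoch Q (m+2*l+1))"
  assumes ml: "Suc n = m + l"
  shows "jcoef Q n l = A m l * ((1 - Q^m) * (1 - Q^(m+2*l+1)))"
    and "jcoef Q n (Suc l) = A m l * ((1 - Q^m) * (1 - Q^(m-1)))"
    and "jcoef Q (Suc n) l = A m l * ((1 - Q^(2*(m+l))) * (1 - Q^(2*(m+l)+1)))"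
    and "l > 0 \<Longrightarrow> jcoef Q n (l-1) = A m l * ((1 - Q^(m+2*l)) * (1 - Q^(m+2*l+1)))"
proof -
  note nz = qpoch_nz[OF assms(1)] one_minus_power_nz[OF assms(1)]
  have 1: "2*(m+l)-1 = 2*n+1" unfolding ml[symmetric] by simp
  show "jcoef Q n l = A m l * ((1 - Q^m) * (1 - Q^(m+2*l+1)))"
  proof (cases m)
    case 0 then show ?thesis using ml by (simp add: jcoef_def)
  next
    case (Suc m')
    then have e: "n - l = m'" "n+1+l = m+2*l" "l \<le> n" using ml by auto
    then have q0: "jcoef Q n l = qpoch Q (2*n+1) / (qpoch Q m' * qpoch Q (m+2*l))"
      unfolding jcoef_def e(1,2) by simp
    have q1: "qpoch Q (m+2*l+1) = qpoch Q (m+2*l) * (1 - Q^(m+2*l+1))" by (simp add: qpoch_def)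
    have q2: "1 - Q^m \<noteq> 0" "1 - Q^(m+2*l+1) \<noteq> 0" using nz(2)[of m'] nz(2)[of "m+2*l"] Suc by simp_all
    have q3: "qpoch Q m = qpoch Q m' * (1 - Q^m)" by (simp add: qpoch_Suc Suc)
    show ?thesis unfolding A_def 1 q0 q1 q3 by (rule expand_fraction(1)[OF q2])
  qed
  show "jcoef Q n (Suc l) = A m l * ((1 - Q^m) * (1 - Q^(m-1)))"
  proof (cases m)
    case 0 then show ?thesis using ml by (simp add: jcoef_def)
  next
    case (Suc m')
    show ?thesis
    proof (cases m')
      case 0 then show ?thesis using ml Suc by (simp add: jcoef_def)
    next
      case (Suc m'')
      with \<open>m = Suc m'\<close> have m: "m = Suc (Suc m'')" by simp
      then have e: "n - Suc l = m''" "n+1+Suc l = m+2*l+1" "Suc l \<le> n" using ml by auto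
      then have q0: "jcoef Q n (Suc l) = qpoch Q (2*n+1) / (qpoch Q m'' * qpoch Q (m+2*l+1))"
        unfolding jcoef_def e(1,2) by simp
      have q2: "1 - Q^(m-1) \<noteq> 0" "1 - Q^m \<noteq> 0" using nz(2)[of m''] nz(2)[of "Suc m''"] m by simp_all
      have q3: "qpoch Q m = qpoch Q m'' * (1 - Q^(m-1)) * (1 - Q^m)" by (simp add: qpoch_Suc m)
      show ?thesis unfolding A_def 1 q0 q3 by (rule expand_fraction(2)[OF q2])
    qed
  qed
  show "jcoef Q (Suc n) l = A m l * ((1 - Q^(2*(m+l))) * (1 - Q^(2*(m+l)+1)))"
  proof -
    have e: "Suc n - l = m" "Suc n + 1 + l = m+2*l+1" "l \<le> Suc n" "2 * Suc n + 1 = Suc (Suc (2*n+1))"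
      "2*(m+l) = Suc (2*n+1)"
      using ml by auto
    show ?thesis unfolding A_def jcoef_def e using e(3)
      by (simp add: qpoch_Suc del: power_Suc)
  qed
  show "jcoef Q n (l-1) = A m l * ((1 - Q^(m+2*l)) * (1 - Q^(m+2*l+1)))" if "l > 0"
  proof -
    obtain l' where l': "l = Suc l'" using \<open>l > 0\<close> by (cases l) auto
    have e: "n - l' = m" "n + 1 + l' = m + 2*l' + 1" "l' \<le> n" using ml l' by auto
    have "qpoch Q (m+2*l+1) = qpoch Q (m+2*l'+1) * (1 - Q^(m+2*l)) * (1 - Q^(m+2*l+1))"
      by (simp add: l' qpoch_Suc del: power_Suc)
    moreover have "jcoef Q n (l-1) = qpoch Q (2*n+1) / (qpoch Q m * qpoch Q (m+2*l'+1))"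
      unfolding jcoef_def l' diff_Suc_1 e(1,2) using e(3) by simp
    moreover have "1 - Q^(m+2*l) \<noteq> 0" "1 - Q^(m+2*l+1) \<noteq> 0"
      using nz(2)[of "m+2*l'+1"] nz(2)[of "m+2*l'+2"] by (simp_all add: l')
    ultimately show ?thesis unfolding A_def 1 using nz(1) by simp
  qed
qed

text \<open>This is the comparison of coefficients for multiplication by
  \<open>1 + R^2 - R * (x + 1/x)\<close> with \<open>R = Q^Suc n\<close>. At \<open>l = 0\<close>
  the left neighbour has index -1, which the reflection \<open>l -> -1-l\<close> of the triple
  product folds back to 0.\<close>

lemma jcoef_rec:
  fixes Q :: "'a::{real_normed_field,banach}"
  assumes "norm Q < 1" and ln: "l \<le> Suc n"
  shows "Q^l * jcoef Q (Suc n) l = (1 + (Q^Suc n)^2) * Q^l * jcoef Q n l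
     + Q^Suc n * (jcoef Q n (if l = 0 then 0 else l - 1) + Q^(2*l+1) * jcoef Q n (Suc l))"
proof -
  obtain m where m: "Suc n = m + l" using ln by (metis le_Suc_ex add.commute)
  note r = jcoef_rec_aux[OF assms(1) m]
  define A where "A = qpoch Q (2*(m+l)-1) / (qpoch Q m * qpoch Q (m+2*l+1))"
  have r0: "jcoef Q n (if l = 0 then 0 else l - 1) = A * ((1 - Q^(m+2*l)) * (1 - Q^(m+2*l+1)))"
    using r(1) r(4) by (cases "l = 0") (simp_all add: A_def)
  have p: "Q * ((1 - Q^m) * (1 - Q^(m-1))) = (1 - Q^m) * (Q - Q^m)"
    by (cases m) (simp_all add: algebra_simps)
  have "Q^l * ((1 - Q^(2*(m+l))) * (1 - Q^(2*(m+l)+1))) =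
     (1 + (Q^(m+l))^2) * Q^l * ((1 - Q^m) * (1 - Q^(m+2*l+1)))
     + Q^(m+l) * ((1 - Q^(m+2*l)) * (1 - Q^(m+2*l+1)) + Q^(2*l) * ((1 - Q^m) * (Q - Q^m)))"
    by (simp add: power_add power_mult power_mult_distrib power2_eq_square algebra_simps)
  also have "Q^(2*l) * ((1 - Q^m) * (Q - Q^m)) = Q^(2*l+1) * ((1 - Q^m) * (1 - Q^(m-1)))"
    unfolding p[symmetric] by simp
  finally have "A * (Q^l * ((1 - Q^(2*(m+l))) * (1 - Q^(2*(m+l)+1)))) =
     A * ((1 + (Q^(m+l))^2) * Q^l * ((1 - Q^m) * (1 - Q^(m+2*l+1)))
     + Q^(m+l) * ((1 - Q^(m+2*l)) * (1 - Q^(m+2*l+1)) + Q^(2*l+1) * ((1 - Q^m) * (1 - Q^(m-1)))))"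
    by simp
  then show ?thesis unfolding r(1-3) r0 unfolding m A_def[symmetric]
    by (simp only: distrib_left mult.assoc mult.left_commute)
qed

text \<open>Summation by parts for \<open>w = (x + 1/x) * v\<close>, where
  \<open>v l = x^l - (1/x)^(l+1)\<close>. The special first equation expresses
  \<open>v (-1) = - v 0\<close>.\<close>

lemma three_term_sum:
  fixes c v w :: "nat \<Rightarrow> 'a::comm_ring_1"
  assumes "w 0 = v 1 - v 0" "\<And>l. w (Suc l) = v (Suc (Suc l)) + v l"
  shows "(\<Sum>l\<le>n. c l * w l) = (c 1 - c 0) * v 0 + (\<Sum>l\<le>n. (c l + c (Suc (Suc l))) * v (Suc l))
     - c (Suc n) * v n - c (Suc (Suc n)) * v (Suc n)"
  by (induction n) (simp_all add: assms algebra_simps)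

text \<open>The two-sided sum is folded: \<open>l\<close> and \<open>-1-l\<close> have the same
  triangular exponent and opposite signs, which leaves the antisymmetric functions
  \<open>x^l - (1/x)^(l+1)\<close>. Together with \<open>1 - 1/x\<close> there are
  \<open>2n+1\<close> factors, as the binomials require.\<close>

lemma jacobi_triple_finite:
  fixes Q x :: "'a::{real_normed_field,banach}"
  assumes Q: "norm Q < 1" and x: "x \<noteq> 0"
  shows "(1 - 1/x) * (\<Prod>k<n. (1 - x * Q^Suc k) * (1 - (1/x) * Q^Suc k)) =
     (\<Sum>l\<le>n. (-1)^l * Q^tri l * jcoef Q n l * (x^l - (1/x)^Suc l))"
proof (induction n)
  case 0
  show ?case using one_minus_power_nz[OF Q, of 0] by (simp add: jcoef_def qpoch_def)
next
  case (Suc n)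
  define v where "v = (\<lambda>l. x^l - (1/x)^Suc l)"
  define w where "w = (\<lambda>l. (x + 1/x) * v l)"
  define c where "c = (\<lambda>l. (-1)^l * Q^tri l * jcoef Q n l)"
  define R where "R = Q^Suc n"
  have w0: "w 0 = v 1 - v 0" "\<And>l. w (Suc l) = v (Suc (Suc l)) + v l"
    using x by (simp_all add: w_def v_def field_simps)
  have c0: "c l = 0" if "l > n" for l using that by (simp add: c_def jcoef_def)
  have "(1 - 1/x) * (\<Prod>k<Suc n. (1 - x * Q^Suc k) * (1 - (1/x) * Q^Suc k)) =
     (\<Sum>l\<le>n. c l * v l) * ((1 - x*R) * (1 - (1/x)*R))"
    using Suc.IH by (simp add: c_def v_def R_def mult.assoc)
  also have "(1 - x*R) * (1 - (1/x)*R) = (1 + R^2) - R * (x + 1/x)"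
    using x by (simp add: field_simps power2_eq_square)
  also have "(\<Sum>l\<le>n. c l * v l) * ((1 + R^2) - R * (x + 1/x)) =
      (1 + R^2) * (\<Sum>l\<le>n. c l * v l) - R * (\<Sum>l\<le>n. c l * w l)"
    by (simp add: w_def sum_distrib_left sum_distrib_right algebra_simps sum_subtractf sum.distrib)
  also have "(\<Sum>l\<le>n. c l * w l) = (c 1 - c 0) * v 0 + (\<Sum>l\<le>n. (c l + c (Suc (Suc l))) * v (Suc l))"
    using three_term_sum[OF w0, of c n] c0[of "Suc n"] c0[of "Suc (Suc n)"] by simp
  also have "(\<Sum>l\<le>n. c l * v l) = c 0 * v 0 + (\<Sum>l\<le>n. c (Suc l) * v (Suc l))"
    using sum.atMost_Suc_shift[of "\<lambda>l. c l * v l" n] c0[of "Suc n"] by simp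
  also have "(1 + R^2) * (c 0 * v 0 + (\<Sum>l\<le>n. c (Suc l) * v (Suc l)))
       - R * ((c 1 - c 0) * v 0 + (\<Sum>l\<le>n. (c l + c (Suc (Suc l))) * v (Suc l)))
     = ((1 + R^2) * c 0 - R * (c 1 - c 0)) * v 0
       + (\<Sum>l\<le>n. ((1 + R^2) * c (Suc l) - R * (c l + c (Suc (Suc l)))) * v (Suc l))"
    by (simp add: sum_distrib_left algebra_simps sum_subtractf sum.distrib)
  also have "(1 + R^2) * c 0 - R * (c 1 - c 0) = jcoef Q (Suc n) 0"
    using jcoef_rec[OF Q, of 0 n] by (simp add: c_def R_def tri_Suc algebra_simps)
  also have "(1 + R^2) * c (Suc l) - R * (c l + c (Suc (Suc l))) =
      (-1)^Suc l * Q^tri (Suc l) * jcoef Q (Suc n) (Suc l)" if "l \<le> n" for l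
  proof -
    have "(-1)^Suc l * Q^tri (Suc l) * jcoef Q (Suc n) (Suc l) =
       (-1)^Suc l * Q^tri l * (Q^Suc l * jcoef Q (Suc n) (Suc l))"
      by (simp add: tri_Suc power_add)
    also have "Q^Suc l * jcoef Q (Suc n) (Suc l) = (1 + R^2) * Q^Suc l * jcoef Q n (Suc l)
     + R * (jcoef Q n l + Q^(2*Suc l+1) * jcoef Q n (Suc (Suc l)))"
      using jcoef_rec[OF Q, of "Suc l" n] that by (simp add: R_def)
    also have "(-1)^Suc l * Q^tri l * ((1 + R^2) * Q^Suc l * jcoef Q n (Suc l)
     + R * (jcoef Q n l + Q^(2*Suc l+1) * jcoef Q n (Suc (Suc l)))) =
      (1 + R^2) * c (Suc l) - R * (c l + c (Suc (Suc l)))"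
    proof -
      have "2 * Suc l + 1 = Suc l + Suc (Suc l)" by simp
      then have e: "Q^(2*Suc l+1) = Q^Suc l * Q^Suc (Suc l)" by (simp only: power_add)
      have gen: "- s * T * ((1 + R^2) * U * a + R * (b + U * W * d)) =
         (1 + R^2) * (- s * (T * U) * a) - R * (s * T * b + s * (T * U * W) * d)" for s T U W a b d :: 'a
        by (simp add: algebra_simps)
      have "(-1)^Suc l = - ((-1)^l :: 'a)" "(-1)^Suc (Suc l) = ((-1)^l :: 'a)" by simp_all
      then show ?thesis
        unfolding c_def tri_Suc e unfolding power_add by (simp only: gen)
    qed
    finally show ?thesis ..
  qed
  hence "(\<Sum>l\<le>n. ((1 + R^2) * c (Suc l) - R * (c l + c (Suc (Suc l)))) * v (Suc l)) =
     (\<Sum>l\<le>n. (-1)^Suc l * Q^tri (Suc l) * jcoef Q (Suc n) (Suc l) * v (Suc l))"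
    by (intro sum.cong) auto
  also have "jcoef Q (Suc n) 0 * v 0 + \<dots> = (\<Sum>l\<le>Suc n. (-1)^l * Q^tri l * jcoef Q (Suc n) l * v l)"
    by (simp add: sum.atMost_Suc_shift[of _ n] del: sum.atMost_Suc)
  finally show ?case by (simp only: v_def)
qed

section \<open>Passage to the infinite triple product\<close>

lemma jcoef_LIMSEQ:
  assumes "norm Q < 1"
  shows "(\<lambda>n. jcoef Q n l) \<longlonglongrightarrow> 1 / qinf Q"
proof -
  have f: "filterlim (\<lambda>n. 2*n+1) at_top sequentially" "filterlim (\<lambda>n. n-l) at_top sequentially"
     "filterlim (\<lambda>n. n+1+l) at_top sequentially" for l :: nat
    by (auto intro!: filterlim_at_top_mono[OF filterlim_ident] filterlim_minus_const_nat_at_top)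
  have "(\<lambda>n. qpoch Q (2*n+1) / (qpoch Q (n-l) * qpoch Q (n+1+l))) \<longlonglongrightarrow> qinf Q / (qinf Q * qinf Q)"
    by (intro tendsto_divide tendsto_mult filterlim_compose[OF qpoch_LIMSEQ[OF assms]] f)
       (use qinf_nz[OF assms] in auto)
  moreover have "eventually (\<lambda>n. jcoef Q n l = qpoch Q (2*n+1) / (qpoch Q (n-l) * qpoch Q (n+1+l))) sequentially"
    using eventually_ge_at_top[of l] by eventually_elim (simp add: jcoef_def)
  ultimately show ?thesis using qinf_nz[OF assms] by (simp add: tendsto_cong)
qed

lemma jcoef_bounded:
  assumes "norm Q < 1"
  obtains B where "B > 0" "\<And>n l. norm (jcoef Q n l) \<le> B"
proof -
  obtain B1 where B1: "B1 > 0" "\<And>n. norm (qpoch Q n) \<le> B1" using qpoch_bounded[OF assms] by auto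
  obtain B2 where B2: "B2 > 0" "\<And>n. norm (inverse (qpoch Q n)) \<le> B2" using qpoch_inverse_bounded[OF assms] by auto
  have "norm (jcoef Q n l) \<le> B1 * (B2 * B2)" for n l
  proof (cases "l \<le> n")
    case True
    then have "norm (jcoef Q n l) = norm (qpoch Q (2*n+1)) *
        (norm (inverse (qpoch Q (n-l))) * norm (inverse (qpoch Q (n+1+l))))"
      by (simp add: jcoef_def divide_inverse norm_mult)
    also have "\<dots> \<le> B1 * (B2 * B2)"
      using B1 B2 by (intro mult_mono) (auto intro: less_imp_le)
    finally show ?thesis .
  qed (use B1 B2 in \<open>auto simp: jcoef_def\<close>)
  then show ?thesis using that[of "B1 * (B2 * B2)"] B1 B2 by simp
qed

lemma summable_tri:
  fixes r y :: real
  assumes "0 \<le> r" "r < 1" "0 \<le> y"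
  shows "summable (\<lambda>l. r ^ tri l * y ^ l)"
proof -
  have "(\<lambda>l. r ^ Suc l * y) \<longlonglongrightarrow> 0"
    by (rule tendsto_mult_left_zero[OF LIMSEQ_Suc[OF LIMSEQ_realpow_zero[OF assms(1,2)]]])
  then have "eventually (\<lambda>l. r ^ Suc l * y < 1/2) sequentially"
    by (rule order_tendstoD) simp
  then obtain N where N: "\<And>l. l \<ge> N \<Longrightarrow> r ^ Suc l * y < 1/2"
    by (auto simp: eventually_at_top_linorder)
  show ?thesis
  proof (rule summable_ratio_test[of "1/2" N])
    fix l assume "l \<ge> N"
    have "norm (r ^ tri (Suc l) * y ^ Suc l) = (r ^ Suc l * y) * (r ^ tri l * y ^ l)"
      using assms by (simp add: tri_Suc power_add abs_mult)
    also have "\<dots> \<le> 1/2 * (r ^ tri l * y ^ l)"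
      using N[OF \<open>l \<ge> N\<close>] assms by (intro mult_right_mono) auto
    finally show "norm (r ^ tri (Suc l) * y ^ Suc l) \<le> 1/2 * norm (r ^ tri l * y ^ l)"
      using assms by simp
  qed auto
qed

text \<open>Dominated convergence for series: \<open>jcoef Q n l\<close> tends to
  \<open>1 / qinf Q\<close> and is bounded in \<open>n\<close> and \<open>l\<close>, and
  \<open>Q^tri l\<close> beats any geometric growth of \<open>u\<close>. Leaving \<open>u\<close>
  open covers both the triple product and its derivative at \<open>x = 1\<close>.\<close>

lemma jacobi_tannery:
  fixes Q :: "'a::{real_normed_field,banach}"
  assumes Q: "norm Q < 1" and y: "y \<ge> 0" and D: "\<And>l. norm (u l) \<le> D * y ^ l"
  assumes lim: "(\<lambda>n. \<Sum>l\<le>n. (-1)^l * Q^tri l * jcoef Q n l * u l) \<longlonglongrightarrow> L"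
  shows "(\<lambda>l. (-1)^l * Q^tri l * u l) sums (qinf Q * L)"
proof -
  obtain B where B: "B > 0" "\<And>n l. norm (jcoef Q n l) \<le> B" using jcoef_bounded[OF Q] by blast
  define a where "a = (\<lambda>l n. (-1)^l * Q^tri l * jcoef Q n l * u l)"
  define b where "b = (\<lambda>l. (-1)^l * Q^tri l * (1 / qinf Q) * u l)"
  define M where "M = (\<lambda>l. (B * D) * (norm Q ^ tri l * y ^ l))"
  have 1: "(a l \<longlongrightarrow> b l) sequentially" for l
    unfolding a_def b_def by (intro tendsto_intros jcoef_LIMSEQ Q)
  have bd: "norm (a l n) \<le> M l" for l n
  proof -
    have "norm (a l n) = norm Q ^ tri l * (norm (jcoef Q n l) * norm (u l))"
      by (simp add: a_def norm_mult norm_power)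
    also have "\<dots> \<le> norm Q ^ tri l * (B * (D * y ^ l))"
      by (intro mult_left_mono mult_mono B D) (use B in auto)
    finally show ?thesis by (simp add: M_def mult_ac)
  qed
  have M: "summable M" unfolding M_def by (intro summable_mult summable_tri) (use Q y in auto)
  have "eventually (\<lambda>n. summable (\<lambda>k. norm (a k n))) sequentially \<and> summable (\<lambda>n. norm (b n)) \<and>
           ((\<lambda>n. suminf (\<lambda>k. a k n)) \<longlongrightarrow> suminf b) sequentially"
    by (rule tannerys_theorem[OF 1 _ M]) (auto simp: bd case_prod_unfold)
  then have b: "summable b" "(\<lambda>n. suminf (\<lambda>k. a k n)) \<longlonglongrightarrow> suminf b"
    by (auto dest: summable_norm_cancel)
  have "suminf (\<lambda>k. a k n) = (\<Sum>l\<le>n. (-1)^l * Q^tri l * jcoef Q n l * u l)" for n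
    unfolding a_def by (rule suminf_finite) (auto simp: jcoef_def)
  with b(2) lim have "suminf b = L" by (simp add: LIMSEQ_unique)
  with b(1) have "b sums L" by (simp add: sums_iff)
  from sums_mult[OF this, of "qinf Q"] show ?thesis
    using qinf_nz[OF Q] by (simp add: b_def field_simps)
qed

text \<open>The limit of the product is a hypothesis, because each application first regroups the
  factors for its special \<open>x\<close> and finds the limit from known products.\<close>

theorem jacobi_triple:
  fixes Q x :: "'a::{real_normed_field,banach}"
  assumes Q: "norm Q < 1" and x: "x \<noteq> 0"
  assumes lim: "(\<lambda>n. \<Prod>k<n. (1 - x * Q^Suc k) * (1 - (1/x) * Q^Suc k)) \<longlonglongrightarrow> P"
  shows "(\<lambda>l. (-1)^l * Q^tri l * (x^l - (1/x)^Suc l)) sums (qinf Q * ((1 - 1/x) * P))"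
proof (rule jacobi_tannery[OF Q])
  define y where "y = max (norm x) (norm (1/x))"
  show "0 \<le> y" by (simp add: y_def le_max_iff_disj)
  show "norm (x^l - (1/x)^Suc l) \<le> (1 + y) * y ^ l" for l
  proof -
    have "norm (x^l - (1/x)^Suc l) \<le> norm x ^ l + norm (1/x) ^ Suc l"
      by (rule order_trans[OF norm_triangle_ineq4]) (simp add: norm_power norm_mult norm_divide)
    also have "\<dots> \<le> y ^ l + y ^ Suc l" by (intro add_mono power_mono) (auto simp: y_def)
    finally show ?thesis by (simp add: algebra_simps)
  qed
  show "(\<lambda>n. \<Sum>l\<le>n. (-1)^l * Q^tri l * jcoef Q n l * (x^l - (1/x)^Suc l)) \<longlonglongrightarrow> (1 - 1/x) * P"
    unfolding jacobi_triple_finite[OF Q x, symmetric] by (intro tendsto_mult tendsto_const lim)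
qed

text \<open>The cofactor of \<open>1 - 1/x\<close> has the value \<open>2l+1\<close> at
  \<open>x = 1\<close>; these values become the weights in the series for the cube.\<close>

lemma power_diff_quotient:
  fixes x :: "'a::field"
  assumes "x \<noteq> 0"
  shows "x^l - (1/x)^Suc l = (1 - 1/x) * (\<Sum>i\<le>2*l. x^i) / x^l"
proof -
  have "(x - 1) * (\<Sum>i\<le>2*l. x^i) = x ^ Suc (2*l) - 1"
    using sum_gp_basic[of x "2*l"] by (simp add: algebra_simps)
  then have e: "(1 - 1/x) * (\<Sum>i\<le>2*l. x^i) = (x ^ Suc (2*l) - 1) / x"
    using assms by (simp add: field_simps)
  show ?thesis unfolding e using assms by (simp add: field_simps power_add power_mult power2_eq_square)
qed

text \<open>Both sides of the finite triple product are divided by \<open>1 - 1/x\<close> before \<open>x\<close> tends to \<open>1\<close>.\<close>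

lemma jacobi_cube_finite:
  fixes Q :: "'a::{real_normed_field,banach}"
  assumes Q: "norm Q < 1"
  shows "(qpoch Q n)\<^sup>2 = (\<Sum>l\<le>n. (-1)^l * Q^tri l * jcoef Q n l * of_nat (2*l+1))"
proof -
  define f where "f = (\<lambda>x. \<Prod>k<n. (1 - x * Q^Suc k) * (1 - (1/x) * Q^Suc k))"
  define g where "g = (\<lambda>x. \<Sum>l\<le>n. (-1)^l * Q^tri l * jcoef Q n l * ((\<Sum>i\<le>2*l. x^i) / x^l))"
  have fg: "f x = g x" if "x \<noteq> 0" "x \<noteq> 1" for x
  proof -
    have "(1 - 1/x) * f x = (1 - 1/x) * g x"
      unfolding f_def g_def jacobi_triple_finite[OF Q that(1)] power_diff_quotient[OF that(1)]
      by (simp add: sum_distrib_left mult_ac)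
    then show ?thesis using that by simp
  qed
  have "(f \<longlongrightarrow> (f 1)) (at 1)" unfolding f_def by (intro tendsto_intros) auto
  moreover have "(g \<longlongrightarrow> (g 1)) (at 1)" unfolding g_def by (intro tendsto_intros) auto
  moreover have "eventually (\<lambda>x. f x = g x) (at 1)"
    using eventually_neq_at_within[of 0 "1::'a" UNIV] eventually_neq_at_within[of 1 "1::'a" UNIV]
    by eventually_elim (rule fg)
  ultimately have "f 1 = g 1"
    using tendsto_unique[OF trivial_limit_at] tendsto_cong[of f g "at 1" "g 1"] by blast
  then show ?thesis by (simp add: f_def g_def qpoch_def power2_eq_square prod.distrib)
qed

theorem jacobi_cube:
  fixes Q :: "'a::{real_normed_field,banach}"
  assumes Q: "norm Q < 1"
  shows "(\<lambda>l. (-1)^l * Q^tri l * of_nat (2*l+1)) sums (qinf Q ^ 3)"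
proof -
  have "(\<lambda>l. (-1)^l * Q^tri l * of_nat (2*l+1)) sums (qinf Q * (qinf Q)\<^sup>2)"
  proof (rule jacobi_tannery[OF Q])
    show "norm (of_nat (2*l+1) :: 'a) \<le> 1 * 3 ^ l" for l
    proof -
      have "2*l+1 \<le> 3 ^ l" by (induction l) auto
      then have "real (2*l+1) \<le> real (3 ^ l)" by (rule of_nat_mono)
      then show ?thesis by (simp only: norm_of_nat of_nat_power of_nat_numeral mult_1)
    qed
    show "(\<lambda>n. \<Sum>l\<le>n. (-1)^l * Q^tri l * jcoef Q n l * of_nat (2*l+1)) \<longlonglongrightarrow> (qinf Q)\<^sup>2"
      unfolding jacobi_cube_finite[OF Q, symmetric] by (intro tendsto_intros qpoch_LIMSEQ Q)
  qed auto
  then show ?thesis by (simp add: power3_eq_cube power2_eq_square mult.assoc)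
qed

section \<open>Theta series for eta and its cube\<close>

lemma norm_power_less_one:
  fixes q :: "'a::real_normed_field"
  assumes "norm q < 1" "k > 0"
  shows "norm (q ^ k) < 1"
  using assms unfolding norm_power by (cases "q = 0") (auto simp: power_less_one_iff zero_power)

text \<open>Triple product with base \<open>q^3\<close> and \<open>x = 1/q\<close>: its factors have
  the exponents \<open>3k+2\<close> and \<open>3k+4\<close>, and \<open>qinf (q^3)\<close> supplies
  \<open>3k+3\<close>. Only the exponent 1 is missing, and it comes from
  \<open>1 - 1/x = 1 - q\<close>.\<close>

lemma pentagonal:
  fixes q :: "'a::{real_normed_field,banach}"
  assumes q: "norm q < 1" and q0: "q \<noteq> 0"
  shows "(\<lambda>l. (-1)^l * (q^3)^tri l * ((1/q)^l - q^Suc l)) sums qinf q"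
proof -
  have q3: "norm (q^3) < 1" using q by (intro norm_power_less_one) auto
  have q1: "1 - q \<noteq> 0" using one_minus_power_nz[OF q, of 0] by simp
  define P where "P = (\<lambda>n. \<Prod>k<n. (1 - (1/q) * (q^3)^Suc k) * (1 - (1/(1/q)) * (q^3)^Suc k))"
  have P: "P n = qpoch q (3*n+1) / (qpoch (q^3) n * (1 - q))" for n
  proof -
    have "P n * (qpoch (q^3) n * (1 - q)) = qpoch q (3*n+1)"
    proof (induction n)
      case 0 then show ?case by (simp add: P_def qpoch_def)
    next
      case (Suc n)
      have e: "3 * Suc n + 1 = Suc (Suc (Suc (3*n+1)))" by simp
      have f: "(1/q) * (q^3)^Suc n = q^Suc (3*n+1)" "(1/(1/q)) * (q^3)^Suc n = q^Suc (Suc (Suc (3*n+1)))"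
         "(q^3)^Suc n = q^Suc (Suc (3*n+1))"
        using q0 by (simp_all add: power_mult[symmetric] power_add eval_nat_numeral power_mult_distrib)
      have "P (Suc n) * (qpoch (q^3) (Suc n) * (1 - q)) =
         (P n * (qpoch (q^3) n * (1 - q))) * (1 - (q^3)^Suc n) * (1 - (1/q) * (q^3)^Suc n) * (1 - (1/(1/q)) * (q^3)^Suc n)"
        unfolding P_def qpoch_Suc prod.lessThan_Suc by (simp only: mult_ac)
      also have "\<dots> = qpoch q (3 * Suc n + 1)"
        unfolding Suc.IH unfolding f(1,2) unfolding f(3) e qpoch_Suc by (simp only: mult_ac)
      finally show ?case .
    qed
    then show ?thesis using q1 qpoch_nz[OF q3] by (simp add: field_simps)
  qed
  have "filterlim (\<lambda>n. 3*n+1) at_top sequentially"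
    by (auto intro!: filterlim_at_top_mono[OF filterlim_ident])
  then have "P \<longlonglongrightarrow> qinf q / (qinf (q^3) * (1 - q))"
    unfolding P by (intro tendsto_divide tendsto_mult qpoch_LIMSEQ[OF q3] tendsto_const
       filterlim_compose[OF qpoch_LIMSEQ[OF q]]) (use qinf_nz[OF q3] q1 in auto)
  from jacobi_triple[OF q3 _ this[unfolded P_def]] show ?thesis
    using q0 q1 qinf_nz[OF q3] by simp
qed

lemma tri_24: "24 * tri l = 12 * (l * Suc l)"
  using two_tri[of l] by linarith

text \<open>With \<open>q = t^24\<close> the factor \<open>q^(1/24)\<close> is an honest power, and
  multiplying by \<open>t\<close> completes the pentagonal exponents to the squares of
  \<open>6l+1\<close> and \<open>6l+5\<close>.\<close>

lemma pentagonal_t: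
  fixes t :: "'a::{real_normed_field,banach}"
  assumes t: "norm t < 1" and t0: "t \<noteq> 0"
  shows "(\<lambda>l. (-1)^l * (t^(6*l+1)\<^sup>2 - t^(6*l+5)\<^sup>2)) sums (t * qinf (t^24))"
proof -
  have "norm (t^24) < 1" using t by (intro norm_power_less_one) auto
  from sums_mult[OF pentagonal[OF this], of t] t0
  have *: "(\<lambda>l. t * ((-1)^l * ((t^24)^3)^tri l * ((1/t^24)^l - (t^24)^Suc l))) sums (t * qinf (t^24))" by simp
  have X: "t * ((-1)^l * ((t^24)^3)^tri l * ((1/t^24)^l - (t^24)^Suc l)) = (-1)^l * (t^(6*l+1)\<^sup>2 - t^(6*l+5)\<^sup>2)" for l
  proof -
    have e1: "3 * (24 * tri l) + 1 = (6*l+1)\<^sup>2 + 24 * l"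
      unfolding tri_24 by (simp add: power2_eq_square algebra_simps)
    have e2: "3 * (24 * tri l) + 1 + 24 * Suc l = (6*l+5)\<^sup>2"
      unfolding tri_24 by (simp add: power2_eq_square algebra_simps)
    have p: "((t^24)^3)^tri l = t^(3 * (24 * tri l))" "(1/t^24)^l = 1 / t^(24*l)" "(t^24)^Suc l = t^(24 * Suc l)"
      by (simp_all only: power_mult[symmetric] power_one_over mult_ac)
    have "t * ((-1)^l * ((t^24)^3)^tri l * ((1/t^24)^l - (t^24)^Suc l)) =
       (-1)^l * (t^(3 * (24 * tri l) + 1) / t^(24*l) - t^(3 * (24 * tri l) + 1 + 24 * Suc l))"
      unfolding p power_add power_one_right by (simp add: algebra_simps)
    also have "t^(3 * (24 * tri l) + 1) / t^(24*l) = t^(6*l+1)\<^sup>2"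
      unfolding e1 power_add using t0 by simp
    finally show ?thesis unfolding e2 .
  qed
  show ?thesis using * unfolding X .
qed

lemma cube_t:
  fixes t :: "'a::{real_normed_field,banach}"
  assumes t: "norm t < 1"
  shows "(\<lambda>l. (-1)^l * of_nat (2*l+1) * t^(3*(2*l+1)\<^sup>2)) sums ((t * qinf (t^24))^3)"
proof -
  have "norm (t^24) < 1" using t by (intro norm_power_less_one) auto
  from sums_mult[OF jacobi_cube[OF this], of "t^3"]
  have *: "(\<lambda>l. t^3 * ((-1)^l * (t^24)^tri l * of_nat (2*l+1))) sums (t^3 * qinf (t^24)^3)" .
  have X: "t^3 * ((-1)^l * (t^24)^tri l * of_nat (2*l+1)) = (-1)^l * of_nat (2*l+1) * t^(3*(2*l+1)\<^sup>2)" for l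
  proof -
    have e: "3*(2*l+1)\<^sup>2 = 3 + 24 * tri l" unfolding tri_24 by (simp add: power2_eq_square algebra_simps)
    show ?thesis unfolding e power_add power_mult by (simp only: mult_ac)
  qed
  show ?thesis using * unfolding X power_mult_distrib .
qed

section \<open>Theta constants as series and as products\<close>

definition qodd :: "'a::{real_normed_field,banach} \<Rightarrow> nat \<Rightarrow> 'a" where
  "qodd q n = (\<Prod>k<n. 1 - q ^ (2*k+1))"

lemma qpoch_double: "qpoch q (2*n) = qpoch (q\<^sup>2) n * qodd q n"
  by (induction n) (simp_all add: qpoch_def qodd_def power_mult[symmetric] power_add mult_ac del: power_Suc)

lemma qodd_LIMSEQ:
  assumes "norm q < 1"
  shows "qodd q \<longlonglongrightarrow> qinf q / qinf (q\<^sup>2)"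
proof -
  have q2: "norm (q\<^sup>2) < 1" using assms by (intro norm_power_less_one) auto
  have "qodd q = (\<lambda>n. qpoch q (2*n) / qpoch (q\<^sup>2) n)"
    using qpoch_nz[OF q2] by (auto simp: fun_eq_iff qpoch_double)
  moreover have "filterlim (\<lambda>n::nat. 2*n) at_top sequentially"
    by (auto intro!: filterlim_at_top_mono[OF filterlim_ident])
  ultimately show ?thesis
    using qinf_nz[OF q2]
    by (auto intro!: tendsto_divide qpoch_LIMSEQ[OF q2] filterlim_compose[OF qpoch_LIMSEQ[OF assms]])
qed

text \<open>The odd factors of \<open>q\<close> and \<open>-q\<close> multiply to
  \<open>1 - q^(4k+2)\<close>, the odd factors of \<open>q^2\<close>. The relation is the limit of
  this, read through \<open>qodd_LIMSEQ\<close>.\<close>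

lemma qinf_minus:
  fixes q :: "'a::{real_normed_field,banach}"
  assumes q: "norm q < 1"
  shows "qinf q * qinf (-q) * qinf (q^4) = qinf (q\<^sup>2) ^ 3"
proof -
  have q2: "norm (q\<^sup>2) < 1" "norm (q^4) < 1" using q by (auto intro!: norm_power_less_one)
  have "qodd q n * qodd (-q) n = qodd (q\<^sup>2) n" for n
    unfolding qodd_def prod.distrib[symmetric]
    by (intro prod.cong refl) (simp add: algebra_simps power_mult[symmetric] power_add[symmetric])
  then have "(\<lambda>n. qodd (q\<^sup>2) n) \<longlonglongrightarrow> (qinf q / qinf (q\<^sup>2)) * (qinf (-q) / qinf ((-q)\<^sup>2))"
    using tendsto_mult[OF qodd_LIMSEQ[OF q] qodd_LIMSEQ[of "-q"]] q by simp
  with qodd_LIMSEQ[OF q2(1)] have "(qinf q / qinf (q\<^sup>2)) * (qinf (-q) / qinf (q\<^sup>2)) = qinf (q\<^sup>2) / qinf ((q\<^sup>2)\<^sup>2)"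
    using LIMSEQ_unique by force
  moreover have "(q\<^sup>2)\<^sup>2 = q^4" by simp
  ultimately show ?thesis
    using qinf_nz[OF q2(1)] qinf_nz[OF q2(2)] by (simp add: field_simps power3_eq_cube)
qed

text \<open>Jacobi's theta_3 as a function of the nome. The sum runs over all exponents rather than
  over squares, so that it is a power series and can be differentiated termwise.\<close>

definition theta :: "'a::{real_normed_field,banach} \<Rightarrow> 'a" where
  "theta q = suminf (\<lambda>n. (if n = 0 then 1 else if \<exists>l. n = l\<^sup>2 then 2 else 0) * q ^ n)"

text \<open>Jacobi's theta_2 without its factor \<open>q^(1/4)\<close>, hence a power series, with
  value 2 at 0.\<close>

definition theta2 :: "'a::{real_normed_field,banach} \<Rightarrow> 'a" where
  "theta2 q = suminf (\<lambda>n. (if \<exists>l. n = l * Suc l then 2 else 0) * q ^ n)"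

lemma theta_summable:
  fixes q :: "'a::{real_normed_field,banach}"
  assumes "norm q < 1"
  shows "summable (\<lambda>n. norm ((if n = 0 then 1 else if \<exists>l. n = l\<^sup>2 then 2 else 0) * q ^ n))"
    and "summable (\<lambda>n. norm ((if \<exists>l. n = l * Suc l then 2 else 0) * q ^ n))"
proof -
  have s: "summable (\<lambda>n. 2 * norm q ^ n)" using assms by (intro summable_mult summable_geometric) auto
  show "summable (\<lambda>n. norm ((if n = 0 then 1 else if \<exists>l. n = l\<^sup>2 then 2 else 0) * q ^ n))"
    by (rule summable_comparison_test'[OF s, of 0]) (auto simp: norm_mult norm_power)
  show "summable (\<lambda>n. norm ((if \<exists>l. n = l * Suc l then 2 else 0) * q ^ n))"
    by (rule summable_comparison_test'[OF s, of 0]) (auto simp: norm_mult norm_power)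
qed

lemma theta_sums_squares:
  fixes q :: "'a::{real_normed_field,banach}"
  assumes "norm q < 1"
  shows "(\<lambda>l. (if l = 0 then 1 else 2) * q ^ (l\<^sup>2)) sums theta q"
proof -
  define f where "f = (\<lambda>n. (if n = 0 then 1 else if \<exists>l. n = l\<^sup>2 then 2 else 0) * q ^ n)"
  have "f sums theta q" using theta_summable(1)[OF assms] unfolding f_def theta_def
    by (intro summable_sums) (rule summable_norm_cancel)
  moreover have "(\<lambda>l. f (l\<^sup>2)) sums theta q \<longleftrightarrow> f sums theta q"
  proof (rule sums_mono_reindex)
    show "strict_mono (\<lambda>l::nat. l\<^sup>2)" by (rule strict_monoI) (simp add: power_strict_mono)
    show "f n = 0" if "n \<notin> range (\<lambda>l::nat. l\<^sup>2)" for n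
      using that range_eqI[of 0 "\<lambda>l::nat. l\<^sup>2" 0] unfolding f_def by (cases "n = 0") auto
  qed
  moreover have "f (l\<^sup>2) = (if l = 0 then 1 else 2) * q ^ (l\<^sup>2)" for l by (auto simp: f_def)
  ultimately show ?thesis by simp
qed

lemma theta2_sums:
  fixes q :: "'a::{real_normed_field,banach}"
  assumes "norm q < 1"
  shows "(\<lambda>l. 2 * q ^ (l * Suc l)) sums theta2 q"
proof -
  define f where "f = (\<lambda>n. (if \<exists>l. n = l * Suc l then 2 else 0) * q ^ n)"
  have "f sums theta2 q" using theta_summable(2)[OF assms] unfolding f_def theta2_def
    by (intro summable_sums) (rule summable_norm_cancel)
  moreover have "(\<lambda>l. f (l * Suc l)) sums theta2 q \<longleftrightarrow> f sums theta2 q"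
  proof (rule sums_mono_reindex)
    show "strict_mono (\<lambda>l::nat. l * Suc l)" by (rule strict_monoI) (intro mult_strict_mono, auto)
    show "f n = 0" if "n \<notin> range (\<lambda>l::nat. l * Suc l)" for n
      using that unfolding f_def by auto
  qed
  moreover have "f (l * Suc l) = 2 * q ^ (l * Suc l)" for l by (auto simp: f_def)
  ultimately show ?thesis by simp
qed

text \<open>Triple product with base \<open>q^2\<close> and \<open>x = -1/q\<close>. The two
  families of odd factors are shifted against each other by one step, so a single factor
  \<open>1 + q\<close> appears in the denominator and cancels against
  \<open>1 - 1/x\<close>.\<close>

lemma theta_product:
  fixes q :: "'a::{real_normed_field,banach}"
  assumes q: "norm q < 1" and q0: "q \<noteq> 0"
  shows "theta q = (qinf (-q))\<^sup>2 / qinf (q\<^sup>2)"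
proof -
  have q2: "norm (q\<^sup>2) < 1" using q by (intro norm_power_less_one) auto
  have q1: "1 + q \<noteq> 0" using one_minus_power_nz[of "-q" 0] q by simp
  define P where "P = (\<lambda>n. \<Prod>k<n. (1 - (-1/q) * (q\<^sup>2)^Suc k) * (1 - (1/(-1/q)) * (q\<^sup>2)^Suc k))"
  have P: "P n = qodd (-q) n * qodd (-q) (Suc n) / (1 + q)" for n
  proof -
    have "P n * (1 + q) = qodd (-q) n * qodd (-q) (Suc n)"
    proof (induction n)
      case 0 then show ?case by (simp add: P_def qodd_def)
    next
      case (Suc n)
      have f: "(-1/q) * (q\<^sup>2)^Suc n = (-q)^(2*n+1)" "(1/(-1/q)) * (q\<^sup>2)^Suc n = (-q)^(2*Suc n+1)"
        using q0 by (simp_all add: power_mult power2_eq_square)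
      have "P (Suc n) * (1 + q) = (P n * (1 + q)) * ((1 - (-q)^(2*n+1)) * (1 - (-q)^(2*Suc n+1)))"
        unfolding P_def prod.lessThan_Suc f by (simp only: mult_ac)
      also have "\<dots> = qodd (-q) (Suc n) * qodd (-q) (Suc (Suc n))"
        unfolding Suc.IH qodd_def prod.lessThan_Suc by (simp only: mult_ac)
      finally show ?case .
    qed
    then show ?thesis using q1 by (simp add: field_simps)
  qed
  define L where "L = qinf (-q) / qinf (q\<^sup>2)"
  have L: "qodd (-q) \<longlonglongrightarrow> L" using qodd_LIMSEQ[of "-q"] q by (simp add: L_def)
  have "P \<longlonglongrightarrow> L * L / (1 + q)"
    unfolding P by (intro tendsto_divide tendsto_mult L LIMSEQ_Suc[OF L] tendsto_const q1)
  from jacobi_triple[OF q2 _ this[unfolded P_def]]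
  have "(\<lambda>l. (-1)^l * (q\<^sup>2)^tri l * ((-1/q)^l - (1/(-1/q))^Suc l)) sums (qinf (q\<^sup>2) * ((1 + q) * (L * L / (1 + q))))"
    using q0 by simp
  also have "qinf (q\<^sup>2) * ((1 + q) * (L * L / (1 + q))) = (qinf (-q))\<^sup>2 / qinf (q\<^sup>2)"
  proof -
    have "(1 + q) * (L * L / (1 + q)) = L * L" using q1 by simp
    then show ?thesis using qinf_nz[OF q2] by (simp only: L_def) (simp add: power2_eq_square)
  qed
  also have "(\<lambda>l. (-1)^l * (q\<^sup>2)^tri l * ((-1/q)^l - (1/(-1/q))^Suc l)) = (\<lambda>l. q^l\<^sup>2 + q^(Suc l)\<^sup>2)"
  proof
    fix l
    have e: "l * Suc l = l\<^sup>2 + l" "(Suc l)\<^sup>2 = l * Suc l + Suc l" by (simp_all add: power2_eq_square)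
    have a: "(q\<^sup>2)^tri l = q^(l\<^sup>2 + l)" unfolding power_mult[symmetric] two_tri e(1) ..
    have b: "(-1/q)^l = (-1)^l / q^l" by (rule power_divide)
    have b': "(1/(-1/q))^Suc l = (-1)^Suc l * q^Suc l" using power_minus[of q "Suc l"] by simp
    have c: "(-1)^l * (-1)^l = (1::'a)" by (metis power_mult_distrib mult_minus1_right minus_minus power_one)
    have "(-1)^l * (q\<^sup>2)^tri l * ((-1/q)^l - (1/(-1/q))^Suc l) =
      ((-1)^l * (-1)^l) * (q^(l\<^sup>2 + l) / q^l + q^(l\<^sup>2 + l) * q^Suc l)"
      unfolding a b b' by (simp add: algebra_simps)
    also have "\<dots> = q^l\<^sup>2 + q^(Suc l)\<^sup>2"
      unfolding c e using q0 by (simp add: power_add)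
    finally show "(-1)^l * (q\<^sup>2)^tri l * ((-1/q)^l - (1/(-1/q))^Suc l) = q^l\<^sup>2 + q^(Suc l)\<^sup>2" .
  qed
  finally have s: "(\<lambda>l. q^l\<^sup>2 + q^(Suc l)\<^sup>2) sums ((qinf (-q))\<^sup>2 / qinf (q\<^sup>2))" .
  \<comment> \<open>In \<open>q^(l^2) + q^((l+1)^2)\<close>, summed over \<open>l\<close>, the
    square 0 occurs once and every other square twice; this is the weighting of
    \<open>theta\<close>.\<close>
  have t1: "(\<lambda>l. (if l = 0 then 1 else 2) * q ^ (l\<^sup>2)) sums theta q"
    by (rule theta_sums_squares[OF q])
  have "(\<lambda>l. (2 * q ^ ((Suc l)\<^sup>2))) sums (theta q - 1)"
    using sums_Suc_iff[of "\<lambda>l. (if l = 0 then 1 else 2) * q ^ (l\<^sup>2)" "theta q - 1"] t1 by simp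
  then have h: "(\<lambda>l. q ^ ((Suc l)\<^sup>2)) sums ((theta q - 1) / 2)"
    using sums_divide[of "\<lambda>l. (2 * q ^ ((Suc l)\<^sup>2))" _ 2] by simp
  have "(\<lambda>l. q ^ (l\<^sup>2)) sums ((theta q - 1) / 2 + 1)"
    using sums_Suc_iff[of "\<lambda>l. q ^ (l\<^sup>2)" "(theta q - 1)/2"] h by simp
  from sums_add[OF this h] have "(\<lambda>l. q^l\<^sup>2 + q^(Suc l)\<^sup>2) sums theta q" by (simp add: field_simps)
  with s show ?thesis by (rule sums_unique2[symmetric])
qed

text \<open>Triple product with base \<open>q^2\<close> and \<open>x = -1\<close>; the factors
  \<open>1 + Q^k\<close> are the quotients \<open>(1 - Q^(2k)) / (1 - Q^k)\<close>.\<close>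

lemma theta2_product:
  fixes q :: "'a::{real_normed_field,banach}"
  assumes q: "norm q < 1"
  shows "theta2 q = 2 * (qinf (q^4))\<^sup>2 / qinf (q\<^sup>2)"
proof -
  have q2: "norm (q\<^sup>2) < 1" "norm (q^4) < 1" using q by (auto intro!: norm_power_less_one)
  define R where "R = (\<lambda>n. \<Prod>k<n. 1 + (q\<^sup>2)^Suc k)"
  have "q^4 = q\<^sup>2 * q\<^sup>2" by (simp flip: power_add)
  then have "(q^4)^Suc k = (q\<^sup>2)^Suc k * (q\<^sup>2)^Suc k" for k
    by (simp only: power_mult_distrib)
  then have "qpoch (q\<^sup>2) n * R n = qpoch (q^4) n" for n
    unfolding R_def qpoch_def prod.distrib[symmetric]
    by (intro prod.cong refl) (simp only: ring_distribs mult_1 mult_1_right, simp)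
  then have "R = (\<lambda>n. qpoch (q^4) n / qpoch (q\<^sup>2) n)"
    using qpoch_nz[OF q2(1)] by (auto simp: fun_eq_iff field_simps)
  then have R: "R \<longlonglongrightarrow> qinf (q^4) / qinf (q\<^sup>2)"
    using qinf_nz[OF q2(1)] by (auto intro!: tendsto_divide qpoch_LIMSEQ q2)
  have "(\<lambda>n. \<Prod>k<n. (1 - (-1) * (q\<^sup>2)^Suc k) * (1 - (1/(-1)) * (q\<^sup>2)^Suc k)) = (\<lambda>n. R n * R n)"
    by (simp add: R_def prod.distrib)
  with tendsto_mult[OF R R] have "(\<lambda>n. \<Prod>k<n. (1 - (-1) * (q\<^sup>2)^Suc k) * (1 - (1/(-1)) * (q\<^sup>2)^Suc k)) \<longlonglongrightarrow>
     qinf (q^4) / qinf (q\<^sup>2) * (qinf (q^4) / qinf (q\<^sup>2))" by simp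
  from jacobi_triple[OF q2(1) _ this]
  have *: "(\<lambda>l. (-1)^l * (q\<^sup>2)^tri l * ((-1)^l - (1/(-1))^Suc l)) sums (2 * (qinf (q^4))\<^sup>2 / qinf (q\<^sup>2))"
    using qinf_nz[OF q2(1)] by (simp add: power2_eq_square field_simps)
  have X: "(-1)^l * (q\<^sup>2)^tri l * ((-1)^l - (1/(-1))^Suc l) = 2 * q ^ (l * Suc l)" for l
  proof -
    have c: "(-1)^l * (-1)^l = (1::'a)" by (metis power_mult_distrib mult_minus1_right minus_minus power_one)
    have a: "(q\<^sup>2)^tri l = q^(l * Suc l)" unfolding power_mult[symmetric] two_tri ..
    have "(-1)^l * (q\<^sup>2)^tri l * ((-1)^l - (1/(-1))^Suc l) = ((-1)^l * (-1)^l) * (2 * q ^ (l * Suc l))"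
      unfolding a by (simp add: algebra_simps)
    then show ?thesis unfolding c by simp
  qed
  have "(\<lambda>l. 2 * q ^ (l * Suc l)) sums (2 * (qinf (q^4))\<^sup>2 / qinf (q\<^sup>2))" using * unfolding X .
  with theta2_sums[OF q] show ?thesis by (rule sums_unique2)
qed

section \<open>Fourier approximation and Poisson summation\<close>

definition e1 :: "real \<Rightarrow> complex" where
  "e1 x = cis (2 * pi * x)"

lemma e1_0 [simp]: "e1 0 = 1"
  by (simp add: e1_def)

lemma norm_e1 [simp]: "cmod (e1 x) = 1"
  by (simp add: e1_def)

lemma e1_add: "e1 (x + y) = e1 x * e1 y"
  by (simp add: e1_def cis_mult distrib_left)

lemma e1_of_int [simp]: "e1 (of_int k) = 1"
  by (simp add: e1_def cis_multiple_2pi)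

lemma e1_add_int [simp]: "e1 (x + of_int k) = e1 x"
  by (simp add: e1_add)

lemma e1_minus: "e1 (-x) = cnj (e1 x)"
  by (simp add: e1_def cis_cnj)

lemma e1_eq_iff: "e1 x = e1 y \<longleftrightarrow> (\<exists>k::int. x = y + of_int k)"
proof
  assume "e1 x = e1 y"
  then have "cos (2*pi*x) = cos (2*pi*y)" "sin (2*pi*x) = sin (2*pi*y)"
    by (auto simp: e1_def complex_eq_iff)
  then obtain n :: int where "2*pi*x = 2*pi*y + 2*pi*n"
    using sin_cos_eq_iff[of "2*pi*x" "2*pi*y"] by auto
  then have "2*pi*x = 2*pi*(y + n)" by (simp add: distrib_left)
  then show "\<exists>k::int. x = y + of_int k" by auto
qed auto

lemma continuous_on_e1 [continuous_intros]:
  "continuous_on S f \<Longrightarrow> continuous_on S (\<lambda>x. e1 (f x))"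
  unfolding e1_def by (intro continuous_intros)

section \<open>Density of trigonometric polynomials\<close>

inductive trig :: "(real \<Rightarrow> complex) \<Rightarrow> bool" where
  mono: "trig (\<lambda>x. c * e1 (of_int k * x))"
| add: "trig f \<Longrightarrow> trig g \<Longrightarrow> trig (\<lambda>x. f x + g x)"

lemma trig_const: "trig (\<lambda>x. c)"
  using trig.mono[of c 0] by simp

lemma trig_cmult: "trig f \<Longrightarrow> trig (\<lambda>x. c * f x)"
proof (induction rule: trig.induct)
  case (mono d k)
  then show ?case using trig.mono[of "c * d" k] by (simp add: mult.assoc)
next
  case (add f g)
  then show ?case using trig.add by (simp add: distrib_left)
qed

lemma trig_mult: "trig f \<Longrightarrow> trig g \<Longrightarrow> trig (\<lambda>x. f x * g x)"
proof (induction rule: trig.induct)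
  case (mono c k)
  from mono.prems show ?case
  proof (induction rule: trig.induct)
    case (mono d l)
    have "c * e1 (of_int k * x) * (d * e1 (of_int l * x)) = (c * d) * e1 (of_int (k + l) * x)" for x
      by (simp add: distrib_right e1_add)
    then show ?case using trig.mono[of "c * d" "k + l"] by (simp only:)
  next
    case (add f g)
    then show ?case using trig.add by (simp add: distrib_left)
  qed
next
  case (add f g)
  then show ?case using trig.add by (simp add: distrib_right)
qed

lemma continuous_on_trig: "trig f \<Longrightarrow> continuous_on S f"
  by (induction rule: trig.induct) (auto intro!: continuous_intros)

text \<open>On the unit circle a real-linear function is a combination of \<open>z\<close> and its
  conjugate, that is, of the frequencies 1 and -1.\<close>

lemma trig_real_polynomial:
  fixes p :: "complex \<Rightarrow> real"
  assumes "real_polynomial_function p"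
  shows "trig (\<lambda>x. of_real (p (e1 x)))"
  using assms
proof (induction rule: real_polynomial_function.induct)
  case (linear f)
  then interpret bounded_linear f .
  have f: "f z = Re z * f 1 + Im z * f \<i>" for z
  proof -
    have "f z = f (Re z *\<^sub>R 1 + Im z *\<^sub>R \<i>)" by (rule arg_cong[of _ _ f]) (simp add: complex_eq_iff)
    then show ?thesis by (simp add: add scaleR)
  qed
  define A where "A = (of_real (f 1) - \<i> * of_real (f \<i>)) / 2"
  define B where "B = (of_real (f 1) + \<i> * of_real (f \<i>)) / 2"
  have "of_real (f (e1 x)) = A * e1 (of_int 1 * x) + B * e1 (of_int (-1) * x)" for x
    unfolding f[of "e1 x"] by (simp add: A_def B_def complex_eq_iff e1_def field_simps)
  then show ?case using trig.add[OF trig.mono[of A 1] trig.mono[of B "-1"]] by simp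
next
  case (const c)
  then show ?case by (rule trig_const)
next
  case (add f g)
  then show ?case using trig.add by simp
next
  case (mult f g)
  then show ?case using trig_mult by simp
qed

lemma periodic_of_int:
  fixes h :: "real \<Rightarrow> 'a"
  assumes "\<And>x. h (x + 1) = h x"
  shows "h (x + of_int k) = h x"
proof -
  have n: "h (x + of_nat n) = h x" for n x
  proof (induction n)
    case (Suc n)
    have "h (x + of_nat (Suc n)) = h ((x + of_nat n) + 1)" by (simp add: add_ac)
    then show ?case using assms Suc by simp
  qed simp
  show ?thesis
  proof (cases "k \<ge> 0")
    case True
    then show ?thesis using n[of x "nat k"] by simp
  next
    case False
    then show ?thesis using n[of "x + of_int k" "nat (-k)"] by simp
  qed
qed

text \<open>A periodic function descends to the circle. The map from \<open>{0..1}\<close> onto the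
  circle is a quotient map, being continuous from a compact to a Hausdorff space, so continuity
  descends as well and the Stone-Weierstrass theorem applies.\<close>

theorem trig_approximation:
  fixes h :: "real \<Rightarrow> real"
  assumes h: "continuous_on UNIV h" and per: "\<And>x. h (x + 1) = h x" and e: "e > 0"
  obtains g where "trig g" "\<And>x. cmod (of_real (h x) - g x) < e"
proof -
  define H where "H = (\<lambda>z. h (SOME x. e1 x = z))"
  have He: "H (e1 x) = h x" for x
  proof -
    have "e1 (SOME y. e1 y = e1 x) = e1 x" by (rule someI) (rule refl)
    then obtain k :: int where "(SOME y. e1 y = e1 x) = x + of_int k" using e1_eq_iff by auto
    then show ?thesis unfolding H_def using periodic_of_int[of h, OF per] by simp
  qed
  have im: "e1 ` {0..1} = sphere 0 1"
  proof (intro equalityI subsetI)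
    fix z :: complex assume "z \<in> sphere 0 1"
    then have "z = exp (\<i> * of_real (Arg2pi z))" using Arg2pi_eq[of z] by simp
    then have "z = e1 (Arg2pi z / (2*pi))" by (simp add: e1_def cis_conv_exp)
    moreover have "Arg2pi z / (2*pi) \<in> {0..1}" using Arg2pi[of z] by (simp add: field_simps)
    ultimately show "z \<in> e1 ` {0..1}" by blast
  qed auto
  have "quotient_map (top_of_set {0..1}) (top_of_set (sphere 0 1)) e1"
  proof (rule continuous_imp_quotient_map)
    have "continuous_on {0..1} e1" using continuous_on_e1[OF continuous_on_id] by simp
    then show "continuous_map (top_of_set {0..1}) (top_of_set (sphere 0 1)) e1"
      using im by (simp add: continuous_map_in_subtopology image_subset_iff_funcset[symmetric])
    show "compact_space (top_of_set {0..1::real})"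
      by (simp add: compact_space_subtopology)
    show "Hausdorff_space (top_of_set (sphere (0::complex) 1))"
      by (simp add: Hausdorff_space_subtopology)
  qed (use im in simp)
  moreover have "continuous_map (top_of_set {0..1}) euclideanreal (H \<circ> e1)"
    using continuous_on_subset[OF h] He by (simp add: o_def)
  ultimately have "continuous_map (top_of_set (sphere 0 1)) euclideanreal H"
    by (rule continuous_compose_quotient_map)
  then have "continuous_on (sphere 0 1) H" by simp
  then obtain p where p: "real_polynomial_function p" "\<And>z. z \<in> sphere 0 1 \<Longrightarrow> \<bar>H z - p z\<bar> < e"
    using Stone_Weierstrass_real_polynomial_function[of "sphere 0 1" H e] e by auto
  show ?thesis
  proof (rule that[OF trig_real_polynomial[OF p(1)]])
    fix x
    have "\<bar>h x - p (e1 x)\<bar> < e" using p(2)[of "e1 x"] He by simp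
    then show "cmod (of_real (h x) - of_real (p (e1 x))) < e"
      by (metis norm_of_real of_real_diff real_norm_def)
  qed
qed

lemma e1_integral:
  fixes k :: int
  shows "((\<lambda>x. e1 (of_int k * x)) has_integral (if k = 0 then 1 else 0)) {0..1}"
proof (cases "k = 0")
  case True
  then show ?thesis using has_integral_const_real[of "1::complex" 0 1] by simp
next
  case False
  define F where "F = (\<lambda>x. e1 (of_int k * x) / (2 * pi * \<i> * of_int k))"
  have "((\<lambda>x. e1 (of_int k * x)) has_integral (F 1 - F 0)) {0..1}"
  proof (rule fundamental_theorem_of_calculus)
    fix x :: real
    have "((\<lambda>x. exp (of_real x * (2 * pi * \<i> * of_int k)) / (2 * pi * \<i> * of_int k)) has_vector_derivative
        exp (of_real x * (2 * pi * \<i> * of_int k))) (at x within {0..1})"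
      using False by (auto intro!: derivative_eq_intros has_vector_derivative_real_field simp: field_simps)
    then show "(F has_vector_derivative e1 (of_int k * x)) (at x within {0..1})"
      by (simp add: F_def e1_def cis_conv_exp mult_ac)
  qed simp
  moreover have "F 1 - F 0 = 0" by (simp add: F_def)
  ultimately show ?thesis using False by simp
qed

text \<open>Since \<open>h\<close> is orthogonal to all trigonometric polynomials and its conjugate
  is a uniform limit of such polynomials, the integral of \<open>|h|^2\<close> vanishes.\<close>

lemma fourier_unique:
  fixes h :: "real \<Rightarrow> complex"
  assumes h: "continuous_on UNIV h" and per: "\<And>x. h (x + 1) = h x"
    and zero: "\<And>k::int. integral {0..1} (\<lambda>x. h x * e1 (of_int k * x)) = 0"
  shows "h x = 0"
proof -
  have int: "(\<lambda>x. h x * g x) integrable_on {0..1}" if "trig g" for g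
    using continuous_on_subset[OF h] continuous_on_trig[OF that]
    by (intro integrable_continuous_interval continuous_intros) auto
  have orth: "integral {0..1} (\<lambda>x. h x * g x) = 0" if "trig g" for g
    using that
  proof (induction rule: trig.induct)
    case (mono c k)
    have "integral {0..1} (\<lambda>x. h x * (c * e1 (of_int k * x))) = integral {0..1} (\<lambda>x. c * (h x * e1 (of_int k * x)))"
      by (simp add: mult_ac)
    then show ?case using zero by simp
  next
    case (add f g)
    then show ?case using int by (simp add: distrib_left integral_add)
  qed
  have hc: "continuous_on {0..1} h" using h continuous_on_subset by blast
  obtain B where B: "B > 0" "\<And>x. x \<in> {0..1} \<Longrightarrow> cmod (h x) \<le> B"
    using compact_imp_bounded[OF compact_continuous_image[OF hc compact_Icc]]
    unfolding bounded_pos by auto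
  define J where "J = integral {0..1} (\<lambda>x. h x * cnj (h x))"
  have small: "cmod J \<le> B * (2 * e)" if e: "e > 0" for e
  proof -
    obtain g1 where g1: "trig g1" "\<And>x. cmod (of_real (Re (h x)) - g1 x) < e"
      using trig_approximation[of "\<lambda>x. Re (h x)" e] h per e by (auto intro: continuous_intros)
    obtain g2 where g2: "trig g2" "\<And>x. cmod (of_real (Im (h x)) - g2 x) < e"
      using trig_approximation[of "\<lambda>x. Im (h x)" e] h per e by (auto intro: continuous_intros)
    \<comment> \<open>Real and imaginary parts are approximated separately and combined to the
      conjugate of \<open>h\<close>, so that \<open>h * g\<close> is close to
      \<open>|h|^2\<close>.\<close>
    define g where "g = (\<lambda>x. g1 x + (-\<i>) * g2 x)"
    have tg: "trig g" unfolding g_def by (intro trig.add trig_cmult g1 g2)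
    have d: "cmod (cnj (h x) - g x) \<le> 2 * e" for x
    proof -
      have "cnj (h x) - g x = (of_real (Re (h x)) - g1 x) + (-\<i>) * (of_real (Im (h x)) - g2 x)"
        by (simp add: g_def complex_eq_iff)
      also have "cmod \<dots> \<le> cmod (of_real (Re (h x)) - g1 x) + cmod (of_real (Im (h x)) - g2 x)"
        by (rule order_trans[OF norm_triangle_ineq]) (simp add: norm_mult)
      finally show ?thesis using g1(2)[of x] g2(2)[of x] by linarith
    qed
    have ic: "(\<lambda>x. h x * cnj (h x)) integrable_on {0..1}"
      using hc by (intro integrable_continuous_interval continuous_intros)
    have "J = integral {0..1} (\<lambda>x. h x * cnj (h x)) - integral {0..1} (\<lambda>x. h x * g x)"
      by (simp add: J_def orth[OF tg])
    also have "\<dots> = integral {0..1} (\<lambda>x. h x * (cnj (h x) - g x))"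
      using integral_diff[OF ic int[OF tg]] by (simp add: right_diff_distrib)
    also have "cmod \<dots> \<le> (B * (2 * e)) * (1 - 0)"
    proof (rule integral_bound)
      show "continuous_on {0..1} (\<lambda>x. h x * (cnj (h x) - g x))"
        using hc continuous_on_trig[OF tg] by (intro continuous_intros)
      show "cmod (h x * (cnj (h x) - g x)) \<le> B * (2 * e)" if "x \<in> {0..1}" for x
        unfolding norm_mult using B that d[of x] by (intro mult_mono) auto
    qed simp
    finally show ?thesis by simp
  qed
  have J0: "J = 0"
  proof (rule ccontr)
    assume "J \<noteq> 0"
    then have "cmod J > 0" by simp
    then have "cmod J \<le> B * (2 * (cmod J / (4 * B)))" using small[of "cmod J / (4 * B)"] B by simp
    then show False using B \<open>cmod J > 0\<close> by simp
  qed
  have cn: "continuous_on {0..1} (\<lambda>x. (cmod (h x))\<^sup>2)" using hc by (intro continuous_intros)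
  have "J = of_real (integral {0..1} (\<lambda>x. (cmod (h x))\<^sup>2))"
    unfolding J_def complex_norm_square[symmetric]
    using integral_linear[OF integrable_continuous_interval[OF cn] bounded_linear_of_real[where 'a=complex]]
    by (simp add: o_def)
  with J0 have "integral {0..1} (\<lambda>x. (cmod (h x))\<^sup>2) = 0" by simp
  then have z: "h x = 0" if "x \<in> {0..1}" for x
    using integral_eq_0_iff[OF cn] that by auto
  have "h x = h (x - of_int \<lfloor>x\<rfloor>)" using periodic_of_int[of h, OF per, of "x - of_int \<lfloor>x\<rfloor>" "\<lfloor>x\<rfloor>"] by simp
  also have "\<dots> = 0" by (rule z) (simp, linarith)
  finally show ?thesis .
qed

section \<open>Series indexed by the integers\<close>

lemma abs_summable_on_int:
  fixes f :: "int \<Rightarrow> 'a::banach" and g :: "nat \<Rightarrow> real"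
  assumes "summable g" "\<And>n. norm (f n) \<le> g (nat \<bar>n\<bar>)"
  shows "(\<lambda>n. norm (f n)) summable_on UNIV"
proof -
  have g0: "g n \<ge> 0" for n using order_trans[OF norm_ge_zero assms(2)[of "int n"]] by simp
  then have g: "g summable_on UNIV"
    using assms(1) by (intro norm_summable_imp_summable_on) simp
  have 1: "(\<lambda>n. g (nat \<bar>n\<bar>)) summable_on range int"
    using g by (subst summable_on_reindex) (auto simp: o_def)
  have 2: "(\<lambda>n. g (nat \<bar>n\<bar>)) summable_on range (\<lambda>n. - int n)"
    using g by (subst summable_on_reindex) (auto simp: o_def inj_on_def)
  have "range int \<union> range (\<lambda>n. - int n) = UNIV"
  proof -
    have "x \<in> range int \<union> range (\<lambda>n. - int n)" for x
      by (cases x rule: int_cases2) auto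
    then show ?thesis by blast
  qed
  with summable_on_union[OF 1 2] have "(\<lambda>n. g (nat \<bar>n\<bar>)) summable_on UNIV" by simp
  then show ?thesis by (rule Infinite_Sum.abs_summable_on_comparison_test') (rule assms(2))
qed

lemma filterlim_int_intervals:
  "filterlim (\<lambda>N::nat. {- int N..<int N}) (finite_subsets_at_top UNIV) sequentially"
  unfolding filterlim_finite_subsets_at_top
proof (intro allI impI)
  fix Y :: "int set" assume "finite Y \<and> Y \<subseteq> UNIV"
  then have Y: "finite Y" by simp
  define M where "M = nat (Max (insert 0 (abs ` Y))) + 1"
  have M: "\<bar>x\<bar> < int M" if "x \<in> Y" for x
  proof -
    have "\<bar>x\<bar> \<le> Max (insert 0 (abs ` Y))" using Y that by (intro Max_ge) auto
    moreover have "0 \<le> Max (insert 0 (abs ` Y))" using Y by (intro Max_ge) auto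
    ultimately show ?thesis unfolding M_def by linarith
  qed
  show "eventually (\<lambda>N. finite {- int N..<int N} \<and> Y \<subseteq> {- int N..<int N} \<and> {- int N..<int N} \<subseteq> UNIV) sequentially"
    using eventually_ge_at_top[of M]
  proof eventually_elim
    case (elim N)
    have "x \<in> {- int N..<int N}" if "x \<in> Y" for x using M[OF that] elim by auto
    then show ?case by auto
  qed
qed

text \<open>Pairing \<open>j\<close> with \<open>-j-1\<close> makes the sums over
  \<open>{-N..<N}\<close> the partial sums, so that unconditional sums over the integers become
  ordinary series.\<close>

lemma int_sums:
  fixes f :: "int \<Rightarrow> 'a::real_normed_vector"
  assumes "(f has_sum S) UNIV"
  shows "(\<lambda>j. f (int j) + f (- int j - 1)) sums S"
proof -
  have "(\<lambda>N. sum f {- int N..<int N}) \<longlonglongrightarrow> S"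
    using filterlim_compose[OF assms[unfolded has_sum_def] filterlim_int_intervals] .
  moreover have "sum f {- int N..<int N} = (\<Sum>j<N. f (int j) + f (- int j - 1))" for N
  proof (induction N)
    case (Suc N)
    have "{- int (Suc N)..<int (Suc N)} = insert (int N) (insert (- int N - 1) {- int N..<int N})" by auto
    then show ?case using Suc by (simp add: add_ac)
  qed simp
  ultimately show ?thesis by (simp add: sums_def)
qed

lemma uniform_series_integral:
  fixes f :: "int \<Rightarrow> real \<Rightarrow> complex"
  assumes cont: "\<And>n. continuous_on {a..b} (f n)"
    and bd: "\<And>n x. x \<in> {a..b} \<Longrightarrow> cmod (f n x) \<le> M n" and M: "M summable_on UNIV"
  shows "((\<lambda>n. integral {a..b} (f n)) has_sum integral {a..b} (\<lambda>x. infsum (\<lambda>n. f n x) UNIV)) UNIV"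
    and "continuous_on {a..b} (\<lambda>x. infsum (\<lambda>n. f n x) UNIV)"
proof -
  have ul: "uniform_limit {a..b} (\<lambda>Y x. \<Sum>n\<in>Y. f n x) (\<lambda>x. infsum (\<lambda>n. f n x) UNIV) (finite_subsets_at_top UNIV)"
    by (rule Weierstrass_m_test_general[OF bd M]) auto
  have c: "continuous_on {a..b} (\<lambda>x. \<Sum>n\<in>Y. f n x)" for Y
    by (intro continuous_on_sum cont)
  show "continuous_on {a..b} (\<lambda>x. infsum (\<lambda>n. f n x) UNIV)"
    by (rule uniform_limit_theorem[OF _ ul]) (auto simp: c)
  obtain I J where IJ: "\<And>Y. ((\<lambda>x. \<Sum>n\<in>Y. f n x) has_integral I Y) {a..b}"
     "((\<lambda>x. infsum (\<lambda>n. f n x) UNIV) has_integral J) {a..b}" "(I \<longlongrightarrow> J) (finite_subsets_at_top UNIV)"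
    using uniform_limit_integral[OF ul c] by auto
  have "I Y = (\<Sum>n\<in>Y. integral {a..b} (f n))" if "finite Y" for Y
    using integral_unique[OF IJ(1)[of Y]] integrable_continuous_interval[OF cont] that
    by (simp add: integral_sum)
  then have "(sum (\<lambda>n. integral {a..b} (f n)) \<longlongrightarrow> J) (finite_subsets_at_top UNIV)"
    using IJ(3) by (rule_tac Lim_transform_eventually) (auto intro: eventually_finite_subsets_at_top_weakI)
  then show "((\<lambda>n. integral {a..b} (f n)) has_sum integral {a..b} (\<lambda>x. infsum (\<lambda>n. f n x) UNIV)) UNIV"
    using integral_unique[OF IJ(2)] by (simp add: has_sum_def)
qed

section \<open>Poisson summation for Gaussians\<close>

definition gs :: "real \<Rightarrow> real \<Rightarrow> real" where
  "gs t x = exp (- (pi * t * x\<^sup>2))"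

lemma continuous_on_gs [continuous_intros]:
  "continuous_on S f \<Longrightarrow> continuous_on S (\<lambda>x. gs t (f x))"
  unfolding gs_def by (intro continuous_intros)

lemma gs_minus [simp]: "gs t (-x) = gs t x"
  by (simp add: gs_def)

text \<open>This is the characteristic function of the standard normal distribution after a linear
  substitution.\<close>

lemma gauss_fourier:
  assumes t: "t > 0"
  shows "((\<lambda>x. of_real (gs t x) * e1 (s * x)) has_integral of_real (gs (1/t) s / sqrt t)) UNIV"
proof -
  \<comment> \<open>This scale turns the exponent \<open>x^2 / 2\<close> of the normal density into
    \<open>pi * t * x^2\<close>.\<close>
  define c where "c = sqrt (2 * pi * t)"
  have c: "c > 0" "c\<^sup>2 = 2 * pi * t" using t by (auto simp: c_def)
  define u where "u = 2 * pi * s / c"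
  interpret real_distribution std_normal_distribution by (rule real_dist_normal_dist)
  define f where "f = (\<lambda>x. std_normal_density x *\<^sub>R exp (\<i> * complex_of_real (u * x)))"
  have "integrable std_normal_distribution (\<lambda>x. exp (\<i> * complex_of_real (u * x)))"
    by (rule integrable_iexp) auto
  then have "integrable lborel f"
    unfolding f_def by (subst (asm) integrable_density) auto
  moreover have "integral\<^sup>L lborel f = complex_of_real (exp (- (u\<^sup>2) / 2))"
    using char_std_normal_distribution[THEN fun_cong, of u]
    unfolding f_def char_def by (subst (asm) integral_density) auto
  ultimately have "has_bochner_integral lborel f (of_real (exp (- (u\<^sup>2) / 2)))"
    by (simp add: has_bochner_integral_iff)
  then have h: "has_bochner_integral lborel (\<lambda>x. f (0 + c * x)) (of_real (exp (- (u\<^sup>2) / 2)) /\<^sub>R \<bar>c\<bar>)"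
    using lborel_has_bochner_integral_real_affine_iff[of c f _ 0] c by blast
  have "((\<lambda>x. f (0 + c * x)) has_integral (of_real (exp (- (u\<^sup>2) / 2)) /\<^sub>R \<bar>c\<bar>)) UNIV"
    using has_integral_integral_lborel[of "\<lambda>x. f (0 + c * x)"] h by (simp add: has_bochner_integral_iff)
  from has_integral_mult_right[OF this, of "complex_of_real (sqrt (2*pi))"]
  have *: "((\<lambda>x. of_real (sqrt (2*pi)) * f (0 + c * x)) has_integral
     (of_real (sqrt (2*pi)) * (of_real (exp (- (u\<^sup>2) / 2)) /\<^sub>R \<bar>c\<bar>))) UNIV" .
  have 1: "of_real (sqrt (2*pi)) * f (0 + c * x) = of_real (gs t x) * e1 (s * x)" for x
  proof -
    have "sqrt (2*pi) * std_normal_density (c * x) = gs t x"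
      unfolding std_normal_density_def gs_def using c by (simp add: power_mult_distrib)
    moreover have "exp (\<i> * complex_of_real (u * (c * x))) = e1 (s * x)"
      using c(1) by (simp add: e1_def cis_conv_exp u_def mult_ac)
    ultimately show ?thesis by (simp add: f_def scaleR_conv_of_real flip: of_real_mult mult.assoc)
  qed
  have 2: "of_real (sqrt (2*pi)) * (of_real (exp (- (u\<^sup>2) / 2)) /\<^sub>R \<bar>c\<bar>) = complex_of_real (gs (1/t) s / sqrt t)"
  proof -
    have "u\<^sup>2 / 2 = pi * (1/t) * s\<^sup>2"
      unfolding u_def power_divide power_mult_distrib c(2) using t by (simp add: power2_eq_square)
    then have ex: "exp (- (u\<^sup>2) / 2) = gs (1/t) s" by (simp add: gs_def)
    have "sqrt (2*pi) / \<bar>c\<bar> = 1 / sqrt t"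
      using t unfolding c_def by (simp add: real_sqrt_mult)
    then have e: "(sqrt (2*pi) / \<bar>c\<bar>) * x = x / sqrt t" for x by (simp only:) simp
    have ab: "of_real a * (of_real b /\<^sub>R d) = complex_of_real ((a / d) * b)" for a b d :: real
      by (simp add: scaleR_conv_of_real divide_inverse)
    show ?thesis unfolding ex ab e ..
  qed
  show ?thesis using * unfolding 1 2 .
qed

definition gbound :: "real \<Rightarrow> real \<Rightarrow> nat \<Rightarrow> real" where
  "gbound t R n = exp (pi * t * R\<^sup>2) * exp (- (pi * t / 2)) ^ n"

lemma summable_gbound: "t > 0 \<Longrightarrow> summable (gbound t R)"
  unfolding gbound_def by (intro summable_mult summable_geometric) simp

text \<open>Completing the square gives \<open>(x + n)^2 >= n^2/2 - x^2\<close>, and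
  \<open>n^2 >= |n|\<close> for integers; the resulting bound is geometric in \<open>|n|\<close> and
  uniform for \<open>|x| <= R\<close>.\<close>

lemma gs_bound:
  assumes "t > 0" "\<bar>x\<bar> \<le> R"
  shows "gs t (x + of_int n) \<le> gbound t R (nat \<bar>n\<bar>)"
proof -
  have 1: "x\<^sup>2 \<le> R\<^sup>2" using assms(2) by (intro abs_le_square_iff[THEN iffD1]) auto
  have "(of_int n)\<^sup>2 / 2 - x\<^sup>2 \<le> (x + of_int n)\<^sup>2"
    using sum_squares_ge_zero[of "2*x + of_int n" 0] by (simp add: power2_eq_square algebra_simps)
  moreover have "real (nat \<bar>n\<bar>) \<le> (of_int n)\<^sup>2"
  proof -
    have "\<bar>n\<bar> * 1 \<le> \<bar>n\<bar> * \<bar>n\<bar>" by (cases "n = 0", simp, rule mult_left_mono) auto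
    then have "\<bar>n\<bar> \<le> n\<^sup>2" by (simp add: power2_eq_square)
    then have "real_of_int \<bar>n\<bar> \<le> real_of_int (n\<^sup>2)" by (rule of_int_le_iff[THEN iffD2])
    then show ?thesis by simp
  qed
  ultimately have "real (nat \<bar>n\<bar>) / 2 - R\<^sup>2 \<le> (x + of_int n)\<^sup>2" using 1 by linarith
  then have "pi * t * (real (nat \<bar>n\<bar>) / 2 - R\<^sup>2) \<le> pi * t * (x + of_int n)\<^sup>2"
    using assms(1) by (intro mult_left_mono) auto
  then have "- (pi * t * (x + of_int n)\<^sup>2) \<le> pi * t * R\<^sup>2 + real (nat \<bar>n\<bar>) * - (pi * t / 2)"
    by (simp add: algebra_simps)
  then have "gs t (x + of_int n) \<le> exp (pi * t * R\<^sup>2 + real (nat \<bar>n\<bar>) * - (pi * t / 2))"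
    unfolding gs_def exp_le_cancel_iff .
  then show ?thesis unfolding gbound_def exp_add exp_of_nat_mult .
qed

definition gper :: "real \<Rightarrow> real \<Rightarrow> complex" where
  "gper t x = infsum (\<lambda>n::int. of_real (gs t (x + of_int n))) UNIV"

lemma gs_nonneg [simp]: "gs t x \<ge> 0"
  by (simp add: gs_def)

lemma gbound_summable_on_int: "t > 0 \<Longrightarrow> (\<lambda>n::int. gbound t R (nat \<bar>n\<bar>)) summable_on UNIV"
  by (rule abs_summable_summable[OF abs_summable_on_int[OF summable_gbound[of t R]]])
     (auto simp: gbound_def)

lemma gper_has_sum:
  assumes "t > 0"
  shows "((\<lambda>n::int. complex_of_real (gs t (x + of_int n))) has_sum gper t x) UNIV"
proof -
  have "(\<lambda>n::int. norm (complex_of_real (gs t (x + of_int n)))) summable_on UNIV"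
    by (rule abs_summable_on_int[OF summable_gbound[of t "\<bar>x\<bar>"]]) (use assms gs_bound[of t x "\<bar>x\<bar>"] in auto)
  then show ?thesis unfolding gper_def by (rule has_sum_infsum[OF abs_summable_summable])
qed

lemma continuous_on_gper:
  assumes t: "t > 0"
  shows "continuous_on UNIV (gper t)"
proof -
  have "isCont (gper t) x" for x
  proof -
    have "continuous_on {-(\<bar>x\<bar>+1)..\<bar>x\<bar>+1} (gper t)"
      unfolding gper_def [abs_def]
      by (rule uniform_series_integral(2)[OF _ _ gbound_summable_on_int[OF t, of "\<bar>x\<bar>+1"]])
         (use gs_bound[OF t, of _ "\<bar>x\<bar>+1"] in \<open>auto intro!: continuous_intros simp: abs_le_iff\<close>)
    then show ?thesis by (rule continuous_on_interior) (auto simp: abs_if)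
  qed
  then show ?thesis by (simp add: continuous_on_eq_continuous_at)
qed

lemma gper_periodic: "gper t (x + 1) = gper t x"
proof -
  have "bij (\<lambda>n::int. n + 1)" by (rule bij_betw_byWitness[of _ "\<lambda>n. n - 1"]) auto
  from infsum_reindex_bij_betw[OF this, of "\<lambda>n. complex_of_real (gs t (x + of_int n))"]
  show ?thesis by (simp add: gper_def add_ac)
qed

text \<open>Unfolding: \<open>e1 (k * x)\<close> has period 1, so integrating against the periodised
  Gaussian over one period gives the integral over the line, which is the Fourier transform at
  \<open>k\<close>.\<close>

lemma gper_coeff:
  assumes t: "t > 0"
  shows "integral {0..1} (\<lambda>x. gper t x * e1 (of_int k * x)) = of_real (gs (1/t) (of_int k) / sqrt t)"
proof -
  define \<phi> where "\<phi> = (\<lambda>x. complex_of_real (gs t x) * e1 (of_int k * x))"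
  have c\<phi>: "continuous_on S \<phi>" for S unfolding \<phi>_def by (intro continuous_intros)
  have per: "complex_of_real (gs t (x + of_int n)) * e1 (of_int k * x) = \<phi> (x + of_int n)" for x and n :: int
  proof -
    have "e1 (of_int k * (x + of_int n)) = e1 (of_int k * x + of_int (k * n))" by (simp add: distrib_left)
    then show ?thesis unfolding \<phi>_def by (simp only: e1_add_int)
  qed
  have eq: "gper t x * e1 (of_int k * x) = infsum (\<lambda>n::int. \<phi> (x + of_int n)) UNIV" for x
    unfolding gper_def per[symmetric] by (rule infsum_cmult_left'[symmetric])
  have "((\<lambda>n::int. integral {0..1} (\<lambda>x. \<phi> (x + of_int n))) has_sum integral {0..1} (\<lambda>x. infsum (\<lambda>n::int. \<phi> (x + of_int n)) UNIV)) UNIV"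
  proof (rule uniform_series_integral(1)[OF _ _ gbound_summable_on_int[OF t, of 1]])
    show "cmod (\<phi> (x + of_int n)) \<le> gbound t 1 (nat \<bar>n\<bar>)" if "x \<in> {0..1}" for n x
      using gs_bound[OF t, of x 1 n] that by (simp add: \<phi>_def norm_mult)
  qed (auto intro!: continuous_on_compose2[OF c\<phi>[of UNIV]] continuous_intros)
  then have hs: "((\<lambda>n::int. integral {of_int n..of_int n + 1} \<phi>) has_sum integral {0..1} (\<lambda>x. gper t x * e1 (of_int k * x))) UNIV"
    unfolding eq using integral_shift_real_ivl[of "of_int n" "of_int n" "of_int n + 1" \<phi> for n] by simp
  have fin: "sum (\<lambda>n. integral {of_int n..of_int n + 1} \<phi>) {- int N..<int N} = integral {- real N..real N} \<phi>" for N
  proof (induction N)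
    case (Suc N)
    have i: "\<phi> integrable_on {a..b}" for a b by (rule integrable_continuous_interval[OF c\<phi>])
    have "{- int (Suc N)..<int (Suc N)} = insert (int N) (insert (- int N - 1) {- int N..<int N})" by auto
    then have "sum (\<lambda>n. integral {of_int n..of_int n + 1} \<phi>) {- int (Suc N)..<int (Suc N)} =
       integral {real N..real N + 1} \<phi> + (integral {- real N - 1..- real N} \<phi> + integral {- real N..real N} \<phi>)"
      using Suc by (simp add: add_ac)
    also have "integral {- real N - 1..- real N} \<phi> + integral {- real N..real N} \<phi> = integral {- real N - 1..real N} \<phi>"
      by (rule Henstock_Kurzweil_Integration.integral_combine) (auto intro: i)
    also have "integral {real N..real N + 1} \<phi> + integral {- real N - 1..real N} \<phi> = integral {- real N - 1..real N + 1} \<phi>"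
      using Henstock_Kurzweil_Integration.integral_combine[of "- real N - 1" "real N" "real N + 1" \<phi>] i by (simp add: add_ac)
    finally show ?case by (simp only: of_nat_Suc minus_add_distrib add_ac diff_conv_add_uminus)
  qed simp
  have "(\<lambda>N. integral {- real N..real N} \<phi>) \<longlonglongrightarrow> integral {0..1} (\<lambda>x. gper t x * e1 (of_int k * x))"
    using filterlim_compose[OF hs[unfolded has_sum_def] filterlim_int_intervals] unfolding fin .
  moreover have "(\<lambda>N. integral {- real N..real N} \<phi>) \<longlonglongrightarrow> of_real (gs (1/t) (of_int k) / sqrt t)"
    unfolding LIMSEQ_iff
  proof (intro allI impI)
    fix e :: real assume "e > 0"
    with gauss_fourier[OF t, of "of_int k"] obtain B where B: "B > 0"
      "\<And>a b. ball 0 B \<subseteq> cbox a b \<Longrightarrow> norm (integral (cbox a b) \<phi> - of_real (gs (1/t) (of_int k) / sqrt t)) < e"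
      unfolding has_integral_alt' \<phi>_def[symmetric] by auto
    show "\<exists>N0. \<forall>N\<ge>N0. norm (integral {- real N..real N} \<phi> - of_real (gs (1/t) (of_int k) / sqrt t)) < e"
    proof (intro exI allI impI)
      fix N assume "N \<ge> nat \<lceil>B\<rceil>"
      then have "B \<le> real N" by linarith
      then have "ball 0 B \<subseteq> cbox (- real N) (real N)" by (auto simp: dist_real_def)
      then show "norm (integral {- real N..real N} \<phi> - of_real (gs (1/t) (of_int k) / sqrt t)) < e"
        using B(2)[of "- real N" "real N"] by simp
    qed
  qed
  ultimately show ?thesis by (rule LIMSEQ_unique)
qed

text \<open>The dual series \<open>d\<close> is continuous and periodic and has the same Fourier
  coefficients as \<open>gper t\<close>, so \<open>fourier_unique\<close> applies to the
  difference.\<close>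

theorem poisson_gauss:
  assumes t: "t > 0"
  shows "((\<lambda>k::int. of_real (gs (1/t) (of_int k) / sqrt t) * e1 (of_int k * x)) has_sum gper t x) UNIV"
proof -
  define D where "D = (\<lambda>k::int. complex_of_real (gs (1/t) (of_int k) / sqrt t))"
  define M where "M = (\<lambda>n::int. gbound (1/t) 0 (nat \<bar>n\<bar>) * (1 / sqrt t))"
  have DM: "cmod (D k) \<le> M k" for k
  proof -
    have "gs (1/t) (of_int k) * (1 / sqrt t) \<le> M k"
      unfolding M_def using gs_bound[of "1/t" 0 0 k] t by (intro mult_right_mono) auto
    then show ?thesis using t by (simp add: D_def norm_divide)
  qed
  have M: "M summable_on UNIV"
    unfolding M_def using t by (intro summable_on_cmult_left gbound_summable_on_int) auto
  have sm: "(\<lambda>k. D k * e1 (of_int k * x)) summable_on UNIV" for x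
    by (rule abs_summable_summable[OF Infinite_Sum.abs_summable_on_comparison_test'[OF M]]) (simp add: norm_mult DM)
  define d where "d = (\<lambda>x. infsum (\<lambda>k. D k * e1 (of_int k * x)) UNIV)"
  have dc: "isCont d x" for x
  proof -
    have "continuous_on {x - 1..x + 1} d" unfolding d_def
      by (rule uniform_series_integral(2)[OF _ _ M]) (auto intro!: continuous_intros simp: norm_mult DM)
    then show ?thesis by (rule continuous_on_interior) auto
  qed
  have dper: "d (x + 1) = d x" for x
    unfolding d_def by (intro infsum_cong) (simp add: distrib_left)
  have coeff: "integral {0..1} (\<lambda>x. d x * e1 (of_int k * x)) = D k" for k
  proof -
    have e: "D n * e1 (of_int n * x) * e1 (of_int k * x) = D n * e1 (of_int (n + k) * x)" for n x
      by (simp add: distrib_right e1_add mult.assoc)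
    have "((\<lambda>n. integral {0..1} (\<lambda>x. D n * e1 (of_int (n + k) * x))) has_sum
       integral {0..1} (\<lambda>x. infsum (\<lambda>n. D n * e1 (of_int (n + k) * x)) UNIV)) UNIV"
      by (rule uniform_series_integral(1)[OF _ _ M]) (auto intro!: continuous_intros simp: norm_mult DM)
    also have "(\<lambda>x. infsum (\<lambda>n. D n * e1 (of_int (n + k) * x)) UNIV) = (\<lambda>x. d x * e1 (of_int k * x))"
      unfolding d_def e[symmetric] by (simp add: infsum_cmult_left')
    finally have A: "((\<lambda>n. integral {0..1} (\<lambda>x. D n * e1 (of_int (n + k) * x))) has_sum
       integral {0..1} (\<lambda>x. d x * e1 (of_int k * x))) UNIV" .
    \<comment> \<open>Orthogonality keeps only the frequency \<open>n = -k\<close>; since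
      \<open>D\<close> is even, the coefficient is \<open>D k\<close>.\<close>
    have B: "integral {0..1} (\<lambda>x. D n * e1 (of_int (n + k) * x)) = (if n = -k then D n else 0)" for n
      using integral_unique[OF has_integral_mult_right[OF e1_integral[of "n+k"], of "D n"]]
      by (auto simp: eq_neg_iff_add_eq_0)
    have "((\<lambda>n. if n = -k then D n else 0) has_sum integral {0..1} (\<lambda>x. d x * e1 (of_int k * x))) UNIV"
      using A unfolding B .
    moreover have "((\<lambda>n. if n = -k then D n else 0) has_sum D (-k)) UNIV"
      by (rule has_sum_finite_neutralI[of "{-k}"]) auto
    ultimately show ?thesis using has_sum_unique by (fastforce simp: D_def)
  qed
  have "gper t x - d x = 0" for x
  proof (rule fourier_unique)
    show "continuous_on UNIV (\<lambda>x. gper t x - d x)"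
      using continuous_on_gper[OF t] dc by (intro continuous_on_diff) (auto simp: continuous_on_eq_continuous_at)
    show "gper t (x + 1) - d (x + 1) = gper t x - d x" for x by (simp add: gper_periodic dper)
    show "integral {0..1} (\<lambda>x. (gper t x - d x) * e1 (of_int k * x)) = 0" for k
    proof -
      have "(\<lambda>x. gper t x * e1 (of_int k * x)) integrable_on {0..1}"
        "(\<lambda>x. d x * e1 (of_int k * x)) integrable_on {0..1}"
        using continuous_on_subset[OF continuous_on_gper[OF t]] dc
        by (auto intro!: integrable_continuous_interval continuous_intros simp: continuous_at_imp_continuous_on)
      then show ?thesis
        by (simp add: left_diff_distrib integral_diff gper_coeff[OF t] coeff D_def)
    qed
  qed
  then have "gper t x = d x" by simp
  then show ?thesis using has_sum_infsum[OF sm[of x]] by (simp add: d_def D_def)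
qed

section \<open>The eta function and its fourth power\<close>

definition chi12 :: "nat \<Rightarrow> int" where
  "chi12 n = (if n mod 12 = 1 \<or> n mod 12 = 11 then 1 else if n mod 12 = 5 \<or> n mod 12 = 7 then -1 else 0)"

definition chi4 :: "nat \<Rightarrow> int" where
  "chi4 n = (if n mod 4 = 1 then 1 else if n mod 4 = 3 then -1 else 0)"

lemma sum_block:
  "sum f {l*k..<l*k+k} = (\<Sum>i<k. f (i + l*k))" for l k :: nat
  using sum.shift_bounds_nat_ivl[of f 0 "l*k" k] by (simp add: atLeast0LessThan add.commute)

lemma chi12_summable:
  fixes t :: "'a::{real_normed_field,banach}"
  assumes "norm t < 1"
  shows "summable (\<lambda>n. norm (of_int (chi12 n) * t ^ n\<^sup>2))"
proof (rule summable_comparison_test')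
  show "summable (\<lambda>n. norm t ^ n)" using assms by (intro summable_geometric) simp
  fix n :: nat
  have "norm (of_int (chi12 n) * t ^ n\<^sup>2) \<le> norm t ^ n\<^sup>2"
    by (simp add: norm_mult norm_power chi12_def)
  also have "\<dots> \<le> norm t ^ n"
    using assms by (intro power_decreasing) (auto simp: power2_eq_square)
  finally show "norm (norm (of_int (chi12 n) * t ^ n\<^sup>2)) \<le> norm t ^ n" by simp
qed

lemma chi4_summable:
  fixes t :: "'a::{real_normed_field,banach}"
  assumes "norm t < 1"
  shows "summable (\<lambda>n. norm (of_int (chi4 n) * of_nat n * t ^ (3*n\<^sup>2)))"
proof (rule summable_comparison_test')
  show "summable (\<lambda>n. of_nat (Suc n) * norm t ^ n)"
    using geometric_deriv_sums[of "norm t"] assms by (simp add: sums_iff)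
  fix n :: nat
  have "norm (of_int (chi4 n) * of_nat n * t ^ (3*n\<^sup>2)) \<le> of_nat n * norm t ^ (3*n\<^sup>2)"
    by (simp add: norm_mult norm_power chi4_def)
  also have "\<dots> \<le> of_nat (Suc n) * norm t ^ n"
    using assms by (intro mult_mono power_decreasing) (auto simp: power2_eq_square)
  finally show "norm (norm (of_int (chi4 n) * of_nat n * t ^ (3*n\<^sup>2))) \<le> of_nat (Suc n) * norm t ^ n" by simp
qed

text \<open>In blocks of six only \<open>6l+1\<close> and \<open>6l+5\<close> are prime to 6, and
  their signs alternate with \<open>l\<close>, as in \<open>pentagonal_t\<close>.\<close>

theorem eta_chi12:
  fixes t :: "'a::{real_normed_field,banach}"
  assumes t: "norm t < 1" "t \<noteq> 0"
  shows "(\<lambda>n. of_int (chi12 n) * t ^ n\<^sup>2) sums (t * qinf (t^24))"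
proof -
  define f where "f = (\<lambda>n. of_int (chi12 n) * t ^ n\<^sup>2)"
  have "summable f" unfolding f_def by (rule summable_norm_cancel[OF chi12_summable[OF t(1)]])
  then obtain s where s: "f sums s" by (auto simp: summable_def)
  have "(\<lambda>l. sum f {l*6..<l*6+6}) sums s" by (rule sums_group[OF s]) simp
  moreover have "sum f {l*6..<l*6+6} = (-1)^l * (t^(6*l+1)\<^sup>2 - t^(6*l+5)\<^sup>2)" for l
  proof -
    have six: "{..<6::nat} = {0,1,2,3,4,5}" by auto
    have c: "chi12 (0 + l*6) = 0" "chi12 (2 + l*6) = 0" "chi12 (3 + l*6) = 0" "chi12 (4 + l*6) = 0"
      unfolding chi12_def by presburger+
    have o: "chi12 (1 + l*6) = (if even l then 1 else -1)" "chi12 (5 + l*6) = (if even l then -1 else 1)"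
      unfolding chi12_def by presburger+
    have e: "6*l+1 = 1 + l*6" "6*l+5 = 5 + l*6" by simp_all
    show ?thesis unfolding sum_block six f_def e
      by (simp add: c[simplified] o[simplified])
  qed
  ultimately show ?thesis using sums_unique2[OF _ pentagonal_t[OF t]] s f_def by simp
qed

theorem eta_cube_chi4:
  fixes t :: "'a::{real_normed_field,banach}"
  assumes t: "norm t < 1"
  shows "(\<lambda>n. of_int (chi4 n) * of_nat n * t ^ (3*n\<^sup>2)) sums ((t * qinf (t^24))^3)"
proof -
  define f where "f = (\<lambda>n. of_int (chi4 n) * of_nat n * t ^ (3*n\<^sup>2))"
  have "summable f" unfolding f_def by (rule summable_norm_cancel[OF chi4_summable[OF t]])
  then obtain s where s: "f sums s" by (auto simp: summable_def)
  have "(\<lambda>l. sum f {l*2..<l*2+2}) sums s" by (rule sums_group[OF s]) simp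
  moreover have "sum f {l*2..<l*2+2} = (-1)^l * of_nat (2*l+1) * t^(3*(2*l+1)\<^sup>2)" for l
  proof -
    have two: "{..<2::nat} = {0,1}" by auto
    have o: "chi4 (0 + l*2) = 0" "chi4 (1 + l*2) = (if even l then 1 else -1)"
      unfolding chi4_def by presburger+
    have e: "2*l+1 = 1 + l*2" by simp
    show ?thesis unfolding sum_block two f_def e by (simp add: o[simplified])
  qed
  ultimately show ?thesis using sums_unique2[OF _ cube_t[OF t]] s f_def by simp
qed

section \<open>Inversion of eta on the imaginary axis\<close>

definition tau24 :: "complex \<Rightarrow> complex" where
  "tau24 \<tau> = exp (2 * of_real pi * \<i> * \<tau> / 24)"

lemma norm_tau24: "cmod (tau24 \<tau>) = exp (- (pi * Im \<tau> / 12))"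
  by (simp add: tau24_def)

lemma tau24_bounds: "Im \<tau> > 0 \<Longrightarrow> cmod (tau24 \<tau>) < 1" "tau24 \<tau> \<noteq> 0"
  by (simp_all add: norm_tau24) (simp add: tau24_def)

lemma tau24_power: "tau24 \<tau> ^ n = exp (2 * of_real pi * \<i> * \<tau> * of_nat n / 24)"
  unfolding tau24_def exp_of_nat_mult[symmetric] by (simp add: mult_ac)

lemma dedekind_eta_eq: "dedekind_eta \<tau> = tau24 \<tau> * qinf (tau24 \<tau> ^ 24)"
proof -
  have "tau24 \<tau> ^ 24 = exp (2 * of_real pi * \<i> * \<tau>)" unfolding tau24_power by (simp add: mult_ac)
  then show ?thesis unfolding dedekind_eta_def qinf_def tau24_def by simp
qed

lemma tau24_imaginary: "tau24 (\<i> * of_real y) ^ n\<^sup>2 = of_real (gs (y/12) (of_nat n))"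
  unfolding tau24_power gs_def exp_of_real[symmetric]
  by (rule arg_cong[of _ _ exp]) (simp add: field_simps)

lemma eta_imaginary_sums:
  assumes "y > 0"
  shows "(\<lambda>n. complex_of_real (of_int (chi12 n) * gs (y/12) (of_nat n))) sums dedekind_eta (\<i> * of_real y)"
  using eta_chi12[of "tau24 (\<i> * of_real y)"] tau24_bounds[of "\<i> * of_real y"] assms
  unfolding dedekind_eta_eq by (simp add: tau24_imaginary)

text \<open>The absolute values of the integers \<open>12n + 1\<close> are the naturals congruent to
  1 or 11 modulo 12, those of \<open>12n + 7\<close> the ones congruent to 7 or 5. As the Gaussian
  is even, the two shifted periodisations carry the two signs of \<open>chi12\<close>.\<close>

lemma eta_imaginary_gper:
  assumes y: "y > 0"
  shows "dedekind_eta (\<i> * of_real y) = gper (12*y) (1/12) - gper (12*y) (7/12)"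
proof -
  define f where "f = (\<lambda>n. complex_of_real (of_int (chi12 n) * gs (y/12) (of_nat n)))"
  have "(\<lambda>l. sum f {l*12..<l*12+12}) sums dedekind_eta (\<i> * of_real y)"
    by (rule sums_group) (use eta_imaginary_sums[OF y] in \<open>auto simp: f_def\<close>)
  moreover have "sum f {l*12..<l*12+12} =
     (complex_of_real (gs (12*y) (1/12 + of_int (int l))) + complex_of_real (gs (12*y) (1/12 + of_int (- int l - 1))))
     - (complex_of_real (gs (12*y) (7/12 + of_int (int l))) + complex_of_real (gs (12*y) (7/12 + of_int (- int l - 1))))" for l
  proof -
    have tw: "{..<12::nat} = {0,1,2,3,4,5,6,7,8,9,10,11}" by auto presburger
    have c: "chi12 (0 + l*12) = 0" "chi12 (1 + l*12) = 1" "chi12 (2 + l*12) = 0" "chi12 (3 + l*12) = 0" "chi12 (4 + l*12) = 0"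
       "chi12 (5 + l*12) = -1" "chi12 (6 + l*12) = 0" "chi12 (7 + l*12) = -1" "chi12 (8 + l*12) = 0" "chi12 (9 + l*12) = 0"
       "chi12 (10 + l*12) = 0" "chi12 (11 + l*12) = 1"
      unfolding chi12_def by presburger+
    have g: "gs (12*y) x = gs (y/12) (12*x)" for x by (simp add: gs_def power_mult_distrib)
    have m: "12 * (1/12 + of_int (int l)) = real (1 + l*12)" "12 * (1/12 + of_int (- int l - 1)) = - real (11 + l*12)"
       "12 * (7/12 + of_int (int l)) = real (7 + l*12)" "12 * (7/12 + of_int (- int l - 1)) = - real (5 + l*12)"
      by simp_all
    have "sum f {l*12..<l*12+12} = f (1 + l*12) + f (5 + l*12) + f (7 + l*12) + f (11 + l*12)"
      unfolding sum_block tw by (simp add: f_def c[simplified])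
    also have "\<dots> = complex_of_real (gs (y/12) (real (1 + l*12))) - complex_of_real (gs (y/12) (real (5 + l*12)))
       - complex_of_real (gs (y/12) (real (7 + l*12))) + complex_of_real (gs (y/12) (real (11 + l*12)))"
      unfolding f_def c by simp
    finally show ?thesis unfolding g m gs_minus by simp
  qed
  moreover have "(\<lambda>l. (complex_of_real (gs (12*y) (1/12 + of_int (int l))) + complex_of_real (gs (12*y) (1/12 + of_int (- int l - 1))))
     - (complex_of_real (gs (12*y) (7/12 + of_int (int l))) + complex_of_real (gs (12*y) (7/12 + of_int (- int l - 1)))))
     sums (gper (12*y) (1/12) - gper (12*y) (7/12))"
    by (intro sums_diff int_sums gper_has_sum) (use y in auto)
  ultimately show ?thesis using sums_unique2 by (metis (no_types, lifting) sums_cong)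
qed

text \<open>Half of the Gauss sum of \<open>chi12\<close>: the frequencies 11/12 and 5/12 are
  conjugate to 1/12 and 7/12. Thus \<open>chi12\<close> reproduces itself under the finite Fourier
  transform, with the full sum equal to \<open>2 * sqrt 3 * chi12 n\<close>.\<close>

lemma chi12_cos: "Re (e1 (real n / 12) - e1 (7 * real n / 12)) = sqrt 3 * of_int (chi12 n)"
proof -
  have h: "e1 (real n / 2) = (-1) ^ n"
  proof -
    have t2: "2 * pi * (real n / 2) = real n * pi" by simp
    show ?thesis unfolding e1_def t2
      by (induction n) (simp_all add: distrib_right cis_mult[symmetric])
  qed
  \<comment> \<open>Since 7/12 = 1/12 + 1/2, the two terms differ by the sign \<open>(-1)^n\<close>,
    and only odd residues contribute.\<close>
  have "e1 (7 * real n / 12) = e1 (real n / 12) * e1 (real n / 2)"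
    unfolding e1_add[symmetric] by (rule arg_cong[of _ _ e1]) simp
  then have 1: "e1 (real n / 12) - e1 (7 * real n / 12) = e1 (real n / 12) * (1 - (-1) ^ n)"
    by (simp add: h algebra_simps)
  define r where "r = n mod 12"
  have "real n / 12 = real r / 12 + of_int (int (n div 12))"
  proof -
    have "n = r + 12 * (n div 12)" by (simp add: r_def)
    then have "real n = real r + 12 * real (n div 12)" by (metis of_nat_add of_nat_mult of_nat_numeral)
    then show ?thesis by (simp add: field_simps)
  qed
  then have 2: "e1 (real n / 12) = e1 (real r / 12)" by (simp only: e1_add_int)
  have 3: "(-1::complex) ^ n = (-1) ^ r"
  proof -
    have "even n \<longleftrightarrow> even r" unfolding r_def by presburger
    then show ?thesis by (cases "even n") auto
  qed
  have c: "cos (pi/6) = sqrt 3 / 2" by (rule cos_30)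
  have c5: "cos (5*pi/6) = - (sqrt 3 / 2)" using cos_pi_minus[of "pi/6"] c by (simp add: field_simps)
  have c7: "cos (7*pi/6) = - (sqrt 3 / 2)" using cos_periodic_pi[of "pi/6"] c by (simp add: field_simps)
  have c9: "cos (9*pi/6) = 0" using cos_periodic_pi[of "pi/2"] by (simp add: field_simps)
  have c11: "cos (11*pi/6) = sqrt 3 / 2" using cos_2pi_minus[of "pi/6"] c by (simp add: field_simps)
  have c3: "cos (3*pi/6) = 0" by (simp add: cos_pi_half[simplified])
  have R: "Re (e1 (real r / 12)) = cos (real r * pi / 6)" by (simp add: e1_def mult_ac)
  have "r < 12" by (simp add: r_def)
  then have "even r \<or> r = 1 \<or> r = 3 \<or> r = 5 \<or> r = 7 \<or> r = 9 \<or> r = 11" by presburger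
  then consider "even r" | "r = 1" | "r = 3" | "r = 5" | "r = 7" | "r = 9" | "r = 11" by blast
  then have "Re (e1 (real r / 12) * (1 - (-1) ^ r)) = sqrt 3 * of_int (chi12 r)"
  proof cases
    case 1
    then have "chi12 r = 0" unfolding chi12_def by presburger
    with 1 show ?thesis by simp
  qed (use R c c3 c5 c7 c9 c11 in \<open>simp_all add: chi12_def\<close>)
  moreover have "chi12 r = chi12 n" by (simp add: chi12_def r_def)
  moreover have "e1 (real n / 12) - e1 (7 * real n / 12) = e1 (real r / 12) * (1 - (-1) ^ r)"
    by (simp only: 1) (simp only: 2 3)
  ultimately show ?thesis by (simp only:)
qed

text \<open>Poisson summation on both periodisations replaces the coefficients by their Fourier
  transform, which after averaging over \<open>k\<close> and \<open>-k\<close> is a multiple of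
  \<open>chi12\<close>; the series obtained is again eta, at \<open>i/y\<close>.\<close>

theorem eta_inversion_imaginary:
  assumes y: "y > 0"
  shows "dedekind_eta (\<i> * of_real y) * of_real (sqrt y) = dedekind_eta (\<i> * of_real (1/y))"
proof -
  define D where "D = (\<lambda>k::int. complex_of_real (gs (1/(12*y)) (of_int k) / sqrt (12*y)))"
  define c where "c = (\<lambda>k::int. e1 (of_int k * (1/12)) - e1 (of_int k * (7/12)))"
  define S where "S = dedekind_eta (\<i> * of_real y)"
  have 1: "((\<lambda>k. D k * c k) has_sum S) UNIV"
  proof -
    have "((\<lambda>k. D k * e1 (of_int k * (1/12))) has_sum gper (12*y) (1/12)) UNIV"
      "((\<lambda>k. D k * e1 (of_int k * (7/12))) has_sum gper (12*y) (7/12)) UNIV"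
      unfolding D_def by (rule poisson_gauss; use y in simp)+
    then have "((\<lambda>k. D k * e1 (of_int k * (1/12)) + - (D k * e1 (of_int k * (7/12)))) has_sum
        (gper (12*y) (1/12) + - gper (12*y) (7/12))) UNIV"
      by (intro has_sum_add) (simp_all add: has_sum_uminus)
    then show ?thesis by (simp add: c_def S_def eta_imaginary_gper[OF y] right_diff_distrib)
  qed
  have "bij (uminus :: int \<Rightarrow> int)" by (rule bij_uminus)
  then have "((\<lambda>k. D (-k) * c (-k)) has_sum S) UNIV"
    using 1 by (rule has_sum_reindex_bij_betw[THEN iffD2])
  moreover have D: "D (-k) = D k" for k by (simp add: D_def)
  ultimately have "((\<lambda>k. D k * c (-k)) has_sum S) UNIV" by simp
  from has_sum_add[OF 1 this] have "((\<lambda>k. D k * c k + D k * c (-k)) has_sum (S + S)) UNIV" .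
  moreover have "D k * c k + D k * c (-k) = D k * of_real (2 * sqrt 3 * of_int (chi12 (nat \<bar>k\<bar>)))" for k
  proof -
    have m: "c (-k) = cnj (c k)" for k
      by (simp add: c_def flip: e1_minus)
    have cc: "c k + c (-k) = of_real (2 * Re (c k))" for k unfolding m by (simp add: complex_add_cnj)
    have n: "c (int n) + c (- int n) = of_real (2 * sqrt 3 * of_int (chi12 n))" for n
    proof -
      have e: "of_int (int n) * (1/12) = real n / 12" "of_int (int n) * (7/12) = 7 * real n / 12" by simp_all
      have "Re (c (int n)) = sqrt 3 * of_int (chi12 n)"
        unfolding c_def e by (rule chi12_cos)
      then show ?thesis unfolding cc by (simp only: mult.assoc)
    qed
    have "c k + c (-k) = of_real (2 * sqrt 3 * of_int (chi12 (nat \<bar>k\<bar>)))"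
      using n[of "nat \<bar>k\<bar>"] by (cases "k \<ge> 0") (simp_all add: add.commute)
    then show ?thesis by (simp flip: distrib_left)
  qed
  ultimately have "((\<lambda>k. D k * of_real (2 * sqrt 3 * of_int (chi12 (nat \<bar>k\<bar>)))) has_sum (S + S)) UNIV" by simp
  from int_sums[OF this]
  have A: "(\<lambda>j. D (int j) * of_real (2 * sqrt 3 * of_int (chi12 j)) + D (int (Suc j)) * of_real (2 * sqrt 3 * of_int (chi12 (Suc j)))) sums (S + S)"
  proof (rule sums_cong[THEN iffD1, rotated])
    fix j
    have s: "- int j - 1 = - int (Suc j)" by simp
    have "D (- int j - 1) = D (int (Suc j))" "nat \<bar>- int j - 1\<bar> = Suc j"
      unfolding s by (rule D) simp
    then show "D (int j) * of_real (2 * sqrt 3 * of_int (chi12 (nat \<bar>int j\<bar>))) +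
         D (- int j - 1) * of_real (2 * sqrt 3 * of_int (chi12 (nat \<bar>- int j - 1\<bar>))) =
         D (int j) * of_real (2 * sqrt 3 * of_int (chi12 j)) + D (int (Suc j)) * of_real (2 * sqrt 3 * of_int (chi12 (Suc j)))"
      by simp
  qed
  define E where "E = dedekind_eta (\<i> * of_real (1/y))"
  define K where "K = complex_of_real (2 * sqrt 3 / sqrt (12*y))"
  have KE: "(\<lambda>n. K * complex_of_real (of_int (chi12 n) * gs ((1/y)/12) (of_nat n))) sums (K * E)"
    unfolding E_def by (intro sums_mult eta_imaginary_sums) (use y in simp)
  have X: "K * complex_of_real (of_int (chi12 n) * gs ((1/y)/12) (of_nat n)) =
     D (int n) * of_real (2 * sqrt 3 * of_int (chi12 n))" for n
    by (simp add: K_def D_def mult.commute[of y])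
  have B: "(\<lambda>n. D (int n) * of_real (2 * sqrt 3 * of_int (chi12 n))) sums (K * E)" using KE unfolding X .
  define G where "G = (\<lambda>n. D (int n) * of_real (2 * sqrt 3 * of_int (chi12 n)))"
  \<comment> \<open>\<open>int_sums\<close> meets every positive index twice, as \<open>j\<close>
    and as \<open>-(j+1)\<close>. Since \<open>chi12 0 = 0\<close>, the shifted copy has the same
    sum as the unshifted one.\<close>
  have G0: "G 0 = 0" by (simp add: G_def chi12_def)
  have "(\<lambda>n. G (Suc n)) sums (K * E)"
    using B sums_Suc_iff[of G "K * E"] unfolding G0 add_0_right by (simp only: G_def)
  then have "(\<lambda>n. D (int (Suc n)) * of_real (2 * sqrt 3 * of_int (chi12 (Suc n)))) sums (K * E)"
    unfolding G_def .
  from sums_unique2[OF A sums_add[OF B this]] have "S = K * E" by simp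
  moreover have "2 * sqrt 3 / sqrt (12*y) * sqrt y = 1"
  proof -
    have "sqrt (12*y) = 2 * sqrt 3 * sqrt y"
      using real_sqrt_mult[of 4 "3*y"] by (simp add: real_sqrt_mult)
    then show ?thesis using y by simp
  qed
  then have "K * of_real (sqrt y) = 1" unfolding K_def by (metis of_real_1 of_real_mult)
  ultimately have "S * of_real (sqrt y) = E" by (metis mult.assoc mult.commute mult.right_neutral)
  then show ?thesis by (simp add: S_def E_def)
qed

section \<open>The coefficients of the fourth power\<close>

definition psi_fiber :: "nat \<Rightarrow> (nat \<times> nat) set" where
  "psi_fiber n = {p. (fst p)\<^sup>2 + 3 * (snd p)\<^sup>2 = n}"

definition psi_fun :: "nat \<Rightarrow> int" where
  "psi_fun n = (\<Sum>p\<in>psi_fiber n. chi12 (fst p) * chi4 (snd p) * int (snd p))"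

lemma finite_psi_fiber [simp]: "finite (psi_fiber n)"
proof (rule finite_subset)
  show "psi_fiber n \<subseteq> {..n} \<times> {..n}"
  proof
    fix p assume "p \<in> psi_fiber n"
    then have e: "(fst p)\<^sup>2 + 3 * (snd p)\<^sup>2 = n" by (simp add: psi_fiber_def)
    have "fst p \<le> (fst p)\<^sup>2" "snd p \<le> (snd p)\<^sup>2" by (simp_all add: power2_eq_square)
    with e have "fst p \<le> n" "snd p \<le> n" by linarith+
    then show "p \<in> {..n} \<times> {..n}" by (cases p) simp
  qed
qed simp

text \<open>The absolutely convergent double series of \<open>eta * eta^3\<close> is regrouped by
  the value of \<open>x^2 + 3 y^2\<close>.\<close>

lemma eta4_psi_fun:
  fixes t :: complex
  assumes t: "norm t < 1" "t \<noteq> 0"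
  shows "(\<lambda>n. of_int (psi_fun n) * t ^ n) sums ((t * qinf (t^24)) ^ 4)"
proof -
  define A where "A = (\<lambda>a. of_int (chi12 a) * t ^ a\<^sup>2)"
  define B where "B = (\<lambda>b. of_int (chi4 b) * of_nat b * t ^ (3*b\<^sup>2))"
  define E where "E = t * qinf (t^24)"
  have A: "(A has_sum E) UNIV"
    unfolding A_def E_def by (rule norm_summable_imp_has_sum[OF chi12_summable[OF t(1)] eta_chi12[OF t]])
  have B: "(B has_sum E^3) UNIV"
    unfolding B_def E_def by (rule norm_summable_imp_has_sum[OF chi4_summable[OF t(1)] eta_cube_chi4[OF t(1)]])
  have nA: "(\<lambda>a. norm (A a)) summable_on UNIV"
    using chi12_summable[OF t(1)] unfolding A_def by (intro norm_summable_imp_summable_on) simp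
  have nB: "(\<lambda>a. norm (B a)) summable_on UNIV"
    using chi4_summable[OF t(1)] unfolding B_def by (intro norm_summable_imp_summable_on) simp
  define f where "f = (\<lambda>p. A (fst p) * B (snd p))"
  have "(\<lambda>p. norm (f p)) summable_on (UNIV \<times> UNIV)"
  proof (rule summable_on_SigmaI)
    show "((\<lambda>b. norm (f (a, b))) has_sum (norm (A a) * infsum (\<lambda>b. norm (B b)) UNIV)) UNIV" for a
      unfolding f_def fst_conv snd_conv norm_mult by (intro has_sum_cmult_right has_sum_infsum nB)
    show "(\<lambda>a. norm (A a) * infsum (\<lambda>b. norm (B b)) UNIV) summable_on UNIV"
      by (rule summable_on_cmult_left[OF nA])
  qed auto
  then have "f summable_on (UNIV \<times> UNIV)" by (rule abs_summable_summable)
  then have "(f has_sum (E * E^3)) (UNIV \<times> UNIV)"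
    by (rule has_sum_SigmaI[rotated 2])
       (auto simp: f_def intro!: has_sum_cmult_right has_sum_cmult_left A B)
  moreover have "bij_betw snd (Sigma UNIV psi_fiber) (UNIV \<times> UNIV)"
    by (rule bij_betw_byWitness[of _ "\<lambda>p. ((fst p)\<^sup>2 + 3 * (snd p)\<^sup>2, p)"]) (auto simp: psi_fiber_def)
  ultimately have "((\<lambda>x. f (snd x)) has_sum (E * E^3)) (Sigma UNIV psi_fiber)"
    by (simp add: has_sum_reindex_bij_betw)
  then have "((\<lambda>n. sum f (psi_fiber n)) has_sum (E * E^3)) UNIV"
    by (rule has_sum_SigmaD) (simp add: has_sum_finite)
  moreover have "sum f (psi_fiber n) = of_int (psi_fun n) * t ^ n" for n
  proof -
    have "f p = of_int (chi12 (fst p) * chi4 (snd p) * int (snd p)) * t ^ n" if "p \<in> psi_fiber n" for p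
    proof -
      have "t ^ n = t ^ (fst p)\<^sup>2 * t ^ (3 * (snd p)\<^sup>2)"
        using that unfolding power_add[symmetric] by (simp add: psi_fiber_def)
      then show ?thesis by (simp add: f_def A_def B_def)
    qed
    then show ?thesis by (simp add: psi_fun_def sum_distrib_right)
  qed
  ultimately have "((\<lambda>n. of_int (psi_fun n) * t ^ n) has_sum (E * E^3)) UNIV" by simp
  then have "(\<lambda>n. of_int (psi_fun n) * t ^ n) sums (E * E^3)" by (rule has_sum_imp_sums)
  then show ?thesis by (simp add: E_def eval_nat_numeral)
qed

lemma tau24_surj:
  assumes "cmod t < 1" "t \<noteq> 0"
  obtains \<tau> where "Im \<tau> > 0" "tau24 \<tau> = t"
proof
  define \<tau> where "\<tau> = Ln t * (12 / (of_real pi * \<i>))"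
  have "2 * of_real pi * \<i> * \<tau> / 24 = Ln t" by (simp add: \<tau>_def field_simps)
  then show "tau24 \<tau> = t" unfolding tau24_def using assms by simp
  then have "cmod (tau24 \<tau>) < 1" using assms by simp
  then show "Im \<tau> > 0" by (simp add: norm_tau24 zero_less_mult_iff)
qed

text \<open>Zeros of a nontrivial power series are isolated. The hypothesis leaves out
  \<open>x = 0\<close>, so \<open>a 0\<close> is first obtained as a limit.\<close>

lemma powser_eq_zero:
  fixes a :: "nat \<Rightarrow> complex"
  assumes "\<And>x. x \<noteq> 0 \<Longrightarrow> norm x < 1 \<Longrightarrow> (\<lambda>n. a n * x ^ n) sums 0"
  shows "a n = 0"
proof -
  have "((\<lambda>x::complex. 0) \<longlongrightarrow> a 0) (at 0)"
    by (rule powser_limit_0_strong[of 1]) (use assms in auto)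
  then have a0: "a 0 = 0" using tendsto_unique[OF trivial_limit_at _ tendsto_const] by fastforce
  have s: "(\<lambda>n. a n * (x - 0) ^ n) sums 0" if "norm (x - 0) < 1" for x
    using assms[of x] that powser_sums_zero[of a] a0 by (cases "x = 0") auto
  show ?thesis
  proof (rule ccontr)
    assume "a n \<noteq> 0"
    then have "n > 0" using a0 by (cases n) auto
    obtain r :: real where r: "0 < r" "\<And>z. z \<in> cball 0 r - {0::complex} \<Longrightarrow> (0::complex) \<noteq> 0"
      by (rule powser_0_nonzero[of 1 0 a "\<lambda>x. 0" n]) (use s \<open>a n \<noteq> 0\<close> \<open>n > 0\<close> in auto)
    have "complex_of_real r \<in> cball 0 r - {0}" using r(1) by auto
    then show False using r(2) by blast
  qed
qed

text \<open>The definite description is met: existence is \<open>eta4_psi_fun\<close>, and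
  uniqueness is that of power series, because \<open>tau24\<close> maps the upper half-plane onto
  the punctured disc.\<close>

theorem psi_eq: "psi = psi_fun"
  unfolding psi_def
proof (rule the_equality)
  show *: "\<forall>\<tau>. Im \<tau> > 0 \<longrightarrow> (\<lambda>n. of_int (psi_fun n) * exp (2 * of_real pi * \<i> * \<tau> * of_nat n / 24)) sums
       (dedekind_eta \<tau> ^ 4)"
    unfolding tau24_power[symmetric] dedekind_eta_eq using eta4_psi_fun tau24_bounds by auto
  fix f :: "nat \<Rightarrow> int"
  assume f: "\<forall>\<tau>. Im \<tau> > 0 \<longrightarrow> (\<lambda>n. of_int (f n) * exp (2 * of_real pi * \<i> * \<tau> * of_nat n / 24)) sums
       (dedekind_eta \<tau> ^ 4)"
  have "(\<lambda>n. complex_of_int (f n - psi_fun n) * t ^ n) sums 0" if t: "t \<noteq> 0" "norm t < 1" for t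
  proof -
    obtain \<tau> where \<tau>: "Im \<tau> > 0" "tau24 \<tau> = t" using tau24_surj t by blast
    then have "(\<lambda>n. complex_of_int (f n) * t ^ n - complex_of_int (psi_fun n) * t ^ n) sums (dedekind_eta \<tau> ^ 4 - dedekind_eta \<tau> ^ 4)"
      using f * unfolding tau24_power[symmetric] by (intro sums_diff) auto
    then show ?thesis by (simp add: left_diff_distrib)
  qed
  then have "complex_of_int (f n - psi_fun n) = 0" for n by (rule powser_eq_zero)
  then have "f n - psi_fun n = 0" for n by (simp only: of_int_eq_0_iff)
  then show "f = psi_fun" by auto
qed

lemma psi_0: "psi 0 = 0"
proof -
  have "psi_fiber 0 = {(0,0)}" by (auto simp: psi_fiber_def)
  then show ?thesis by (simp add: psi_eq psi_fun_def chi12_def)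
qed

definition eta4 :: "complex \<Rightarrow> complex" where
  "eta4 t = (t * qinf (t^24)) ^ 4"

lemma eta4_sums: "cmod t < 1 \<Longrightarrow> (\<lambda>n. of_int (psi n) * t ^ n) sums eta4 t"
  using eta4_psi_fun[of t] powser_sums_zero[of "\<lambda>n. of_int (psi n)"]
  by (cases "t = 0") (auto simp: psi_eq psi_0[unfolded psi_eq] eta4_def)

text \<open>If \<open>chi12 x\<close> is nonzero, \<open>x\<close> is prime to 6 and
  \<open>x^2\<close> is 1 modulo 24; if \<open>chi4 y\<close> is nonzero, \<open>y\<close> is odd
  and \<open>3 y^2\<close> is 3 modulo 24.\<close>

lemma psi_mod_24: assumes "psi n \<noteq> 0" shows "n mod 24 = 4"
proof -
  have "\<exists>p\<in>psi_fiber n. chi12 (fst p) * chi4 (snd p) * int (snd p) \<noteq> 0"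
  proof (rule ccontr)
    assume "\<not> (\<exists>p\<in>psi_fiber n. chi12 (fst p) * chi4 (snd p) * int (snd p) \<noteq> 0)"
    then have "psi n = 0" unfolding psi_eq psi_fun_def by (intro sum.neutral) blast
    with assms show False by simp
  qed
  then obtain p where p: "p \<in> psi_fiber n" "chi12 (fst p) * chi4 (snd p) * int (snd p) \<noteq> 0" by blast
  define a b where "a = fst p" and "b = snd p"
  have n: "a\<^sup>2 + 3 * b\<^sup>2 = n" using p by (simp add: psi_fiber_def a_def b_def)
  have a: "a mod 12 = 1 \<or> a mod 12 = 5 \<or> a mod 12 = 7 \<or> a mod 12 = 11"
    using p(2) unfolding chi12_def a_def by (auto split: if_splits)
  have "b mod 4 = 1 \<or> b mod 4 = 3" using p(2) unfolding chi4_def b_def by (auto split: if_splits)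
  moreover have d: "m mod (k * 2) = m mod k \<or> m mod (k * 2) = m mod k + k" for m k :: nat
    unfolding mod_mult2_eq by (cases "even (m div k)") (simp_all add: even_iff_mod_2_eq_zero odd_iff_mod_2_eq_one)
  ultimately have b: "b mod 8 = 1 \<or> b mod 8 = 3 \<or> b mod 8 = 5 \<or> b mod 8 = 7"
    using d[of b 4] by simp linarith
  have "a mod 24 = a mod 12 \<or> a mod 24 = a mod 12 + 12" using d[of a 12] by simp
  then have "a mod 24 = 1 \<or> a mod 24 = 5 \<or> a mod 24 = 7 \<or> a mod 24 = 11 \<or> a mod 24 = 13 \<or> a mod 24 = 17
    \<or> a mod 24 = 19 \<or> a mod 24 = 23" using a by (elim disjE; simp)
  then have a2: "(a mod 24)\<^sup>2 mod 24 = 1" by (elim disjE) simp_all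
  have "(b mod 8)\<^sup>2 mod 8 = 1" using b by (elim disjE) simp_all
  then have "b\<^sup>2 mod 8 = 1" by (simp add: power_mod)
  then have "(3 * b\<^sup>2) mod (3 * 8) = 3" by (simp only: mult_mod_right[symmetric])
  moreover have "a\<^sup>2 mod 24 = 1" using a2 by (simp add: power_mod)
  ultimately show ?thesis unfolding n[symmetric] using mod_add_eq[of "a\<^sup>2" 24 "3 * b\<^sup>2"] by simp
qed

section \<open>The primitive and its functional equations\<close>

definition hexp_series :: "complex \<Rightarrow> complex" where
  "hexp_series t = suminf (\<lambda>n. of_int (psi n) / of_nat n * t ^ n)"

definition hexpF :: "complex \<Rightarrow> complex" where
  "hexpF \<tau> = 12 * of_real C_hexp / (\<i> * of_real pi) * hexp_series (tau24 \<tau>)"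

lemma hexp_series_summable:
  fixes t :: complex
  assumes "cmod t < 1"
  shows "summable (\<lambda>n. of_int (psi n) / of_nat n * t ^ n)"
proof (rule summable_comparison_test')
  define r where "r = (1 + cmod t) / 2"
  have r: "cmod t < r" "r < 1" "0 \<le> r" using assms by (auto simp: r_def)
  have "summable (\<lambda>n. of_int (psi n) * (complex_of_real r) ^ n)"
    using eta4_sums[of "of_real r"] r by (simp add: sums_iff)
  then show "summable (\<lambda>n. norm (of_int (psi n) * t ^ n))"
    by (rule powser_insidea) (use r in simp)
  fix n :: nat
  show "norm (of_int (psi n) / of_nat n * t ^ n) \<le> norm (of_int (psi n) * t ^ n)"
    using mult_right_mono[of 1 "real n" "norm (of_int (psi n) * t ^ n)"]
    by (cases "n = 0") (auto simp: norm_mult norm_divide field_simps)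
qed

lemma hexp_series_deriv:
  assumes "cmod t < 1" "t \<noteq> 0"
  shows "(hexp_series has_field_derivative (eta4 t / t)) (at t)"
proof -
  define c where "c = (\<lambda>n. complex_of_int (psi n) / of_nat n)"
  define K where "K = complex_of_real ((1 + cmod t) / 2)"
  have nK: "cmod K = (1 + cmod t) / 2" unfolding K_def norm_of_real by simp
  then have K: "cmod t < cmod K" "cmod K < 1" using assms by auto
  have "((\<lambda>x. suminf (\<lambda>n. c n * x ^ n)) has_field_derivative suminf (\<lambda>n. diffs c n * t ^ n)) (at t)"
    by (rule termdiffs_strong[OF _ K(1)]) (use hexp_series_summable[OF K(2)] in \<open>simp add: c_def\<close>)
  moreover have "diffs c n = of_int (psi (Suc n))" for n by (simp add: diffs_def c_def del: of_nat_Suc)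
  moreover have "suminf (\<lambda>n. of_int (psi (Suc n)) * t ^ n) = eta4 t / t"
  proof -
    have "(\<lambda>n. of_int (psi (Suc n)) * t ^ Suc n) sums eta4 t"
      using eta4_sums[OF assms(1)] sums_Suc_iff[of "\<lambda>n. of_int (psi n) * t ^ n" "eta4 t"] by (simp add: psi_0)
    from sums_divide[OF this, of t] show ?thesis using assms(2) by (simp add: sums_iff)
  qed
  ultimately show ?thesis unfolding hexp_series_def [abs_def] c_def by simp
qed

lemma hexp_integrand_eq: "hexp_integrand \<tau> = of_real C_hexp * eta4 (tau24 \<tau>)"
  by (simp add: hexp_integrand_def dedekind_eta_eq eta4_def)

lemma tau24_deriv: "(tau24 has_field_derivative (2 * of_real pi * \<i> / 24 * tau24 \<tau>)) (at \<tau>)"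
  unfolding tau24_def [abs_def] by (auto intro!: derivative_eq_intros simp: mult_ac)

theorem hexpF_deriv:
  assumes "Im \<tau> > 0"
  shows "(hexpF has_field_derivative hexp_integrand \<tau>) (at \<tau>)"
proof -
  note b = tau24_bounds(1)[OF assms] tau24_bounds(2)[of \<tau>]
  have "((\<lambda>\<tau>. 12 * of_real C_hexp / (\<i> * of_real pi) * hexp_series (tau24 \<tau>)) has_field_derivative
     12 * of_real C_hexp / (\<i> * of_real pi) * (eta4 (tau24 \<tau>) / tau24 \<tau> * (2 * of_real pi * \<i> / 24 * tau24 \<tau>))) (at \<tau>)"
    by (intro DERIV_cmult DERIV_chain2[OF hexp_series_deriv[OF b] tau24_deriv])
  moreover have "12 * of_real C_hexp / (\<i> * of_real pi) * (eta4 (tau24 \<tau>) / tau24 \<tau> * (2 * of_real pi * \<i> / 24 * tau24 \<tau>))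
     = hexp_integrand \<tau>"
    unfolding hexp_integrand_eq using b by (simp add: field_simps)
  ultimately show ?thesis unfolding hexpF_def [abs_def] by simp
qed

definition zeta6 :: complex where "zeta6 = exp (\<i> * of_real pi / 3)"

theorem hexpF_translate: assumes "Im \<tau> > 0" shows "hexpF (\<tau> + 1) = zeta6 * hexpF \<tau>"
proof -
  define w where "w = exp (2 * of_real pi * \<i> / 24)"
  have t: "tau24 (\<tau> + 1) = tau24 \<tau> * w"
    unfolding tau24_def w_def exp_add[symmetric]
    by (rule arg_cong[of _ _ exp]) (simp add: distrib_left add_divide_distrib)
  have w4: "w ^ 4 = zeta6" unfolding w_def zeta6_def exp_of_nat_mult[symmetric] by simp
  have "of_nat 24 * (2 * of_real pi * \<i> / 24) = 2 * of_real pi * \<i>" by simp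
  then have w24: "w ^ 24 = 1" unfolding w_def exp_of_nat_mult[symmetric] by (simp only: exp_two_pi_i)
  have X: "of_int (psi n) / of_nat n * (tau24 \<tau> * w) ^ n = zeta6 * (of_int (psi n) / of_nat n * tau24 \<tau> ^ n)" for n
  proof (cases "psi n = 0")
    case False
    then have "n = 24 * (n div 24) + 4" using psi_mod_24[of n] by presburger
    then have "w ^ n = (w ^ 24) ^ (n div 24) * w ^ 4" by (metis power_add power_mult)
    then show ?thesis by (simp add: w24 w4 power_mult_distrib)
  qed simp
  show ?thesis
    unfolding hexpF_def hexp_series_def t X
      suminf_mult[OF hexp_series_summable[OF tau24_bounds(1)[OF assms]]] by (simp only: mult_ac)
qed

lemma open_upper: "open {z::complex. Im z > 0}"
  by (rule open_halfspace_Im_gt)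

lemma convex_upper: "convex {z::complex. Im z > 0}"
  by (rule convex_halfspace_Im_gt)

lemma Im_neg_inverse: "Im (-1/\<tau>) = Im \<tau> / (cmod \<tau>)\<^sup>2"
  by (simp add: Im_divide cmod_power2)

lemma Im_neg_inverse_pos: assumes "Im \<tau> > 0" shows "Im (-1/\<tau>) > 0"
proof -
  have "\<tau> \<noteq> 0" using assms by auto
  then show ?thesis unfolding Im_neg_inverse using assms by simp
qed

lemma holomorphic_eta4: "eta4 holomorphic_on ball 0 1"
  by (rule power_series_holomorphic[of 0 1 "\<lambda>n. of_int (psi n)"]) (use eta4_sums in auto)

lemma holomorphic_dedekind_eta4: "(\<lambda>\<tau>. dedekind_eta \<tau> ^ 4) holomorphic_on {z. Im z > 0}"
proof -
  have "tau24 holomorphic_on {z. Im z > 0}"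
    using tau24_deriv by (intro derivative_intros holomorphic_onI) (auto simp: field_differentiable_def dest: has_field_derivative_at_within)
  then have "(eta4 \<circ> tau24) holomorphic_on {z. Im z > 0}"
    by (rule holomorphic_on_compose_gen[OF _ holomorphic_eta4]) (use tau24_bounds in auto)
  then show ?thesis by (simp add: o_def eta4_def dedekind_eta_eq)
qed

text \<open>The identity theorem carries the inversion from the imaginary axis to the half-plane.
  The fourth power avoids a branch of the square root: at \<open>\<tau> = i * y\<close> the factor
  \<open>sqrt y ^ 4 = y^2\<close> is \<open>- \<tau>^2\<close>.\<close>

theorem eta4_inversion:
  assumes "Im \<tau> > 0"
  shows "dedekind_eta (-1/\<tau>) ^ 4 = - \<tau>\<^sup>2 * dedekind_eta \<tau> ^ 4"
proof -
  define U where "U = {\<i> * complex_of_real y | y. y > 0}"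
  define f where "f = (\<lambda>\<tau>. dedekind_eta (-1/\<tau>) ^ 4 + \<tau>\<^sup>2 * dedekind_eta \<tau> ^ 4)"
  have "f \<tau> = 0"
  proof (rule analytic_continuation[where f = f and S = "{z. Im z > 0}" and U = U and \<xi> = \<i>])
    have "(\<lambda>\<tau>. -1/\<tau>) holomorphic_on {z. Im z > 0}" by (intro holomorphic_intros) auto
    then have "((\<lambda>\<tau>. dedekind_eta \<tau> ^ 4) \<circ> (\<lambda>\<tau>. -1/\<tau>)) holomorphic_on {z. Im z > 0}"
      by (rule holomorphic_on_compose_gen[OF _ holomorphic_dedekind_eta4]) (use Im_neg_inverse_pos in auto)
    then show "f holomorphic_on {z. Im z > 0}"
      unfolding o_def f_def
      by (intro holomorphic_on_add holomorphic_on_mult[OF holomorphic_on_power[OF holomorphic_on_ident] holomorphic_dedekind_eta4])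
    show "\<i> islimpt U"
      unfolding islimpt_sequential
    proof (intro exI conjI allI)
      show "\<i> * complex_of_real (1 + 1 / Suc n) \<in> U - {\<i>}" for n
        unfolding U_def by (auto simp: complex_eq_iff intro!: exI[of _ "1 + 1 / Suc n"] add_pos_pos)
      have "(\<lambda>n. \<i> * complex_of_real (1 + 1 / Suc n)) \<longlonglongrightarrow> \<i> * complex_of_real (1 + 0)"
        by (intro tendsto_intros) (rule LIMSEQ_Suc[OF lim_1_over_n])
      then show "(\<lambda>n. \<i> * complex_of_real (1 + 1 / Suc n)) \<longlonglongrightarrow> \<i>" by simp
    qed
    show "f z = 0" if "z \<in> U" for z
    proof -
      obtain y where y: "y > 0" "z = \<i> * complex_of_real y" using \<open>z \<in> U\<close> by (auto simp: U_def)
      have "-1/z = \<i> * complex_of_real (1/y)" using y by (simp add: field_simps)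
      then have "dedekind_eta (-1/z) ^ 4 = (dedekind_eta z * of_real (sqrt y)) ^ 4"
        using eta_inversion_imaginary[OF y(1)] y(2) by simp
      also have "\<dots> = of_real (y\<^sup>2) * dedekind_eta z ^ 4"
      proof -
        have "sqrt y ^ 4 = y\<^sup>2" using y(1) by (simp add: power4_eq_xxxx power2_eq_square)
        then show ?thesis by (simp add: power_mult_distrib flip: of_real_power)
      qed
      finally show ?thesis using y by (simp add: f_def power_mult_distrib)
    qed
  qed (use assms open_upper convex_upper convex_connected in \<open>auto simp: U_def\<close>)
  then show ?thesis by (simp add: f_def add_eq_0_iff)
qed

text \<open>The constant of the inversion formula, evaluated at the fixed point of
  \<open>\<tau> -> -1/\<tau>\<close>.\<close>

definition hexpS :: complex where "hexpS = 2 * hexpF \<i>"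

text \<open>By weight two and the minus sign in \<open>eta4_inversion\<close> the derivatives of
  \<open>hexpF (-1/\<tau>)\<close> and \<open>hexpF \<tau>\<close> cancel, so the sum is
  constant.\<close>

theorem hexpF_inversion:
  assumes "Im \<tau> > 0"
  shows "hexpF (-1/\<tau>) = hexpS - hexpF \<tau>"
proof -
  have "\<exists>c. \<forall>z\<in>{z. Im z > 0}. hexpF (-1/z) + hexpF z = c"
  proof (rule has_field_derivative_zero_constant[OF convex_upper])
    fix z assume "z \<in> {z. Im z > 0}"
    then have z: "Im z > 0" "z \<noteq> 0" by auto
    have "((\<lambda>z. -1/z) has_field_derivative (1/z\<^sup>2)) (at z)"
      using z by (auto intro!: derivative_eq_intros simp: power2_eq_square field_simps)
    from DERIV_add[OF DERIV_chain2[OF hexpF_deriv[OF Im_neg_inverse_pos[OF z(1)]] this] hexpF_deriv[OF z(1)]]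
    have "((\<lambda>z. hexpF (-1/z) + hexpF z) has_field_derivative (hexp_integrand (-1/z) * (1/z\<^sup>2) + hexp_integrand z)) (at z)" .
    moreover have "hexp_integrand (-1/z) * (1/z\<^sup>2) + hexp_integrand z = 0"
      unfolding hexp_integrand_def eta4_inversion[OF z(1)] using z(2) by simp
    ultimately show "((\<lambda>z. hexpF (-1/z) + hexpF z) has_field_derivative 0) (at z within {z. Im z > 0})"
      by (simp add: has_field_derivative_at_within)
  qed
  then obtain c where c: "\<And>z. Im z > 0 \<Longrightarrow> hexpF (-1/z) + hexpF z = c" by auto
  have "c = hexpS" using c[of \<i>] by (simp add: hexpS_def)
  then show ?thesis using c[OF assms] by (simp add: eq_diff_eq)
qed

section \<open>The value at the cusp 0\<close>

lemma theta_even_odd: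
  fixes q :: "'a::{real_normed_field,banach}"
  assumes q: "norm q < 1"
  shows "theta q = theta (q^4) + q * theta2 (q^4)"
proof -
  have q4: "norm (q^4) < 1" using q by (intro norm_power_less_one) auto
  define f where "f = (\<lambda>l::nat. (if l = 0 then 1 else 2) * q ^ (l\<^sup>2))"
  have "(\<lambda>n. sum f {n*2..<n*2+2}) sums theta q"
    by (rule sums_group) (use theta_sums_squares[OF q] in \<open>simp_all add: f_def\<close>)
  moreover have "sum f {n*2..<n*2+2} = (if n = 0 then 1 else 2) * (q^4) ^ (n\<^sup>2) + q * (2 * (q^4) ^ (n * Suc n))" for n
  proof -
    have e: "(n*2)\<^sup>2 = 4 * n\<^sup>2" "(n*2+1)\<^sup>2 = 1 + 4 * (n * Suc n)" by (simp_all add: power2_eq_square algebra_simps)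
    have "sum f {n*2..<n*2+2} = f (n*2) + f (n*2+1)" by (simp add: numeral_2_eq_2)
    also have "\<dots> = (if n = 0 then 1 else 2) * q ^ (4 * n\<^sup>2) + 2 * q ^ (1 + 4 * (n * Suc n))"
      unfolding f_def e by simp
    finally show ?thesis unfolding power_add power_mult by (simp add: mult_ac)
  qed
  moreover have "(\<lambda>n. (if n = 0 then 1 else 2) * (q^4) ^ (n\<^sup>2) + q * (2 * (q^4) ^ (n * Suc n))) sums (theta (q^4) + q * theta2 (q^4))"
    by (intro sums_add sums_mult theta_sums_squares theta2_sums q4)
  ultimately show ?thesis using sums_unique2 by force
qed

lemma theta_0 [simp]: "theta 0 = (1::'a::{real_normed_field,banach})"
  unfolding theta_def by (subst powser_zero) simp

lemma theta2_0 [simp]: "theta2 0 = (2::'a::{real_normed_field,banach})"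
  unfolding theta2_def by (subst powser_zero) (auto intro: exI[of _ 0])

lemma theta_mult_minus:
  fixes q :: "'a::{real_normed_field,banach}"
  assumes q: "norm q < 1" "q \<noteq> 0"
  shows "theta q * theta (-q) = (theta (- (q\<^sup>2)))\<^sup>2"
proof -
  have q2: "norm (q\<^sup>2) < 1" "norm (q^4) < 1" using q by (auto intro!: norm_power_less_one)
  have "theta q = (qinf (-q))\<^sup>2 / qinf (q\<^sup>2)" "theta (-q) = (qinf q)\<^sup>2 / qinf (q\<^sup>2)"
    "theta (- (q\<^sup>2)) = (qinf (q\<^sup>2))\<^sup>2 / qinf (q^4)"
    using theta_product[of q] theta_product[of "-q"] theta_product[of "- (q\<^sup>2)"] q q2 by simp_all
  note t = this
  have "theta q * theta (-q) = (qinf q * qinf (-q))\<^sup>2 / (qinf (q\<^sup>2))\<^sup>2"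
    unfolding t by (simp add: power_mult_distrib power2_eq_square mult_ac)
  also have "qinf q * qinf (-q) = qinf (q\<^sup>2) ^ 3 / qinf (q^4)"
    using qinf_minus[OF q(1)] qinf_nz[OF q2(2)] by (simp add: field_simps)
  also have "(qinf (q\<^sup>2) ^ 3 / qinf (q^4))\<^sup>2 / (qinf (q\<^sup>2))\<^sup>2 = (theta (- (q\<^sup>2)))\<^sup>2"
    unfolding t using qinf_nz[OF q2(1)] qinf_nz[OF q2(2)]
    by (simp add: power_divide power_mult_distrib power2_eq_square power3_eq_cube)
  finally show ?thesis .
qed

lemma theta2_square:
  fixes q :: "'a::{real_normed_field,banach}"
  assumes q: "norm q < 1" "q \<noteq> 0"
  shows "(theta2 q)\<^sup>2 = 2 * theta2 (q\<^sup>2) * theta (q\<^sup>2)"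
proof -
  have q2: "norm (q\<^sup>2) < 1" "norm (q^4) < 1" "norm (q^8) < 1" using q by (auto intro!: norm_power_less_one)
  note nz = q2[THEN qinf_nz]
  have t: "theta2 q = 2 * (qinf (q^4))\<^sup>2 / qinf (q\<^sup>2)" "theta2 (q\<^sup>2) = 2 * (qinf (q^8))\<^sup>2 / qinf (q^4)"
     "theta (q\<^sup>2) = (qinf (- (q\<^sup>2)))\<^sup>2 / qinf (q^4)"
    using theta2_product[of q] theta2_product[of "q\<^sup>2"] theta_product[of "q\<^sup>2"] q q2
    by (simp_all flip: power_mult)
  have m: "qinf (q\<^sup>2) * qinf (- (q\<^sup>2)) * qinf (q^8) = qinf (q^4) ^ 3"
    using qinf_minus[OF q2(1)] by (simp flip: power_mult)
  then have "(qinf (q\<^sup>2) * qinf (- (q\<^sup>2)) * qinf (q^8))\<^sup>2 = (qinf (q^4) ^ 3)\<^sup>2" by simp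
  then show ?thesis unfolding t using nz
    by (simp add: power2_eq_square power3_eq_cube field_simps)
qed

lemma theta_triple:
  fixes q :: "'a::{real_normed_field,banach}"
  assumes q: "norm q < 1" "q \<noteq> 0"
  shows "theta q * theta (-q) * theta2 q = 2 * qinf (q\<^sup>2) ^ 3"
proof -
  have q2: "norm (q\<^sup>2) < 1" "norm (q^4) < 1" using q by (auto intro!: norm_power_less_one)
  have "theta (- (q\<^sup>2)) = (qinf (q\<^sup>2))\<^sup>2 / qinf (q^4)"
    using theta_product[of "- (q\<^sup>2)"] q q2 by simp
  then show ?thesis unfolding theta_mult_minus[OF q] theta2_product[OF q(1)]
    using q2[THEN qinf_nz] by (simp add: power2_eq_square power3_eq_cube field_simps)
qed

text \<open>Continuity of the derivative at 0 is included because \<open>lam_deriv\<close> takes a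
  limit there.\<close>

lemma bounded_powser_deriv:
  fixes a :: "nat \<Rightarrow> real"
  assumes a: "\<And>n. \<bar>a n\<bar> \<le> 2"
  obtains D where "\<And>x. \<bar>x\<bar> < 1 \<Longrightarrow> ((\<lambda>x. suminf (\<lambda>n. a n * x ^ n)) has_real_derivative D x) (at x)" "isCont D 0"
proof -
  have sm: "summable (\<lambda>n. a n * x ^ n)" if "norm x < 1" for x
  proof (rule summable_comparison_test'[of "\<lambda>n. 2 * \<bar>x\<bar> ^ n" 0])
    show "summable (\<lambda>n. 2 * \<bar>x\<bar> ^ n)" using that by (intro summable_mult summable_geometric) simp
    show "norm (a n * x ^ n) \<le> 2 * \<bar>x\<bar> ^ n" for n
      using mult_right_mono[OF a[of n], of "\<bar>x\<bar> ^ n"] by (simp add: abs_mult power_abs)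
  qed
  have der: "((\<lambda>x. suminf (\<lambda>n. c n * x ^ n)) has_real_derivative suminf (\<lambda>n. diffs c n * x ^ n)) (at x)"
    if "\<And>x. norm x < 1 \<Longrightarrow> summable (\<lambda>n. c n * x ^ n)" "\<bar>x\<bar> < 1" for c and x :: real
    by (rule termdiffs_strong[of c "(1 + \<bar>x\<bar>) / 2"]) (use that in auto)
  have sd: "summable (\<lambda>n. diffs a n * x ^ n)" if "norm x < 1" for x
    by (rule termdiff_converges[of x 1]) (use sm that in auto)
  show ?thesis
    by (rule that[OF der[of a, OF sm]]) (auto intro: DERIV_isCont[OF der[of "diffs a", OF sd]])
qed

lemma theta_deriv_exists:
  obtains D3 D2 :: "real \<Rightarrow> real"
  where "\<And>x. \<bar>x\<bar> < 1 \<Longrightarrow> (theta has_real_derivative D3 x) (at x)" "isCont D3 0"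
    "\<And>x. \<bar>x\<bar> < 1 \<Longrightarrow> (theta2 has_real_derivative D2 x) (at x)" "isCont D2 0"
proof -
  obtain D3 :: "real \<Rightarrow> real" where D3: "\<And>x. \<bar>x\<bar> < 1 \<Longrightarrow> (theta has_real_derivative D3 x) (at x)" "isCont D3 0"
    unfolding theta_def [abs_def] by (rule bounded_powser_deriv[of "\<lambda>n. if n = 0 then 1 else if \<exists>l. n = l\<^sup>2 then 2 else 0"]) auto
  obtain D2 :: "real \<Rightarrow> real" where D2: "\<And>x. \<bar>x\<bar> < 1 \<Longrightarrow> (theta2 has_real_derivative D2 x) (at x)" "isCont D2 0"
    unfolding theta2_def [abs_def] by (rule bounded_powser_deriv[of "\<lambda>n. if \<exists>l. n = l * Suc l then 2 else 0"]) auto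
  show ?thesis by (rule that[OF D3 D2])
qed

lemma abs_power2_less_one: "\<bar>q::real\<bar> < 1 \<Longrightarrow> \<bar>q\<^sup>2\<bar> < 1"
  using norm_power_less_one[of q 2] by simp

lemma dyadic_power_tendsto_0:
  fixes q :: real
  assumes "\<bar>q\<bar> < 1"
  shows "(\<lambda>n. q ^ (2^n)) \<longlonglongrightarrow> 0" "(\<lambda>n. 2^n * q ^ (2^n)) \<longlonglongrightarrow> 0"
proof -
  have f: "filterlim (\<lambda>n. 2^n :: nat) at_top sequentially"
    by (rule filterlim_at_top_mono[OF filterlim_ident]) (simp add: less_imp_le)
  show "(\<lambda>n. q ^ (2^n)) \<longlonglongrightarrow> 0"
    using filterlim_compose[OF LIMSEQ_power_zero[of q] f] assms by simp
  show "(\<lambda>n. 2^n * q ^ (2^n)) \<longlonglongrightarrow> 0"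
    using filterlim_compose[OF powser_times_n_limit_0[of q] f] assms by simp
qed

text \<open>The defect \<open>E\<close> satisfies \<open>E q = -2 * E (q^2)\<close>, hence
  \<open>E q = (-2)^n * E (q^(2^n))\<close>. Being differentiable with \<open>E 0 = 0\<close>, it is
  \<open>O(x)\<close> at 0, while \<open>2^n * q^(2^n)\<close> tends to 0.\<close>

lemma theta_square_sum:
  fixes q :: real
  assumes q: "\<bar>q\<bar> < 1" "q \<noteq> 0"
  shows "(theta q)\<^sup>2 + (theta (-q))\<^sup>2 = 2 * (theta (q\<^sup>2))\<^sup>2"
proof -
  define E where "E = (\<lambda>q::real. (theta q)\<^sup>2 + (theta (-q))\<^sup>2 - 2 * (theta (q\<^sup>2))\<^sup>2)"
  have E2: "E x = -2 * E (x\<^sup>2)" if "\<bar>x\<bar> < 1" "x \<noteq> 0" for x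
  proof -
    \<comment> \<open>By \<open>theta_even_odd\<close> only the even squares survive in the
      sum.\<close>
    have s: "theta x + theta (-x) = 2 * theta (x^4)"
      using theta_even_odd[of x] theta_even_odd[of "-x"] that by simp
    have "(theta x)\<^sup>2 + (theta (-x))\<^sup>2 = (theta x + theta (-x))\<^sup>2 - 2 * (theta x * theta (-x))"
      by (simp add: power2_eq_square algebra_simps)
    also have "\<dots> = 4 * (theta (x^4))\<^sup>2 - 2 * (theta (- (x\<^sup>2)))\<^sup>2"
      unfolding s using theta_mult_minus[of x] that by (simp add: power_mult_distrib)
    finally show ?thesis by (simp add: E_def flip: power_mult)
  qed
  have En: "E q = (-2)^n * E (q ^ (2^n))" for n
  proof (induction n)
    case (Suc n)
    have "\<bar>q ^ (2^n)\<bar> < 1" using norm_power_less_one[of q "2^n"] q by simp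
    then have "E (q ^ (2^n)) = -2 * E ((q ^ (2^n))\<^sup>2)" using E2 q by simp
    also have "(q ^ (2^n))\<^sup>2 = q ^ (2 ^ Suc n)" by (simp add: mult.commute flip: power_mult)
    finally show ?case using Suc by simp
  qed simp
  obtain D3 D2 :: "real \<Rightarrow> real" where D: "\<And>x. \<bar>x\<bar> < 1 \<Longrightarrow> (theta has_real_derivative D3 x) (at x)" "isCont D3 0"
     "\<And>x. \<bar>x\<bar> < 1 \<Longrightarrow> (theta2 has_real_derivative D2 x) (at x)" "isCont D2 0"
    by (rule theta_deriv_exists, rule that)
  have d: "(theta has_real_derivative D3 0) (at x)" if "x = 0" for x using D(1)[of 0] that by simp
  have "\<exists>e. (E has_real_derivative e) (at 0)"
    unfolding E_def by (rule exI) (auto intro!: derivative_eq_intros DERIV_chain2[OF d])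
  then obtain e where "(E has_real_derivative e) (at 0)" by blast
  moreover have E0: "E 0 = 0" by (simp add: E_def)
  ultimately have "((\<lambda>x. E x / x) \<longlongrightarrow> e) (at 0)" by (simp add: has_field_derivative_iff)
  moreover have "filterlim (\<lambda>n. q ^ (2^n)) (at 0) sequentially"
    using dyadic_power_tendsto_0(1)[OF q(1)] q(2) by (auto simp: filterlim_at)
  ultimately have l: "(\<lambda>n. E (q ^ (2^n)) / q ^ (2^n)) \<longlonglongrightarrow> e" by (rule filterlim_compose)
  have "(\<lambda>n. (2^n * q ^ (2^n)) * (E (q ^ (2^n)) / q ^ (2^n))) \<longlonglongrightarrow> 0 * e"
    by (intro tendsto_mult dyadic_power_tendsto_0(2) q l)
  moreover have "\<bar>(2^n * q ^ (2^n)) * (E (q ^ (2^n)) / q ^ (2^n))\<bar> = \<bar>E q\<bar>" for n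
    unfolding En[of n] using q(2) by (simp add: abs_mult power_abs)
  ultimately have "(\<lambda>n::nat. \<bar>E q\<bar>) \<longlonglongrightarrow> 0" using tendsto_rabs_zero by fastforce
  then have "E q = 0" by (simp add: LIMSEQ_const_iff)
  then show ?thesis by (simp add: E_def)
qed

text \<open>Jacobi's quartic identity; the factor \<open>q\<close> is the fourth power of the one
  omitted from \<open>theta2\<close>. The left side splits into the difference of squares, which
  parity evaluates, and the sum of squares from \<open>theta_square_sum\<close>.\<close>

theorem theta_jacobi:
  fixes q :: real
  assumes q: "\<bar>q\<bar> < 1" "q \<noteq> 0"
  shows "theta q ^ 4 - theta (-q) ^ 4 = q * theta2 q ^ 4"
proof -
  note q2 = abs_power2_less_one[OF q(1)]
  have d: "theta q - theta (-q) = 2 * q * theta2 (q^4)" and s: "theta q + theta (-q) = 2 * theta (q^4)"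
    using theta_even_odd[of q] theta_even_odd[of "-q"] q by simp_all
  have 1: "(theta2 (q\<^sup>2))\<^sup>2 = 2 * theta2 (q^4) * theta (q^4)"
    using theta2_square[of "q\<^sup>2"] q q2 by (simp flip: power_mult)
  have "(theta q)\<^sup>2 - (theta (-q))\<^sup>2 = (theta q - theta (-q)) * (theta q + theta (-q))"
    by (simp add: power2_eq_square algebra_simps)
  also have "\<dots> = 2 * q * (theta2 (q\<^sup>2))\<^sup>2" unfolding d s 1 by simp
  finally have 2: "(theta q)\<^sup>2 - (theta (-q))\<^sup>2 = 2 * q * (theta2 (q\<^sup>2))\<^sup>2" .
  have "theta q ^ 4 - theta (-q) ^ 4 = ((theta q)\<^sup>2 - (theta (-q))\<^sup>2) * ((theta q)\<^sup>2 + (theta (-q))\<^sup>2)"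
    by (simp add: power2_eq_square power4_eq_xxxx algebra_simps)
  also have "\<dots> = q * (2 * theta2 (q\<^sup>2) * theta (q\<^sup>2))\<^sup>2"
    unfolding 2 theta_square_sum[OF q] by (simp add: power2_eq_square)
  also have "2 * theta2 (q\<^sup>2) * theta (q\<^sup>2) = (theta2 q)\<^sup>2"
    using theta2_square[of q] q by simp
  finally show ?thesis by (simp flip: power_mult)
qed

lemma qinf_real_pos:
  fixes q :: real
  assumes "0 \<le> q" "q < 1"
  shows "qinf q > 0"
proof -
  have q: "norm q < 1" using assms by simp
  have "qpoch q n > 0" for n
    unfolding qpoch_def
  proof (rule prod_pos)
    show "0 < 1 - q ^ Suc k" for k using norm_power_less_one[of q "Suc k"] q assms by (simp del: power_Suc)
  qed
  then have "qinf q \<ge> 0"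
    using LIMSEQ_le_const[OF qpoch_LIMSEQ[OF q], of 0] by (auto intro: less_imp_le)
  then show ?thesis using qinf_nz[OF q] by linarith
qed

lemma theta_pos:
  fixes q :: real
  assumes q: "\<bar>q\<bar> < 1"
  shows "theta q > 0"
proof (cases "q = 0")
  case False
  have "qinf (q\<^sup>2) > 0" using abs_power2_less_one[OF q] by (intro qinf_real_pos) auto
  moreover have "qinf (-q) \<noteq> 0" using qinf_nz[of "-q"] q by simp
  ultimately show ?thesis using theta_product[of q] q False by simp
qed simp

lemma theta2_pos:
  fixes q :: real
  assumes q: "\<bar>q\<bar> < 1"
  shows "theta2 q > 0"
proof -
  have "qinf (q\<^sup>2) > 0" "qinf (q^4) > 0"
    using abs_power2_less_one[OF q] norm_power_less_one[of q 4] q by (auto intro!: qinf_real_pos)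
  then show ?thesis using theta2_product[of q] q by simp
qed

section \<open>The modular function lambda and its derivative\<close>

definition lam :: "real \<Rightarrow> real" where "lam q = q * (theta2 q / theta q) ^ 4"

text \<open>The complementary modulus \<open>k'\<close>, that is
  \<open>theta_4^2 / theta_3^2\<close>.\<close>

definition kap :: "real \<Rightarrow> real" where "kap q = (theta (-q))\<^sup>2 / (theta q)\<^sup>2"

lemma lam_kap:
  assumes q: "\<bar>q\<bar> < 1" "q \<noteq> 0"
  shows "lam q = 1 - (kap q)\<^sup>2"
proof -
  have "theta q ^ 4 > 0" using theta_pos[OF q(1)] by simp
  then have "lam q = (theta q ^ 4 - theta (-q) ^ 4) / theta q ^ 4"
    unfolding theta_jacobi[OF q] lam_def by (simp add: power_divide)
  also have "\<dots> = 1 - (kap q)\<^sup>2"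
    using \<open>theta q ^ 4 > 0\<close> by (simp add: kap_def power_divide diff_divide_distrib flip: power_mult)
  finally show ?thesis .
qed

lemma kap_pos: "\<bar>q\<bar> < 1 \<Longrightarrow> kap q > 0"
  using theta_pos[of q] theta_pos[of "-q"] by (simp add: kap_def)

lemma lam_bounds:
  assumes "0 < q" "q < 1"
  shows "0 < lam q" "lam q < 1"
proof -
  have q: "\<bar>q\<bar> < 1" "q \<noteq> 0" using assms by auto
  show "0 < lam q" using theta_pos[OF q(1)] theta2_pos[OF q(1)] assms by (simp add: lam_def)
  show "lam q < 1" using lam_kap[OF q] kap_pos[OF q(1)] by simp
qed

lemma kap_less_1: "0 < q \<Longrightarrow> q < 1 \<Longrightarrow> kap q < 1"
  using lam_bounds[of q] lam_kap[of q] kap_pos[of q] power_less_one_iff[of "kap q" 2] by simp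

text \<open>Landen's transformation, or one step of the arithmetic-geometric mean:
  \<open>theta (q^2) ^ 2\<close> is the arithmetic and \<open>theta (- (q^2)) ^ 2\<close> the
  geometric mean of \<open>theta q ^ 2\<close> and \<open>theta (-q) ^ 2\<close>.\<close>

lemma kap_square:
  assumes q: "\<bar>q\<bar> < 1" "q \<noteq> 0"
  shows "(kap (q\<^sup>2))\<^sup>2 = 4 * kap q / (1 + kap q)\<^sup>2"
proof -
  have t: "theta q > 0" "theta (-q) > 0" using theta_pos q by auto
  have e: "(theta (- (q\<^sup>2)))\<^sup>2 = theta q * theta (-q)" "(theta (q\<^sup>2))\<^sup>2 = ((theta q)\<^sup>2 + (theta (-q))\<^sup>2) / 2"
    using theta_mult_minus[of q] theta_square_sum[of q] q by simp_all
  have "kap (q\<^sup>2) = 2 * (theta q * theta (-q)) / ((theta q)\<^sup>2 + (theta (-q))\<^sup>2)"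
    unfolding kap_def e by simp
  moreover have "1 + kap q = ((theta q)\<^sup>2 + (theta (-q))\<^sup>2) / (theta q)\<^sup>2"
    using t by (simp add: kap_def add_divide_distrib)
  ultimately show ?thesis
    using t by (simp add: kap_def power_divide power_mult_distrib flip: power_mult) (simp add: power2_eq_square power4_eq_xxxx)
qed

text \<open>The quotient \<open>g\<close> of the actual derivative by the expected one is invariant
  under \<open>x -> x^2\<close> by Landen's transformation. Hence \<open>g q\<close> equals the
  limit along \<open>q^(2^n)\<close>, which is \<open>g 0 = 1\<close>.\<close>

theorem lam_deriv:
  assumes q: "0 < q" "q < 1"
  shows "(lam has_real_derivative (lam q * (1 - lam q) * theta q ^ 4 / q)) (at q)"
proof -
  obtain D3 D2 :: "real \<Rightarrow> real" where D: "\<And>x. \<bar>x\<bar> < 1 \<Longrightarrow> (theta has_real_derivative D3 x) (at x)" "isCont D3 0"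
    "\<And>x. \<bar>x\<bar> < 1 \<Longrightarrow> (theta2 has_real_derivative D2 x) (at x)" "isCont D2 0"
    by (rule theta_deriv_exists, rule that)
  \<comment> \<open>This is \<open>lam x / x\<close> in a form that is continuous at 0, with the
    value 16; it keeps \<open>g\<close> continuous there.\<close>
  define mu where "mu = (\<lambda>x::real. (theta2 x / theta x) ^ 4)"
  define lamD where "lamD = (\<lambda>x. mu x + x * (4 * (theta2 x / theta x) ^ 3 * ((D2 x * theta x - theta2 x * D3 x) / (theta x * theta x))))"
  define g where "g = (\<lambda>x. lamD x / (mu x * theta (-x) ^ 4))"
  have lamD: "(lam has_real_derivative lamD x) (at x)" if "\<bar>x\<bar> < 1" for x
  proof -
    have "theta x \<noteq> 0" using theta_pos[OF that] by simp
    then show ?thesis unfolding lam_def [abs_def] lamD_def mu_def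
      by (auto intro!: derivative_eq_intros D(1)[OF that] D(3)[OF that])
  qed
  define kD where "kD = (\<lambda>x. (2 * theta (-x) * - D3 (-x) * (theta x)\<^sup>2 - (theta (-x))\<^sup>2 * (2 * theta x * D3 x)) / ((theta x)\<^sup>2 * (theta x)\<^sup>2))"
  have kD: "(kap has_real_derivative kD x) (at x)" if "\<bar>x\<bar> < 1" for x
  proof -
    have "theta x \<noteq> 0" using theta_pos[OF that] by simp
    moreover have "((\<lambda>x. theta (-x)) has_real_derivative (D3 (-x) * -1)) (at x)"
      by (rule DERIV_chain2[OF D(1)]) (use that in \<open>auto intro!: derivative_eq_intros\<close>)
    ultimately show ?thesis unfolding kap_def [abs_def] kD_def
      by (auto intro!: derivative_eq_intros D(1)[OF that])
  qed
  have ginv: "g (x\<^sup>2) = g x" if x: "0 < x" "x < 1" for x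
  proof -
    have x1: "\<bar>x\<bar> < 1" "x \<noteq> 0" using x by auto
    have xx: "\<bar>x\<^sup>2\<bar> < 1" "x\<^sup>2 \<noteq> 0" using abs_power2_less_one x1 by auto
    define k where "k = kap x"
    have k: "0 < k" "k < 1" using kap_pos[OF x1(1)] kap_less_1[OF x] by (auto simp: k_def)
    have t: "theta x > 0" "theta (-x) > 0" using theta_pos x1 by auto
    have ev: "eventually (\<lambda>z. z \<in> {-1<..<1} - {0}) (nhds x)"
      by (rule eventually_nhds_in_open) (use x in auto)
    \<comment> \<open>The derivative of \<open>lam\<close> is expressed through \<open>k\<close> and
      \<open>kD x\<close> twice, at \<open>x\<close> from \<open>lam_kap\<close> and at
      \<open>x^2\<close> from \<open>kap_square\<close>; both values of \<open>g\<close> then become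
      the same multiple of \<open>kD x\<close>.\<close>
    have d1: "lamD x = - (2 * k * kD x)"
    proof -
      have "((\<lambda>z. 1 - (kap z)\<^sup>2) has_real_derivative (- (2 * k * kD x))) (at x)"
        unfolding k_def by (auto intro!: derivative_eq_intros kD x1)
      moreover have "((\<lambda>z. 1 - (kap z)\<^sup>2) has_real_derivative lamD x) (at x)"
        by (rule DERIV_cong_ev[THEN iffD1, OF refl _ refl lamD[OF x1(1)]])
           (use ev in eventually_elim, auto simp: lam_kap)
      ultimately show ?thesis by (metis DERIV_unique)
    qed
    have d2: "lamD (x\<^sup>2) * (2 * x) = - (4 * (1 - k) * kD x / (1 + k) ^ 3)"
    proof -
      have a: "((\<lambda>z. 1 - 4 * kap z / (1 + kap z)\<^sup>2) has_real_derivative (- (4 * (1 - k) * kD x / (1 + k) ^ 3))) (at x)"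
      proof -
        have "1 + k \<noteq> 0" using k by simp
        have n: "((\<lambda>z. 4 * kap z) has_real_derivative (4 * kD x)) (at x)"
          by (rule DERIV_cmult[OF kD[OF x1(1)]])
        have d: "((\<lambda>z. (1 + kap z)\<^sup>2) has_real_derivative (2 * (1 + k) * kD x)) (at x)"
          unfolding k_def by (auto intro!: derivative_eq_intros kD[OF x1(1)])
        have "((\<lambda>z. 1 - 4 * kap z / (1 + kap z)\<^sup>2) has_real_derivative
           (0 - (4 * kD x * (1 + kap x)\<^sup>2 - 4 * kap x * (2 * (1 + k) * kD x)) / ((1 + kap x)\<^sup>2 * (1 + kap x)\<^sup>2))) (at x)"
          using \<open>1 + k \<noteq> 0\<close> by (intro DERIV_diff DERIV_const DERIV_divide n d) (simp add: k_def)
        moreover have "0 - (4 * kD x * (1 + k)\<^sup>2 - 4 * k * (2 * (1 + k) * kD x)) / ((1 + k)\<^sup>2 * (1 + k)\<^sup>2) = - (4 * (1 - k) * kD x / (1 + k) ^ 3)"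
        proof -
          have "(4 * kD x * (1 + k)\<^sup>2 - 4 * k * (2 * (1 + k) * kD x)) = (4 * (1 - k) * kD x) * (1 + k)"
            by (simp add: power2_eq_square algebra_simps)
          moreover have "(1 + k)\<^sup>2 * (1 + k)\<^sup>2 = (1 + k) ^ 3 * (1 + k)"
            by (simp add: power2_eq_square power3_eq_cube)
          ultimately show ?thesis using \<open>1 + k \<noteq> 0\<close> by simp
        qed
        ultimately show ?thesis unfolding k_def[symmetric] by simp
      qed
      have b: "((\<lambda>z. lam (z\<^sup>2)) has_real_derivative (lamD (x\<^sup>2) * (2 * x))) (at x)"
        by (rule DERIV_chain2[OF lamD]) (use xx in \<open>auto intro!: derivative_eq_intros\<close>)
      have "((\<lambda>z. 1 - 4 * kap z / (1 + kap z)\<^sup>2) has_real_derivative lamD (x\<^sup>2) * (2 * x)) (at x)"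
      proof (rule DERIV_cong_ev[THEN iffD1, OF refl _ refl b])
        show "eventually (\<lambda>z. lam (z\<^sup>2) = 1 - 4 * kap z / (1 + kap z)\<^sup>2) (nhds x)"
          using ev
        proof eventually_elim
          case (elim z)
          then have z: "\<bar>z\<bar> < 1" "z \<noteq> 0" by auto
          then show ?case using lam_kap[of "z\<^sup>2"] kap_square[OF z] abs_power2_less_one[OF z(1)] by simp
        qed
      qed
      with a show ?thesis by (metis DERIV_unique)
    qed
    have mu1: "mu x = (1 - k\<^sup>2) / x" using lam_kap[OF x1] x by (simp add: lam_def mu_def k_def field_simps)
    have mu2: "mu (x\<^sup>2) = ((1 - k) / (1 + k))\<^sup>2 / x\<^sup>2"
    proof -
      have "x\<^sup>2 * mu (x\<^sup>2) = 1 - 4 * k / (1 + k)\<^sup>2"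
        using lam_kap[OF xx] kap_square[OF x1] by (simp add: lam_def mu_def k_def)
      also have "\<dots> = ((1 - k) / (1 + k))\<^sup>2"
      proof -
        have "(1 + k)\<^sup>2 \<noteq> 0" using k by simp
        then have "1 - 4 * k / (1 + k)\<^sup>2 = ((1 + k)\<^sup>2 - 4 * k) / (1 + k)\<^sup>2" by (simp add: diff_divide_distrib)
        also have "(1 + k)\<^sup>2 - 4 * k = (1 - k)\<^sup>2" by (simp add: power2_eq_square algebra_simps)
        finally show ?thesis by (simp add: power_divide)
      qed
      finally show ?thesis
        by (simp only: nonzero_eq_divide_eq[OF xx(2)] mult.commute[of "mu (x\<^sup>2)"])
    qed
    have t4: "theta (- (x\<^sup>2)) ^ 4 = (theta x * theta (-x))\<^sup>2"
      using theta_mult_minus[of x] x1 by (simp flip: power_mult)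
    have kt: "k * (theta x)\<^sup>2 = (theta (-x))\<^sup>2" using t by (simp add: k_def kap_def)
    have L2: "lamD (x\<^sup>2) = - (2 * (1 - k) * kD x / ((1 + k) ^ 3 * x))"
    proof -
      have "lamD (x\<^sup>2) = (lamD (x\<^sup>2) * (2 * x)) / (2 * x)" using x by simp
      also have "\<dots> = - (2 * (1 - k) * kD x / ((1 + k) ^ 3 * x))"
      proof -
        have "- (4 * M * K / N) / (2 * z) = - (2 * M * K / (N * z))" for M K N z :: real by simp
        then show ?thesis unfolding d2 .
      qed
      finally show ?thesis .
    qed
    have gen1: "- (2 * M * K / (N ^ 3 * z)) / ((M / N)\<^sup>2 / z\<^sup>2 * T) = - (2 * z * K) / (M * N * T)"
      if "M \<noteq> 0" "N \<noteq> 0" "z \<noteq> 0" "T \<noteq> 0" for M N K T z :: real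
      using that by (simp add: divide_simps power2_eq_square power3_eq_cube)
    have gen2: "- (2 * z * K) / (M * N * (H / j)) = - (2 * j * K) / (M * N / z * H)"
      if "M \<noteq> 0" "N \<noteq> 0" "z \<noteq> 0" "H \<noteq> 0" "j \<noteq> 0" for M N K H j z :: real
      using that by (simp add: divide_simps)
    have nz: "1 + k \<noteq> 0" "1 - k \<noteq> 0" "x \<noteq> 0" "theta x \<noteq> 0" "theta (-x) \<noteq> 0" using k x t by auto
    have k2: "1 - k\<^sup>2 = (1 - k) * (1 + k)" by (simp add: power2_eq_square algebra_simps)
    have "g (x\<^sup>2) = - (2 * x * kD x) / ((1 - k) * (1 + k) * (theta x * theta (-x))\<^sup>2)"
      unfolding g_def L2 mu2 t4 by (rule gen1) (use nz in auto)
    also have "(theta x * theta (-x))\<^sup>2 = theta (-x) ^ 4 / k"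
    proof -
      have "k * (theta x * theta (-x))\<^sup>2 = (k * (theta x)\<^sup>2) * (theta (-x))\<^sup>2" by (simp add: power_mult_distrib)
      also have "\<dots> = theta (-x) ^ 4" unfolding kt by (simp add: power2_eq_square power4_eq_xxxx)
      finally show ?thesis using k by (simp add: field_simps)
    qed
    also have "- (2 * x * kD x) / ((1 - k) * (1 + k) * (theta (-x) ^ 4 / k)) = g x"
      unfolding g_def d1 mu1 k2 by (rule gen2) (use nz k in auto)
    finally show ?thesis .
  qed
  have gn: "g q = g (q ^ (2^n))" for n
  proof (induction n)
    case (Suc n)
    have "q ^ (2^n) < 1" using norm_power_less_one[of q "2^n"] q by simp
    then have "g ((q ^ (2^n))\<^sup>2) = g (q ^ (2^n))" using q by (intro ginv) auto
    then show ?case using Suc by (simp add: mult.commute flip: power_mult)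
  qed simp
  have c3: "isCont theta (0::real)" and c2: "isCont theta2 (0::real)"
    using DERIV_isCont[OF D(1)[of 0]] DERIV_isCont[OF D(3)[of 0]] by auto
  have c3': "isCont (\<lambda>x::real. theta (-x)) 0"
    by (rule isCont_o2[where g = theta]) (use c3 in auto)
  have "isCont g 0"
    unfolding g_def lamD_def mu_def by (intro continuous_intros c3 c2 c3' D) auto
  moreover have "g 0 = 1" by (simp add: g_def lamD_def mu_def)
  ultimately have "(\<lambda>n. g (q ^ (2^n))) \<longlonglongrightarrow> 1"
    using isCont_tendsto_compose[OF _ dyadic_power_tendsto_0(1)[of q], of g] q by simp
  then have "g q = 1" using gn by (simp add: LIMSEQ_const_iff)
  moreover have t: "theta q > 0" "theta (-q) > 0" "theta2 q > 0" using theta_pos theta2_pos q by auto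
  ultimately have "lamD q = mu q * theta (-q) ^ 4" by (simp add: g_def mu_def)
  also have "\<dots> = lam q * (1 - lam q) * theta q ^ 4 / q"
  proof -
    have "1 - lam q = theta (-q) ^ 4 / theta q ^ 4"
      using lam_kap[of q] q by (simp add: kap_def power_divide flip: power_mult)
    then show ?thesis using t q by (simp add: lam_def mu_def)
  qed
  finally show ?thesis using lamD[of q] q by simp
qed

text \<open>Only the imaginary part matters, since it alone determines \<open>|tau24|\<close>. The
  filter is arbitrary because the lemma serves the imaginary axis, a sequence on it, and every
  cusp.\<close>

lemma at_0_hexpF:
  assumes "filterlim g at_top F" and that: "\<And>x. Im (z x) = g x"
  shows "((\<lambda>x. hexpF (z x)) \<longlongrightarrow> 0) F"
proof -
  have "((\<lambda>x. exp (- (pi / 12 * g x))) \<longlongrightarrow> 0) F"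
    using assms by (intro filterlim_compose[OF exp_at_bot] filterlim_compose[OF filterlim_uminus_at_bot_at_top]
        filterlim_tendsto_pos_mult_at_top[OF tendsto_const]) auto
  then have "((\<lambda>x. cmod (tau24 (z x))) \<longlongrightarrow> 0) F"
    by (simp add: norm_tau24 that)
  then have t: "((\<lambda>x. tau24 (z x)) \<longlongrightarrow> 0) F" by (rule tendsto_norm_zero_cancel)
  have "isCont hexp_series 0"
  proof -
    define c where "c = (\<lambda>n. complex_of_int (psi n) / of_nat n)"
    have "isCont (\<lambda>x. suminf (\<lambda>n. c n * x ^ n)) 0"
      by (rule isCont_powser[of c "of_real (1/2)"]) (use hexp_series_summable[of "of_real (1/2)"] in \<open>simp_all add: c_def\<close>)
    then show ?thesis unfolding hexp_series_def [abs_def] c_def .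
  qed
  moreover have "hexp_series 0 = 0" unfolding hexp_series_def by (subst powser_zero) simp
  ultimately have "((\<lambda>x. hexp_series (tau24 (z x))) \<longlongrightarrow> 0) F"
    using isCont_tendsto_compose[OF _ t, of hexp_series] by simp
  from tendsto_mult[OF tendsto_const this] show ?thesis
    unfolding hexpF_def by (rule tendsto_eq_rhs) simp
qed

section \<open>The Beta integral on the imaginary axis\<close>

lemma qinf_of_real:
  fixes x :: real
  assumes "\<bar>x\<bar> < 1"
  shows "qinf (complex_of_real x) = of_real (qinf x)"
proof (rule LIMSEQ_unique)
  show "qpoch (complex_of_real x) \<longlonglongrightarrow> qinf (complex_of_real x)"
    by (rule qpoch_LIMSEQ) (use assms in simp)
  have "(\<lambda>n. complex_of_real (qpoch x n)) \<longlonglongrightarrow> of_real (qinf x)"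
    by (intro tendsto_of_real qpoch_LIMSEQ) (use assms in simp)
  also have "(\<lambda>n. complex_of_real (qpoch x n)) = qpoch (complex_of_real x)"
    by (simp add: fun_eq_iff qpoch_def)
  finally show "qpoch (complex_of_real x) \<longlonglongrightarrow> of_real (qinf x)" .
qed

text \<open>Jacobi's nome at \<open>\<tau> = i * y\<close>, the square root of the \<open>q\<close>
  in the definition of eta.\<close>

definition nome :: "real \<Rightarrow> real" where "nome y = exp (- (pi * y))"

lemma nome_bounds: "y > 0 \<Longrightarrow> 0 < nome y" "y > 0 \<Longrightarrow> nome y < 1"
  by (simp_all add: nome_def)

definition abeta :: "real \<Rightarrow> real" where
  "abeta x = integral {0..x} (\<lambda>t. t powr (-2/3) * (1 - t) powr (-2/3))"

lemma abeta_integrable: "(\<lambda>t. t powr (-2/3) * (1 - t) powr (-2/3)) integrable_on {0..1::real}"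
  and abeta_1: "abeta 1 = Beta (1/3) (1/3)"
proof -
  have "((\<lambda>t. t powr (1/3 - 1) * (1 - t) powr (1/3 - 1)) has_integral Beta (1/3) (1/3)) {0..1::real}"
    by (rule has_integral_Beta_real) auto
  then have "((\<lambda>t. t powr (-2/3) * (1 - t) powr (-2/3)) has_integral Beta (1/3) (1/3)) {0..1::real}" by simp
  then show "(\<lambda>t. t powr (-2/3) * (1 - t) powr (-2/3)) integrable_on {0..1::real}" "abeta 1 = Beta (1/3) (1/3)"
    unfolding abeta_def by (auto simp: has_integral_iff)
qed

lemma continuous_on_abeta: "continuous_on {0..1} abeta"
  unfolding abeta_def [abs_def] by (rule indefinite_integral_continuous_1[OF abeta_integrable])

lemma abeta_deriv:
  assumes x: "0 < x" "x < 1"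
  shows "(abeta has_real_derivative (x * (1 - x)) powr (-2/3)) (at x)"
proof -
  define f where "f = (\<lambda>t::real. t powr (-2/3) * (1 - t) powr (-2/3))"
  \<comment> \<open>The integrand is singular at 0 and 1, so the fundamental theorem is applied on
    an interior interval around \<open>x\<close>, and the constant \<open>abeta a\<close> is
    added.\<close>
  define a b where "a = x / 2" and "b = (1 + x) / 2"
  have ab: "0 < a" "a < x" "x < b" "b < 1" using x by (auto simp: a_def b_def)
  have "continuous_on {a..b} f" unfolding f_def using ab by (intro continuous_intros) auto
  then have "((\<lambda>u. integral {a..u} f) has_real_derivative f x) (at x within {a..b})"
    by (rule integral_has_real_derivative) (use ab in auto)
  then have d: "((\<lambda>u. integral {a..u} f) has_real_derivative f x) (at x)"
    using ab by (simp add: at_within_Icc_at)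
  have 1: "((\<lambda>u. abeta a + integral {a..u} f) has_real_derivative f x) (at x)"
    using DERIV_add[OF DERIV_const d] by simp
  have 2: "eventually (\<lambda>u. abeta a + integral {a..u} f = abeta u) (nhds x)"
  proof -
    have "eventually (\<lambda>u. u \<in> {a<..<b}) (nhds x)" by (rule eventually_nhds_in_open) (use ab in auto)
    then show ?thesis
    proof eventually_elim
      case (elim u)
      have "f integrable_on {0..u}"
        by (rule integrable_on_subinterval[OF abeta_integrable[folded f_def]]) (use elim ab in auto)
      then show ?case
        unfolding abeta_def f_def[symmetric]
        by (intro Henstock_Kurzweil_Integration.integral_combine) (use elim ab in auto)
    qed
  qed
  have "(abeta has_real_derivative f x) (at x)"
    using DERIV_cong_ev[OF refl 2 refl] 1 by blast
  moreover have "f x = (x * (1 - x)) powr (-2/3)" using x by (simp add: f_def powr_mult)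
  ultimately show ?thesis by simp
qed

text \<open>By \<open>theta_triple\<close> the product of Jacobi's three theta constants is
  \<open>2 * eta^3\<close>, so \<open>16 * eta^12 = lam * (1 - lam) * theta^12\<close>. All
  quantities are positive here, so the real cube root may be taken.\<close>

lemma dedekind_eta_imaginary_power4:
  assumes y: "y > 0"
  defines "q \<equiv> nome y"
  shows "dedekind_eta (\<i> * of_real y) ^ 4 = of_real ((lam q * (1 - lam q) / 16) powr (1/3) * theta q ^ 4)"
proof -
  define t where "t = exp (- (pi * y / 12))"
  have q: "0 < q" "q < 1" "\<bar>q\<bar> < 1" "q \<noteq> 0" using nome_bounds[OF y] by (auto simp: q_def)
  have t12: "t ^ 12 = q" unfolding t_def q_def nome_def exp_of_nat_mult[symmetric] by simp
  have t24: "t ^ 24 = q\<^sup>2" unfolding t12[symmetric] by (simp flip: power_mult)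
  have t: "0 < t" by (simp add: t_def)
  have q2: "\<bar>q\<^sup>2\<bar> < 1" by (rule abs_power2_less_one[OF q(3)])
  have T: "tau24 (\<i> * of_real y) = of_real t"
    by (simp add: tau24_def t_def flip: exp_of_real)
  have e: "dedekind_eta (\<i> * of_real y) = of_real (t * qinf (q\<^sup>2))"
    unfolding dedekind_eta_eq T using qinf_of_real[OF q2] by (simp flip: of_real_power t24)
  have pos: "qinf (q\<^sup>2) > 0" using q2 by (intro qinf_real_pos) auto
  have lam: "0 < lam q" "lam q < 1" using lam_bounds q by auto
  have th: "theta q > 0" "theta (-q) > 0" using theta_pos q by auto
  have l1: "lam q * theta q ^ 4 = q * theta2 q ^ 4" using th by (simp add: lam_def power_divide)
  have l2: "(1 - lam q) * theta q ^ 4 = theta (-q) ^ 4"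
    using lam_kap[OF q(3,4)] th by (simp add: kap_def power_divide flip: power_mult)
  have "16 * ((t * qinf (q\<^sup>2)) ^ 4) ^ 3 = q * (2 * qinf (q\<^sup>2) ^ 3) ^ 4"
    by (simp add: power_mult_distrib t12 flip: power_mult)
  also have "2 * qinf (q\<^sup>2) ^ 3 = theta q * theta (-q) * theta2 q"
    using theta_triple[of q] q by simp
  also have "q * (theta q * theta (-q) * theta2 q) ^ 4 = theta q ^ 4 * theta (-q) ^ 4 * (q * theta2 q ^ 4)"
    by (simp add: power_mult_distrib)
  also have "\<dots> = lam q * (1 - lam q) * (theta q ^ 4) ^ 3"
    unfolding l1[symmetric] l2[symmetric] by (simp add: power3_eq_cube)
  also have "\<dots> = 16 * ((lam q * (1 - lam q) / 16) powr (1/3) * theta q ^ 4) ^ 3"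
  proof -
    have "((lam q * (1 - lam q) / 16) powr (1/3)) ^ 3 = (lam q * (1 - lam q) / 16) powr (1/3 * 3)"
      using lam by (simp add: powr_powr flip: powr_realpow)
    then show ?thesis using lam by (simp add: power_mult_distrib)
  qed
  finally have Q: "((t * qinf (q\<^sup>2)) ^ 4) ^ 3 = ((lam q * (1 - lam q) / 16) powr (1/3) * theta q ^ 4) ^ 3" by simp
  have "of_real ((t * qinf (q\<^sup>2)) ^ 4) = complex_of_real ((lam q * (1 - lam q) / 16) powr (1/3) * theta q ^ 4)"
    by (intro arg_cong[of _ _ of_real]) (rule power_eq_imp_eq_base[OF Q], auto)
  then show ?thesis unfolding e of_real_power .
qed

definition hexp_const :: real where "hexp_const = C_hexp / (pi * 16 powr (1/3))"

text \<open>Along the axis \<open>lam\<close> has the derivative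
  \<open>- pi * lam * (1 - lam) * theta^4\<close> in \<open>y\<close>. Times the integrand of
  \<open>abeta\<close> this leaves the exponent \<open>-2/3 + 1 = 1/3\<close>, which is
  \<open>eta^4\<close> up to the factor in \<open>hexp_const\<close>. Both sides have the same
  derivative and vanish as \<open>y\<close> grows.\<close>

lemma hexpF_imaginary:
  assumes y: "y > 0"
  shows "hexpF (\<i> * of_real y) = - \<i> * of_real (hexp_const * abeta (lam (nome y)))"
proof -
  define Z where "Z = (\<lambda>y. hexpF (\<i> * of_real y) + \<i> * of_real (hexp_const * abeta (lam (nome y))))"
  have dZ: "(Z has_vector_derivative 0) (at y)" if y: "y > 0" for y
  proof -
    define q where "q = nome y"
    have q: "0 < q" "q < 1" using nome_bounds[OF y] by (auto simp: q_def)
    have lam: "0 < lam q" "lam q < 1" using lam_bounds q by auto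
    define P where "P = lam q * (1 - lam q)"
    have P: "P > 0" using lam by (simp add: P_def)
    have n: "(nome has_real_derivative (- pi * nome y)) (at y)"
      unfolding nome_def [abs_def] by (auto intro!: derivative_eq_intros)
    from DERIV_chain2[OF abeta_deriv[OF lam, unfolded q_def] DERIV_chain2[OF lam_deriv[OF q, unfolded q_def] n]]
    have "((\<lambda>y. abeta (lam (nome y))) has_real_derivative P powr (-2/3) * (P * theta q ^ 4 / q * (- pi * q))) (at y)"
      by (simp add: P_def q_def)
    also have "P powr (-2/3) * (P * theta q ^ 4 / q * (- pi * q)) = - (pi * (P powr (1/3) * theta q ^ 4))"
    proof -
      have "P powr (-2/3) * P = P powr (1/3)" using powr_add[of P "-2/3" 1] P by simp
      then have "P powr (-2/3) * (P * theta q ^ 4 / q * (- pi * q)) = - (pi * (P powr (1/3) * theta q ^ 4))"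
        using q by (simp add: field_simps)
      then show ?thesis .
    qed
    finally have "((\<lambda>y. abeta (lam (nome y))) has_real_derivative - (pi * (P powr (1/3) * theta q ^ 4))) (at y)" .
    from DERIV_cmult[OF this, of hexp_const]
    have "((\<lambda>y. hexp_const * abeta (lam (nome y))) has_real_derivative (- (C_hexp * ((P / 16) powr (1/3) * theta q ^ 4)))) (at y)"
      using P by (simp add: hexp_const_def powr_divide)
    then have 1: "((\<lambda>y. \<i> * of_real (hexp_const * abeta (lam (nome y)))) has_vector_derivative
       (\<i> * of_real (- (C_hexp * ((P / 16) powr (1/3) * theta q ^ 4))))) (at y)"
      by (intro has_vector_derivative_mult_right has_vector_derivative_of_real)
    have "((\<lambda>y. \<i> * complex_of_real y) has_vector_derivative \<i>) (at y)"
      by (auto intro!: derivative_eq_intros has_vector_derivative_real_field)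
    then have "((hexpF \<circ> (\<lambda>y. \<i> * complex_of_real y)) has_vector_derivative (\<i> * hexp_integrand (\<i> * of_real y))) (at y)"
      by (rule field_vector_diff_chain_at) (use hexpF_deriv[of "\<i> * of_real y"] y in auto)
    moreover have "\<i> * hexp_integrand (\<i> * of_real y) = \<i> * of_real (C_hexp * ((P / 16) powr (1/3) * theta q ^ 4))"
      unfolding hexp_integrand_def dedekind_eta_imaginary_power4[OF y] by (simp add: P_def q_def)
    ultimately have 2: "((\<lambda>y. hexpF (\<i> * complex_of_real y)) has_vector_derivative \<i> * of_real (C_hexp * ((P / 16) powr (1/3) * theta q ^ 4))) (at y)"
      by (simp add: o_def)
    show ?thesis unfolding Z_def using has_vector_derivative_add[OF 2 1] by simp
  qed
  have const: "Z y' = Z y" if "y \<le> y'" "y > 0" for y y'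
  proof -
    have d: "(Z has_vector_derivative 0) (at x within {y..y'})" if "x \<in> {y..y'}" for x
      by (rule has_vector_derivative_at_within[OF dZ]) (use \<open>y > 0\<close> that in auto)
    obtain c where "\<And>x. x \<in> {y..y'} \<Longrightarrow> Z x = c"
      using has_vector_derivative_zero_constant[OF convex_real_interval(5)[of y y'] d] by blast
    then show ?thesis using that by auto
  qed
  have ev: "eventually (\<lambda>y'. Z y' = Z y) at_top"
    using eventually_ge_at_top[of y] by eventually_elim (use const y in auto)
  have n0: "(nome \<longlongrightarrow> 0) at_top"
    unfolding nome_def [abs_def]
    by (intro filterlim_compose[OF exp_at_bot] filterlim_compose[OF filterlim_uminus_at_bot_at_top]
        filterlim_tendsto_pos_mult_at_top[OF tendsto_const] filterlim_ident) auto
  have "isCont lam 0"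
  proof -
    obtain D3 D2 :: "real \<Rightarrow> real" where D: "\<And>x. \<bar>x\<bar> < 1 \<Longrightarrow> (theta has_real_derivative D3 x) (at x)" "isCont D3 0"
      "\<And>x. \<bar>x\<bar> < 1 \<Longrightarrow> (theta2 has_real_derivative D2 x) (at x)" "isCont D2 0"
      by (rule theta_deriv_exists, rule that)
    have c: "isCont theta (0::real)" "isCont theta2 (0::real)"
      using DERIV_isCont[OF D(1)[of 0]] DERIV_isCont[OF D(3)[of 0]] by auto
    show ?thesis unfolding lam_def [abs_def] by (intro continuous_intros c) auto
  qed
  from isCont_tendsto_compose[OF this n0] have l0: "((\<lambda>y. lam (nome y)) \<longlongrightarrow> 0) at_top" by (simp add: lam_def)
  have "((\<lambda>y. abeta (lam (nome y))) \<longlongrightarrow> abeta 0) at_top"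
    by (rule continuous_on_tendsto_compose[OF continuous_on_abeta l0])
       (auto intro!: eventually_mono[OF eventually_gt_at_top[of 0]] less_imp_le lam_bounds nome_bounds)
  then have a0: "((\<lambda>y. abeta (lam (nome y))) \<longlongrightarrow> 0) at_top" by (simp add: abeta_def)
  have h0: "((\<lambda>y. hexpF (\<i> * of_real y)) \<longlongrightarrow> 0) at_top"
    by (rule at_0_hexpF[OF filterlim_ident]) simp
  have zl: "(Z \<longlongrightarrow> 0 + \<i> * of_real (hexp_const * 0)) at_top"
    unfolding Z_def by (intro tendsto_intros h0 a0)
  have zy: "(Z \<longlongrightarrow> Z y) at_top"
    using ev by (rule tendsto_eventually)
  have "Z y = 0" using tendsto_unique[OF trivial_limit_at_top_linorder zy zl] by simp
  then show ?thesis by (simp add: Z_def add_eq_0_iff)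
qed

text \<open>At \<open>y = 2^(-n)\<close> Landen's relation becomes a recursion. The sequence
  decreases to some \<open>L < 1\<close> with \<open>L^2 (1+L)^2 = 4 L\<close>, which leaves only
  \<open>L = 0\<close>.\<close>

lemma kap_dyadic_tendsto: "(\<lambda>n. kap (nome (1 / 2^n))) \<longlonglongrightarrow> 0"
proof -
  define k where "k = (\<lambda>n. kap (nome (1 / 2^n)))"
  have b: "0 < nome (1 / 2^n)" "nome (1 / 2^n) < 1" for n :: nat by (simp_all add: nome_bounds)
  have k: "0 < k n" "k n < 1" for n
    using kap_pos[of "nome (1 / 2^n)"] kap_less_1[OF b[of n]] b[of n] by (simp_all add: k_def)
  have rec: "(k n)\<^sup>2 * (1 + k (Suc n))\<^sup>2 = 4 * k (Suc n)" for n
  proof -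
    have "(nome (1 / 2^Suc n))\<^sup>2 = nome (1 / 2^n)"
      unfolding nome_def exp_of_nat_mult[symmetric] by simp
    then have "(k n)\<^sup>2 = 4 * k (Suc n) / (1 + k (Suc n))\<^sup>2"
      using kap_square[of "nome (1 / 2^Suc n)"] b[of "Suc n"] by (simp add: k_def)
    then show ?thesis using k[of "Suc n"] by simp
  qed
  have "k (Suc n) \<le> k n" for n
  proof -
    have "(1 + k (Suc n))\<^sup>2 \<le> 2\<^sup>2" by (rule power_mono) (use k[of "Suc n"] in auto)
    then have "k (Suc n) * (1 + k (Suc n))\<^sup>2 \<le> 1 * 4" by (intro mult_mono) (use k[of "Suc n"] in auto)
    then have "k (Suc n) * (k (Suc n) * (1 + k (Suc n))\<^sup>2) \<le> k (Suc n) * 4"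
      using k[of "Suc n"] by (intro mult_left_mono) auto
    then have "(k (Suc n))\<^sup>2 * (1 + k (Suc n))\<^sup>2 \<le> (k n)\<^sup>2 * (1 + k (Suc n))\<^sup>2"
      unfolding rec by (simp add: power2_eq_square mult_ac)
    then have "(k (Suc n))\<^sup>2 \<le> (k n)\<^sup>2" using k[of "Suc n"] by (simp add: mult_le_cancel_right zero_less_power)
    then show ?thesis using k[of n] power2_le_imp_le by (metis less_imp_le)
  qed
  then have dec: "decseq k" by (rule decseq_SucI)
  then obtain L where L: "k \<longlonglongrightarrow> L" using decseq_convergent[of k 0] k by (metis less_imp_le)
  have L0: "0 \<le> L" by (rule LIMSEQ_le_const[OF L]) (use k in \<open>auto intro: less_imp_le\<close>)
  have "L \<le> k 0" by (rule decseq_ge[OF dec L])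
  then have L1: "L < 1" using k[of 0] by simp
  have "(\<lambda>n. (k n)\<^sup>2 * (1 + k (Suc n))\<^sup>2) \<longlonglongrightarrow> L\<^sup>2 * (1 + L)\<^sup>2"
    by (intro tendsto_intros L LIMSEQ_Suc[OF L])
  moreover have "(\<lambda>n. (k n)\<^sup>2 * (1 + k (Suc n))\<^sup>2) \<longlonglongrightarrow> 4 * L"
    unfolding rec by (intro tendsto_intros LIMSEQ_Suc[OF L])
  ultimately have e: "L\<^sup>2 * (1 + L)\<^sup>2 = 4 * L" by (rule LIMSEQ_unique)
  have "L = 0"
  proof (rule ccontr)
    assume "L \<noteq> 0"
    with L0 have "L > 0" by simp
    have "(1 + L)\<^sup>2 < 2\<^sup>2" by (rule power_strict_mono) (use L1 L0 in auto)
    then have "L * (1 + L)\<^sup>2 < 1 * 4" by (intro mult_strict_mono) (use \<open>L > 0\<close> L1 in auto)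
    then have "L * (L * (1 + L)\<^sup>2) < L * 4" using \<open>L > 0\<close> by simp
    moreover have "L * (L * (1 + L)\<^sup>2) = L\<^sup>2 * (1 + L)\<^sup>2" by (simp add: power2_eq_square)
    ultimately show False using e by linarith
  qed
  with L show ?thesis by (simp add: k_def)
qed

text \<open>By inversion \<open>hexpF (i/2^n)\<close> tends to \<open>hexpS\<close>, while
  \<open>lam\<close> tends to 1 at these points and the incomplete Beta integral becomes
  complete.\<close>

theorem hexpS_eq: "hexpS = - \<i> * of_real abs_omega0"
proof -
  define y where "y = (\<lambda>n::nat. 1 / 2^n :: real)"
  have y: "y n > 0" for n by (simp add: y_def)
  have "(\<lambda>n. kap (nome (y n))) \<longlonglongrightarrow> 0" using kap_dyadic_tendsto by (simp add: y_def)
  then have "(\<lambda>n. 1 - (kap (nome (y n)))\<^sup>2) \<longlonglongrightarrow> 1 - 0\<^sup>2" by (intro tendsto_intros)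
  moreover have "lam (nome (y n)) = 1 - (kap (nome (y n)))\<^sup>2" for n
    by (rule lam_kap) (use nome_bounds[OF y[of n]] in auto)
  ultimately have l: "(\<lambda>n. lam (nome (y n))) \<longlonglongrightarrow> 1" by simp
  have "(\<lambda>n. abeta (lam (nome (y n)))) \<longlonglongrightarrow> abeta 1"
    by (rule continuous_on_tendsto_compose[OF continuous_on_abeta l])
       (auto intro!: always_eventually less_imp_le lam_bounds nome_bounds y)
  then have "(\<lambda>n. - \<i> * of_real (hexp_const * abeta (lam (nome (y n))))) \<longlonglongrightarrow> - \<i> * of_real (hexp_const * abeta 1)"
    by (intro tendsto_intros)
  then have 1: "(\<lambda>n. hexpF (\<i> * of_real (y n))) \<longlonglongrightarrow> - \<i> * of_real (hexp_const * Beta (1/3) (1/3))"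
    using y by (simp add: hexpF_imaginary abeta_1)
  have "hexpF (\<i> * of_real (y n)) = hexpS - hexpF (\<i> * of_real (2^n))" for n
  proof -
    have "-1 / (\<i> * complex_of_real (2^n)) = \<i> * of_real (y n)" by (simp add: y_def field_simps)
    then show ?thesis using hexpF_inversion[of "\<i> * of_real (2^n)"] by simp
  qed
  moreover have "(\<lambda>n. hexpF (\<i> * of_real (2^n))) \<longlonglongrightarrow> 0"
    by (rule at_0_hexpF[of "\<lambda>n. 2^n"])
       (simp_all add: filterlim_at_top_mono[OF filterlim_real_sequentially] less_imp_le[OF of_nat_less_two_power])
  then have "(\<lambda>n. hexpS - hexpF (\<i> * of_real (2^n))) \<longlonglongrightarrow> hexpS - 0" by (intro tendsto_intros)
  ultimately have "(\<lambda>n. hexpF (\<i> * of_real (y n))) \<longlonglongrightarrow> hexpS" by simp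
  from LIMSEQ_unique[OF this 1] have S: "hexpS = - \<i> * of_real (hexp_const * Beta (1/3) (1/3))" .
  have "hexp_const * Beta (1/3) (1/3) = abs_omega0"
  proof -
    define G where "G = Gamma (1/3 :: real)"
    have G: "G > 0" by (simp add: G_def Gamma_real_pos)
    \<comment> \<open>The reflection formula, transported from the complex to the real Gamma
      function, eliminates \<open>Gamma (2/3)\<close> from the Beta value.\<close>
    have "Gamma (complex_of_real (1/3)) * Gamma (1 - complex_of_real (1/3)) = of_real pi / sin (of_real pi * complex_of_real (1/3))"
      by (rule Gamma_reflection_complex)
    also have "1 - complex_of_real (1/3) = of_real (1 - 1/3)" by simp
    also have "of_real pi / sin (of_real pi * complex_of_real (1/3)) = of_real (pi / sin (pi * (1/3)))"
    proof -
      have s: "sin (of_real pi * complex_of_real (1/3)) = of_real (sin (pi * (1/3)))"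
        by (simp only: of_real_mult[symmetric] sin_of_real)
      show ?thesis unfolding s by (rule of_real_divide[symmetric])
    qed
    finally have "complex_of_real (Gamma (1/3) * Gamma (1 - 1/3)) = of_real (pi / sin (pi * (1/3)))"
      by (simp only: Gamma_complex_of_real of_real_mult)
    then have R: "Gamma (1/3) * Gamma (1 - 1/3) = pi / sin (pi * (1/3 :: real))" by (simp only: of_real_eq_iff)
    have s60: "sin (pi * (1/3)) = sqrt 3 / 2" using sin_60 by simp
    have "G * Gamma (2/3) = 2 * pi / sqrt 3" using R unfolding s60 by (simp add: G_def)
    then have G2: "Gamma (2/3) = 2 * pi / (sqrt 3 * G)" using G by (simp add: field_simps)
    have "Beta (1/3) (1/3 :: real) = G * G / Gamma (2/3)" by (simp add: Beta_def G_def)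
    then have B: "Beta (1/3) (1/3 :: real) = G ^ 3 * sqrt 3 / (2 * pi)"
      unfolding G2 using G by (simp add: power3_eq_cube)
    have p1: "(16::real) powr (1/3) = 2 powr (4/3)" using powr_powr[of "2::real" 4 "1/3"] by simp
    have p2: "(2::real) powr (10/3) = 2 powr (4/3) * 4" using powr_add[of "2::real" "4/3" 2] by simp
    have p3: "pi powr (5/2) = pi powr (1/2) * pi\<^sup>2" using powr_add[of pi "1/2" 2] by simp
    have p4: "(3::real) powr (3/4) = 3 powr (1/4) * sqrt 3"
      using powr_add[of "3::real" "1/4" "1/2"] by (simp add: powr_half_sqrt)
    have "sqrt 3 \<noteq> 0" "(2::real) powr (4/3) \<noteq> 0" "(3::real) powr (1/4) \<noteq> 0" by auto
    then show ?thesis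
      unfolding hexp_const_def C_hexp_def abs_omega0_def B p1 p2 p3 p4 G_def[symmetric]
      using G by (simp add: field_simps power2_eq_square)
  qed
  then show ?thesis unfolding S by simp
qed

section \<open>The derived subgroup and its free generators\<close>

lemma mat2_nth [simp]:
  "mat2 a b c d $ 1 $ 1 = a" "mat2 a b c d $ 1 $ 2 = b" "mat2 a b c d $ 2 $ 1 = c" "mat2 a b c d $ 2 $ 2 = d"
  by (simp_all add: mat2_def)

lemma mat2_eqI: "A $ 1 $ 1 = a \<Longrightarrow> A $ 1 $ 2 = b \<Longrightarrow> A $ 2 $ 1 = c \<Longrightarrow> A $ 2 $ 2 = d \<Longrightarrow> A = mat2 a b c d"
  by (simp add: vec_eq_iff forall_2)

lemma mat2_exhaust: obtains a b c d where "A = mat2 a b c d"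
  using mat2_eqI[OF refl refl refl refl] by blast

lemma mat2_mult [simp]:
  "mat2 a b c d ** mat2 e f g h = mat2 (a*e + b*g) (a*f + b*h) (c*e + d*g) (c*f + d*h)"
  by (rule mat2_eqI) (simp_all add: matrix_matrix_mult_def sum_2)

lemma det_mat2 [simp]: "det (mat2 a b c d) = a * d - b * c"
  by (simp add: det_2)

lemma mat_1_eq: "(mat 1 :: int^2^2) = mat2 1 0 0 1"
  by (rule mat2_eqI) (simp_all add: mat_def)

lemma mat2_uminus [simp]: "- mat2 a b c d = mat2 (-a) (-b) (-c) (-d)"
  by (rule mat2_eqI) simp_all

lemma mat2_eq_iff [simp]: "mat2 a b c d = mat2 a' b' c' d' \<longleftrightarrow> a = a' \<and> b = b' \<and> c = c' \<and> d = d'"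
  by (auto simp: mat2_def vec_eq_iff forall_2)

lemma SL2Z_simps [simp]: "carrier SL2Z = {A. det A = 1}" "mult SL2Z = (**)" "one SL2Z = mat 1"
  by (simp_all add: SL2Z_def)

lemma group_SL2Z: "group SL2Z"
proof (rule groupI)
  fix x assume "x \<in> carrier SL2Z"
  moreover obtain a b c d where "x = mat2 a b c d" by (rule mat2_exhaust)
  ultimately have "mat2 d (-b) (-c) a \<in> carrier SL2Z" "mat2 d (-b) (-c) a \<otimes>\<^bsub>SL2Z\<^esub> x = \<one>\<^bsub>SL2Z\<^esub>"
    by (auto simp: mat_1_eq algebra_simps)
  then show "\<exists>y\<in>carrier SL2Z. y \<otimes>\<^bsub>SL2Z\<^esub> x = \<one>\<^bsub>SL2Z\<^esub>" by blast
qed (simp_all add: det_mul matrix_mul_assoc)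

interpretation SL: group SL2Z by (rule group_SL2Z)

lemma psl_class_eq: "psl_class A = {A, - A}"
proof -
  obtain a b c d where "A = mat2 a b c d" by (rule mat2_exhaust)
  then have "(- mat 1) ** A = - A" by (simp add: mat_1_eq)
  then show ?thesis by (auto simp: psl_class_def r_coset_def)
qed

lemma uminus_mult_left:
  fixes A B :: "int^2^2"
  shows "(- A) ** B = - (A ** B)"
proof -
  obtain a b c d e f g h where "A = mat2 a b c d" "B = mat2 e f g h" by (metis mat2_exhaust)
  then show ?thesis by (simp add: algebra_simps)
qed

lemma uminus_mult_right:
  fixes A B :: "int^2^2"
  shows "A ** (- B) = - (A ** B)"
proof -
  obtain a b c d e f g h where "A = mat2 a b c d" "B = mat2 e f g h" by (metis mat2_exhaust)
  then show ?thesis by (simp add: algebra_simps)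
qed

lemma center_normal: "{mat 1, - mat 1} \<lhd> SL2Z"
proof (rule SL.normalI)
  have d: "det (- mat 1 :: int^2^2) = 1" by (simp add: mat_1_eq)
  show "subgroup {mat 1, - mat 1} SL2Z"
  proof (rule SL.subgroupI)
    fix x assume x: "x \<in> {mat 1, - mat 1 :: int^2^2}"
    have "x ** x = mat 1" using x by (auto simp: mat_1_eq)
    then have "inv\<^bsub>SL2Z\<^esub> x = x" using x d by (intro SL.inv_equality) auto
    then show "inv\<^bsub>SL2Z\<^esub> x \<in> {mat 1, - mat 1}" using x by simp
  qed (auto simp: d uminus_mult_left)
  show "\<forall>x\<in>carrier SL2Z. {mat 1, - mat 1} #>\<^bsub>SL2Z\<^esub> x = x <#\<^bsub>SL2Z\<^esub> {mat 1, - mat 1}"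
    by (auto simp: r_coset_def l_coset_def uminus_mult_left uminus_mult_right)
qed

interpretation N: normal "{mat 1, - mat 1}" SL2Z by (rule center_normal)

interpretation PSL: group PSL2Z
  unfolding PSL2Z_def by (rule N.factorgroup_is_group)

lemma carrier_PSL2Z: "carrier PSL2Z = psl_class ` {A. det A = 1}"
  by (auto simp: PSL2Z_def FactGroup_def RCOSETS_def psl_class_def)

lemma psl_class_closed [simp, intro]: "det A = 1 \<Longrightarrow> psl_class A \<in> carrier PSL2Z"
  by (simp add: carrier_PSL2Z)

lemma psl_class_mult: "psl_class A \<otimes>\<^bsub>PSL2Z\<^esub> psl_class B = psl_class (A ** B)"
  by (auto simp: PSL2Z_def FactGroup_def set_mult_def psl_class_eq uminus_mult_left uminus_mult_right)

lemma psl_class_one: "psl_class (mat 1) = \<one>\<^bsub>PSL2Z\<^esub>"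
  by (simp add: PSL2Z_def FactGroup_def psl_class_eq)

lemma psl_class_inv:
  assumes "det A = 1" "B ** A = mat 1" "det B = 1"
  shows "inv\<^bsub>PSL2Z\<^esub> (psl_class A) = psl_class B"
  using assms by (intro PSL.inv_equality) (simp_all add: psl_class_mult psl_class_one)

lemma psl_class_eq_iff: "psl_class A = psl_class B \<longleftrightarrow> A = B \<or> A = - B"
  by (auto simp: psl_class_eq doubleton_eq_iff)

section \<open>The subgroup generated by X and Y\<close>

definition pT :: "int \<Rightarrow> (int^2^2) set" where "pT k = psl_class (mat2 1 k 0 1)"
definition pS :: "(int^2^2) set" where "pS = psl_class (mat2 0 (-1) 1 0)"
definition pX :: "(int^2^2) set" where "pX = psl_class matX"
definition pY :: "(int^2^2) set" where "pY = psl_class matY"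

lemma matX_eq: "matX = mat2 1 1 1 2" and matY_eq: "matY = mat2 2 1 1 1"
  by (simp_all add: matX_def matY_def matL_def matR_def)

lemma pgen_closed [simp]: "pT k \<in> carrier PSL2Z" "pS \<in> carrier PSL2Z" "pX \<in> carrier PSL2Z" "pY \<in> carrier PSL2Z"
  by (simp_all add: pT_def pS_def pX_def pY_def matX_eq matY_eq)

lemma pT_add: "pT k \<otimes>\<^bsub>PSL2Z\<^esub> pT l = pT (k + l)"
  by (simp add: pT_def psl_class_mult add.commute)

lemma pT_0: "pT 0 = \<one>\<^bsub>PSL2Z\<^esub>"
  by (simp add: pT_def mat_1_eq flip: psl_class_one)

lemma pT_inv: "inv\<^bsub>PSL2Z\<^esub> (pT k) = pT (-k)"
  by (rule PSL.inv_equality) (simp_all add: pT_add pT_0)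

lemma inv_pX: "inv\<^bsub>PSL2Z\<^esub> pX = psl_class (mat2 2 (-1) (-1) 1)"
  unfolding pX_def by (rule psl_class_inv) (simp_all add: matX_eq mat_1_eq)

lemma inv_pY: "inv\<^bsub>PSL2Z\<^esub> pY = psl_class (mat2 1 (-1) (-1) 2)"
  unfolding pY_def by (rule psl_class_inv) (simp_all add: matY_eq mat_1_eq)

lemma inv_pS: "inv\<^bsub>PSL2Z\<^esub> pS = pS"
proof -
  have "mat2 0 (-1) 1 0 ** mat2 0 (-1) 1 0 = - (mat 1 :: int^2^2)" by (simp add: mat_1_eq)
  then have "pS \<otimes>\<^bsub>PSL2Z\<^esub> pS = psl_class (- mat 1)" unfolding pS_def psl_class_mult by simp
  also have "\<dots> = \<one>\<^bsub>PSL2Z\<^esub>" unfolding psl_class_one[symmetric] psl_class_eq_iff by simp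
  finally show ?thesis by (intro PSL.inv_equality) auto
qed

definition HXY :: "(int^2^2) set set" where "HXY = generate PSL2Z {pX, pY}"

lemma subgroup_HXY: "subgroup HXY PSL2Z"
  unfolding HXY_def by (rule PSL.generate_is_subgroup) simp

lemma HXY_closed: "h \<in> HXY \<Longrightarrow> h \<in> carrier PSL2Z"
  using subgroup.subset[OF subgroup_HXY] by auto

lemmas HXY_m_closed = subgroup.m_closed[OF subgroup_HXY]
lemmas HXY_inv_closed = subgroup.m_inv_closed[OF subgroup_HXY]

lemma pX_in_HXY: "pX \<in> HXY" and pY_in_HXY: "pY \<in> HXY"
  unfolding HXY_def by (auto intro: generate.incl)

lemma (in group) conj_generate:
  assumes g: "g \<in> carrier G" and K: "K \<subseteq> carrier G"
    and c: "\<And>k. k \<in> K \<Longrightarrow> g \<otimes> k \<otimes> inv g \<in> generate G K" and h: "h \<in> generate G K"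
  shows "g \<otimes> h \<otimes> inv g \<in> generate G K"
  using h
proof (induction rule: generate.induct)
  case one
  then show ?case using g by (simp add: generate.one)
next
  case (incl h)
  then show ?case by (rule c)
next
  case (inv h)
  then have "h \<in> carrier G" using K by auto
  then have "g \<otimes> inv h \<otimes> inv g = inv (g \<otimes> h \<otimes> inv g)" using g by (simp add: inv_mult_group m_assoc)
  then show ?case using c[OF inv] by (simp add: generate_m_inv_closed[OF K])
next
  case (eng h1 h2)
  then have "h1 \<in> carrier G" "h2 \<in> carrier G" using generate_in_carrier[OF K] by auto
  then have "g \<otimes> (h1 \<otimes> h2) \<otimes> inv g = (g \<otimes> h1 \<otimes> inv g) \<otimes> (g \<otimes> h2 \<otimes> inv g)"
    using g by (simp add: m_assoc inv_solve_left)
  then show ?case using eng.IH by (simp add: generate.eng)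
qed

text \<open>Conjugation by the translation \<open>T\<close> sends \<open>X\<close> to
  \<open>Y\<close> and \<open>Y\<close> to \<open>Y X^(-1)\<close>; its inverse sends
  \<open>Y\<close> to \<open>X\<close> and \<open>X\<close> to \<open>Y^(-1) X\<close>. These four
  matrix identities show that \<open>T\<close> normalises \<open>HXY\<close>.\<close>

lemma conj_HXY_aux: "h \<in> HXY \<Longrightarrow> pT 1 \<otimes>\<^bsub>PSL2Z\<^esub> h \<otimes>\<^bsub>PSL2Z\<^esub> pT (-1) \<in> HXY"
  "h \<in> HXY \<Longrightarrow> pT (-1) \<otimes>\<^bsub>PSL2Z\<^esub> h \<otimes>\<^bsub>PSL2Z\<^esub> pT 1 \<in> HXY"
proof -
  have 1: "pT 1 \<otimes>\<^bsub>PSL2Z\<^esub> pX \<otimes>\<^bsub>PSL2Z\<^esub> pT (-1) = pY"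
    "pT 1 \<otimes>\<^bsub>PSL2Z\<^esub> pY \<otimes>\<^bsub>PSL2Z\<^esub> pT (-1) = pY \<otimes>\<^bsub>PSL2Z\<^esub> inv\<^bsub>PSL2Z\<^esub> pX"
    "pT (-1) \<otimes>\<^bsub>PSL2Z\<^esub> pY \<otimes>\<^bsub>PSL2Z\<^esub> pT 1 = pX"
    "pT (-1) \<otimes>\<^bsub>PSL2Z\<^esub> pX \<otimes>\<^bsub>PSL2Z\<^esub> pT 1 = inv\<^bsub>PSL2Z\<^esub> pY \<otimes>\<^bsub>PSL2Z\<^esub> pX"
    unfolding inv_pX inv_pY unfolding pX_def pY_def pT_def psl_class_mult by (simp_all add: matX_eq matY_eq)
  have i: "pY \<otimes>\<^bsub>PSL2Z\<^esub> inv\<^bsub>PSL2Z\<^esub> pX \<in> HXY" "inv\<^bsub>PSL2Z\<^esub> pY \<otimes>\<^bsub>PSL2Z\<^esub> pX \<in> HXY"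
    by (intro HXY_m_closed HXY_inv_closed pX_in_HXY pY_in_HXY)+
  note mem = 1 i pX_in_HXY pY_in_HXY
  have c1: "pT 1 \<otimes>\<^bsub>PSL2Z\<^esub> k \<otimes>\<^bsub>PSL2Z\<^esub> inv\<^bsub>PSL2Z\<^esub> (pT 1) \<in> generate PSL2Z {pX, pY}" if "k \<in> {pX, pY}" for k
    using that mem by (auto simp: pT_inv HXY_def[symmetric])
  have c2: "pT (-1) \<otimes>\<^bsub>PSL2Z\<^esub> k \<otimes>\<^bsub>PSL2Z\<^esub> inv\<^bsub>PSL2Z\<^esub> (pT (-1)) \<in> generate PSL2Z {pX, pY}" if "k \<in> {pX, pY}" for k
    using that mem by (auto simp: pT_inv HXY_def[symmetric])
  show "pT 1 \<otimes>\<^bsub>PSL2Z\<^esub> h \<otimes>\<^bsub>PSL2Z\<^esub> pT (-1) \<in> HXY" if "h \<in> HXY"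
    using PSL.conj_generate[OF _ _ c1, of h] that by (simp add: pT_inv HXY_def)
  show "pT (-1) \<otimes>\<^bsub>PSL2Z\<^esub> h \<otimes>\<^bsub>PSL2Z\<^esub> pT 1 \<in> HXY" if "h \<in> HXY"
    using PSL.conj_generate[OF _ _ c2, of h] that by (simp add: pT_inv HXY_def)
qed

lemma conj_HXY:
  assumes h: "h \<in> HXY"
  shows "pT k \<otimes>\<^bsub>PSL2Z\<^esub> h \<otimes>\<^bsub>PSL2Z\<^esub> pT (-k) \<in> HXY"
proof (induction k rule: int_induct[where k = 0])
  case base
  show ?case using h HXY_closed[OF h] by (simp add: pT_0)
next
  case (step1 i)
  have "pT (i + 1) \<otimes>\<^bsub>PSL2Z\<^esub> h \<otimes>\<^bsub>PSL2Z\<^esub> pT (- (i + 1)) =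
     (pT 1 \<otimes>\<^bsub>PSL2Z\<^esub> pT i) \<otimes>\<^bsub>PSL2Z\<^esub> h \<otimes>\<^bsub>PSL2Z\<^esub> (pT (-i) \<otimes>\<^bsub>PSL2Z\<^esub> pT (-1))"
    by (simp add: pT_add add.commute)
  also have "\<dots> = pT 1 \<otimes>\<^bsub>PSL2Z\<^esub> (pT i \<otimes>\<^bsub>PSL2Z\<^esub> h \<otimes>\<^bsub>PSL2Z\<^esub> pT (-i)) \<otimes>\<^bsub>PSL2Z\<^esub> pT (-1)"
    using HXY_closed[OF h] by (simp add: PSL.m_assoc)
  finally show ?case using conj_HXY_aux(1)[OF step1(2)] by simp
next
  case (step2 i)
  have "pT (i - 1) \<otimes>\<^bsub>PSL2Z\<^esub> h \<otimes>\<^bsub>PSL2Z\<^esub> pT (- (i - 1)) =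
     (pT (-1) \<otimes>\<^bsub>PSL2Z\<^esub> pT i) \<otimes>\<^bsub>PSL2Z\<^esub> h \<otimes>\<^bsub>PSL2Z\<^esub> (pT (-i) \<otimes>\<^bsub>PSL2Z\<^esub> pT 1)"
    by (simp add: pT_add add.commute)
  also have "\<dots> = pT (-1) \<otimes>\<^bsub>PSL2Z\<^esub> (pT i \<otimes>\<^bsub>PSL2Z\<^esub> h \<otimes>\<^bsub>PSL2Z\<^esub> pT (-i)) \<otimes>\<^bsub>PSL2Z\<^esub> pT 1"
    using HXY_closed[OF h] by (simp add: PSL.m_assoc)
  finally show ?case using conj_HXY_aux(2)[OF step2(2)] by simp
qed

text \<open>As \<open>T\<close> normalises \<open>HXY\<close>, its powers can be moved past elements
  of \<open>HXY\<close> and collected on the right.\<close>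

lemma pT_shift:
  assumes h: "h \<in> HXY"
  obtains h' where "h' \<in> HXY" "pT k \<otimes>\<^bsub>PSL2Z\<^esub> (h \<otimes>\<^bsub>PSL2Z\<^esub> pT l) = h' \<otimes>\<^bsub>PSL2Z\<^esub> pT (k + l)"
proof (rule that[OF conj_HXY[OF h, of k]])
  have "(pT k \<otimes>\<^bsub>PSL2Z\<^esub> h \<otimes>\<^bsub>PSL2Z\<^esub> pT (-k)) \<otimes>\<^bsub>PSL2Z\<^esub> pT (k + l) = pT k \<otimes>\<^bsub>PSL2Z\<^esub> (h \<otimes>\<^bsub>PSL2Z\<^esub> (pT (-k) \<otimes>\<^bsub>PSL2Z\<^esub> pT (k + l)))"
    using HXY_closed[OF h] by (simp add: PSL.m_assoc)
  then show "pT k \<otimes>\<^bsub>PSL2Z\<^esub> (h \<otimes>\<^bsub>PSL2Z\<^esub> pT l) = (pT k \<otimes>\<^bsub>PSL2Z\<^esub> h \<otimes>\<^bsub>PSL2Z\<^esub> pT (-k)) \<otimes>\<^bsub>PSL2Z\<^esub> pT (k + l)"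
    by (simp add: pT_add)
qed

text \<open>The inversion \<open>S\<close> also lies in \<open>HXY\<close> times powers of
  \<open>T\<close>. The exponent agrees with the abelianised modular group, which is cyclic of order
  6 and generated by \<open>T\<close>, with \<open>S\<close> equal to \<open>T^3\<close>.\<close>

lemma pS_eq: "pS = (inv\<^bsub>PSL2Z\<^esub> pY \<otimes>\<^bsub>PSL2Z\<^esub> pX) \<otimes>\<^bsub>PSL2Z\<^esub> pT (-3)"
  unfolding inv_pY unfolding pX_def pS_def pT_def psl_class_mult by (simp add: matX_eq)

lemma pS_shift:
  assumes h: "h \<in> HXY"
  obtains h' where "h' \<in> HXY" "pS \<otimes>\<^bsub>PSL2Z\<^esub> (h \<otimes>\<^bsub>PSL2Z\<^esub> pT l) = h' \<otimes>\<^bsub>PSL2Z\<^esub> pT (-3 + l)"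
proof -
  define w where "w = inv\<^bsub>PSL2Z\<^esub> pY \<otimes>\<^bsub>PSL2Z\<^esub> pX"
  have w: "w \<in> HXY" unfolding w_def by (intro HXY_m_closed HXY_inv_closed pX_in_HXY pY_in_HXY)
  obtain h' where h': "h' \<in> HXY" "pT (-3) \<otimes>\<^bsub>PSL2Z\<^esub> (h \<otimes>\<^bsub>PSL2Z\<^esub> pT l) = h' \<otimes>\<^bsub>PSL2Z\<^esub> pT (-3 + l)"
    by (rule pT_shift[OF h])
  have "pS \<otimes>\<^bsub>PSL2Z\<^esub> (h \<otimes>\<^bsub>PSL2Z\<^esub> pT l) = w \<otimes>\<^bsub>PSL2Z\<^esub> (pT (-3) \<otimes>\<^bsub>PSL2Z\<^esub> (h \<otimes>\<^bsub>PSL2Z\<^esub> pT l))"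
    unfolding pS_eq w_def[symmetric] using HXY_closed h w by (simp add: PSL.m_assoc)
  also have "\<dots> = (w \<otimes>\<^bsub>PSL2Z\<^esub> h') \<otimes>\<^bsub>PSL2Z\<^esub> pT (-3 + l)"
    unfolding h'(2) using HXY_closed h' w by (simp add: PSL.m_assoc)
  finally show ?thesis using that[of "w \<otimes>\<^bsub>PSL2Z\<^esub> h'"] HXY_m_closed w h' by blast
qed

text \<open>Euclid's algorithm on the first column.\<close>

lemma PSL2Z_decompose_mat:
  "a * d - b * c = 1 \<Longrightarrow> \<exists>h\<in>HXY. \<exists>k. psl_class (mat2 a b c d) = h \<otimes>\<^bsub>PSL2Z\<^esub> pT k"
proof (induction "nat \<bar>c\<bar>" arbitrary: a b c d rule: less_induct)
  case less
  show ?case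
  proof (cases "c = 0")
    case True
    with less.prems have "a * d = 1" by simp
    then have "a = 1 \<and> d = 1 \<or> a = -1 \<and> d = -1" using zmult_eq_1_iff by auto
    then have "psl_class (mat2 a b c d) = pT (a * b)"
      using True unfolding pT_def psl_class_eq_iff by auto
    also have "\<dots> = \<one>\<^bsub>PSL2Z\<^esub> \<otimes>\<^bsub>PSL2Z\<^esub> pT (a * b)" by simp
    finally show ?thesis using subgroup.one_closed[OF subgroup_HXY] by blast
  next
    case False
    \<comment> \<open>Division with remainder on the first column: the matrix is
      \<open>T^n S B\<close>, where \<open>B\<close> has first column
      \<open>(c, -r)\<close>.\<close>
    define n r where "n = a div c" and "r = a mod c"
    have a: "a = n * c + r" by (simp add: n_def r_def)
    have "\<bar>r\<bar> < \<bar>c\<bar>" unfolding r_def using False by (rule abs_mod_less)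
    then have lt: "nat \<bar>- r\<bar> < nat \<bar>c\<bar>" by simp
    define d' where "d' = - (b - n * d)"
    have e: "c * d' - d * (- r) = 1"
      using less.prems unfolding d'_def a by (simp add: algebra_simps)
    from less.hyps[OF lt e] obtain h k where hk: "h \<in> HXY" "psl_class (mat2 c d (-r) d') = h \<otimes>\<^bsub>PSL2Z\<^esub> pT k" by blast
    obtain h1 where h1: "h1 \<in> HXY" "pS \<otimes>\<^bsub>PSL2Z\<^esub> (h \<otimes>\<^bsub>PSL2Z\<^esub> pT k) = h1 \<otimes>\<^bsub>PSL2Z\<^esub> pT (-3 + k)"
      by (rule pS_shift[OF hk(1)])
    obtain h2 where h2: "h2 \<in> HXY" "pT n \<otimes>\<^bsub>PSL2Z\<^esub> (h1 \<otimes>\<^bsub>PSL2Z\<^esub> pT (-3 + k)) = h2 \<otimes>\<^bsub>PSL2Z\<^esub> pT (n + (-3 + k))"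
      by (rule pT_shift[OF h1(1)])
    have "mat2 1 n 0 1 ** (mat2 0 (-1) 1 0 ** mat2 c d (-r) d') = mat2 a b c d"
      unfolding d'_def a by simp
    then have "psl_class (mat2 a b c d) = pT n \<otimes>\<^bsub>PSL2Z\<^esub> (pS \<otimes>\<^bsub>PSL2Z\<^esub> psl_class (mat2 c d (-r) d'))"
      unfolding pT_def pS_def psl_class_mult by simp
    then show ?thesis unfolding hk(2) h1(2) h2(2) using h2(1) by blast
  qed
qed

lemma PSL2Z_decompose:
  assumes "g \<in> carrier PSL2Z"
  obtains h k where "h \<in> HXY" "g = h \<otimes>\<^bsub>PSL2Z\<^esub> pT k"
proof -
  obtain A where A: "det A = 1" "g = psl_class A" using assms by (auto simp: carrier_PSL2Z)
  obtain a b c d where "A = mat2 a b c d" by (rule mat2_exhaust)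
  then show ?thesis using A PSL2Z_decompose_mat[of a d b c] that by auto
qed

text \<open>With elements written as \<open>h T^k\<close>, the powers of \<open>T\<close> cancel in
  every commutator, which leaves a product of \<open>T\<close>-conjugates of elements of
  \<open>HXY\<close>. Conversely \<open>X = [S, T^(-1)]\<close> and
  \<open>Y = [T, S]\<close>.\<close>

theorem PSL2Z'_eq: "PSL2Z' = HXY"
proof (rule subset_antisym)
  show "PSL2Z' \<subseteq> HXY"
    unfolding PSL2Z'_def derived_def
  proof (rule PSL.generate_subgroup_incl[OF _ subgroup_HXY], intro subsetI)
    fix x assume "x \<in> derived_set PSL2Z (carrier PSL2Z)"
    then obtain g1 g2 where g: "g1 \<in> carrier PSL2Z" "g2 \<in> carrier PSL2Z"
      "x = g1 \<otimes>\<^bsub>PSL2Z\<^esub> g2 \<otimes>\<^bsub>PSL2Z\<^esub> inv\<^bsub>PSL2Z\<^esub> g1 \<otimes>\<^bsub>PSL2Z\<^esub> inv\<^bsub>PSL2Z\<^esub> g2" by auto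
    obtain h1 k where 1: "h1 \<in> HXY" "g1 = h1 \<otimes>\<^bsub>PSL2Z\<^esub> pT k" by (rule PSL2Z_decompose[OF g(1)])
    obtain h2 l where 2: "h2 \<in> HXY" "g2 = h2 \<otimes>\<^bsub>PSL2Z\<^esub> pT l" by (rule PSL2Z_decompose[OF g(2)])
    note c = HXY_closed[OF 1(1)] HXY_closed[OF 2(1)]
    have i: "inv\<^bsub>PSL2Z\<^esub> g1 = pT (-k) \<otimes>\<^bsub>PSL2Z\<^esub> inv\<^bsub>PSL2Z\<^esub> h1" "inv\<^bsub>PSL2Z\<^esub> g2 = pT (-l) \<otimes>\<^bsub>PSL2Z\<^esub> inv\<^bsub>PSL2Z\<^esub> h2"
      unfolding 1(2) 2(2) using c by (simp_all add: PSL.inv_mult_group pT_inv)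
    have "x = h1 \<otimes>\<^bsub>PSL2Z\<^esub> (pT k \<otimes>\<^bsub>PSL2Z\<^esub> (h2 \<otimes>\<^bsub>PSL2Z\<^esub> ((pT l \<otimes>\<^bsub>PSL2Z\<^esub> pT (-k)) \<otimes>\<^bsub>PSL2Z\<^esub> (inv\<^bsub>PSL2Z\<^esub> h1 \<otimes>\<^bsub>PSL2Z\<^esub> (pT (-l) \<otimes>\<^bsub>PSL2Z\<^esub> inv\<^bsub>PSL2Z\<^esub> h2)))))"
      unfolding g(3) i unfolding 1(2) 2(2) using c by (simp add: PSL.m_assoc)
    also have "pT l \<otimes>\<^bsub>PSL2Z\<^esub> pT (-k) = pT (-k) \<otimes>\<^bsub>PSL2Z\<^esub> pT l" by (simp add: pT_add)
    finally have "x = h1 \<otimes>\<^bsub>PSL2Z\<^esub> ((pT k \<otimes>\<^bsub>PSL2Z\<^esub> h2 \<otimes>\<^bsub>PSL2Z\<^esub> pT (-k)) \<otimes>\<^bsub>PSL2Z\<^esub>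
        ((pT l \<otimes>\<^bsub>PSL2Z\<^esub> inv\<^bsub>PSL2Z\<^esub> h1 \<otimes>\<^bsub>PSL2Z\<^esub> pT (-l)) \<otimes>\<^bsub>PSL2Z\<^esub> inv\<^bsub>PSL2Z\<^esub> h2))"
      using c by (simp add: PSL.m_assoc)
    then show "x \<in> HXY"
      using HXY_m_closed HXY_inv_closed conj_HXY 1(1) 2(1) by simp
  qed
  have comm: "g1 \<otimes>\<^bsub>PSL2Z\<^esub> g2 \<otimes>\<^bsub>PSL2Z\<^esub> inv\<^bsub>PSL2Z\<^esub> g1 \<otimes>\<^bsub>PSL2Z\<^esub> inv\<^bsub>PSL2Z\<^esub> g2 \<in> PSL2Z'"
    if "g1 \<in> carrier PSL2Z" "g2 \<in> carrier PSL2Z" for g1 g2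
    unfolding PSL2Z'_def derived_def using that by (intro generate.incl) blast
  have "pX = pS \<otimes>\<^bsub>PSL2Z\<^esub> pT (-1) \<otimes>\<^bsub>PSL2Z\<^esub> inv\<^bsub>PSL2Z\<^esub> pS \<otimes>\<^bsub>PSL2Z\<^esub> inv\<^bsub>PSL2Z\<^esub> (pT (-1))"
    unfolding inv_pS pT_inv unfolding pX_def pS_def pT_def psl_class_mult psl_class_eq_iff by (simp add: matX_eq)
  then have X: "pX \<in> PSL2Z'" using comm[of pS "pT (-1)"] by simp
  have "pY = pT 1 \<otimes>\<^bsub>PSL2Z\<^esub> pS \<otimes>\<^bsub>PSL2Z\<^esub> inv\<^bsub>PSL2Z\<^esub> (pT 1) \<otimes>\<^bsub>PSL2Z\<^esub> inv\<^bsub>PSL2Z\<^esub> pS"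
    unfolding inv_pS pT_inv unfolding pY_def pS_def pT_def psl_class_mult psl_class_eq_iff by (simp add: matY_eq)
  then have Y: "pY \<in> PSL2Z'" using comm[of "pT 1" pS] by simp
  have "subgroup PSL2Z' PSL2Z" unfolding PSL2Z'_def by (rule PSL.derived_is_subgroup) simp
  then show "HXY \<subseteq> PSL2Z'" unfolding HXY_def using X Y by (intro PSL.generate_subgroup_incl) auto
qed

lemma (in comm_group) mult_swap_pairs:
  assumes "a \<in> carrier G" "b \<in> carrier G" "c \<in> carrier G" "d \<in> carrier G"
  shows "(a \<otimes> b) \<otimes> (c \<otimes> d) = (a \<otimes> c) \<otimes> (b \<otimes> d)"
  using assms by (simp add: m_ac)

text \<open>In an abelian quotient, words in two generators collect to \<open>x^m y^n\<close>. The
  quotient is formed inside \<open>H\<close>, of which the derived subgroup is normal.\<close>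

lemma (in group) derived_coset_word:
  assumes xy: "x \<in> carrier G" "y \<in> carrier G" and h: "h \<in> generate G {x, y}"
  defines "H \<equiv> generate G {x, y}"
  shows "\<exists>(m::int) (n::int). derived G H #> h = derived G H #> (x [^] m \<otimes> y [^] n)"
proof -
  define K where "K = G\<lparr>carrier := H\<rparr>"
  define D where "D = derived G H"
  have H: "subgroup H G" unfolding H_def by (rule generate_is_subgroup) (use xy in auto)
  have xH: "x \<in> H" and yH: "y \<in> H" unfolding H_def by (auto intro: generate.incl)
  interpret K: group K unfolding K_def by (rule subgroup.subgroup_is_group[OF H group_axioms])
  interpret DK: normal D K unfolding D_def K_def by (rule derived_subgroup_is_normal[OF H])
  interpret Q: comm_group "K Mod D" unfolding D_def K_def by (rule derived_quot_of_subgroup_is_comm_group[OF H])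
  define f where "f = (\<lambda>a. D #>\<^bsub>K\<^esub> a)"
  interpret f: group_hom K "K Mod D" f
    unfolding group_hom_def group_hom_axioms_def f_def using DK.r_coset_hom_Mod K.group_axioms Q.group_axioms by blast
  have carrK: "carrier K = H" by (simp add: K_def)
  have fc: "f a \<in> carrier (K Mod D)" if "a \<in> H" for a using f.hom_closed that carrK by simp
  have "\<exists>(m::int) (n::int). f h = f x [^]\<^bsub>K Mod D\<^esub> m \<otimes>\<^bsub>K Mod D\<^esub> f y [^]\<^bsub>K Mod D\<^esub> n" if "h \<in> generate G {x, y}" for h
    using that
  proof (induction rule: generate.induct)
    case one
    have "f \<one> = \<one>\<^bsub>K Mod D\<^esub>" using f.hom_one by (simp add: K_def)
    moreover have "f x [^]\<^bsub>K Mod D\<^esub> (0::int) \<otimes>\<^bsub>K Mod D\<^esub> f y [^]\<^bsub>K Mod D\<^esub> (0::int) = \<one>\<^bsub>K Mod D\<^esub>"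
      by (simp only: int_pow_0 Q.l_one[OF Q.one_closed])
    ultimately have "f \<one> = f x [^]\<^bsub>K Mod D\<^esub> (0::int) \<otimes>\<^bsub>K Mod D\<^esub> f y [^]\<^bsub>K Mod D\<^esub> (0::int)"
      by (simp only:)
    then show ?case by blast
  next
    case (incl h)
    then consider "h = x" | "h = y" by blast
    then show ?case
    proof cases
      case 1
      then have "f h = f x [^]\<^bsub>K Mod D\<^esub> (1::int) \<otimes>\<^bsub>K Mod D\<^esub> f y [^]\<^bsub>K Mod D\<^esub> (0::int)"
        by (simp only: int_pow_0 Q.int_pow_1[OF fc[OF xH]] Q.r_one[OF fc[OF xH]])
      then show ?thesis by blast
    next
      case 2
      then have "f h = f x [^]\<^bsub>K Mod D\<^esub> (0::int) \<otimes>\<^bsub>K Mod D\<^esub> f y [^]\<^bsub>K Mod D\<^esub> (1::int)"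
        by (simp only: int_pow_0 Q.int_pow_1[OF fc[OF yH]] Q.l_one[OF fc[OF yH]])
      then show ?thesis by blast
    qed
  next
    case (inv h)
    have iK: "f (inv a) = inv\<^bsub>K Mod D\<^esub> (f a)" if "a \<in> H" for a
      using f.hom_inv[of a] m_inv_consistent[OF H that] that carrK by (simp add: K_def)
    from inv consider "h = x" | "h = y" by blast
    then show ?case
    proof cases
      case 1
      then have "f (inv h) = f x [^]\<^bsub>K Mod D\<^esub> (-1::int) \<otimes>\<^bsub>K Mod D\<^esub> f y [^]\<^bsub>K Mod D\<^esub> (0::int)"
        by (simp only: iK[OF xH] int_pow_0 Q.int_pow_neg[OF fc[OF xH]] Q.int_pow_1[OF fc[OF xH]] Q.r_one[OF Q.inv_closed[OF fc[OF xH]]])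
      then show ?thesis by blast
    next
      case 2
      then have "f (inv h) = f x [^]\<^bsub>K Mod D\<^esub> (0::int) \<otimes>\<^bsub>K Mod D\<^esub> f y [^]\<^bsub>K Mod D\<^esub> (-1::int)"
        by (simp only: iK[OF yH] int_pow_0 Q.int_pow_neg[OF fc[OF yH]] Q.int_pow_1[OF fc[OF yH]] Q.l_one[OF Q.inv_closed[OF fc[OF yH]]])
      then show ?thesis by blast
    qed
  next
    case (eng h1 h2)
    then obtain m1 n1 m2 n2 :: int where
      1: "f h1 = f x [^]\<^bsub>K Mod D\<^esub> m1 \<otimes>\<^bsub>K Mod D\<^esub> f y [^]\<^bsub>K Mod D\<^esub> n1"
      and 2: "f h2 = f x [^]\<^bsub>K Mod D\<^esub> m2 \<otimes>\<^bsub>K Mod D\<^esub> f y [^]\<^bsub>K Mod D\<^esub> n2" by blast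
    have "f (h1 \<otimes> h2) = f h1 \<otimes>\<^bsub>K Mod D\<^esub> f h2"
      using f.hom_mult[of h1 h2] eng.hyps carrK by (simp add: K_def H_def)
    also have "\<dots> = f x [^]\<^bsub>K Mod D\<^esub> (m1 + m2) \<otimes>\<^bsub>K Mod D\<^esub> f y [^]\<^bsub>K Mod D\<^esub> (n1 + n2)"
      unfolding 1 2 Q.int_pow_mult[OF fc[OF xH]] Q.int_pow_mult[OF fc[OF yH]]
      by (intro Q.mult_swap_pairs Q.int_pow_closed fc xH yH)
    finally show ?case by blast
  qed
  from this[OF h] obtain m n :: int where mn: "f h = f x [^]\<^bsub>K Mod D\<^esub> m \<otimes>\<^bsub>K Mod D\<^esub> f y [^]\<^bsub>K Mod D\<^esub> n" by blast
  have p: "f (a [^] k) = f a [^]\<^bsub>K Mod D\<^esub> k" if "a \<in> H" for a and k :: int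
    using f.hom_int_pow[of a k] int_pow_consistent[OF H that, of k] that carrK by (simp add: K_def)
  have pc: "a [^] k \<in> H" if "a \<in> H" for a and k :: int by (rule subgroup_int_pow_closed[OF H that])
  have "f (x [^] m \<otimes> y [^] n) = f (x [^] m) \<otimes>\<^bsub>K Mod D\<^esub> f (y [^] n)"
    using f.hom_mult[of "x [^] m" "y [^] n"] pc xH yH carrK by (simp add: K_def)
  then have "f h = f (x [^] m \<otimes> y [^] n)" unfolding mn p[OF xH] p[OF yH] by simp
  \<comment> \<open>Cosets in \<open>K\<close> and in \<open>G\<close> are formed with the same
    multiplication, so they agree.\<close>
  then show ?thesis unfolding f_def D_def K_def r_coset_def by auto
qed

theorem congruent_XY_exists:
  assumes "psl_class A \<in> PSL2Z'"
  shows "\<exists>m n. congruent_XY A m n"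
  using PSL.derived_coset_word[OF pgen_closed(3,4), of "psl_class A"] assms
  unfolding congruent_XY_def PSL2Z''_def PSL2Z'_eq HXY_def pX_def[symmetric] pY_def[symmetric] by blast

text \<open>The column is completed by Bezout's identity, and the class is decomposed as
  \<open>h T^k\<close>; multiplying by \<open>T^(-k)\<close> on the right alters only the second
  column.\<close>

theorem derived_column_exists:
  assumes "coprime a c"
  shows "\<exists>b d. mat2 a b c d \<in> carrier SL2Z \<and> psl_class (mat2 a b c d) \<in> PSL2Z'"
proof -
  obtain u v where "u * a + v * c = 1" using bezout_int[of a c] assms by auto
  then have det: "a * u - (-v) * c = 1" by (simp add: algebra_simps)
  from PSL2Z_decompose_mat[OF det] obtain h k where hk: "h \<in> HXY" "psl_class (mat2 a (-v) c u) = h \<otimes>\<^bsub>PSL2Z\<^esub> pT k" by blast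
  have "psl_class (mat2 a (-v) c u ** mat2 1 (-k) 0 1) = psl_class (mat2 a (-v) c u) \<otimes>\<^bsub>PSL2Z\<^esub> pT (-k)"
    by (simp add: pT_def psl_class_mult)
  also have "\<dots> = h" unfolding hk(2) using HXY_closed[OF hk(1)] by (simp add: PSL.m_assoc pT_add pT_0)
  finally have "psl_class (mat2 a (-v - a*k) c (u - c*k)) \<in> PSL2Z'"
    unfolding PSL2Z'_eq using hk(1) by (simp add: algebra_simps)
  moreover have "mat2 a (-v - a*k) c (u - c*k) \<in> carrier SL2Z" using det by (simp add: algebra_simps)
  ultimately show ?thesis by blast
qed

section \<open>A Tauberian theorem\<close>

lemma cesaro_null:
  fixes e :: "nat \<Rightarrow> real"
  assumes "e \<longlonglongrightarrow> 0"
  shows "(\<lambda>N. (\<Sum>n\<le>N. \<bar>e n\<bar>) / real (Suc N)) \<longlonglongrightarrow> 0"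
proof (rule LIMSEQ_I)
  fix r :: real assume r: "r > 0"
  obtain M where M: "\<And>n. n \<ge> M \<Longrightarrow> \<bar>e n\<bar> < r/2"
    using LIMSEQ_D[OF assms, of "r/2"] r by auto
  define S where "S = (\<Sum>n<M. \<bar>e n\<bar>)"
  obtain N0 :: nat where N0: "2 * S / r < real N0" using reals_Archimedean2 by blast
  show "\<exists>N1. \<forall>N\<ge>N1. norm ((\<Sum>n\<le>N. \<bar>e n\<bar>) / real (Suc N) - 0) < r"
  proof (intro exI allI impI)
    fix N assume N: "N \<ge> max M N0"
    have "(\<Sum>n\<le>N. \<bar>e n\<bar>) = S + (\<Sum>n\<in>{M..N}. \<bar>e n\<bar>)"
    proof -
      have "{..N} = {..<M} \<union> {M..N}" using N by auto
      then show ?thesis unfolding S_def by (simp only:) (rule sum.union_disjoint, auto)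
    qed
    also have "(\<Sum>n\<in>{M..N}. \<bar>e n\<bar>) \<le> (\<Sum>n\<in>{M..N}. r/2)"
    proof (rule sum_mono)
      fix n assume "n \<in> {M..N}"
      then have "\<bar>e n\<bar> < r/2" by (intro M) simp
      then show "\<bar>e n\<bar> \<le> r/2" by simp
    qed
    also have "\<dots> \<le> real (Suc N) * (r/2)" using r by simp
    finally have 1: "(\<Sum>n\<le>N. \<bar>e n\<bar>) \<le> S + real (Suc N) * (r/2)" by simp
    have "2 * S < r * real N0" using N0 r by (simp add: field_simps)
    also have "\<dots> \<le> r * real (Suc N)" using N r by (intro mult_left_mono) auto
    finally have "2 * S < r * real (Suc N)" .
    then have "(\<Sum>n\<le>N. \<bar>e n\<bar>) < r * real (Suc N)" using 1 by (simp add: field_simps)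
    then show "norm ((\<Sum>n\<le>N. \<bar>e n\<bar>) / real (Suc N) - 0) < r"
      by (simp add: field_simps sum_nonneg)
  qed
qed

text \<open>The partial sum up to \<open>N\<close> is compared with the Abel mean at a point at
  distance about \<open>1/N\<close> from 1. Bernoulli's inequality bounds the head by a Cesaro mean
  of \<open>n |c n|\<close>, and a geometric series bounds the tail.\<close>

lemma tauber_first:
  fixes c :: "nat \<Rightarrow> complex"
  assumes nc: "(\<lambda>n. of_nat n * c n) \<longlonglongrightarrow> 0"
    and sm: "\<And>x::real. 0 < x \<Longrightarrow> x < 1 \<Longrightarrow> summable (\<lambda>n. c n * of_real x ^ n)"
    and abel: "((\<lambda>x. suminf (\<lambda>n. c n * of_real x ^ n)) \<longlongrightarrow> s) (at_left (1::real))"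
  shows "c sums s"
proof -
  define e where "e = (\<lambda>n. real n * cmod (c n))"
  have e: "e \<longlonglongrightarrow> 0" using tendsto_norm[OF nc] by (simp add: e_def norm_mult)
  have e0: "e n \<ge> 0" for n by (simp add: e_def)
  \<comment> \<open>The second successor keeps \<open>x 0\<close> positive.\<close>
  define x where "x = (\<lambda>N. 1 - 1 / real (Suc (Suc N)))"
  have x: "0 < x N" "x N < 1" for N by (simp_all add: x_def field_simps)
  define g where "g = (\<lambda>N. suminf (\<lambda>n. c n * of_real (x N) ^ n))"
  have "filterlim x (at_left 1) sequentially"
  proof -
    have "x \<longlonglongrightarrow> 1 - 0" unfolding x_def
      by (intro tendsto_diff tendsto_const LIMSEQ_Suc[OF LIMSEQ_Suc[OF lim_1_over_n]])
    moreover have "x N \<noteq> 1" for N using x[of N] by simp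
    ultimately show ?thesis using x by (auto simp: filterlim_at)
  qed
  then have g: "g \<longlonglongrightarrow> s" unfolding g_def by (rule filterlim_compose[OF abel])
  have diff: "(\<lambda>N. (\<Sum>n\<le>N. c n) - g N) \<longlonglongrightarrow> 0"
  proof (rule LIMSEQ_I)
    fix r :: real assume r: "r > 0"
    obtain M1 where M1: "\<And>n. n \<ge> M1 \<Longrightarrow> e n < r/4"
      using LIMSEQ_D[OF e, of "r/4"] r e0 by auto
    obtain M2 where M2: "\<And>N. N \<ge> M2 \<Longrightarrow> (\<Sum>n\<le>N. \<bar>e n\<bar>) / real (Suc N) < r/4"
      using LIMSEQ_D[OF cesaro_null[OF e], of "r/4"] r by (auto simp: sum_nonneg)
    show "\<exists>N1. \<forall>N\<ge>N1. norm ((\<Sum>n\<le>N. c n) - g N - 0) < r"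
    proof (intro exI allI impI)
      fix N assume N: "N \<ge> max M1 M2"
      have sumN: "summable (\<lambda>n. c n * of_real (x N) ^ n)" by (rule sm) (rule x)+
      have split: "g N = (\<Sum>n\<le>N. c n * of_real (x N) ^ n) + suminf (\<lambda>n. c (n + Suc N) * of_real (x N) ^ (n + Suc N))"
        unfolding g_def using suminf_split_initial_segment[OF sumN, of "Suc N"] by (simp add: lessThan_Suc_atMost)
      have A: "cmod ((\<Sum>n\<le>N. c n) - (\<Sum>n\<le>N. c n * of_real (x N) ^ n)) \<le> r/4"
      proof -
        have "cmod ((\<Sum>n\<le>N. c n) - (\<Sum>n\<le>N. c n * of_real (x N) ^ n)) = cmod (\<Sum>n\<le>N. c n * (1 - of_real (x N) ^ n))"
          by (simp add: sum_subtractf right_diff_distrib)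
        also have "\<dots> \<le> (\<Sum>n\<le>N. e n * (1 - x N))"
        proof (rule sum_norm_le)
          fix n
          have "1 - real n * (1 - x N) \<le> (1 - (1 - x N)) ^ n"
            using Bernoulli_inequality[of "- (1 - x N)" n] x[of N] by (simp add: algebra_simps)
          then have "1 - x N ^ n \<le> real n * (1 - x N)" by simp
          moreover have "x N ^ n \<le> 1" using x[of N] by (intro power_le_one) auto
          moreover have "cmod (1 - of_real (x N) ^ n) = \<bar>1 - x N ^ n\<bar>"
            by (metis norm_of_real of_real_1 of_real_diff of_real_power)
          ultimately have "cmod (1 - of_real (x N) ^ n) \<le> real n * (1 - x N)" by simp
          then have "cmod (c n) * cmod (1 - of_real (x N) ^ n) \<le> cmod (c n) * (real n * (1 - x N))"
            by (rule mult_left_mono) simp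
          then show "cmod (c n * (1 - of_real (x N) ^ n)) \<le> e n * (1 - x N)"
            by (simp add: e_def norm_mult mult_ac)
        qed
        also have "\<dots> = (\<Sum>n\<le>N. e n) / real (Suc (Suc N))" by (simp add: x_def sum_divide_distrib)
        also have "\<dots> \<le> (\<Sum>n\<le>N. \<bar>e n\<bar>) / real (Suc N)"
          using e0 by (simp add: sum_nonneg frac_le)
        also have "\<dots> < r/4" using N by (intro M2) simp
        finally show ?thesis by simp
      qed
      have B: "cmod (suminf (\<lambda>n. c (n + Suc N) * of_real (x N) ^ (n + Suc N))) \<le> r/2"
      proof -
        have geo: "summable (\<lambda>n. (r/4 / real (Suc N)) * x N ^ n)"
          using x[of N] by (intro summable_mult summable_geometric) simp
        have bd: "norm (c (n + Suc N) * of_real (x N) ^ (n + Suc N)) \<le> (r/4 / real (Suc N)) * x N ^ n" for n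
        proof -
          have "e (n + Suc N) < r/4" using M1 N by simp
          then have "real (Suc N) * cmod (c (n + Suc N)) \<le> r/4"
            using mult_right_mono[of "real (Suc N)" "real (n + Suc N)" "cmod (c (n + Suc N))"] by (simp add: e_def)
          then have "cmod (c (n + Suc N)) \<le> r/4 / real (Suc N)" by (simp add: field_simps)
          moreover have "x N ^ (n + Suc N) \<le> x N ^ n" using x[of N] by (intro power_decreasing) auto
          ultimately have "cmod (c (n + Suc N)) * x N ^ (n + Suc N) \<le> (r/4 / real (Suc N)) * x N ^ n"
            using x[of N] r by (intro mult_mono) auto
          then show ?thesis using x[of N] by (simp add: norm_mult norm_power)
        qed
        have sn: "summable (\<lambda>n. norm (c (n + Suc N) * of_real (x N) ^ (n + Suc N)))"
          by (rule summable_comparison_test'[OF geo, of 0]) (use bd in simp)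
        have "cmod (suminf (\<lambda>n. c (n + Suc N) * of_real (x N) ^ (n + Suc N))) \<le> suminf (\<lambda>n. norm (c (n + Suc N) * of_real (x N) ^ (n + Suc N)))"
          by (rule summable_norm[OF sn])
        also have "\<dots> \<le> suminf (\<lambda>n. (r/4 / real (Suc N)) * x N ^ n)" by (rule suminf_le[OF bd sn geo])
        also have "\<dots> = (r/4 / real (Suc N)) * (1 / (1 - x N))"
          using x[of N] by (subst suminf_mult) (auto intro!: summable_geometric simp: suminf_geometric)
        also have "\<dots> = r/4 * (real (Suc (Suc N)) / real (Suc N))" by (simp add: x_def)
        also have "\<dots> \<le> r/4 * 2" using r by (intro mult_left_mono) (auto simp: field_simps)
        finally show ?thesis by simp
      qed
      have "cmod ((\<Sum>n\<le>N. c n) - g N) \<le> r/4 + r/2"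
        unfolding split diff_diff_add[symmetric]
        by (rule order_trans[OF norm_triangle_ineq4 add_mono[OF A B]])
      then show "norm ((\<Sum>n\<le>N. c n) - g N - 0) < r" using r by simp
    qed
  qed
  have "(\<lambda>N. ((\<Sum>n\<le>N. c n) - g N) + g N) \<longlonglongrightarrow> 0 + s" by (rule tendsto_add[OF diff g])
  then show ?thesis by (simp add: sums_def_le)
qed

text \<open>Summation by parts: with \<open>t N\<close> the sum of \<open>n * a n\<close>, the
  partial sums of \<open>a\<close> and \<open>b\<close> differ by \<open>t N / (N+1)\<close>, which
  tends to 0, and so does \<open>n * b n = t n / (n+1)\<close>. Hence \<open>tauber_first\<close>
  applies to \<open>b\<close>, whose Abel means differ from those of \<open>a\<close> by
  \<open>1 - x\<close> times a power series with null coefficients.\<close>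

theorem tauber_second:
  fixes a :: "nat \<Rightarrow> complex"
  assumes sm: "\<And>x::real. 0 < x \<Longrightarrow> x < 1 \<Longrightarrow> summable (\<lambda>n. a n * of_real x ^ n)"
    and abel: "((\<lambda>x. suminf (\<lambda>n. a n * of_real x ^ n)) \<longlongrightarrow> s) (at_left (1::real))"
    and T: "(\<lambda>N. (\<Sum>n\<le>N. of_nat n * a n) / of_nat N) \<longlonglongrightarrow> 0"
  shows "a sums s"
proof -
  define t where "t = (\<lambda>N. \<Sum>n\<le>N. of_nat n * a n)"
  define b where "b = (\<lambda>n. if n = 0 then a 0 else t n / (of_nat n * of_nat (Suc n)))"
  have t0: "t 0 = 0" by (simp add: t_def)
  have tn: "(\<lambda>n. t n / of_nat (Suc n)) \<longlonglongrightarrow> 0"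
  proof -
    have l: "(\<lambda>n. t n / of_nat n * (of_nat n / of_nat (Suc n))) \<longlonglongrightarrow> 0 * 1"
      by (intro tendsto_mult LIMSEQ_n_over_Suc_n) (use T in \<open>simp add: t_def\<close>)
    have "eventually (\<lambda>n. t n / of_nat n * (of_nat n / of_nat (Suc n)) = t n / of_nat (Suc n)) sequentially"
      using eventually_gt_at_top[of 0] by eventually_elim (simp del: of_nat_Suc)
    from Lim_transform_eventually[OF l[unfolded mult_zero_left] this] show ?thesis .
  qed
  have nb: "(\<lambda>n. of_nat n * b n) \<longlonglongrightarrow> 0"
  proof -
    have "of_nat n * b n = t n / of_nat (Suc n)" for n
      by (cases "n = 0") (simp_all add: b_def t0 del: of_nat_Suc)
    then show ?thesis using tn by simp
  qed
  have part: "(\<Sum>n\<le>N. a n) = (\<Sum>n\<le>N. b n) + t N / of_nat (Suc N)" for N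
  proof (induction N)
    case 0 then show ?case by (simp add: b_def t0)
  next
    case (Suc N)
    have e: "t (Suc N) = t N + of_nat (Suc N) * a (Suc N)" by (simp add: t_def)
    have nz: "(of_nat (Suc N) :: complex) \<noteq> 0" "(of_nat (Suc (Suc N)) :: complex) \<noteq> 0" by (simp_all del: of_nat_Suc)
    have d: "(of_nat (Suc (Suc N)) :: complex) = of_nat (Suc N) + 1" by simp
    have gen: "T / m + x = (T + m * x) / (m * (m + 1)) + (T + m * x) / (m + 1)" if "m \<noteq> 0" "m + 1 \<noteq> 0" for T m x :: complex
      using that by (simp add: divide_simps) (simp add: algebra_simps)
    have "t N / of_nat (Suc N) + a (Suc N) = b (Suc N) + t (Suc N) / of_nat (Suc (Suc N))"
      unfolding b_def e d using gen[of "of_nat (Suc N)" "t N" "a (Suc N)"] nz unfolding d by (simp del: of_nat_Suc)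
    then show ?case using Suc by (simp add: algebra_simps)
  qed
  obtain Bt where Bt: "Bt > 0" "\<And>n. cmod (t n / of_nat (Suc n)) \<le> Bt"
    using convergent_imp_Bseq[OF convergentI[OF tn]] by (auto elim: BseqE)
  have smt: "summable (\<lambda>n. norm (t n / of_nat (Suc n) * of_real x ^ n))" if "0 < x" "x < 1" for x :: real
  proof (rule summable_comparison_test'[of "\<lambda>n. Bt * x ^ n" 0])
    show "summable (\<lambda>n. Bt * x ^ n)" using that by (intro summable_mult summable_geometric) simp
    show "norm (norm (t n / of_nat (Suc n) * of_real x ^ n)) \<le> Bt * x ^ n" for n
      using mult_right_mono[OF Bt(2)[of n], of "x ^ n"] that by (simp add: norm_mult norm_power norm_divide)
  qed
  have bx: "(\<lambda>n. b n * of_real x ^ n) sums (suminf (\<lambda>n. a n * of_real x ^ n) - (1 - of_real x) * suminf (\<lambda>n. t n / of_nat (Suc n) * of_real x ^ n))"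
    if x: "0 < x" "x < 1" for x :: real
  proof -
    define z0 where "z0 = complex_of_real x"
    have p: "(\<Sum>n\<le>N. b n * z0 ^ n) = (\<Sum>n\<le>N. a n * z0 ^ n) - (1 - z0) * (\<Sum>n\<le>N. t n / of_nat (Suc n) * z0 ^ n) - z0 * (t N / of_nat (Suc N) * z0 ^ N)" for N
    proof (induction N)
      case 0 then show ?case by (simp add: b_def t0)
    next
      case (Suc N)
      have e: "t (Suc N) = t N + of_nat (Suc N) * a (Suc N)" by (simp add: t_def)
      have nz: "(of_nat (Suc N) :: complex) \<noteq> 0" "(of_nat (Suc (Suc N)) :: complex) \<noteq> 0" by (simp_all del: of_nat_Suc)
      have d: "(of_nat (Suc (Suc N)) :: complex) = of_nat (Suc N) + 1" by simp
      have gen: "(T + m * y) / (m * (m + 1)) = y - (1 - z) * ((T + m * y) / (m + 1)) - z * ((T + m * y) / (m + 1)) + T / m"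
        if "m \<noteq> 0" "m + 1 \<noteq> 0" for T m y z :: complex
        using that by (simp add: divide_simps) (simp add: algebra_simps)
      have "b (Suc N) = a (Suc N) - (1 - z0) * (t (Suc N) / of_nat (Suc (Suc N))) - z0 * (t (Suc N) / of_nat (Suc (Suc N))) + t N / of_nat (Suc N)"
        unfolding b_def e d using gen[of "of_nat (Suc N)" "t N" "a (Suc N)" z0] nz unfolding d by (simp del: of_nat_Suc)
      moreover have gen2: "B * (z * w) = A * (z * w) - (1 - z) * (T * (z * w)) - z * (T * (z * w)) + z * (p * w)"
        if "B = A - (1 - z) * T - z * T + p" for A B T p z w :: complex
        unfolding that by (simp add: algebra_simps)
      ultimately have "b (Suc N) * z0 ^ Suc N = a (Suc N) * z0 ^ Suc N - (1 - z0) * (t (Suc N) / of_nat (Suc (Suc N)) * z0 ^ Suc N)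
         - z0 * (t (Suc N) / of_nat (Suc (Suc N)) * z0 ^ Suc N) + z0 * (t N / of_nat (Suc N) * z0 ^ N)"
        unfolding power_Suc by blast
      then show ?case using Suc.IH by (simp only: sum.atMost_Suc distrib_left) (simp add: algebra_simps del: of_nat_Suc power_Suc)
    qed
    have l1: "(\<lambda>N. \<Sum>n\<le>N. a n * z0 ^ n) \<longlonglongrightarrow> suminf (\<lambda>n. a n * z0 ^ n)"
      using summable_sums[OF sm[OF x]] by (simp add: sums_def_le z0_def)
    have l2: "(\<lambda>N. \<Sum>n\<le>N. t n / of_nat (Suc n) * z0 ^ n) \<longlonglongrightarrow> suminf (\<lambda>n. t n / of_nat (Suc n) * z0 ^ n)"
      using summable_sums[OF summable_norm_cancel[OF smt[OF x]]] by (simp add: sums_def_le z0_def)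
    have l3: "(\<lambda>N. t N / of_nat (Suc N) * z0 ^ N) \<longlonglongrightarrow> 0"
      using summable_LIMSEQ_zero[OF summable_norm_cancel[OF smt[OF x]]] by (simp add: z0_def)
    have "(\<lambda>N. \<Sum>n\<le>N. b n * z0 ^ n) \<longlonglongrightarrow> suminf (\<lambda>n. a n * z0 ^ n) - (1 - z0) * suminf (\<lambda>n. t n / of_nat (Suc n) * z0 ^ n) - z0 * 0"
      unfolding p by (intro tendsto_intros l1 l2 l3)
    then show ?thesis by (simp add: sums_def_le z0_def)
  qed
  \<comment> \<open>An Abel mean of a null sequence: the first \<open>M\<close> terms contribute at
    most \<open>(1 - x) * K\<close>, the others at most \<open>r/2\<close>.\<close>
  have small: "((\<lambda>x. (1 - complex_of_real x) * suminf (\<lambda>n. t n / of_nat (Suc n) * of_real x ^ n)) \<longlongrightarrow> 0) (at_left 1)"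
  proof (rule tendstoI)
    fix r :: real assume r: "r > 0"
    obtain M where M: "\<And>n. n \<ge> M \<Longrightarrow> cmod (t n / of_nat (Suc n)) < r/2"
      using LIMSEQ_D[OF tn, of "r/2"] r by auto
    define K where "K = real M * Bt"
    have "((\<lambda>x::real. (1 - x) * K) \<longlongrightarrow> (1 - 1) * K) (at_left 1)" by (intro tendsto_intros)
    then have "eventually (\<lambda>x::real. (1 - x) * K < r/2) (at_left 1)"
      using r by (intro order_tendstoD(2)[of _ "(1-1)*K"]) auto
    moreover have "eventually (\<lambda>x::real. x \<in> {0<..<1}) (at_left 1)" by (rule eventually_at_left_1) auto
    ultimately show "eventually (\<lambda>x. dist ((1 - complex_of_real x) * suminf (\<lambda>n. t n / of_nat (Suc n) * of_real x ^ n)) 0 < r) (at_left 1)"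
    proof eventually_elim
      case (elim x)
      then have x: "0 < x" "x < 1" by auto
      define d where "d = (\<lambda>n. norm (t n / of_nat (Suc n) * of_real x ^ n))"
      have d: "summable d" unfolding d_def by (rule smt[OF x])
      have "cmod (suminf (\<lambda>n. t n / of_nat (Suc n) * of_real x ^ n)) \<le> suminf d"
        unfolding d_def by (rule summable_norm[OF smt[OF x]])
      also have "suminf d = suminf (\<lambda>n. d (n + M)) + (\<Sum>n<M. d n)" by (rule suminf_split_initial_segment[OF d])
      also have "(\<Sum>n<M. d n) \<le> (\<Sum>n<M. Bt)"
      proof (rule sum_mono)
        fix n
        have "x ^ n \<le> 1" using x by (intro power_le_one) auto
        then show "d n \<le> Bt"
          unfolding d_def norm_mult norm_power using mult_mono[OF Bt(2)[of n], of "x ^ n" 1] x Bt(1) by simp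
      qed
      also have "\<dots> = K" by (simp add: K_def)
      also have "suminf (\<lambda>n. d (n + M)) \<le> suminf (\<lambda>n. r/2 * x ^ n)"
      proof (rule suminf_le)
        show "summable (\<lambda>n. d (n + M))" using d by (rule summable_ignore_initial_segment)
        show "summable (\<lambda>n. r/2 * x ^ n)" using x by (intro summable_mult summable_geometric) simp
        show "d (n + M) \<le> r/2 * x ^ n" for n
        proof -
          have "x ^ (n + M) \<le> x ^ n" using x by (intro power_decreasing) auto
          then show ?thesis
            unfolding d_def norm_mult norm_power using M[of "n + M"] x r by (intro mult_mono) auto
        qed
      qed
      also have "suminf (\<lambda>n. r/2 * x ^ n) = r/2 / (1 - x)"
        using x by (subst suminf_mult) (auto intro!: summable_geometric simp: suminf_geometric)
      finally have "(1 - x) * cmod (suminf (\<lambda>n. t n / of_nat (Suc n) * of_real x ^ n)) \<le> (1 - x) * (r/2 / (1 - x) + K)"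
        using x by (intro mult_left_mono) auto
      also have "\<dots> = r/2 + (1 - x) * K" using x by (simp add: field_simps)
      also have "\<dots> < r" using elim by simp
      finally have "(1 - x) * cmod (suminf (\<lambda>n. t n / of_nat (Suc n) * of_real x ^ n)) < r" .
      moreover have "cmod (1 - complex_of_real x) = 1 - x"
        using x by (metis norm_of_real of_real_1 of_real_diff abs_of_pos diff_gt_0_iff_gt)
      ultimately show ?case by (simp add: norm_mult)
    qed
  qed
  have "b sums s"
  proof (rule tauber_first[OF nb])
    show "summable (\<lambda>n. b n * of_real x ^ n)" if "0 < x" "x < 1" for x :: real
      using bx[OF that] by (simp add: sums_iff)
    have "((\<lambda>x. suminf (\<lambda>n. a n * of_real x ^ n) - (1 - complex_of_real x) * suminf (\<lambda>n. t n / of_nat (Suc n) * of_real x ^ n)) \<longlongrightarrow> s - 0) (at_left 1)"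
      by (intro tendsto_diff abel small)
    moreover have "eventually (\<lambda>x::real. suminf (\<lambda>n. a n * of_real x ^ n) - (1 - complex_of_real x) * suminf (\<lambda>n. t n / of_nat (Suc n) * of_real x ^ n)
        = suminf (\<lambda>n. b n * of_real x ^ n)) (at_left 1)"
    proof (rule eventually_at_leftI)
      fix x :: real assume "x \<in> {0<..<1}"
      then show "suminf (\<lambda>n. a n * of_real x ^ n) - (1 - complex_of_real x) * suminf (\<lambda>n. t n / of_nat (Suc n) * of_real x ^ n)
        = suminf (\<lambda>n. b n * of_real x ^ n)"
        by (intro sums_unique bx) auto
    qed simp
    ultimately show "((\<lambda>x. suminf (\<lambda>n. b n * of_real x ^ n)) \<longlongrightarrow> s) (at_left (1::real))"
      by (simp add: tendsto_cong)
  qed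
  then have "(\<lambda>N. \<Sum>n\<le>N. b n) \<longlonglongrightarrow> s" by (simp add: sums_def_le)
  from tendsto_add[OF this tn] show ?thesis by (simp add: sums_def_le part)
qed

section \<open>Exponential sums\<close>

lemma summation_by_parts_bound:
  fixes w z :: "nat \<Rightarrow> complex"
  assumes z: "\<And>j. cmod (z j) \<le> 1"
  shows "cmod ((\<Sum>j<n. w j * (z (Suc j) - z j)) - w n * z n) \<le> cmod (w 0) + (\<Sum>j<n. cmod (w (Suc j) - w j))"
proof (induction n)
  case 0
  show ?case using mult_left_mono[OF z[of 0], of "cmod (w 0)"] by (simp add: norm_mult)
next
  case (Suc n)
  have "(\<Sum>j<Suc n. w j * (z (Suc j) - z j)) - w (Suc n) * z (Suc n) =
     ((\<Sum>j<n. w j * (z (Suc j) - z j)) - w n * z n) - (w (Suc n) - w n) * z (Suc n)"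
    by (simp add: algebra_simps)
  also have "cmod \<dots> \<le> cmod ((\<Sum>j<n. w j * (z (Suc j) - z j)) - w n * z n) + cmod (w (Suc n) - w n)"
    using mult_left_mono[OF z[of "Suc n"], of "cmod (w (Suc n) - w n)"]
    by (intro order_trans[OF norm_triangle_ineq4]) (simp add: norm_mult)
  finally show ?case using Suc by simp
qed

lemma sin_lower:
  fixes \<theta> d :: real
  assumes "0 < \<theta>" "\<theta> \<le> d" "d \<le> 1 - \<theta>"
  shows "0 < sin (pi * \<theta>)" "sin (pi * \<theta>) \<le> sin (pi * d)"
proof -
  have \<theta>: "\<theta> \<le> 1/2" using assms by simp
  then show "0 < sin (pi * \<theta>)" using assms by (intro sin_gt_zero) auto
  have mono: "sin (pi * \<theta>) \<le> sin (pi * t)" if "\<theta> \<le> t" "t \<le> 1/2" for t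
  proof (rule sin_monotone_2pi_le)
    show "- (pi / 2) \<le> pi * \<theta>" by (rule order_trans[of _ 0]) (use assms in auto)
    show "pi * \<theta> \<le> pi * t" using that by simp
    show "pi * t \<le> pi / 2" using mult_left_mono[OF that(2), of pi] by simp
  qed
  show "sin (pi * \<theta>) \<le> sin (pi * d)"
  proof (cases "d \<le> 1/2")
    case False
    have "sin (pi * d) = sin (pi * (1 - d))"
      using sin_pi_minus[of "pi * d"] by (simp add: right_diff_distrib)
    then show ?thesis using mono[of "1 - d"] assms False by simp
  qed (use mono[of d] assms in simp)
qed

text \<open>The real part is constant, so the variation of \<open>1 / (e1 d - 1)\<close> is half
  that of the cotangent of \<open>pi * d\<close>.\<close>

lemma inverse_e1_minus_1:
  assumes "sin (pi * d) \<noteq> 0"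
  shows "1 / (e1 d - 1) = - (1/2) - \<i> / 2 * of_real (cos (pi * d) / sin (pi * d))"
proof -
  define s c where "s = sin (pi * d)" and "c = cos (pi * d)"
  have e: "e1 d = (of_real c + \<i> * of_real s) ^ 2"
  proof -
    have "of_real c + \<i> * of_real s = cis (pi * d)" by (simp add: c_def s_def complex_eq_iff)
    moreover have "cis (pi * d) ^ 2 = cis (2 * pi * d)" using Complex.DeMoivre[of "pi * d" 2] by (simp only: of_nat_numeral mult.assoc)
    ultimately show ?thesis by (simp only: e1_def)
  qed
  have cs: "complex_of_real c ^ 2 + of_real s ^ 2 = 1"
    unfolding c_def s_def by (metis of_real_1 of_real_add of_real_power sin_cos_squared_add2)
  have "e1 d - 1 = 2 * \<i> * of_real s * (of_real c + \<i> * of_real s)"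
    unfolding e cs[symmetric] by (simp add: power2_eq_square algebra_simps)
  moreover have "(of_real c + \<i> * of_real s) * (of_real c - \<i> * of_real s) = (1::complex)"
    using cs by (simp add: power2_eq_square algebra_simps)
  then have "1 / (of_real c + \<i> * of_real s) = of_real c - \<i> * (of_real s :: complex)"
    by (metis divide_eq_eq mult.commute mult_zero_left zero_neq_one)
  ultimately have "1 / (e1 d - 1) = (of_real c - \<i> * of_real s) / (2 * \<i> * of_real s)"
    by (simp only: divide_divide_eq_left' [symmetric])
  also have "\<dots> = - (1/2) - \<i> / 2 * of_real (c / s)"
    using assms by (simp add: s_def[symmetric] field_simps)
  finally show ?thesis by (simp add: s_def c_def)
qed

text \<open>Two boundary terms of at most \<open>1 + 1/sin\<close>, a total variation of at most
  \<open>1/sin\<close>, and one last summand of modulus 1.\<close>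

definition KL :: "real \<Rightarrow> real" where "KL \<theta> = 3 + 3 / sin (pi * \<theta>)"

text \<open>Each term is \<open>w j * (z (j+1) - z j)\<close> with
  \<open>w j = 1 / (e1 (d j) - 1)\<close>. Monotone differences make the cotangents monotone, so
  after summation by parts the variation of \<open>w\<close> telescopes, and the distance \<theta>
  from the integers bounds it.\<close>

lemma kusmin_landau_unit:
  fixes f :: "nat \<Rightarrow> real"
  assumes \<theta>: "0 < \<theta>" and n: "n > 0"
    and rng: "\<And>j. j < n \<Longrightarrow> \<theta> \<le> f (Suc j) - f j \<and> f (Suc j) - f j \<le> 1 - \<theta>"
    and dec: "\<And>j. Suc j < n \<Longrightarrow> f (Suc (Suc j)) - f (Suc j) \<le> f (Suc j) - f j"
  shows "cmod (\<Sum>j<n. e1 (f j)) \<le> KL \<theta>"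
proof -
  obtain m where Suc: "n = Suc m" using n by (cases n) auto
  define d where "d = (\<lambda>j. f (Suc j) - f j)"
  have d: "\<theta> \<le> d j" "d j \<le> 1 - \<theta>" if "j \<le> m" for j using rng[of j] that Suc by (auto simp: d_def)
  have ds: "d (Suc j) \<le> d j" if "j < m" for j using dec[of j] that Suc by (simp add: d_def)
  define \<sigma> where "\<sigma> = sin (pi * \<theta>)"
  have \<sigma>: "0 < \<sigma>" using sin_lower(1)[OF \<theta> d[of 0]] by (simp add: \<sigma>_def)
  have sd: "\<sigma> \<le> sin (pi * d j)" if "j \<le> m" for j using sin_lower(2)[OF \<theta> d[OF that]] by (simp add: \<sigma>_def)
  define ct where "ct = (\<lambda>j. cos (pi * d j) / sin (pi * d j))"
  have ctb: "\<bar>ct j\<bar> \<le> 1 / \<sigma>" if "j \<le> m" for j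
    unfolding ct_def abs_divide using sd[OF that] \<sigma> by (intro frac_le) auto
  \<comment> \<open>With denominators cleared, the claim is
    \<open>sin (pi * (d j - d (j+1))) >= 0\<close>.\<close>
  have ctm: "ct j \<le> ct (Suc j)" if j: "j < m" for j
  proof -
    have s: "0 < sin (pi * d j)" "0 < sin (pi * d (Suc j))" using sd[of j] sd[of "Suc j"] \<sigma> j by auto
    have "0 \<le> sin (pi * (d j - d (Suc j)))"
      using ds[OF j] d[of j] d[of "Suc j"] \<theta> j by (intro sin_ge_zero) (auto intro!: mult_left_le)
    also have "\<dots> = sin (pi * d j) * cos (pi * d (Suc j)) - cos (pi * d j) * sin (pi * d (Suc j))"
      by (simp add: right_diff_distrib sin_diff)
    finally show ?thesis using s by (simp add: ct_def field_simps)
  qed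
  define w where "w = (\<lambda>j. - (1/2) - \<i> / 2 * complex_of_real (ct j))"
  define z where "z = (\<lambda>j. e1 (f j))"
  have zw: "z j = w j * (z (Suc j) - z j)" if "j \<le> m" for j
  proof -
    have nz: "sin (pi * d j) \<noteq> 0" using sd[OF that] \<sigma> by simp
    have "w j = 1 / (e1 (d j) - 1)" unfolding w_def ct_def by (rule inverse_e1_minus_1[OF nz, symmetric])
    moreover have "w j \<noteq> 0" by (simp add: w_def complex_eq_iff)
    moreover have "z (Suc j) = z j * e1 (d j)" by (simp add: z_def d_def flip: e1_add)
    ultimately have W: "w j * (e1 (d j) - 1) = 1" and Z: "z (Suc j) = z j * e1 (d j)" by simp_all
    have "z j = (w j * (e1 (d j) - 1)) * z j" by (simp only: W mult_1)
    also have "\<dots> = w j * (z j * e1 (d j) - z j)" by (simp add: right_diff_distrib mult_ac)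
    finally show ?thesis unfolding Z .
  qed
  have wb: "cmod (w j) \<le> 1 + 1 / \<sigma>" if "j \<le> m" for j
  proof -
    have "cmod (w j) \<le> 1/2 + 1/2 * \<bar>ct j\<bar>"
      unfolding w_def by (rule order_trans[OF norm_triangle_ineq4]) (simp add: norm_mult norm_divide)
    moreover have "0 < 1 / \<sigma>" using \<sigma> by simp
    ultimately show ?thesis using ctb[OF that] by linarith
  qed
  have wd: "cmod (w (Suc j) - w j) = (ct (Suc j) - ct j) / 2" if "j < m" for j
  proof -
    have "w (Suc j) - w j = - (\<i> / 2 * of_real (ct (Suc j) - ct j))" by (simp add: w_def algebra_simps)
    then show ?thesis using ctm[OF that] by (simp add: norm_mult norm_divide flip: of_real_diff)
  qed
  have tel: "(\<Sum>j<m. cmod (w (Suc j) - w j)) \<le> 1 / \<sigma>"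
  proof -
    have "(\<Sum>j<m. cmod (w (Suc j) - w j)) = (\<Sum>j<m. (ct (Suc j) - ct j) / 2)" by (intro sum.cong wd) auto
    also have "\<dots> = (ct m - ct 0) / 2" by (simp add: sum_lessThan_telescope flip: sum_divide_distrib)
    finally show ?thesis using ctb[of m] ctb[of 0] by (simp add: abs_le_iff)
  qed
  have "(\<Sum>j<n. z j) = (\<Sum>j<m. w j * (z (Suc j) - z j)) + z m"
    using zw Suc by simp
  also have "\<dots> = ((\<Sum>j<m. w j * (z (Suc j) - z j)) - w m * z m) + (w m * z m + z m)" by simp
  also have "cmod \<dots> \<le> (cmod (w 0) + (\<Sum>j<m. cmod (w (Suc j) - w j))) + (cmod (w m) + 1)"
  proof (rule order_trans[OF norm_triangle_ineq add_mono])
    show "cmod ((\<Sum>j<m. w j * (z (Suc j) - z j)) - w m * z m) \<le> cmod (w 0) + (\<Sum>j<m. cmod (w (Suc j) - w j))"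
      by (rule summation_by_parts_bound) (simp add: z_def)
    show "cmod (w m * z m + z m) \<le> cmod (w m) + 1"
      by (rule order_trans[OF norm_triangle_ineq]) (simp add: norm_mult z_def)
  qed
  also have "\<dots> \<le> KL \<theta>" using wb[of 0] wb[of m] tel by (simp add: KL_def \<sigma>_def)
  finally show ?thesis by (simp add: z_def)
qed

text \<open>Subtracting \<open>k * j\<close> from the phase does not change \<open>e1\<close> and
  moves the differences into the unit interval.\<close>

lemma kusmin_landau:
  fixes f :: "nat \<Rightarrow> real" and k :: int and \<theta> :: real
  assumes \<theta>: "0 < \<theta>" and pq: "p < q"
    and rng: "\<And>j. p \<le> j \<Longrightarrow> j < q \<Longrightarrow> k + \<theta> \<le> f (Suc j) - f j \<and> f (Suc j) - f j \<le> k + 1 - \<theta>"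
    and dec: "\<And>j. p \<le> j \<Longrightarrow> Suc j < q \<Longrightarrow> f (Suc (Suc j)) - f (Suc j) \<le> f (Suc j) - f j"
  shows "cmod (\<Sum>j\<in>{p..<q}. e1 (f j)) \<le> KL \<theta>"
proof -
  define g where "g = (\<lambda>j. f (j + p) - of_int k * real j)"
  have "e1 (f (j + p)) = e1 (g j)" for j
  proof -
    have "f (j + p) = g j + of_int (k * int j)" by (simp add: g_def)
    then show ?thesis by (simp only: e1_add_int)
  qed
  then have "(\<Sum>j\<in>{p..<q}. e1 (f j)) = (\<Sum>j<q - p. e1 (g j))"
    using sum.shift_bounds_nat_ivl[of "\<lambda>j. e1 (f j)" 0 p "q - p"]
    by (cases "p \<le> q") (simp_all add: atLeast0LessThan)
  moreover have "cmod (\<Sum>j<q - p. e1 (g j)) \<le> KL \<theta>"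
  proof (rule kusmin_landau_unit)
    show "\<theta> \<le> g (Suc j) - g j \<and> g (Suc j) - g j \<le> 1 - \<theta>" if "j < q - p" for j
      using rng[of "j + p"] that by (simp add: g_def algebra_simps)
    show "g (Suc (Suc j)) - g (Suc j) \<le> g (Suc j) - g j" if "Suc j < q - p" for j
      using dec[of "j + p"] that by (simp add: g_def algebra_simps)
  qed (use \<theta> pq in auto)
  ultimately show ?thesis by simp
qed

section \<open>Van der Corput's estimate\<close>

lemma spaced_card:
  fixes d :: "nat \<Rightarrow> real"
  assumes lam: "gap > 0" and dec: "\<And>j. Suc j < J \<Longrightarrow> d (Suc j) \<le> d j - gap"
    and S: "S \<subseteq> {..<J}" "\<And>j. j \<in> S \<Longrightarrow> x0 \<le> d j \<and> d j \<le> x0 + \<theta>" and \<theta>: "\<theta> \<ge> 0"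
  shows "real (card S) \<le> \<theta> / gap + 1"
proof (cases "S = {}")
  case False
  have fin: "finite S" using S(1) finite_subset by blast
  define p r where "p = Min S" and "r = Max S"
  have pr: "p \<in> S" "r \<in> S" "p \<le> r" using fin False by (auto simp: p_def r_def)
  have "d (p + i) \<le> d p - real i * gap" if "p + i < J" for i
    using that
  proof (induction i)
    case (Suc i)
    then have "d (Suc (p + i)) \<le> d (p + i) - gap" by (intro dec) simp
    then show ?case using Suc by (simp add: algebra_simps)
  qed simp
  from this[of "r - p"] have "d r \<le> d p - real (r - p) * gap" using pr S(1) by auto
  moreover have "d p \<le> x0 + \<theta>" "x0 \<le> d r" using S(2) pr by auto
  ultimately have "real (r - p) * gap \<le> \<theta>" by linarith
  then have 1: "real (r - p) \<le> \<theta> / gap" using lam by (simp add: field_simps)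
  have "S \<subseteq> {p..r}" using fin by (auto simp: p_def r_def)
  then have "card S \<le> card {p..r}" by (intro card_mono) auto
  then have "real (card S) \<le> real (r - p) + 1" using pr(3) by simp
  then show ?thesis using 1 by simp
qed (use \<theta> lam in simp)

text \<open>The indices are grouped by the integer part of the difference \<open>d j\<close>, for
  which at most \<open>2 * M + 3\<close> values occur. Differences within \<theta> of an integer are
  few by \<open>spaced_card\<close>; the others form one block for
  \<open>kusmin_landau\<close>.\<close>

theorem van_der_corput:
  fixes f :: "nat \<Rightarrow> real"
  assumes lam: "gap > 0" and \<theta>: "0 < \<theta>" "\<theta> < 1/2" and M: "M \<ge> 0"
    and dec: "\<And>j. Suc j < J \<Longrightarrow> f (Suc (Suc j)) - f (Suc j) \<le> f (Suc j) - f j - gap"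
    and bd: "\<And>j. j < J \<Longrightarrow> \<bar>f (Suc j) - f j\<bar> \<le> M"
  shows "cmod (\<Sum>j<J. e1 (f j)) \<le> (2 * M + 3) * (2 * (\<theta> / gap + 1) + KL \<theta>)"
proof -
  define d where "d = (\<lambda>j. f (Suc j) - f j)"
  have mono: "d j \<le> d i" if "i \<le> j" "j < J" for i j
    using that
  proof (induction j)
    case (Suc j)
    show ?case
    proof (cases "i = Suc j")
      case False
      then have "d j \<le> d i" using Suc by simp
      moreover have "d (Suc j) \<le> d j - gap" using dec[of j] Suc by (simp add: d_def)
      ultimately show ?thesis using lam by simp
    qed simp
  qed simp
  define Z where "Z = (\<lambda>k. {j \<in> {..<J}. \<lfloor>d j\<rfloor> = k})"
  have block: "cmod (\<Sum>j\<in>Z k. e1 (f j)) \<le> 2 * (\<theta> / gap + 1) + KL \<theta>" for k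
  proof -
    define A where "A = {j \<in> Z k. d j < k + \<theta>}"
    define C where "C = {j \<in> Z k. d j > k + 1 - \<theta>}"
    define B where "B = {j \<in> {..<J}. k + \<theta> \<le> d j \<and> d j \<le> k + 1 - \<theta>}"
    have fl: "of_int k \<le> d j" "d j < of_int k + 1" if "j \<in> Z k" for j
      using that by (auto simp: Z_def floor_eq_iff)
    have ZB: "Z k = B \<union> (A \<union> C)"
    proof (intro equalityI subsetI)
      fix j assume "j \<in> B \<union> (A \<union> C)"
      then show "j \<in> Z k" using \<theta> by (auto simp: A_def C_def B_def Z_def floor_eq_iff)
    qed (auto simp: A_def B_def C_def Z_def)
    have fin: "finite A" "finite B" "finite C" by (auto simp: A_def B_def C_def Z_def)
    have cA: "real (card A) \<le> \<theta> / gap + 1"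
      by (rule spaced_card[OF lam, of J d A "of_int k"])
         (use dec fl \<theta> in \<open>auto simp: A_def d_def Z_def less_imp_le\<close>)
    have cC: "real (card C) \<le> \<theta> / gap + 1"
      by (rule spaced_card[OF lam, of J d C "of_int k + 1 - \<theta>"])
         (use dec fl \<theta> in \<open>auto simp: C_def d_def Z_def less_imp_le\<close>)
    have "cmod (\<Sum>j\<in>B. e1 (f j)) \<le> KL \<theta>"
    proof (cases "B = {}")
      case True
      have "0 < sin (pi * \<theta>)" using sin_lower(1)[of \<theta> \<theta>] \<theta> by simp
      then show ?thesis using True by (simp add: KL_def)
    next
      case False
      define p r where "p = Min B" and "r = Max B"
      have pr: "p \<in> B" "r \<in> B" "p \<le> r" using fin False by (auto simp: p_def r_def)
      \<comment> \<open>As \<open>d\<close> is decreasing, the indices with differences in a given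
        range are consecutive.\<close>
      have "B = {p..<Suc r}"
      proof (intro equalityI subsetI)
        fix j assume "j \<in> {p..<Suc r}"
        moreover have "r < J" using pr by (simp add: B_def)
        ultimately have "d j \<le> d p" "d r \<le> d j" "j < J" by (auto intro!: mono)
        then show "j \<in> B" using pr by (auto simp: B_def)
      qed (use fin in \<open>auto simp: p_def r_def less_Suc_eq_le\<close>)
      moreover have "cmod (\<Sum>j\<in>{p..<Suc r}. e1 (f j)) \<le> KL \<theta>"
      proof (rule kusmin_landau[of \<theta> p "Suc r" k f])
        fix j assume "p \<le> j" "j < Suc r"
        then have "j \<in> B" using \<open>B = {p..<Suc r}\<close> by simp
        then show "k + \<theta> \<le> f (Suc j) - f j \<and> f (Suc j) - f j \<le> k + 1 - \<theta>" by (simp add: B_def d_def)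
      next
        fix j assume "p \<le> j" "Suc j < Suc r"
        then have "Suc j < J" using pr by (simp add: B_def)
        from dec[OF this] show "f (Suc (Suc j)) - f (Suc j) \<le> f (Suc j) - f j" using lam by simp
      qed (use \<theta> pr(3) in auto)
      ultimately show ?thesis by simp
    qed
    moreover have Zs: "(\<Sum>j\<in>Z k. e1 (f j)) = (\<Sum>j\<in>B. e1 (f j)) + (\<Sum>j\<in>A \<union> C. e1 (f j))"
      unfolding ZB
    proof (rule sum.union_disjoint)
      show "B \<inter> (A \<union> C) = {}"
      proof (rule ccontr)
        assume "B \<inter> (A \<union> C) \<noteq> {}"
        then obtain j where "j \<in> B" "j \<in> A \<or> j \<in> C" by blast
        then have "k + \<theta> \<le> d j \<and> d j \<le> k + 1 - \<theta>" "d j < k + \<theta> \<or> d j > k + 1 - \<theta>"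
          unfolding A_def B_def C_def by blast+
        then show False by linarith
      qed
    qed (use fin in auto)
    moreover have "cmod (\<Sum>j\<in>A \<union> C. e1 (f j)) \<le> real (card A) + real (card C)"
    proof -
      have "cmod (\<Sum>j\<in>A \<union> C. e1 (f j)) \<le> (\<Sum>j\<in>A \<union> C. 1)" by (rule sum_norm_le) simp
      also have "\<dots> \<le> real (card A) + real (card C)" using card_Un_le[of A C] by (simp flip: of_nat_add)
      finally show ?thesis .
    qed
    ultimately have "cmod (\<Sum>j\<in>Z k. e1 (f j)) \<le> KL \<theta> + (real (card A) + real (card C))"
      unfolding Zs by (intro order_trans[OF norm_triangle_ineq add_mono])
    then show ?thesis unfolding mult_2 using cA cC by linarith
  qed
  define T where "T = {\<lfloor>- M\<rfloor>..\<lfloor>M\<rfloor>}"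
  have "- M \<le> d j" "d j \<le> M" if "j < J" for j using bd[OF that] by (auto simp: d_def abs_le_iff)
  then have "(\<lambda>j. \<lfloor>d j\<rfloor>) ` {..<J} \<subseteq> T" by (auto simp: T_def intro!: floor_mono)
  then have "(\<Sum>j<J. e1 (f j)) = (\<Sum>k\<in>T. \<Sum>j\<in>Z k. e1 (f j))"
    unfolding Z_def by (intro sum.group[symmetric]) (auto simp: T_def)
  then have "cmod (\<Sum>j<J. e1 (f j)) \<le> (\<Sum>k\<in>T. 2 * (\<theta> / gap + 1) + KL \<theta>)"
    by (simp only:) (rule sum_norm_le, rule block)
  also have "\<dots> = real (card T) * (2 * (\<theta> / gap + 1) + KL \<theta>)" by simp
  also have "\<dots> \<le> (2 * M + 3) * (2 * (\<theta> / gap + 1) + KL \<theta>)"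
  proof (rule mult_right_mono)
    have "real_of_int (\<lfloor>M\<rfloor> - \<lfloor>- M\<rfloor> + 1) \<le> 2 * M + 3" by linarith
    moreover have "\<lfloor>- M\<rfloor> \<le> \<lfloor>M\<rfloor>" using M by (intro floor_mono) simp
    ultimately show "real (card T) \<le> 2 * M + 3" by (simp add: T_def)
    have "0 < sin (pi * \<theta>)" using sin_lower(1)[of \<theta> \<theta>] \<theta> by simp
    then show "0 \<le> 2 * (\<theta> / gap + 1) + KL \<theta>" using lam \<theta> by (simp add: KL_def)
  qed
  finally show ?thesis .
qed

section \<open>Exponential sums along the ellipse \<open>a^2 + 3 y^2 = N\<close>\<close>

definition yroot :: "nat \<Rightarrow> nat \<Rightarrow> real" where
  "yroot N a = sqrt ((real N - (real a)^2) / 3)"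

text \<open>Concavity in quantitative form: with \<open>p\<close>, \<open>q\<close> the outer and
  \<open>r\<close> the middle value, \<open>(p + q)^2 <= 2 * (p^2 + q^2) = 4 * r^2 - 4 * h^2 <= (2 *
  r - h^2 / r)^2\<close>.\<close>

lemma sqrt_second_difference:
  fixes n x h :: real
  assumes "0 \<le> h" "h \<le> x" "x + h \<le> sqrt n" "0 < sqrt n - x"
  shows "sqrt (n - (x + h)^2) + sqrt (n - (x - h)^2) \<le> 2 * sqrt (n - x^2) - h^2 / sqrt n"
proof -
  have n: "0 \<le> n" using assms real_sqrt_ge_0_iff[of n] by linarith
  have bd: "t^2 \<le> n" if "0 \<le> t" "t \<le> sqrt n" for t
    using power_mono[OF that(2,1), of 2] n by simp
  define p q r where "p = sqrt (n - (x + h)^2)" and "q = sqrt (n - (x - h)^2)" and "r = sqrt (n - x^2)"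
  have p2: "p^2 = n - (x + h)^2" "0 \<le> p" unfolding p_def using bd[of "x + h"] assms by auto
  have q2: "q^2 = n - (x - h)^2" "0 \<le> q" unfolding q_def using bd[of "x - h"] assms by auto
  have r2: "r^2 = n - x^2" "0 \<le> r" unfolding r_def using bd[of x] assms by auto
  have rpos: "0 < r"
  proof -
    have "x^2 < (sqrt n)^2" using assms by (intro power_strict_mono) auto
    then show ?thesis using n by (simp add: r_def)
  qed
  have rn: "r \<le> sqrt n" unfolding r_def by (rule real_sqrt_le_mono) simp
  have s: "p^2 + q^2 = 2 * r^2 - 2 * h^2" unfolding p2 q2 r2 by (simp add: power2_eq_square algebra_simps)
  have "0 \<le> p^2 + q^2" by simp
  then have hr: "h^2 \<le> r^2" using s by simp
  have "(p + q)^2 \<le> (2 * r - h^2 / r)^2"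
  proof -
    have "(p + q)^2 \<le> (p + q)^2 + (p - q)^2" by simp
    also have "\<dots> = 2 * (p^2 + q^2)" by (simp add: power2_eq_square algebra_simps)
    also have "\<dots> = 4 * r^2 - 4 * h^2" unfolding s by simp
    also have "\<dots> \<le> 4 * r^2 - 4 * h^2 + (h^2 / r)^2" by simp
    also have "\<dots> = (2 * r - h^2 / r)^2" using rpos by (simp add: power2_diff power_mult_distrib)
    finally show ?thesis .
  qed
  moreover have "h^2 / r \<le> r" using hr rpos by (simp add: divide_le_eq power2_eq_square)
  then have "0 \<le> 2 * r - h^2 / r" using rpos by linarith
  ultimately have "p + q \<le> 2 * r - h^2 / r" by (rule power2_le_imp_le)
  moreover have "h^2 / sqrt n \<le> h^2 / r" by (rule divide_left_mono[OF rn]) (use rpos rn in \<open>simp_all del: real_sqrt_gt_0_iff\<close>)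
  ultimately show ?thesis unfolding p_def q_def r_def by linarith
qed

text \<open>Away from the vertical tangent both roots are at least
  \<open>sqrt (\<epsilon> * n)\<close>, and \<open>(r - p) * (r + p) = h * (2 * x + h)\<close> is at
  most \<open>2 * h * sqrt n\<close>.\<close>

lemma sqrt_first_difference:
  fixes n x h \<epsilon> :: real
  assumes n: "n > 0" and \<epsilon>: "0 < \<epsilon>" "\<epsilon> < 1" and x: "0 \<le> x" "0 \<le> h" "x + h \<le> (1 - \<epsilon>) * sqrt n"
  shows "\<bar>sqrt (n - (x + h)^2) - sqrt (n - x^2)\<bar> \<le> h / sqrt \<epsilon>"
proof -
  have low: "\<epsilon> * n \<le> n - t^2" if "0 \<le> t" "t \<le> (1 - \<epsilon>) * sqrt n" for t
  proof -
    have "t^2 \<le> ((1 - \<epsilon>) * sqrt n)^2" using that by (intro power_mono) auto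
    also have "\<dots> = (1 - \<epsilon>) * ((1 - \<epsilon>) * n)" using n by (simp add: power2_eq_square)
    also have "\<dots> \<le> 1 * ((1 - \<epsilon>) * n)" using n \<epsilon> by (intro mult_right_mono) auto
    finally show ?thesis by (simp add: algebra_simps)
  qed
  define p r where "p = sqrt (n - (x + h)^2)" and "r = sqrt (n - x^2)"
  have en: "0 < \<epsilon> * n" using n \<epsilon> by simp
  have lp: "\<epsilon> * n \<le> n - (x + h)^2" and lr: "\<epsilon> * n \<le> n - x^2" using low[of "x + h"] low[of x] x by auto
  have p: "sqrt (\<epsilon> * n) \<le> p" "p^2 = n - (x + h)^2" unfolding p_def using lp en by auto
  have r: "sqrt (\<epsilon> * n) \<le> r" "r^2 = n - x^2" unfolding r_def using lr en by auto
  have s: "0 < sqrt (\<epsilon> * n)" using en by simp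
  have "(r - p) * (r + p) = r^2 - p^2" by (simp add: power2_eq_square algebra_simps)
  also have "\<dots> = h * (2 * x + h)" unfolding p r by (simp add: power2_eq_square algebra_simps)
  finally have e: "(r - p) * (r + p) = h * (2 * x + h)" .
  have rp: "0 < r + p" using p r s by linarith
  have rp0: "0 \<le> r - p"
  proof (rule ccontr)
    assume "\<not> 0 \<le> r - p"
    then have "(r - p) * (r + p) < 0" using rp by (intro mult_neg_pos) auto
    moreover have "0 \<le> h * (2 * x + h)" using x by simp
    ultimately show False using e by simp
  qed
  have "(r - p) * (2 * sqrt (\<epsilon> * n)) \<le> (r - p) * (r + p)" using rp0 p r by (intro mult_left_mono) auto
  also have "\<dots> \<le> h * (2 * sqrt n)" unfolding e
  proof (rule mult_left_mono)
    have "(1 - \<epsilon>) * sqrt n \<le> 1 * sqrt n" using \<epsilon> n by (intro mult_right_mono) auto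
    then show "2 * x + h \<le> 2 * sqrt n" using x by linarith
  qed (use x in simp)
  finally have "((r - p) * sqrt \<epsilon>) * sqrt n \<le> h * sqrt n" by (simp add: real_sqrt_mult)
  then have "(r - p) * sqrt \<epsilon> \<le> h" using n by simp
  then have "r - p \<le> h / sqrt \<epsilon>" using \<epsilon> by (simp add: field_simps)
  then show ?thesis using rp0 by (simp add: p_def r_def)
qed

lemma sqrt_eventually_ge: "\<exists>N0. \<forall>N\<ge>N0. r \<le> sqrt (real N)"
proof -
  obtain N0 :: nat where N0: "r^2 \<le> real N0" using real_arch_simple by blast
  have "r \<le> sqrt (real N)" if "N \<ge> N0" for N
    by (rule real_le_rsqrt) (use N0 that in linarith)
  then show ?thesis by blast
qed

text \<open>Staying below \<open>(1 - \<epsilon>) \<surd>N\<close> keeps the slope of the square root bounded.\<close>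
lemma weyl_yroot_pos:
  fixes k :: int and Q :: nat and \<epsilon> \<eta> :: real
  assumes k: "k > 0" and Q: "Q > 0" and \<epsilon>: "0 < \<epsilon>" "\<epsilon> < 1" and \<eta>: "\<eta> > 0"
  shows "\<exists>N0. \<forall>N\<ge>N0. \<forall>b J. real (b + Q * J) \<le> (1 - \<epsilon>) * sqrt N \<longrightarrow>
           cmod (\<Sum>j<J. e1 (of_int k * (yroot N (b + Q * j) / Q))) \<le> \<eta> * sqrt N"
proof -
  define M where "M = of_int k / sqrt \<epsilon>"
  have M: "M \<ge> 0" using k \<epsilon> by (simp add: M_def)
  \<comment> \<open>Chosen so small that the main term stays below
    \<open>\<eta> / 2 * sqrt N\<close>; the bound 1/4 keeps it below 1/2.\<close>
  define \<theta> where "\<theta> = min (1/4) (\<eta> / (8 * (2 * M + 3)))"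
  have \<theta>: "0 < \<theta>" "\<theta> < 1/2" using \<eta> M by (auto simp: \<theta>_def min_def)
  have \<theta>M: "(2 * M + 3) * (4 * \<theta>) \<le> \<eta> / 2"
  proof -
    have "\<theta> \<le> \<eta> / (8 * (2 * M + 3))" by (simp add: \<theta>_def)
    then have "\<theta> * (8 * (2 * M + 3)) \<le> \<eta>" using M by (simp add: le_divide_eq)
    then show ?thesis by (simp add: algebra_simps)
  qed
  obtain N1 where N1: "\<And>N. N \<ge> N1 \<Longrightarrow> (2 * M + 3) * (2 + KL \<theta>) * (2 / \<eta>) \<le> sqrt (real N)"
    using sqrt_eventually_ge by blast
  show ?thesis
  proof (intro exI allI impI)
    fix N b J assume N: "max 1 N1 \<le> N" and bJ: "real (b + Q * J) \<le> (1 - \<epsilon>) * sqrt N"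
    define n where "n = real N"
    have n: "n > 0" using N by (simp add: n_def)
    define \<kappa> where "\<kappa> = of_int k / (sqrt 3 * real Q)"
    have \<kappa>: "\<kappa> > 0" using k Q by (simp add: \<kappa>_def)
    define x where "x = (\<lambda>j. real b + real Q * real j)"
    define f where "f = (\<lambda>j. \<kappa> * sqrt (n - (x j)^2))"
    have f: "of_int k * (yroot N (b + Q * j) / Q) = f j" for j
      by (simp add: f_def \<kappa>_def yroot_def x_def n_def real_sqrt_divide)
    define gap where "gap = \<kappa> * ((real Q)^2 / sqrt n)"
    have gap: "gap > 0" using \<kappa> Q n by (simp add: gap_def)
    have xJ: "x j \<le> (1 - \<epsilon>) * sqrt n" if "j \<le> J" for j
    proof -
      have "x j \<le> x J" using that Q by (simp add: x_def)
      then show ?thesis using bJ by (simp add: x_def n_def)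
    qed
    have small: "(1 - \<epsilon>) * sqrt n < 1 * sqrt n" using \<epsilon> n by (intro mult_strict_right_mono) auto
    have "cmod (\<Sum>j<J. e1 (f j)) \<le> (2 * M + 3) * (2 * (\<theta> / gap + 1) + KL \<theta>)"
    proof (rule van_der_corput[OF gap \<theta> M])
      fix j assume j: "Suc j < J"
      have x1: "x (Suc (Suc j)) = x (Suc j) + real Q" "x j = x (Suc j) - real Q"
        by (simp_all add: x_def algebra_simps)
      have "sqrt (n - (x (Suc j) + real Q)^2) + sqrt (n - (x (Suc j) - real Q)^2)
          \<le> 2 * sqrt (n - (x (Suc j))^2) - (real Q)^2 / sqrt n"
      proof (rule sqrt_second_difference)
        show "real Q \<le> x (Suc j)" by (simp add: x_def algebra_simps)
        show "x (Suc j) + real Q \<le> sqrt n" using xJ[of "Suc (Suc j)"] j small x1 by simp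
        show "0 < sqrt n - x (Suc j)" using xJ[of "Suc j"] j small by simp
      qed simp
      from mult_left_mono[OF this, of \<kappa>] \<kappa>
      show "f (Suc (Suc j)) - f (Suc j) \<le> f (Suc j) - f j - gap"
        unfolding f_def gap_def x1 by (simp add: algebra_simps)
    next
      fix j assume j: "j < J"
      have x1: "x (Suc j) = x j + real Q" by (simp add: x_def algebra_simps)
      have "\<bar>sqrt (n - (x j + real Q)^2) - sqrt (n - (x j)^2)\<bar> \<le> real Q / sqrt \<epsilon>"
        by (rule sqrt_first_difference) (use n \<epsilon> xJ[of "Suc j"] j x1 in \<open>auto simp: x_def\<close>)
      then have "\<kappa> * \<bar>sqrt (n - (x j + real Q)^2) - sqrt (n - (x j)^2)\<bar> \<le> \<kappa> * (real Q / sqrt \<epsilon>)"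
        using \<kappa> by (intro mult_left_mono) auto
      also have "\<dots> = M / sqrt 3" using Q by (simp add: \<kappa>_def M_def)
      also have "\<dots> \<le> M" using M by (simp add: divide_le_eq mult_le_cancel_left1)
      also have "\<kappa> * \<bar>sqrt (n - (x j + real Q)^2) - sqrt (n - (x j)^2)\<bar> = \<bar>f (Suc j) - f j\<bar>"
        using \<kappa> by (simp add: f_def x1 abs_mult flip: right_diff_distrib)
      finally show "\<bar>f (Suc j) - f j\<bar> \<le> M" .
    qed
    \<comment> \<open>The second difference is of order \<open>1 / sqrt N\<close>, so
      \<open>\<theta> / gap\<close> is of order \<open>\<theta> * sqrt N\<close>. The free factor
      \<theta> yields the little-o.\<close>
    also have "\<theta> / gap \<le> 2 * \<theta> * sqrt n"
    proof -
      have "1 / gap = sqrt 3 * sqrt n / (of_int k * real Q)"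
        using Q k by (simp add: gap_def \<kappa>_def power2_eq_square field_simps)
      also have "\<dots> \<le> (2 * sqrt n) / 1"
      proof (rule frac_le)
        have "sqrt 3 \<le> 2" by (rule real_le_lsqrt) auto
        then show "sqrt 3 * sqrt n \<le> 2 * sqrt n" using n by (intro mult_right_mono) auto
        have "1 * 1 \<le> of_int k * real Q" using k Q by (intro mult_mono) auto
        then show "1 \<le> of_int k * real Q" by simp
      qed (use n in auto)
      finally have "\<theta> * (1 / gap) \<le> \<theta> * (2 * sqrt n)" using \<theta> by (intro mult_left_mono) auto
      then show ?thesis by (simp add: mult_ac)
    qed
    also have "(2 * M + 3) * (2 * (2 * \<theta> * sqrt n + 1) + KL \<theta>)
        = ((2 * M + 3) * (4 * \<theta>)) * sqrt n + (2 * M + 3) * (2 + KL \<theta>)" by (simp add: algebra_simps)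
    also have "\<dots> \<le> \<eta> / 2 * sqrt n + \<eta> / 2 * sqrt n"
    proof (rule add_mono)
      show "((2 * M + 3) * (4 * \<theta>)) * sqrt n \<le> \<eta> / 2 * sqrt n" using \<theta>M n by (intro mult_right_mono) auto
      have "\<eta> / 2 * ((2 * M + 3) * (2 + KL \<theta>) * (2 / \<eta>)) \<le> \<eta> / 2 * sqrt n"
        using N1[of N] N \<eta> unfolding n_def by (intro mult_left_mono) auto
      then show "(2 * M + 3) * (2 + KL \<theta>) \<le> \<eta> / 2 * sqrt n" using \<eta> by simp
    qed
    finally show "cmod (\<Sum>j<J. e1 (of_int k * (yroot N (b + Q * j) / Q))) \<le> \<eta> * sqrt N"
      unfolding f using M by (simp add: n_def)
  qed
qed

text \<open>Weyl's criterion along arithmetic progressions of columns. It is uniform in the start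
  \<open>b\<close> and the length \<open>J\<close>, since Abel summation later requires all initial
  segments at once.\<close>

definition equidist :: "real \<Rightarrow> nat \<Rightarrow> (real \<Rightarrow> complex) \<Rightarrow> bool" where
  "equidist \<epsilon> Q g \<longleftrightarrow> (\<forall>\<eta>>0. \<exists>N0. \<forall>N\<ge>N0. \<forall>b J. real (b + Q * J) \<le> (1 - \<epsilon>) * sqrt N \<longrightarrow>
     cmod (\<Sum>j<J. g (yroot N (b + Q * j) / Q) - integral {0..1} g) \<le> \<eta> * sqrt N)"

lemma equidist_e1:
  assumes Q: "Q > 0" and \<epsilon>: "0 < \<epsilon>" "\<epsilon> < 1"
  shows "equidist \<epsilon> Q (\<lambda>x. e1 (of_int k * x))"
  unfolding equidist_def
proof (intro allI impI)
  fix \<eta> :: real assume \<eta>: "\<eta> > 0"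
  have int: "integral {0..1} (\<lambda>x. e1 (of_int k * x)) = (if k = 0 then 1 else 0)"
    by (rule integral_unique[OF e1_integral])
  consider "k = 0" | "k > 0" | "k < 0" by linarith
  then show "\<exists>N0. \<forall>N\<ge>N0. \<forall>b J. real (b + Q * J) \<le> (1 - \<epsilon>) * sqrt N \<longrightarrow>
     cmod (\<Sum>j<J. e1 (of_int k * (yroot N (b + Q * j) / Q)) - integral {0..1} (\<lambda>x. e1 (of_int k * x))) \<le> \<eta> * sqrt N"
  proof cases
    case 1
    have "e1 0 = 1" by (simp add: e1_def)
    then show ?thesis using \<eta> by (auto simp: int 1)
  next
    case 2
    then show ?thesis using weyl_yroot_pos[OF 2 Q \<epsilon> \<eta>] by (simp add: int)
  next
    case 3
    have "cmod (\<Sum>j<J. e1 (of_int k * (yroot N (b + Q * j) / Q))) = cmod (\<Sum>j<J. e1 (of_int (- k) * (yroot N (b + Q * j) / Q)))" for N b J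
    proof -
      have "(\<Sum>j<J. e1 (of_int (- k) * (yroot N (b + Q * j) / Q))) = cnj (\<Sum>j<J. e1 (of_int k * (yroot N (b + Q * j) / Q)))"
        by (simp add: e1_minus)
      then show ?thesis by (simp only: complex_mod_cnj)
    qed
    then show ?thesis using weyl_yroot_pos[of "- k", OF _ Q \<epsilon> \<eta>] 3 by (simp add: int)
  qed
qed

lemma equidist_trig:
  assumes "trig g" and Q: "Q > 0" and \<epsilon>: "0 < \<epsilon>" "\<epsilon> < 1"
  shows "equidist \<epsilon> Q g"
  using assms(1)
proof induction
  case (mono c k)
  show ?case unfolding equidist_def
  proof (intro allI impI)
    fix \<eta> :: real assume \<eta>: "\<eta> > 0"
    have "\<eta> / (cmod c + 1) > 0" using \<eta> by (simp add: add_nonneg_pos)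
    from equidist_e1[OF Q \<epsilon>, of k, unfolded equidist_def, rule_format, OF this]
    obtain N0 where N0: "\<And>N b J. N \<ge> N0 \<Longrightarrow> real (b + Q * J) \<le> (1 - \<epsilon>) * sqrt N \<Longrightarrow>
      cmod (\<Sum>j<J. e1 (of_int k * (yroot N (b + Q * j) / Q)) - integral {0..1} (\<lambda>x. e1 (of_int k * x))) \<le> \<eta> / (cmod c + 1) * sqrt N"
      by blast
    show "\<exists>N0. \<forall>N\<ge>N0. \<forall>b J. real (b + Q * J) \<le> (1 - \<epsilon>) * sqrt N \<longrightarrow>
      cmod (\<Sum>j<J. c * e1 (of_int k * (yroot N (b + Q * j) / Q)) - integral {0..1} (\<lambda>x. c * e1 (of_int k * x))) \<le> \<eta> * sqrt N"
    proof (intro exI allI impI)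
      fix N b J assume N: "N0 \<le> N" and bJ: "real (b + Q * J) \<le> (1 - \<epsilon>) * sqrt N"
      have "cmod (\<Sum>j<J. c * e1 (of_int k * (yroot N (b + Q * j) / Q)) - integral {0..1} (\<lambda>x. c * e1 (of_int k * x)))
        = cmod c * cmod (\<Sum>j<J. e1 (of_int k * (yroot N (b + Q * j) / Q)) - integral {0..1} (\<lambda>x. e1 (of_int k * x)))"
        by (simp add: sum_distrib_left flip: right_diff_distrib norm_mult)
      also have "\<dots> \<le> cmod c * (\<eta> / (cmod c + 1) * sqrt N)" by (intro mult_left_mono N0 N bJ) auto
      also have "\<dots> = cmod c / (cmod c + 1) * (\<eta> * sqrt N)" by simp
      also have "\<dots> \<le> 1 * (\<eta> * sqrt N)"
      proof (rule mult_right_mono)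
        show "cmod c / (cmod c + 1) \<le> 1" by (simp add: divide_le_eq add_nonneg_pos)
      qed (use \<eta> in simp)
      finally show "cmod (\<Sum>j<J. c * e1 (of_int k * (yroot N (b + Q * j) / Q)) - integral {0..1} (\<lambda>x. c * e1 (of_int k * x))) \<le> \<eta> * sqrt N"
        by simp
    qed
  qed
next
  case (add f g)
  have int: "f integrable_on {0..1}" "g integrable_on {0..1}"
    using add.hyps by (auto intro!: integrable_continuous_interval continuous_on_subset[OF continuous_on_trig])
  show ?case unfolding equidist_def
  proof (intro allI impI)
    fix \<eta> :: real assume "\<eta> > 0"
    then have \<eta>: "\<eta> / 2 > 0" by simp
    obtain N1 where N1: "\<And>N b J. N \<ge> N1 \<Longrightarrow> real (b + Q * J) \<le> (1 - \<epsilon>) * sqrt N \<Longrightarrow>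
      cmod (\<Sum>j<J. f (yroot N (b + Q * j) / Q) - integral {0..1} f) \<le> \<eta> / 2 * sqrt N"
      using add.IH(1)[unfolded equidist_def, rule_format, OF \<eta>] by blast
    obtain N2 where N2: "\<And>N b J. N \<ge> N2 \<Longrightarrow> real (b + Q * J) \<le> (1 - \<epsilon>) * sqrt N \<Longrightarrow>
      cmod (\<Sum>j<J. g (yroot N (b + Q * j) / Q) - integral {0..1} g) \<le> \<eta> / 2 * sqrt N"
      using add.IH(2)[unfolded equidist_def, rule_format, OF \<eta>] by blast
    show "\<exists>N0. \<forall>N\<ge>N0. \<forall>b J. real (b + Q * J) \<le> (1 - \<epsilon>) * sqrt N \<longrightarrow>
      cmod (\<Sum>j<J. f (yroot N (b + Q * j) / Q) + g (yroot N (b + Q * j) / Q) - integral {0..1} (\<lambda>x. f x + g x)) \<le> \<eta> * sqrt N"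
    proof (intro exI allI impI)
      fix N b J assume N: "max N1 N2 \<le> N" and bJ: "real (b + Q * J) \<le> (1 - \<epsilon>) * sqrt N"
      have "(\<Sum>j<J. f (yroot N (b + Q * j) / Q) + g (yroot N (b + Q * j) / Q) - integral {0..1} (\<lambda>x. f x + g x))
        = (\<Sum>j<J. f (yroot N (b + Q * j) / Q) - integral {0..1} f) + (\<Sum>j<J. g (yroot N (b + Q * j) / Q) - integral {0..1} g)"
        unfolding Henstock_Kurzweil_Integration.integral_add[OF int] sum.distrib[symmetric] by (intro sum.cong) auto
      also have "cmod \<dots> \<le> \<eta> / 2 * sqrt N + \<eta> / 2 * sqrt N"
        by (rule order_trans[OF norm_triangle_ineq add_mono]; rule N1[OF _ bJ] N2[OF _ bJ]) (use N in auto)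
      finally show "cmod (\<Sum>j<J. f (yroot N (b + Q * j) / Q) + g (yroot N (b + Q * j) / Q) - integral {0..1} (\<lambda>x. f x + g x)) \<le> \<eta> * sqrt N"
        by simp
    qed
  qed
qed

text \<open>The uniform error of a trigonometric approximation is summed over
  \<open>J <= sqrt N\<close> terms, so it stays within a small multiple of
  \<open>sqrt N\<close>.\<close>

lemma equidist_continuous:
  fixes h :: "real \<Rightarrow> real"
  assumes cont: "continuous_on UNIV h" and per: "\<And>x. h (x + 1) = h x"
    and Q: "Q > 0" and \<epsilon>: "0 < \<epsilon>" "\<epsilon> < 1" and \<eta>: "\<eta> > 0"
  shows "\<exists>N0. \<forall>N\<ge>N0. \<forall>b J. real (b + Q * J) \<le> (1 - \<epsilon>) * sqrt N \<longrightarrow>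
     \<bar>\<Sum>j<J. h (yroot N (b + Q * j) / Q) - integral {0..1} h\<bar> \<le> \<eta> * sqrt N"
proof -
  have "\<eta> / 4 > 0" using \<eta> by simp
  then obtain g where g: "trig g" and gh: "\<And>x. cmod (of_real (h x) - g x) < \<eta> / 4"
    using trig_approximation[OF cont per] by blast
  have "\<eta> / 2 > 0" using \<eta> by simp
  then obtain N0 where N0: "\<And>N b J. N \<ge> N0 \<Longrightarrow> real (b + Q * J) \<le> (1 - \<epsilon>) * sqrt N \<Longrightarrow>
      cmod (\<Sum>j<J. g (yroot N (b + Q * j) / Q) - integral {0..1} g) \<le> \<eta> / 2 * sqrt N"
    using equidist_trig[OF g Q \<epsilon>, unfolded equidist_def, rule_format, of "\<eta> / 2"] by blast
  have inth: "h integrable_on {0..1}"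
    by (intro integrable_continuous_interval continuous_on_subset[OF cont]) simp
  have intg: "g integrable_on {0..1}"
    by (intro integrable_continuous_interval continuous_on_trig[OF g])
  have inth': "(\<lambda>x. complex_of_real (h x)) integrable_on {0..1}"
    by (rule integrable_continuous_interval, rule continuous_on_of_real, rule continuous_on_subset[OF cont]) simp
  have oi: "complex_of_real (integral {0..1} h) = integral {0..1} (\<lambda>x. complex_of_real (h x))"
    using has_integral_of_real[OF integrable_integral[OF inth], where ?'b = complex] by (simp add: integral_unique)
  have dI: "cmod (of_real (integral {0..1} h) - integral {0..1} g) \<le> \<eta> / 4"
  proof -
    have "of_real (integral {0..1} h) - integral {0..1} g = integral {0..1} (\<lambda>x. of_real (h x) - g x)"
      unfolding oi by (rule Henstock_Kurzweil_Integration.integral_diff[symmetric, OF inth' intg])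
    also have "cmod \<dots> \<le> integral {0..1} (\<lambda>x::real. \<eta> / 4)"
      by (rule integral_norm_bound_integral[OF integrable_diff[OF inth' intg]]) (use gh in \<open>auto intro: less_imp_le\<close>)
    finally show ?thesis by simp
  qed
  show ?thesis
  proof (intro exI allI impI)
    fix N b J assume N: "N0 \<le> N" and bJ: "real (b + Q * J) \<le> (1 - \<epsilon>) * sqrt N"
    define y where "y = (\<lambda>j. yroot N (b + Q * j) / Q)"
    have "J \<le> b + Q * J" using Q by (simp add: trans_le_add2)
    then have "real J \<le> real (b + Q * J)" by (rule of_nat_mono)
    also have "\<dots> \<le> (1 - \<epsilon>) * sqrt N" by (rule bJ)
    also have "\<dots> \<le> 1 * sqrt N" using \<epsilon> by (intro mult_right_mono) auto
    finally have J: "real J \<le> sqrt N" by simp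
    define D where "D = (\<lambda>j. (of_real (h (y j)) - g (y j)) - (of_real (integral {0..1} h) - integral {0..1} g))"
    have eq: "of_real (\<Sum>j<J. h (y j) - integral {0..1} h) = (\<Sum>j<J. D j) + (\<Sum>j<J. g (y j) - integral {0..1} g)"
      unfolding of_real_sum of_real_diff sum.distrib[symmetric] D_def by (intro sum.cong) auto
    have "\<bar>\<Sum>j<J. h (y j) - integral {0..1} h\<bar> = cmod (of_real (\<Sum>j<J. h (y j) - integral {0..1} h))"
      by (rule norm_of_real[symmetric])
    also have "\<dots> \<le> cmod (\<Sum>j<J. D j) + cmod (\<Sum>j<J. g (y j) - integral {0..1} g)"
      unfolding eq by (rule norm_triangle_ineq)
    also have "\<dots> \<le> (\<Sum>j<J. \<eta> / 4 + \<eta> / 4) + \<eta> / 2 * sqrt N"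
    proof (rule add_mono)
      show "cmod (\<Sum>j<J. D j) \<le> (\<Sum>j<J. \<eta> / 4 + \<eta> / 4)"
      proof (rule sum_norm_le)
        fix j
        show "cmod (D j) \<le> \<eta> / 4 + \<eta> / 4"
          unfolding D_def using gh[of "y j"] dI by (intro order_trans[OF norm_triangle_ineq4 add_mono]) auto
      qed
      show "cmod (\<Sum>j<J. g (y j) - integral {0..1} g) \<le> \<eta> / 2 * sqrt N"
        unfolding y_def by (rule N0[OF N bJ])
    qed
    also have "\<dots> = \<eta> / 2 * real J + \<eta> / 2 * sqrt N" by simp
    also have "\<dots> \<le> \<eta> / 2 * sqrt N + \<eta> / 2 * sqrt N" using J \<eta> by (intro add_mono mult_left_mono) auto
    finally show "\<bar>\<Sum>j<J. h (yroot N (b + Q * j) / Q) - integral {0..1} h\<bar> \<le> \<eta> * sqrt N"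
      by (simp add: y_def)
  qed
qed

text \<open>A periodic continuous majorant of the arc of radius \<rho> about \<open>c\<close>. The
  cosine decreases with the distance to the nearest integer, so clamping an affine function of it
  gives a plateau with ramps. The ramps cost \<open>2 * \<delta>\<close>, and parts that wrap around
  0 or 1 another \<open>2 * \<delta>\<close>.\<close>

lemma bump_exists:
  fixes c \<rho> \<delta> :: real
  assumes \<rho>: "0 \<le> \<rho>" "0 < \<delta>" "\<rho> + \<delta> < 1/2" and c: "\<rho> \<le> c" "c + \<rho> \<le> 1"
  shows "\<exists>h. continuous_on UNIV h \<and> (\<forall>x. h (x + 1) = h x) \<and> (\<forall>x. 0 \<le> h x) \<and>
     (\<forall>x (m::int). \<bar>x - c - m\<bar> \<le> \<rho> \<longrightarrow> h x = 1) \<and> integral {0..1} h \<le> 2 * \<rho> + 4 * \<delta>"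
proof -
  define T where "T = (\<lambda>t::real. cos (2 * pi * t))"
  have Tmono: "T s < T t \<longleftrightarrow> \<bar>t\<bar> < \<bar>s\<bar>" if "\<bar>s\<bar> \<le> 1/2" "\<bar>t\<bar> \<le> 1/2" for s t
  proof -
    have ab: "T u = cos (2 * pi * \<bar>u\<bar>)" for u by (cases "u \<ge> 0") (auto simp: T_def)
    have rng: "0 \<le> 2 * pi * \<bar>u\<bar>" "2 * pi * \<bar>u\<bar> \<le> pi" if "\<bar>u\<bar> \<le> 1/2" for u :: real
      using mult_left_mono[OF that, of "2 * pi"] by auto
    have "T s < T t \<longleftrightarrow> 2 * pi * \<bar>t\<bar> < 2 * pi * \<bar>s\<bar>"
      unfolding ab by (rule cos_mono_less_eq) (use rng that in auto)
    then show ?thesis by simp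
  qed
  have Tper: "T (t - of_int m) = T t" for t and m :: int
  proof -
    have T: "T u = Re (e1 u)" for u by (simp add: T_def e1_def)
    show ?thesis unfolding T using e1_add_int[of t "- m"] by simp
  qed
  define \<rho>' where "\<rho>' = \<rho> + \<delta>"
  have D: "T \<rho>' < T \<rho>" using Tmono[of \<rho>' \<rho>] \<rho> by (simp add: \<rho>'_def)
  define h where "h = (\<lambda>x. min 1 (max 0 ((T (x - c) - T \<rho>') / (T \<rho> - T \<rho>'))))"
  have cont: "continuous_on UNIV h" unfolding h_def T_def
    by (intro continuous_intros) (use D in \<open>auto simp: T_def\<close>)
  have per: "h (x + 1) = h x" for x
    using Tper[of "x + 1 - c" 1] by (simp add: h_def)
  have h0: "0 \<le> h x" "h x \<le> 1" for x by (auto simp: h_def)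
  have one: "h x = 1" if "\<bar>x - c - of_int m\<bar> \<le> \<rho>" for x and m :: int
  proof -
    have "\<not> T (x - c - of_int m) < T \<rho>" using Tmono[of "x - c - of_int m" \<rho>] that \<rho> by auto
    then have "T \<rho> \<le> T (x - c)" by (simp add: Tper)
    then have "1 \<le> (T (x - c) - T \<rho>') / (T \<rho> - T \<rho>')" using D by (simp add: le_divide_eq)
    then show ?thesis by (simp add: h_def)
  qed
  have zero: "\<bar>x - c - of_int (round (x - c))\<bar> < \<rho>'" if "h x \<noteq> 0" for x
  proof (rule ccontr)
    assume "\<not> \<bar>x - c - of_int (round (x - c))\<bar> < \<rho>'"
    moreover have "\<bar>x - c - of_int (round (x - c))\<bar> \<le> 1/2"
      using of_int_round_abs_le[of "x - c"] by (simp add: abs_minus_commute)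
    ultimately have "\<not> T \<rho>' < T (x - c - of_int (round (x - c)))"
      using Tmono[of \<rho>' "x - c - of_int (round (x - c))"] \<rho> by (auto simp: \<rho>'_def)
    then have "T (x - c) \<le> T \<rho>'" by (simp add: Tper)
    then have "(T (x - c) - T \<rho>') / (T \<rho> - T \<rho>') \<le> 0" using D by (simp add: divide_le_0_iff)
    then show False using that by (simp add: h_def)
  qed
  have "integral {0..1} h \<le> 2 * \<rho> + 4 * \<delta>"
  proof -
    define st where "st = (\<lambda>a b x::real. if x \<in> {a..b} then 1 else (0::real))"
    have st: "(st a b has_integral (b - a)) {-1..2}" if "-1 \<le> a" "a \<le> b" "b \<le> 2" for a b
    proof -
      have "((\<lambda>x::real. 1::real) has_integral (b - a)) {a..b}" using has_integral_const_real[of "1::real" a b] that by simp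
      then show ?thesis unfolding st_def by (subst has_integral_restrict) (use that in auto)
    qed
    have st0: "0 \<le> st a b x" for a b x by (simp add: st_def)
    have st1: "1 \<le> st a b x" if "x \<in> {a..b}" for a b x using that by (simp add: st_def)
    have "h integrable_on {0..1}" by (intro integrable_continuous_interval continuous_on_subset[OF cont]) simp
    then have "(h has_integral integral {0..1} h) {0..1}" by (rule integrable_integral)
    then have I1: "((\<lambda>x. if x \<in> {0..1} then h x else 0) has_integral integral {0..1} h) {-1..2}"
      by (subst has_integral_restrict) auto
    have I2: "((\<lambda>x. st (c - \<rho>') (c + \<rho>') x + st (1 - \<delta>) 1 x + st 0 \<delta> x) has_integral
        ((c + \<rho>') - (c - \<rho>')) + (1 - (1 - \<delta>)) + (\<delta> - 0)) {-1..2}"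
      by (intro has_integral_add st) (use \<rho> c in \<open>auto simp: \<rho>'_def\<close>)
    have "integral {0..1} h \<le> ((c + \<rho>') - (c - \<rho>')) + (1 - (1 - \<delta>)) + (\<delta> - 0)"
    proof (rule has_integral_le[OF I1 I2])
      fix x :: real
      show "(if x \<in> {0..1} then h x else 0) \<le> st (c - \<rho>') (c + \<rho>') x + st (1 - \<delta>) 1 x + st 0 \<delta> x"
      proof (cases "x \<in> {0..1} \<and> h x \<noteq> 0")
        case True
        define m where "m = round (x - c)"
        have m: "\<bar>x - c - of_int m\<bar> < \<rho>'" using zero True by (simp add: m_def)
        have x: "0 \<le> x" "x \<le> 1" using True by auto
        have "real_of_int m < 2" "real_of_int m > -2" using m x c \<rho> unfolding \<rho>'_def by linarith+
        then consider "m = 0" | "m = 1" | "m = -1" by linarith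
        then have "1 \<le> st (c - \<rho>') (c + \<rho>') x \<or> 1 \<le> st (1 - \<delta>) 1 x \<or> 1 \<le> st 0 \<delta> x"
        proof cases
          case 1
          then have "x \<in> {c - \<rho>'..c + \<rho>'}" using m by auto
          then show ?thesis using st1 by blast
        next
          case 2
          then have "x \<in> {1 - \<delta>..1}" using m x c \<rho> by (auto simp: \<rho>'_def)
          then show ?thesis using st1 by blast
        next
          case 3
          then have "x \<in> {0..\<delta>}" using m x c \<rho> by (auto simp: \<rho>'_def)
          then show ?thesis using st1 by blast
        qed
        then show ?thesis using h0(2)[of x] True st0[of "c - \<rho>'" "c + \<rho>'" x] st0[of "1 - \<delta>" 1 x] st0[of 0 \<delta> x]
          by auto
      qed (use st0 in \<open>auto simp: add_nonneg_nonneg\<close>)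
    qed
    also have "\<dots> = 2 * \<rho> + 4 * \<delta>" by (simp add: \<rho>'_def)
    finally show ?thesis .
  qed
  then show ?thesis using cont per h0 one by blast
qed

section \<open>Integer parts of the roots in residue classes\<close>

definition yfloor :: "nat \<Rightarrow> nat \<Rightarrow> nat" where
  "yfloor N a = nat \<lfloor>yroot N a\<rfloor>"

lemma yroot_antimono: "a \<le> b \<Longrightarrow> yroot N b \<le> yroot N a"
  unfolding yroot_def by (intro real_sqrt_le_mono divide_right_mono diff_left_mono power_mono) auto

lemma yfloor_antimono: "a \<le> b \<Longrightarrow> yfloor N b \<le> yfloor N a"
  unfolding yfloor_def by (intro nat_mono floor_mono yroot_antimono)

lemma yfloor_le: "real (yfloor N a) \<le> sqrt N"
proof -
  have "yroot N a \<le> sqrt N" unfolding yroot_def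
  proof (rule real_sqrt_le_mono)
    have "- (real a)\<^sup>2 \<le> 2 * real N" by (rule order_trans[of _ 0]) auto
    then show "(real N - (real a)\<^sup>2) / 3 \<le> real N" by (simp add: divide_le_eq)
  qed
  moreover have "real (yfloor N a) \<le> max 0 (yroot N a)" unfolding yfloor_def by linarith
  ultimately show ?thesis by (meson max.bounded_iff order_trans real_sqrt_ge_zero of_nat_0_le_iff)
qed

lemma periodic_mod:
  fixes f :: "nat \<Rightarrow> 'a"
  assumes "\<And>n. f (n + Q) = f n"
  shows "f (n + Q * j) = f n" "f (n mod Q) = f n"
proof -
  show *: "f (n + Q * j) = f n" for n j
  proof (induction j)
    case (Suc j)
    then show ?case using assms[of "n + Q * j"] by (simp add: algebra_simps)
  qed simp
  show "f (n mod Q) = f n" using *[of "n mod Q" "n div Q"] by simp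
qed

lemma periodic_bounded:
  fixes f :: "nat \<Rightarrow> complex"
  assumes "\<And>n. f (n + Q) = f n" "Q > 0"
  obtains C where "C > 0" "\<And>n. cmod (f n) \<le> C"
proof
  show "(\<Sum>r<Q. cmod (f r)) + 1 > 0" by (simp add: sum_nonneg add_nonneg_pos)
  fix n
  have "cmod (f n) = cmod (f (n mod Q))" by (simp add: periodic_mod(2)[of f, OF assms(1)])
  also have "\<dots> \<le> (\<Sum>r<Q. cmod (f r))" using assms(2) by (intro member_le_sum) auto
  finally show "cmod (f n) \<le> (\<Sum>r<Q. cmod (f r)) + 1" by simp
qed

lemma length_le_sqrt:
  fixes b Q J N :: nat
  assumes Q: "Q > 0" and \<epsilon>: "0 < \<epsilon>" "\<epsilon> < 1" and bJ: "real (b + Q * J) \<le> (1 - \<epsilon>) * sqrt N"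
  shows "real (b + Q * J) \<le> sqrt N" "real J \<le> sqrt N"
proof -
  have "(1 - \<epsilon>) * sqrt N \<le> 1 * sqrt N" using \<epsilon> by (intro mult_right_mono) auto
  then show 1: "real (b + Q * J) \<le> sqrt N" using bJ by linarith
  have "J \<le> b + Q * J" using Q by (simp add: trans_le_add2)
  then have "real J \<le> real (b + Q * J)" by (rule of_nat_mono)
  then show "real J \<le> sqrt N" using 1 by linarith
qed

text \<open>For \<open>y >= 0\<close> the integer part is congruent to \<open>r\<close> modulo
  \<open>Q\<close> exactly if \<open>y / Q\<close> lies modulo 1 in the arc from \<open>r/Q\<close>
  to \<open>(r+1)/Q\<close>, of centre \<open>c\<close> and radius \<rho>. The bump majorises its
  indicator and has integral at most \<open>1/Q + \<eta>/2\<close>.\<close>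

lemma residue_count_upper:
  fixes \<epsilon> \<eta> :: real
  assumes Q: "Q \<ge> 2" and r: "r < Q" and \<epsilon>: "0 < \<epsilon>" "\<epsilon> < 1" and \<eta>: "\<eta> > 0"
  shows "\<exists>N0. \<forall>N\<ge>N0. \<forall>b J. real (b + Q * J) \<le> (1 - \<epsilon>) * sqrt N \<longrightarrow>
    real (card {j \<in> {..<J}. yfloor N (b + Q * j) mod Q = r}) \<le> real J / Q + \<eta> * sqrt N"
proof -
  define \<rho> where "\<rho> = 1 / (2 * real Q)"
  define \<delta> where "\<delta> = min (1/8) (\<eta> / 8)"
  define c where "c = (real r + 1/2) / Q"
  have Q0: "Q > 0" using Q by simp
  have \<rho>: "0 \<le> \<rho>" "0 < \<delta>" "\<rho> + \<delta> < 1/2"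
  proof -
    have "\<rho> \<le> 1/4" unfolding \<rho>_def using Q by (intro frac_le) auto
    moreover have "\<delta> \<le> 1/8" by (simp add: \<delta>_def)
    ultimately show "\<rho> + \<delta> < 1/2" by linarith
  qed (use \<eta> in \<open>auto simp: \<rho>_def \<delta>_def\<close>)
  have c: "\<rho> \<le> c" "c + \<rho> \<le> 1"
  proof -
    have "real r + 1 \<le> real Q" using r by linarith
    then show "\<rho> \<le> c" "c + \<rho> \<le> 1" using Q0 by (auto simp: \<rho>_def c_def field_simps)
  qed
  obtain h where h: "continuous_on UNIV h" "\<And>x. h (x + 1) = h x" "\<And>x. 0 \<le> h x"
      "\<And>x (m::int). \<bar>x - c - of_int m\<bar> \<le> \<rho> \<Longrightarrow> h x = 1" "integral {0..1} h \<le> 2 * \<rho> + 4 * \<delta>"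
    using bump_exists[OF \<rho> c] by blast
  have I: "integral {0..1} h \<le> 1 / Q + \<eta> / 2"
  proof -
    have "2 * \<rho> = 1 / Q" by (simp add: \<rho>_def)
    moreover have "4 * \<delta> \<le> \<eta> / 2" by (simp add: \<delta>_def min_def)
    ultimately show ?thesis using h(5) by linarith
  qed
  have "\<eta> / 2 > 0" using \<eta> by simp
  then obtain N0 where N0: "\<And>N b J. N \<ge> N0 \<Longrightarrow> real (b + Q * J) \<le> (1 - \<epsilon>) * sqrt N \<Longrightarrow>
     \<bar>\<Sum>j<J. h (yroot N (b + Q * j) / Q) - integral {0..1} h\<bar> \<le> \<eta> / 2 * sqrt N"
    using equidist_continuous[OF h(1,2) Q0 \<epsilon>] by blast
  show ?thesis
  proof (intro exI allI impI)
    fix N b J assume N: "N0 \<le> N" and bJ: "real (b + Q * J) \<le> (1 - \<epsilon>) * sqrt N"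
    note le = length_le_sqrt[OF Q0 \<epsilon> bJ]
    define y where "y = (\<lambda>j. yroot N (b + Q * j) / Q)"
    define S where "S = {j \<in> {..<J}. yfloor N (b + Q * j) mod Q = r}"
    have hS: "h (y j) = 1" if "j \<in> S" for j
    proof -
      have j: "j < J" "yfloor N (b + Q * j) mod Q = r" using that by (auto simp: S_def)
      define B where "B = yfloor N (b + Q * j)"
      define m where "m = B div Q"
      have "b + Q * j \<le> b + Q * J" using j by simp
      then have "real (b + Q * j) \<le> sqrt N" using le(1) of_nat_mono order_trans by blast
      then have "(real (b + Q * j))^2 \<le> (sqrt N)^2" by (intro power_mono) auto
      then have "0 \<le> yroot N (b + Q * j)" by (simp add: yroot_def)
      then have B: "real B \<le> yroot N (b + Q * j)" "yroot N (b + Q * j) < real B + 1"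
        unfolding B_def yfloor_def by linarith+
      have "B = Q * m + r" using j(2) by (simp add: m_def B_def[symmetric] mult_div_mod_eq flip: j(2))
      then have Bm: "real B = real Q * real m + real r" by simp
      have yc: "y j - c - real m = (yroot N (b + Q * j) - real B - 1/2) / Q"
        unfolding y_def c_def Bm using Q0 by (simp add: field_simps)
      have "\<bar>y j - c - of_int (int m)\<bar> = \<bar>yroot N (b + Q * j) - real B - 1/2\<bar> / Q"
        using yc by (simp add: abs_divide)
      also have "\<dots> \<le> (1/2) / Q"
      proof (rule divide_right_mono)
        show "\<bar>yroot N (b + Q * j) - real B - 1/2\<bar> \<le> 1/2" using B by linarith
      qed simp
      finally show ?thesis by (intro h(4)[of _ "int m"]) (simp add: \<rho>_def)
    qed
    have "real (card S) = (\<Sum>j\<in>S. h (y j))" using hS by simp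
    also have "\<dots> \<le> (\<Sum>j<J. h (y j))" by (rule sum_mono2) (auto simp: S_def h(3))
    also have "\<dots> = (\<Sum>j<J. h (y j) - integral {0..1} h) + real J * integral {0..1} h"
      by (simp add: sum_subtractf)
    also have "\<dots> \<le> \<eta> / 2 * sqrt N + real J * (1 / Q + \<eta> / 2)"
    proof (rule add_mono)
      show "(\<Sum>j<J. h (y j) - integral {0..1} h) \<le> \<eta> / 2 * sqrt N"
        using N0[OF N bJ] unfolding y_def by linarith
    qed (use I in \<open>auto intro: mult_left_mono\<close>)
    also have "\<dots> = real J / Q + (\<eta> / 2 * sqrt N + \<eta> / 2 * real J)" by (simp add: algebra_simps)
    also have "\<dots> \<le> real J / Q + (\<eta> / 2 * sqrt N + \<eta> / 2 * sqrt N)"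
      using le(2) \<eta> by (intro add_left_mono mult_left_mono) auto
    finally show "real (card {j \<in> {..<J}. yfloor N (b + Q * j) mod Q = r}) \<le> real J / Q + \<eta> * sqrt N"
      by (simp add: S_def)
  qed
qed

text \<open>Upper bounds for all classes imply lower bounds: the counts add up to \<open>J\<close>,
  so no class can fall short by more than the others may exceed. The zero mean of \<open>P\<close>
  removes the common main term \<open>J / Q\<close>.\<close>

lemma sum_periodic_yfloor:
  fixes P :: "nat \<Rightarrow> complex" and \<epsilon> \<eta> :: real
  assumes Q: "Q \<ge> 2" and per: "\<And>n. P (n + Q) = P n" and mean: "(\<Sum>r<Q. P r) = 0"
    and \<epsilon>: "0 < \<epsilon>" "\<epsilon> < 1" and \<eta>: "\<eta> > 0"
  shows "\<exists>N0. \<forall>N\<ge>N0. \<forall>b J. real (b + Q * J) \<le> (1 - \<epsilon>) * sqrt N \<longrightarrow>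
    cmod (\<Sum>j<J. P (yfloor N (b + Q * j))) \<le> \<eta> * sqrt N"
proof -
  define K where "K = (\<Sum>r<Q. cmod (P r))"
  have K: "K \<ge> 0" by (simp add: K_def sum_nonneg)
  define \<eta>' where "\<eta>' = \<eta> / (real Q * (K + 1))"
  have \<eta>': "\<eta>' > 0" using \<eta> K Q by (simp add: \<eta>'_def)
  have "\<forall>r\<in>{..<Q}. \<exists>N0. \<forall>N\<ge>N0. \<forall>b J. real (b + Q * J) \<le> (1 - \<epsilon>) * sqrt N \<longrightarrow>
    real (card {j \<in> {..<J}. yfloor N (b + Q * j) mod Q = r}) \<le> real J / Q + \<eta>' * sqrt N"
    using residue_count_upper[OF Q _ \<epsilon> \<eta>'] by simp
  from bchoice[OF this] obtain M where M: "\<forall>r\<in>{..<Q}. \<forall>N\<ge>M r. \<forall>b J. real (b + Q * J) \<le> (1 - \<epsilon>) * sqrt N \<longrightarrow>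
    real (card {j \<in> {..<J}. yfloor N (b + Q * j) mod Q = r}) \<le> real J / Q + \<eta>' * sqrt N" ..
  show ?thesis
  proof (intro exI allI impI)
    fix N b J assume N: "(\<Sum>r<Q. M r) \<le> N" and bJ: "real (b + Q * J) \<le> (1 - \<epsilon>) * sqrt N"
    define S where "S = (\<lambda>r. {j \<in> {..<J}. yfloor N (b + Q * j) mod Q = r})"
    define e where "e = (\<lambda>r. real J / Q + \<eta>' * sqrt N - real (card (S r)))"
    have e0: "e r \<ge> 0" if r: "r < Q" for r
    proof -
      have "M r \<le> (\<Sum>r<Q. M r)" using r by (intro member_le_sum) auto
      then show ?thesis using M[rule_format, of r N b J] r bJ N by (simp add: e_def S_def)
    qed
    have group: "(\<Sum>r<Q. \<Sum>j\<in>S r. g j) = (\<Sum>j<J. g j)" for g :: "nat \<Rightarrow> 'b::comm_monoid_add"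
      unfolding S_def by (rule sum.group) (use Q in auto)
    have "(\<Sum>r<Q. real (card (S r))) = real J" using group[of "\<lambda>_. 1::real"] by simp
    then have es: "(\<Sum>r<Q. e r) = real Q * \<eta>' * sqrt N"
      using Q by (simp add: e_def sum_subtractf sum.distrib distrib_left)
    have eb: "\<bar>real (card (S r)) - real J / Q\<bar> \<le> real Q * \<eta>' * sqrt N" if r: "r < Q" for r
    proof -
      have "e r \<le> (\<Sum>r<Q. e r)" using r e0 by (intro member_le_sum) auto
      then have 1: "e r \<le> real Q * \<eta>' * sqrt N" by (simp add: es)
      have "1 * (\<eta>' * sqrt N) \<le> real Q * (\<eta>' * sqrt N)" using Q \<eta>' by (intro mult_right_mono) auto
      moreover have "0 \<le> \<eta>' * sqrt N" using \<eta>' by simp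
      ultimately show ?thesis using 1 e0[OF r] unfolding e_def by (simp add: abs_le_iff)
    qed
    have "(\<Sum>j<J. P (yfloor N (b + Q * j))) = (\<Sum>r<Q. \<Sum>j\<in>S r. P (yfloor N (b + Q * j)))"
      by (rule group[symmetric])
    also have "\<dots> = (\<Sum>r<Q. \<Sum>j\<in>S r. P r)"
    proof (intro sum.cong refl)
      fix r j assume "j \<in> S r"
      then show "P (yfloor N (b + Q * j)) = P r"
        using periodic_mod(2)[of P Q "yfloor N (b + Q * j)", OF per] by (simp add: S_def)
    qed
    also have "\<dots> = (\<Sum>r<Q. P r * of_real (real (card (S r)) - real J / Q)) + (\<Sum>r<Q. P r) * of_real (real J / Q)"
      unfolding sum_distrib_right sum.distrib[symmetric] by (intro sum.cong) (simp_all add: algebra_simps)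
    also have "\<dots> = (\<Sum>r<Q. P r * of_real (real (card (S r)) - real J / Q))" by (simp add: mean)
    also have "cmod \<dots> \<le> (\<Sum>r<Q. cmod (P r) * (real Q * \<eta>' * sqrt N))"
    proof (rule sum_norm_le)
      fix r assume "r \<in> {..<Q}"
      then have "r < Q" by simp
      from mult_left_mono[OF eb[OF this], of "cmod (P r)"]
      show "cmod (P r * of_real (real (card (S r)) - real J / Q)) \<le> cmod (P r) * (real Q * \<eta>' * sqrt N)"
        unfolding norm_mult norm_of_real by simp
    qed
    also have "\<dots> = K * (real Q * \<eta>' * sqrt N)" by (simp add: K_def sum_distrib_right)
    also have "\<dots> \<le> (K + 1) * (real Q * \<eta>' * sqrt N)" using \<eta>' by (intro mult_right_mono) auto
    also have "\<dots> = \<eta> * sqrt N" using K Q by (simp add: \<eta>'_def)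
    finally show "cmod (\<Sum>j<J. P (yfloor N (b + Q * j))) \<le> \<eta> * sqrt N" .
  qed
qed

text \<open>On each residue class of \<open>a\<close> modulo \<open>Q\<close> the factor
  \<open>u\<close> is constant, and fewer than \<open>Q\<close> columns are left over. The range
  handed to a class may exceed \<open>A\<close> by up to \<open>Q\<close>, which is why \<epsilon>
  is halved.\<close>

lemma twisted_sum_yfloor:
  fixes P u :: "nat \<Rightarrow> complex" and \<epsilon> \<eta> :: real
  assumes Q: "Q \<ge> 2" and per: "\<And>n. P (n + Q) = P n" and mean: "(\<Sum>r<Q. P r) = 0"
    and u: "\<And>n. u (n + Q) = u n" and \<epsilon>: "0 < \<epsilon>" "\<epsilon> < 1" and \<eta>: "\<eta> > 0"
  shows "\<exists>N0. \<forall>N\<ge>N0. \<forall>A. real A \<le> (1 - \<epsilon>) * sqrt N \<longrightarrow>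
    cmod (\<Sum>a<A. u a * P (yfloor N a)) \<le> \<eta> * sqrt N"
proof -
  have Q0: "Q > 0" using Q by simp
  obtain Cu where Cu: "Cu > 0" "\<And>n. cmod (u n) \<le> Cu" using periodic_bounded[of u, OF u Q0] by blast
  obtain Cp where Cp: "Cp > 0" "\<And>n. cmod (P n) \<le> Cp" using periodic_bounded[of P, OF per Q0] by blast
  define \<eta>' where "\<eta>' = \<eta> / (2 * real Q * Cu)"
  have \<eta>': "\<eta>' > 0" using \<eta> Cu Q0 by (simp add: \<eta>'_def)
  have \<epsilon>2: "0 < \<epsilon> / 2" "\<epsilon> / 2 < 1" using \<epsilon> by auto
  obtain N1 where N1: "\<And>N b J. N \<ge> N1 \<Longrightarrow> real (b + Q * J) \<le> (1 - \<epsilon> / 2) * sqrt N \<Longrightarrow>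
    cmod (\<Sum>j<J. P (yfloor N (b + Q * j))) \<le> \<eta>' * sqrt N"
    using sum_periodic_yfloor[of Q P, OF Q per mean \<epsilon>2 \<eta>'] by blast
  obtain N2 where N2: "\<And>N. N \<ge> N2 \<Longrightarrow> 2 * real Q / \<epsilon> \<le> sqrt (real N)" using sqrt_eventually_ge by blast
  obtain N3 where N3: "\<And>N. N \<ge> N3 \<Longrightarrow> real Q * (Cu * Cp) * (2 / \<eta>) \<le> sqrt (real N)" using sqrt_eventually_ge by blast
  show ?thesis
  proof (intro exI allI impI)
    fix N A assume N: "max N1 (max N2 N3) \<le> N" and A: "real A \<le> (1 - \<epsilon>) * sqrt N"
    define K where "K = A div Q"
    have KA: "K * Q \<le> A" by (simp add: K_def)
    have Q2: "real Q \<le> \<epsilon> / 2 * sqrt N"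
      using N2[of N] N \<epsilon> by (simp add: field_simps)
    have inner: "cmod (\<Sum>j<K. P (yfloor N (i + Q * j))) \<le> \<eta>' * sqrt N" if "i < Q" for i
    proof (rule N1)
      have "real (i + Q * K) \<le> real Q + real A" using that KA by (simp add: mult.commute flip: of_nat_mult of_nat_add)
      also have "\<dots> \<le> \<epsilon> / 2 * sqrt N + (1 - \<epsilon>) * sqrt N" using Q2 A by (rule add_mono)
      also have "\<dots> = (1 - \<epsilon> / 2) * sqrt N" by (simp add: algebra_simps)
      finally show "real (i + Q * K) \<le> (1 - \<epsilon> / 2) * sqrt N" .
    qed (use N in simp)
    define f where "f = (\<lambda>a. u a * P (yfloor N a))"
    have "(\<Sum>a<K * Q. f a) = (\<Sum>j<K. \<Sum>i<Q. f (i + j * Q))"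
    proof -
      have "(\<Sum>a<K * Q. f a) = (\<Sum>j<K. sum f {j * Q..<j * Q + Q})" by (rule sum.nat_group[symmetric])
      also have "\<dots> = (\<Sum>j<K. \<Sum>i<Q. f (i + j * Q))"
      proof (rule sum.cong[OF refl])
        fix j
        show "sum f {j * Q..<j * Q + Q} = (\<Sum>i<Q. f (i + j * Q))"
          using sum.shift_bounds_nat_ivl[of f 0 "j * Q" Q] by (simp add: add.commute atLeast0LessThan)
      qed
      finally show ?thesis .
    qed
    also have "\<dots> = (\<Sum>i<Q. \<Sum>j<K. f (i + j * Q))" by (rule sum.swap)
    also have "\<dots> = (\<Sum>i<Q. u i * (\<Sum>j<K. P (yfloor N (i + Q * j))))"
    proof (intro sum.cong refl)
      fix i
      have "f (i + j * Q) = u i * P (yfloor N (i + Q * j))" for j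
        using periodic_mod(1)[of u Q i j, OF u] by (simp add: f_def mult.commute)
      then show "(\<Sum>j<K. f (i + j * Q)) = u i * (\<Sum>j<K. P (yfloor N (i + Q * j)))"
        by (simp add: sum_distrib_left)
    qed
    also have "cmod \<dots> \<le> (\<Sum>i<Q. Cu * (\<eta>' * sqrt N))"
      by (rule sum_norm_le) (use inner Cu in \<open>auto simp: norm_mult intro!: mult_mono\<close>)
    also have "\<dots> = \<eta> / 2 * sqrt N" using Cu(1) Q0 by (simp add: \<eta>'_def)
    finally have 1: "cmod (\<Sum>a<K * Q. f a) \<le> \<eta> / 2 * sqrt N" .
    have "cmod (\<Sum>a\<in>{K * Q..<A}. f a) \<le> (\<Sum>a\<in>{K * Q..<A}. Cu * Cp)"
      by (rule sum_norm_le) (use Cu Cp in \<open>auto simp: f_def norm_mult intro!: mult_mono\<close>)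
    also have "\<dots> = real (A - K * Q) * (Cu * Cp)" by simp
    also have "\<dots> \<le> real Q * (Cu * Cp)"
    proof (rule mult_right_mono)
      have "A - K * Q = A mod Q" by (simp add: K_def minus_div_mult_eq_mod)
      then show "real (A - K * Q) \<le> real Q" using Q0 by (simp add: less_imp_le)
    qed (use Cu(1) Cp(1) in simp)
    also have "\<dots> \<le> \<eta> / 2 * sqrt N"
      using N3[of N] N \<eta> by (simp add: field_simps)
    finally have 2: "cmod (\<Sum>a\<in>{K * Q..<A}. f a) \<le> \<eta> / 2 * sqrt N" .
    have "(\<Sum>a<A. f a) = (\<Sum>a<K * Q. f a) + (\<Sum>a\<in>{K * Q..<A}. f a)"
      using sum.atLeastLessThan_concat[of 0 "K * Q" A f] KA by (simp add: atLeast0LessThan)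
    also have "cmod \<dots> \<le> \<eta> / 2 * sqrt N + \<eta> / 2 * sqrt N"
      by (rule order_trans[OF norm_triangle_ineq add_mono[OF 1 2]])
    finally show "cmod (\<Sum>a<A. u a * P (yfloor N a)) \<le> \<eta> * sqrt N" by (simp add: f_def)
  qed
qed

lemma abel_decreasing_bound:
  fixes v :: "nat \<Rightarrow> complex" and w :: "nat \<Rightarrow> real"
  assumes V: "\<And>m. m \<le> n \<Longrightarrow> cmod (\<Sum>a<m. v a) \<le> K" and w: "\<And>a. w (Suc a) \<le> w a" "\<And>a. 0 \<le> w a"
  shows "cmod (\<Sum>a<n. v a * of_real (w a)) \<le> K * w 0"
proof -
  define V' where "V' = (\<lambda>m. \<Sum>a<m. v a)"
  have id: "(\<Sum>a<m. v a * of_real (w a)) = V' m * of_real (w m) + (\<Sum>a<m. V' (Suc a) * of_real (w a - w (Suc a)))" for m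
    by (induction m) (simp_all add: V'_def algebra_simps)
  have "cmod (\<Sum>a<n. v a * of_real (w a)) \<le> K * w n + (\<Sum>a<n. K * (w a - w (Suc a)))"
    unfolding id
  proof (rule order_trans[OF norm_triangle_ineq add_mono])
    show "cmod (V' n * of_real (w n)) \<le> K * w n"
      using mult_right_mono[OF V[of n] w(2)[of n]] w(2)[of n] by (simp add: V'_def norm_mult)
    show "cmod (\<Sum>a<n. V' (Suc a) * of_real (w a - w (Suc a))) \<le> (\<Sum>a<n. K * (w a - w (Suc a)))"
    proof (rule sum_norm_le)
      fix a assume "a \<in> {..<n}"
      then have "Suc a \<le> n" by simp
      have d: "0 \<le> w a - w (Suc a)" using w(1)[of a] by simp
      show "cmod (V' (Suc a) * of_real (w a - w (Suc a))) \<le> K * (w a - w (Suc a))"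
        unfolding norm_mult norm_of_real abs_of_nonneg[OF d] V'_def
        by (rule mult_right_mono[OF V[OF \<open>Suc a \<le> n\<close>] d])
    qed
  qed
  also have "(\<Sum>a<n. K * (w a - w (Suc a))) = K * (w 0 - w n)"
    unfolding sum_distrib_left[symmetric] by (simp add: sum_lessThan_telescope')
  finally show ?thesis by (simp add: algebra_simps)
qed

text \<open>Below \<open>(1 - \<epsilon>) * sqrt N\<close> Abel's inequality applies, as the heights
  decrease in \<open>a\<close>. The remaining columns number about
  \<open>\<epsilon> * sqrt N\<close> and are bounded trivially; \<epsilon> is chosen so that they
  cost a small multiple of \<open>N\<close>.\<close>

lemma weighted_sum_yfloor:
  fixes P u :: "nat \<Rightarrow> complex" and \<eta> :: real
  assumes Q: "Q \<ge> 2" and per: "\<And>n. P (n + Q) = P n" and mean: "(\<Sum>r<Q. P r) = 0"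
    and u: "\<And>n. u (n + Q) = u n" and \<eta>: "\<eta> > 0"
  shows "\<exists>N0. \<forall>N\<ge>N0. cmod (\<Sum>a\<le>nat \<lfloor>sqrt N\<rfloor>. u a * P (yfloor N a) * of_nat (yfloor N a)) \<le> \<eta> * N"
proof -
  have Q0: "Q > 0" using Q by simp
  obtain Cu where Cu: "Cu > 0" "\<And>n. cmod (u n) \<le> Cu" using periodic_bounded[of u, OF u Q0] by blast
  obtain Cp where Cp: "Cp > 0" "\<And>n. cmod (P n) \<le> Cp" using periodic_bounded[of P, OF per Q0] by blast
  define C where "C = Cu * Cp"
  have C: "C > 0" using Cu Cp by (simp add: C_def)
  have fC: "cmod (u a * P b) \<le> C" for a b
    unfolding C_def norm_mult by (intro mult_mono Cu Cp) (use Cu(1) in auto)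
  define \<epsilon> where "\<epsilon> = min (1/2) (\<eta> / (4 * C))"
  have \<epsilon>: "0 < \<epsilon>" "\<epsilon> < 1" using \<eta> C by (auto simp: \<epsilon>_def min_def)
  have C\<epsilon>: "C * \<epsilon> \<le> \<eta> / 4"
  proof -
    have "C * \<epsilon> \<le> C * (\<eta> / (4 * C))" using C by (intro mult_left_mono) (auto simp: \<epsilon>_def)
    then show ?thesis using C by simp
  qed
  have "\<eta> / 4 > 0" using \<eta> by simp
  then obtain N1 where N1: "\<And>N A. N \<ge> N1 \<Longrightarrow> real A \<le> (1 - \<epsilon>) * sqrt N \<Longrightarrow>
    cmod (\<Sum>a<A. u a * P (yfloor N a)) \<le> \<eta> / 4 * sqrt N"
    using twisted_sum_yfloor[of Q P u, OF Q per mean u \<epsilon>] by blast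
  obtain N2 where N2: "\<And>N. N \<ge> N2 \<Longrightarrow> 8 * C / \<eta> \<le> sqrt (real N)" using sqrt_eventually_ge by blast
  show ?thesis
  proof (intro exI allI impI)
    fix N assume N: "max N1 N2 \<le> N"
    define s where "s = sqrt (real N)"
    have s: "0 \<le> s" "s * s = real N" by (simp_all add: s_def)
    define A where "A = nat \<lfloor>(1 - \<epsilon>) * s\<rfloor>"
    define D where "D = nat \<lfloor>s\<rfloor>"
    have es: "0 \<le> (1 - \<epsilon>) * s" "(1 - \<epsilon>) * s \<le> s" using \<epsilon> s(1) by (auto simp: mult_le_cancel_right2)
    have A: "real A \<le> (1 - \<epsilon>) * s" "(1 - \<epsilon>) * s < real A + 1" unfolding A_def using es by linarith+
    have D: "real D \<le> s" unfolding D_def using s(1) by linarith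
    have AD: "A \<le> D" unfolding A_def D_def using es by (intro nat_mono floor_mono)
    define f where "f = (\<lambda>a. u a * P (yfloor N a) * of_nat (yfloor N a))"
    have ys: "real (yfloor N a) \<le> s" for a using yfloor_le by (simp add: s_def)
    have 1: "cmod (\<Sum>a<A. f a) \<le> \<eta> / 4 * N"
    proof -
      have "cmod (\<Sum>a<A. u a * P (yfloor N a) * of_real (real (yfloor N a))) \<le> (\<eta> / 4 * s) * real (yfloor N 0)"
      proof (rule abel_decreasing_bound)
        fix m assume "m \<le> A"
        then have "real m \<le> (1 - \<epsilon>) * sqrt N" using A(1) unfolding s_def by linarith
        then show "cmod (\<Sum>a<m. u a * P (yfloor N a)) \<le> \<eta> / 4 * s" using N1[of N m] N by (simp add: s_def)
      qed (auto intro: yfloor_antimono)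
      also have "\<dots> \<le> (\<eta> / 4 * s) * s" using ys[of 0] \<eta> s(1) by (intro mult_left_mono) auto
      also have "\<dots> = \<eta> / 4 * N" by (simp add: s(2) mult.assoc)
      finally show ?thesis by (simp add: f_def)
    qed
    have "cmod (\<Sum>a\<in>{A..D}. f a) \<le> (\<Sum>a\<in>{A..D}. C * s)"
    proof (rule sum_norm_le)
      fix a
      show "cmod (f a) \<le> C * s" unfolding f_def norm_mult[of "u a * P (yfloor N a)"]
        by (intro mult_mono fC) (use ys C in auto)
    qed
    also have "\<dots> = (real D + 1 - real A) * (C * s)" using AD by (simp add: of_nat_diff)
    also have "\<dots> \<le> (\<epsilon> * s + 2) * (C * s)"
    proof (rule mult_right_mono)
      have "s - (1 - \<epsilon>) * s = \<epsilon> * s" by (simp add: algebra_simps)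
      then show "real D + 1 - real A \<le> \<epsilon> * s + 2" using A(2) D by linarith
    qed (use C s in simp)
    also have "\<dots> = (C * \<epsilon>) * (s * s) + 2 * C * s" by (simp add: algebra_simps)
    also have "\<dots> \<le> \<eta> / 4 * (s * s) + \<eta> / 4 * (s * s)"
    proof (rule add_mono)
      show "(C * \<epsilon>) * (s * s) \<le> \<eta> / 4 * (s * s)" using C\<epsilon> s by (intro mult_right_mono) auto
      have "8 * C / \<eta> \<le> s" using N2[of N] N by (simp add: s_def)
      then have "2 * C \<le> \<eta> / 4 * s" using \<eta> by (simp add: field_simps)
      from mult_right_mono[OF this s(1)] show "2 * C * s \<le> \<eta> / 4 * (s * s)" by (simp add: mult.assoc)
    qed
    finally have 2: "cmod (\<Sum>a\<in>{A..D}. f a) \<le> \<eta> / 2 * N" by (simp add: s(2))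
    have "{..D} = {..<A} \<union> {A..D}" using AD by auto
    then have "(\<Sum>a\<le>D. f a) = (\<Sum>a<A. f a) + (\<Sum>a\<in>{A..D}. f a)"
      by (simp only:) (rule sum.union_disjoint, auto)
    also have "cmod \<dots> \<le> \<eta> / 4 * N + \<eta> / 2 * N" by (rule order_trans[OF norm_triangle_ineq add_mono[OF 1 2]])
    also have "\<dots> \<le> \<eta> * N" using \<eta> by (simp add: mult_right_mono flip: distrib_right)
    finally show "cmod (\<Sum>a\<le>nat \<lfloor>sqrt N\<rfloor>. u a * P (yfloor N a) * of_nat (yfloor N a)) \<le> \<eta> * N"
      by (simp add: f_def D_def s_def)
  qed
qed

section \<open>Twisted partial sums of the coefficients\<close>

lemma periodic_partial_sums:
  fixes f :: "nat \<Rightarrow> complex"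
  assumes per: "\<And>n. f (n + Q) = f n" and z: "(\<Sum>r<Q. f r) = 0"
  shows "(\<Sum>i<n + Q. f i) = (\<Sum>i<n. f i)"
proof (induction n)
  case (Suc n)
  then show ?case using per[of n] by simp
qed (use z in simp)

text \<open>The lattice points of the quarter ellipse are summed column by column.\<close>

lemma sum_psi_pairs:
  "(\<Sum>n\<le>N. of_int (psi n) * w ^ n) =
     (\<Sum>a\<le>nat \<lfloor>sqrt N\<rfloor>. (of_int (chi12 a) * w ^ a\<^sup>2) * (\<Sum>b\<le>yfloor N a. (of_int (chi4 b) * w ^ (3 * b\<^sup>2)) * of_nat b :: complex))"
proof -
  define g where "g = (\<lambda>p. of_int (chi12 (fst p)) * of_int (chi4 (snd p)) * of_nat (snd p) * w ^ ((fst p)\<^sup>2 + 3 * (snd p)\<^sup>2))"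
  have mem: "a\<^sup>2 + 3 * b\<^sup>2 \<le> N \<longleftrightarrow> a \<le> nat \<lfloor>sqrt N\<rfloor> \<and> b \<le> yfloor N a" for a b
  proof -
    have 1: "a \<le> nat \<lfloor>sqrt N\<rfloor> \<longleftrightarrow> a\<^sup>2 \<le> N"
    proof -
      have "a \<le> nat \<lfloor>sqrt N\<rfloor> \<longleftrightarrow> real a \<le> sqrt N" by (simp add: le_nat_iff le_floor_iff)
      also have "\<dots> \<longleftrightarrow> (real a)\<^sup>2 \<le> real N" by (metis of_nat_0_le_iff real_le_rsqrt real_sqrt_le_mono real_sqrt_pow2 real_sqrt_unique sqrt_le_D)
      also have "\<dots> \<longleftrightarrow> a\<^sup>2 \<le> N" by (metis of_nat_le_iff of_nat_power)
      finally show ?thesis .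
    qed
    have 2: "b \<le> yfloor N a \<longleftrightarrow> a\<^sup>2 + 3 * b\<^sup>2 \<le> N" if "a\<^sup>2 \<le> N"
    proof -
      have aN: "(real a)\<^sup>2 \<le> real N" using that by (metis of_nat_le_iff of_nat_power)
      then have y0: "0 \<le> yroot N a" "(yroot N a)\<^sup>2 = (real N - (real a)\<^sup>2) / 3" by (simp_all add: yroot_def)
      have "b \<le> yfloor N a \<longleftrightarrow> real b \<le> yroot N a" unfolding yfloor_def using y0(1) by (simp add: le_nat_iff le_floor_iff)
      also have "\<dots> \<longleftrightarrow> (real b)\<^sup>2 \<le> (yroot N a)\<^sup>2" using y0(1) by (simp add: power2_le_iff_abs_le)
      also have "\<dots> \<longleftrightarrow> real (a\<^sup>2 + 3 * b\<^sup>2) \<le> real N" unfolding y0(2) by (simp add: field_simps)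
      finally show ?thesis by (simp only: of_nat_le_iff)
    qed
    show ?thesis using 1 2 by (cases "a\<^sup>2 \<le> N") auto
  qed
  have "(\<Sum>n\<le>N. of_int (psi n) * w ^ n) = (\<Sum>n\<le>N. \<Sum>p\<in>psi_fiber n. g p)"
  proof (intro sum.cong refl)
    fix n
    show "of_int (psi n) * w ^ n = (\<Sum>p\<in>psi_fiber n. g p)"
      unfolding psi_eq psi_fun_def of_int_sum sum_distrib_right
      by (intro sum.cong refl) (simp add: g_def psi_fiber_def)
  qed
  also have "\<dots> = (\<Sum>p\<in>(\<Union>n\<in>{..N}. psi_fiber n). g p)"
  proof (rule sum.UNION_disjoint[symmetric])
    show "\<forall>n\<in>{..N}. \<forall>m\<in>{..N}. n \<noteq> m \<longrightarrow> psi_fiber n \<inter> psi_fiber m = {}" by (auto simp: psi_fiber_def)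
  qed simp_all
  also have "(\<Union>n\<in>{..N}. psi_fiber n) = (SIGMA a:{..nat \<lfloor>sqrt N\<rfloor>}. {..yfloor N a})"
    using mem by (auto simp: psi_fiber_def)
  also have "(\<Sum>p\<in>(SIGMA a:{..nat \<lfloor>sqrt N\<rfloor>}. {..yfloor N a}). g p) = (\<Sum>a\<le>nat \<lfloor>sqrt N\<rfloor>. \<Sum>b\<le>yfloor N a. g (a, b))"
    by (subst sum.Sigma) (auto simp: case_prod_unfold)
  also have "\<dots> = (\<Sum>a\<le>nat \<lfloor>sqrt N\<rfloor>. (of_int (chi12 a) * w ^ a\<^sup>2) * (\<Sum>b\<le>yfloor N a. (of_int (chi4 b) * w ^ (3 * b\<^sup>2)) * of_nat b))"
    by (simp add: g_def sum_distrib_left power_add mult_ac)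
  finally show ?thesis .
qed

text \<open>Since \<open>12 dvd Q\<close> and \<open>w ^ Q = 1\<close>, all factors have period
  \<open>Q\<close>, and \<open>h\<close> is odd modulo \<open>Q\<close>. Its partial sums are
  therefore periodic, and subtracting their mean leaves a factor \<open>P\<close> to which
  \<open>weighted_sum_yfloor\<close> applies.\<close>

theorem psi_twisted_sum_small:
  fixes w :: complex
  assumes w: "w ^ Q = 1" and Q: "Q > 0" "12 dvd Q"
  shows "(\<lambda>N. (\<Sum>n\<le>N. of_int (psi n) * w ^ n) / of_nat N) \<longlonglongrightarrow> 0"
proof -
  have Q2: "Q \<ge> 2" using Q dvd_imp_le[of 12 Q] by simp
  define u where "u = (\<lambda>a. of_int (chi12 a) * w ^ a\<^sup>2)"
  define h where "h = (\<lambda>b. of_int (chi4 b) * w ^ (3 * b\<^sup>2))"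
  have wq: "w ^ (n + Q * k) = w ^ n" for n k by (simp add: power_add power_mult w)
  have c12: "chi12 (n + Q) = chi12 n" and c4: "chi4 (n + Q) = chi4 n" for n
  proof -
    obtain k where "Q = 12 * k" using Q by (elim dvdE)
    moreover have "(n + 12 * k) mod 12 = n mod 12" "(n + 12 * k) mod 4 = n mod 4"
      using mod_mult_self2[of n 4 "3 * k"] by simp_all
    ultimately show "chi12 (n + Q) = chi12 n" "chi4 (n + Q) = chi4 n" by (simp_all add: chi12_def chi4_def)
  qed
  have uper: "u (n + Q) = u n" for n
  proof -
    have "(n + Q)\<^sup>2 = n\<^sup>2 + Q * (2 * n + Q)" by (simp add: power2_eq_square algebra_simps)
    then show ?thesis by (simp only: u_def c12 wq)
  qed
  have hper: "h (n + Q) = h n" for n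
  proof -
    have "3 * (n + Q)\<^sup>2 = 3 * n\<^sup>2 + Q * (6 * n + 3 * Q)" by (simp add: power2_eq_square algebra_simps)
    then show ?thesis by (simp only: h_def c4 wq)
  qed
  have hodd: "h (Q - b) = - h b" if "b < Q" "b > 0" for b
  proof -
    obtain k where k: "Q = 12 * k" using Q by (elim dvdE)
    have "chi4 (Q - b) = - chi4 b"
    proof -
      have "(Q - b + b) mod 4 = 0" using that k by simp
      then have "((Q - b) mod 4 + b mod 4) mod 4 = 0" by (simp only: mod_add_eq)
      moreover have "n mod 4 = 0 \<or> n mod 4 = 1 \<or> n mod 4 = 2 \<or> n mod 4 = 3" for n :: nat by linarith
      from this[of "Q - b"] this[of b] calculation show ?thesis
        unfolding chi4_def by (elim disjE) simp_all
    qed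
    \<comment> \<open>The squares of \<open>Q - b\<close> and \<open>b\<close> are congruent modulo
      \<open>Q\<close>; multiples of \<open>Q\<close> are added on both sides to stay within the
      naturals.\<close>
    moreover have "w ^ (3 * (Q - b)\<^sup>2) = w ^ (3 * b\<^sup>2)"
    proof -
      define e where "e = Q - b"
      have e: "Q = e + b" using that by (simp add: e_def)
      have id: "3 * e\<^sup>2 + Q * (3 * b) = 3 * b\<^sup>2 + Q * (3 * e)" unfolding e by (simp add: power2_eq_square algebra_simps)
      have "w ^ (3 * e\<^sup>2) = w ^ (3 * e\<^sup>2 + Q * (3 * b))" by (rule wq[symmetric])
      also have "\<dots> = w ^ (3 * b\<^sup>2)" unfolding id by (rule wq)
      finally show ?thesis unfolding e_def .
    qed
    ultimately show ?thesis by (simp add: h_def)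
  qed
  have hz: "(\<Sum>r<Q. h r) = 0"
  proof -
    have "(\<Sum>r\<in>{1..<Q}. h r) = (\<Sum>r\<in>{1..<Q}. h (Q - r))"
      by (rule sum.reindex_bij_witness[where i = "\<lambda>r. Q - r" and j = "\<lambda>r. Q - r"]) auto
    also have "\<dots> = (\<Sum>r\<in>{1..<Q}. - h r)" by (intro sum.cong hodd) auto
    finally have "(\<Sum>r\<in>{1..<Q}. h r) = 0" by (simp add: sum_negf)
    moreover have "{..<Q} = insert 0 {1..<Q}" using Q by auto
    ultimately show ?thesis by (simp add: h_def chi4_def)
  qed
  define Hs where "Hs = (\<lambda>b. \<Sum>i<b. h i)"
  define \<mu> where "\<mu> = (\<Sum>r<Q. Hs (Suc r)) / of_nat Q"
  define P where "P = (\<lambda>b. Hs (Suc b) - \<mu>)"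
  have Hper: "Hs (n + Q) = Hs n" for n unfolding Hs_def by (rule periodic_partial_sums[OF hper hz])
  have Pper: "P (n + Q) = P n" for n using Hper[of "Suc n"] by (simp add: P_def)
  have Pz: "(\<Sum>r<Q. P r) = 0" using Q by (simp add: P_def sum_subtractf \<mu>_def)
  define R where "R = (\<lambda>b. \<Sum>i<b. P i)"
  have Rper: "R (n + Q) = R n" for n unfolding R_def by (rule periodic_partial_sums[OF Pper Pz])
  \<comment> \<open>Summation by parts; the mean \<open>\<mu>\<close> contributes
    \<open>\<mu> * B\<close> to both parts and cancels. The periodic, hence bounded,
    \<open>R\<close> costs only \<open>O(sqrt N)\<close> over all columns.\<close>
  have inner: "(\<Sum>b\<le>B. h b * of_nat b) = P B * of_nat B - R B" for B
    by (induction B) (simp_all add: P_def R_def Hs_def algebra_simps)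
  obtain Cu where Cu: "Cu > 0" "\<And>n. cmod (u n) \<le> Cu" using periodic_bounded[of u, OF uper Q(1)] by blast
  obtain Cr where Cr: "Cr > 0" "\<And>n. cmod (R n) \<le> Cr" using periodic_bounded[of R, OF Rper Q(1)] by blast
  define S where "S = (\<lambda>N. \<Sum>n\<le>N. of_int (psi n) * w ^ n)"
  have S: "S N = (\<Sum>a\<le>nat \<lfloor>sqrt N\<rfloor>. u a * P (yfloor N a) * of_nat (yfloor N a)) - (\<Sum>a\<le>nat \<lfloor>sqrt N\<rfloor>. u a * R (yfloor N a))" for N
  proof -
    have "S N = (\<Sum>a\<le>nat \<lfloor>sqrt N\<rfloor>. u a * (\<Sum>b\<le>yfloor N a. h b * of_nat b))"
      unfolding S_def u_def h_def by (rule sum_psi_pairs)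
    then show ?thesis unfolding inner by (simp add: right_diff_distrib sum_subtractf mult.assoc)
  qed
  have "(\<lambda>N. S N / of_nat N) \<longlonglongrightarrow> 0"
  proof (rule LIMSEQ_I)
    fix r :: real assume r: "r > 0"
    then have "r / 4 > 0" by simp
    from weighted_sum_yfloor[of Q P u, OF Q2 Pper Pz uper this]
    obtain N1 where N1: "\<And>N. N \<ge> N1 \<Longrightarrow> cmod (\<Sum>a\<le>nat \<lfloor>sqrt N\<rfloor>. u a * P (yfloor N a) * of_nat (yfloor N a)) \<le> r / 4 * N"
      by blast
    obtain N2 where N2: "\<And>N. N \<ge> N2 \<Longrightarrow> 8 * (Cu * Cr) / r \<le> sqrt (real N)" using sqrt_eventually_ge by blast
    show "\<exists>no. \<forall>N\<ge>no. norm (S N / of_nat N - 0) < r"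
    proof (intro exI allI impI)
      fix N assume N: "N \<ge> max 1 (max N1 N2)"
      define s where "s = sqrt (real N)"
      have s: "1 \<le> s" "s * s = real N" using N by (simp_all add: s_def)
      have "cmod (\<Sum>a\<le>nat \<lfloor>sqrt N\<rfloor>. u a * R (yfloor N a)) \<le> (\<Sum>a\<le>nat \<lfloor>sqrt N\<rfloor>. Cu * Cr)"
        by (rule sum_norm_le) (use Cu Cr in \<open>auto simp: norm_mult intro!: mult_mono\<close>)
      also have "\<dots> = (real (nat \<lfloor>s\<rfloor>) + 1) * (Cu * Cr)" by (simp add: s_def)
      also have "\<dots> \<le> (2 * s) * (Cu * Cr)"
      proof (rule mult_right_mono)
        show "real (nat \<lfloor>s\<rfloor>) + 1 \<le> 2 * s" using s(1) by linarith
      qed (use Cu(1) Cr(1) in simp)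
      also have "\<dots> \<le> r / 4 * (s * s)"
      proof -
        have "8 * (Cu * Cr) / r \<le> s" using N2[of N] N by (simp add: s_def)
        then have "2 * (Cu * Cr) \<le> r / 4 * s" using r by (simp add: field_simps)
        from mult_right_mono[OF this, of s] s(1) show ?thesis by (simp add: mult_ac)
      qed
      finally have 2: "cmod (\<Sum>a\<le>nat \<lfloor>sqrt N\<rfloor>. u a * R (yfloor N a)) \<le> r / 4 * N" by (simp add: s(2))
      have "cmod (S N) \<le> r / 4 * N + r / 4 * N"
        unfolding S by (rule order_trans[OF norm_triangle_ineq4 add_mono[OF N1 2]]) (use N in simp)
      also have "\<dots> < r * N" using r N by simp
      finally show "norm (S N / of_nat N - 0) < r" using N by (simp add: norm_divide divide_less_eq)
    qed
  qed
  then show ?thesis by (simp add: S_def)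
qed

section \<open>Periods of the hexponential map\<close>

definition mact :: "int^2^2 \<Rightarrow> complex \<Rightarrow> complex" where
  "mact A \<tau> = (of_int (A $ 1 $ 1) * \<tau> + of_int (A $ 1 $ 2)) / (of_int (A $ 2 $ 1) * \<tau> + of_int (A $ 2 $ 2))"

lemma mact_mat2 [simp]:
  "mact (mat2 a b c d) \<tau> = (of_int a * \<tau> + of_int b) / (of_int c * \<tau> + of_int d)"
  by (simp add: mact_def)

lemma mact_uminus: "mact (- A) \<tau> = mact A \<tau>"
proof -
  obtain a b c d where A: "A = mat2 a b c d" by (rule mat2_exhaust)
  have "mact (- A) \<tau> = - (of_int a * \<tau> + of_int b) / - (of_int c * \<tau> + of_int d)" by (simp add: A)
  also have "\<dots> = mact A \<tau>" unfolding A mact_mat2 by (rule minus_divide_divide)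
  finally show ?thesis .
qed

text \<open>The identity also holds at the pole, where both sides are \<open>0\<close>.\<close>
lemma Im_mact:
  assumes "a * d - b * c = 1"
  shows "Im (mact (mat2 a b c d) \<tau>) = Im \<tau> / (cmod (of_int c * \<tau> + of_int d))\<^sup>2"
proof -
  have 1: "of_int a * of_int d - of_int b * of_int c = (1::real)"
    using assms by (metis of_int_1 of_int_diff of_int_mult)
  have "Im ((of_int a * \<tau> + of_int b) * cnj (of_int c * \<tau> + of_int d)) = (of_int a * of_int d - of_int b * of_int c) * Im \<tau>"
    by (simp add: algebra_simps)
  then have "Im ((of_int a * \<tau> + of_int b) * cnj (of_int c * \<tau> + of_int d)) = Im \<tau>" unfolding 1 by simp
  moreover have "mact (mat2 a b c d) \<tau> = (of_int a * \<tau> + of_int b) * cnj (of_int c * \<tau> + of_int d) / of_real ((cmod (of_int c * \<tau> + of_int d))\<^sup>2)"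
    unfolding mact_mat2 by (subst complex_div_cnj) simp
  ultimately show ?thesis by (simp only: Im_divide_of_real)
qed

lemma denominator_nonzero:
  assumes "Im \<tau> > 0" "a * d - b * c = (1::int)"
  shows "of_int c * \<tau> + of_int d \<noteq> 0"
proof
  assume z: "of_int c * \<tau> + of_int d = 0"
  then have "of_int c * Im \<tau> = 0" by (simp add: complex_eq_iff)
  then have "c = 0" using assms(1) by simp
  moreover from this have "d = 0" using z by simp
  ultimately show False using assms(2) by simp
qed

lemma mact_upper:
  assumes "det A = 1" "Im \<tau> > 0"
  shows "Im (mact A \<tau>) > 0"
proof -
  obtain a b c d where A: "A = mat2 a b c d" by (rule mat2_exhaust)
  then have det: "a * d - b * c = 1" using assms(1) by simp
  show ?thesis unfolding A Im_mact[OF det] using denominator_nonzero[OF assms(2) det] assms(2) by simp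
qed

lemma mact_mult:
  assumes "det B = 1" "Im \<tau> > 0"
  shows "mact (A ** B) \<tau> = mact A (mact B \<tau>)"
proof -
  obtain a b c d where A: "A = mat2 a b c d" by (rule mat2_exhaust)
  obtain e f g h where B: "B = mat2 e f g h" by (rule mat2_exhaust)
  have det: "e * h - f * g = 1" using assms(1) B by simp
  define n where "n = of_int g * \<tau> + of_int h"
  have n: "n \<noteq> 0" unfolding n_def by (rule denominator_nonzero[OF assms(2) det])
  define m where "m = of_int e * \<tau> + of_int f"
  have "mact A (mact B \<tau>) = (of_int a * (m / n) + of_int b) / (of_int c * (m / n) + of_int d)"
    by (simp add: A B m_def n_def)
  also have "\<dots> = ((of_int a * m + of_int b * n) / n) / ((of_int c * m + of_int d * n) / n)"
    using n by (simp add: add_divide_distrib)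
  also have "\<dots> = (of_int a * m + of_int b * n) / (of_int c * m + of_int d * n)" using n by simp
  also have "\<dots> = mact (A ** B) \<tau>" by (simp add: A B m_def n_def algebra_simps)
  finally show ?thesis ..
qed

text \<open>The condition ranges over both representatives of the class; since \<open>A\<close> and
  \<open>- A\<close> act alike, one of them decides (\<open>hexp_shift_class\<close>).\<close>

definition hexp_shift :: "(int^2^2) set \<Rightarrow> complex \<Rightarrow> bool" where
  "hexp_shift U s \<longleftrightarrow> U \<in> carrier PSL2Z \<and> (\<forall>A\<in>U. \<forall>\<tau>. Im \<tau> > 0 \<longrightarrow> hexpF (mact A \<tau>) = hexpF \<tau> + s)"

lemma hexp_shift_class:
  assumes "det A = 1"
  shows "hexp_shift (psl_class A) s \<longleftrightarrow> (\<forall>\<tau>. Im \<tau> > 0 \<longrightarrow> hexpF (mact A \<tau>) = hexpF \<tau> + s)"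
proof -
  have "B \<in> psl_class A \<longleftrightarrow> B = A \<or> B = - A" for B by (simp add: psl_class_eq)
  then show ?thesis using psl_class_closed[OF assms] by (auto simp: hexp_shift_def mact_uminus)
qed

lemma hexp_shift_mult:
  assumes "hexp_shift U s" "hexp_shift V t"
  shows "hexp_shift (U \<otimes>\<^bsub>PSL2Z\<^esub> V) (s + t)"
proof -
  obtain A where A: "U = psl_class A" "det A = 1" using assms(1) by (auto simp: hexp_shift_def carrier_PSL2Z)
  obtain B where B: "V = psl_class B" "det B = 1" using assms(2) by (auto simp: hexp_shift_def carrier_PSL2Z)
  have AB: "det (A ** B) = 1" by (simp add: det_mul A(2) B(2))
  note sA = assms(1)[unfolded A(1) hexp_shift_class[OF A(2)], rule_format]
  note sB = assms(2)[unfolded B(1) hexp_shift_class[OF B(2)], rule_format]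
  show ?thesis unfolding A(1) B(1) psl_class_mult hexp_shift_class[OF AB]
  proof (intro allI impI)
    fix \<tau> assume \<tau>: "Im \<tau> > 0"
    show "hexpF (mact (A ** B) \<tau>) = hexpF \<tau> + (s + t)"
      unfolding mact_mult[OF B(2) \<tau>] sA[OF mact_upper[OF B(2) \<tau>]] sB[OF \<tau>] by simp
  qed
qed

lemma hexp_shift_one: "hexp_shift \<one>\<^bsub>PSL2Z\<^esub> 0"
  unfolding psl_class_one[symmetric] by (subst hexp_shift_class) (simp_all add: mat_1_eq)

lemma hexp_shift_inv:
  assumes "hexp_shift U s"
  shows "hexp_shift (inv\<^bsub>PSL2Z\<^esub> U) (- s)"
proof -
  have U: "U \<in> carrier PSL2Z" using assms by (simp add: hexp_shift_def)
  obtain A where A: "U = psl_class A" "det A = 1" using U by (auto simp: carrier_PSL2Z)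
  obtain B where B: "inv\<^bsub>PSL2Z\<^esub> U = psl_class B" "det B = 1" using PSL.inv_closed[OF U] by (auto simp: carrier_PSL2Z)
  have "U \<otimes>\<^bsub>PSL2Z\<^esub> inv\<^bsub>PSL2Z\<^esub> U = \<one>\<^bsub>PSL2Z\<^esub>" using U by (rule PSL.r_inv)
  then have "A ** B = mat 1 \<or> A ** B = - mat 1"
    unfolding B(1) unfolding A(1) psl_class_mult psl_class_one[symmetric] psl_class_eq_iff .
  then have id: "mact (A ** B) \<tau> = \<tau>" for \<tau>
    by (elim disjE) (simp_all only: mact_uminus mat_1_eq mact_mat2, simp_all)
  show ?thesis unfolding B(1) hexp_shift_class[OF B(2)]
  proof (intro allI impI)
    fix \<tau> assume \<tau>: "Im \<tau> > 0"
    have "hexpF (mact A (mact B \<tau>)) = hexpF (mact B \<tau>) + s"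
      by (rule assms[unfolded A(1) hexp_shift_class[OF A(2)], rule_format]) (rule mact_upper[OF B(2) \<tau>])
    then show "hexpF (mact B \<tau>) = hexpF \<tau> + - s"
      unfolding mact_mult[OF B(2) \<tau>, symmetric] id by simp
  qed
qed

lemma hexp_shift_nat_pow: "hexp_shift U s \<Longrightarrow> hexp_shift (U [^]\<^bsub>PSL2Z\<^esub> (n::nat)) (of_nat n * s)"
proof (induction n)
  case (Suc n)
  from hexp_shift_mult[OF Suc.IH[OF Suc.prems] Suc.prems] show ?case
    by (simp add: algebra_simps)
qed (simp add: hexp_shift_one)

lemma hexp_shift_int_pow:
  assumes "hexp_shift U s"
  shows "hexp_shift (U [^]\<^bsub>PSL2Z\<^esub> (n::int)) (of_int n * s)"
proof (cases n)
  case (nonneg k)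
  then show ?thesis using hexp_shift_nat_pow[OF assms, of k] by (simp add: int_pow_int)
next
  case (neg k)
  have "U \<in> carrier PSL2Z" using assms by (simp add: hexp_shift_def)
  then have "U [^]\<^bsub>PSL2Z\<^esub> n = inv\<^bsub>PSL2Z\<^esub> (U [^]\<^bsub>PSL2Z\<^esub> Suc k)" unfolding neg by (rule PSL.int_pow_neg_int)
  moreover have "of_int n * s = - (of_nat (Suc k) * s)" unfolding neg by (simp add: algebra_simps)
  ultimately show ?thesis using hexp_shift_inv[OF hexp_shift_nat_pow[OF assms, of "Suc k"]] by simp
qed

lemma zeta6_eq: "zeta6 = Complex (1/2) (sqrt 3 / 2)"
proof -
  have "zeta6 = cis (pi / 3)" by (simp add: zeta6_def cis_conv_exp)
  then show ?thesis by (simp add: complex_eq_iff cos_60 sin_60)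
qed

lemma zeta6_square: "zeta6 ^ 2 = zeta6 - 1"
  by (simp add: zeta6_eq complex_eq_iff power2_eq_square)

lemma zeta6_nonzero: "zeta6 \<noteq> 0"
  by (simp add: zeta6_def)

text \<open>\<open>L = S T^(-1) S\<close>: the two inversions restore the sign of the primitive, and
  \<open>1 - 1/zeta6 = zeta6\<close> gives the constant.\<close>

lemma hexpF_L:
  assumes \<tau>: "Im \<tau> > 0"
  shows "hexpF (\<tau> / (\<tau> + 1)) = zeta6 * hexpS + hexpF \<tau> / zeta6"
proof -
  define \<rho> where "\<rho> = -1/\<tau>"
  have \<rho>: "Im \<rho> > 0" unfolding \<rho>_def by (rule Im_neg_inverse_pos[OF \<tau>])
  have nz: "\<tau> \<noteq> 0" "\<tau> + 1 \<noteq> 0" using \<tau> by (auto simp: complex_eq_iff)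
  have "\<rho> - 1 = - ((\<tau> + 1) / \<tau>)" using nz(1) by (simp add: \<rho>_def field_simps)
  then have "\<tau> / (\<tau> + 1) = -1 / (\<rho> - 1)" by simp
  moreover have "hexpF (-1 / (\<rho> - 1)) = hexpS - hexpF (\<rho> - 1)" by (rule hexpF_inversion) (use \<rho> in simp)
  moreover have "zeta6 * hexpF (\<rho> - 1) = hexpS - hexpF \<tau>"
    using hexpF_translate[of "\<rho> - 1"] \<rho> hexpF_inversion[OF \<tau>] by (simp add: \<rho>_def)
  then have "hexpF (\<rho> - 1) = (hexpS - hexpF \<tau>) / zeta6" using zeta6_nonzero by (simp add: eq_divide_eq mult.commute)
  ultimately have "hexpF (\<tau> / (\<tau> + 1)) = hexpS - (hexpS - hexpF \<tau>) / zeta6" by (simp only:)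
  moreover have "hexpS / zeta6 = hexpS - zeta6 * hexpS"
  proof -
    have "(hexpS - zeta6 * hexpS) * zeta6 = (zeta6 - zeta6 ^ 2) * hexpS" by (simp add: algebra_simps power2_eq_square)
    also have "\<dots> = hexpS" unfolding zeta6_square by simp
    finally show ?thesis using zeta6_nonzero by (simp add: divide_eq_eq)
  qed
  ultimately show ?thesis by (simp add: diff_divide_distrib)
qed

text \<open>\<open>X = L T\<close>, and the factor \<open>zeta6\<close> from the translation cancels
  the \<open>1/zeta6\<close> in \<open>hexpF_L\<close>. For \<open>Y = T L\<close> the same factor
  also multiplies the constant, which gives \<open>zeta6^2\<close>.\<close>

lemma hexp_shift_pX: "hexp_shift pX (zeta6 * hexpS)"
  unfolding pX_def
proof (subst hexp_shift_class)
  show "\<forall>\<tau>. Im \<tau> > 0 \<longrightarrow> hexpF (mact matX \<tau>) = hexpF \<tau> + zeta6 * hexpS"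
  proof (intro allI impI)
    fix \<tau> assume \<tau>: "Im \<tau> > 0"
    have "mact matX \<tau> = (\<tau> + 1) / ((\<tau> + 1) + 1)" by (simp add: matX_eq)
    then show "hexpF (mact matX \<tau>) = hexpF \<tau> + zeta6 * hexpS"
      using hexpF_L[of "\<tau> + 1"] hexpF_translate[OF \<tau>] \<tau> zeta6_nonzero by simp
  qed
qed (simp add: matX_eq)

lemma hexp_shift_pY: "hexp_shift pY (zeta6 ^ 2 * hexpS)"
  unfolding pY_def
proof (subst hexp_shift_class)
  show "\<forall>\<tau>. Im \<tau> > 0 \<longrightarrow> hexpF (mact matY \<tau>) = hexpF \<tau> + zeta6 ^ 2 * hexpS"
  proof (intro allI impI)
    fix \<tau> assume \<tau>: "Im \<tau> > 0"
    have "\<tau> + 1 \<noteq> 0" using \<tau> by (auto simp: complex_eq_iff)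
    then have "mact matY \<tau> = \<tau> / (\<tau> + 1) + 1" by (simp add: matY_eq field_simps)
    moreover have "Im (\<tau> / (\<tau> + 1)) > 0" using mact_upper[of "mat2 1 0 1 1" \<tau>] \<tau> by simp
    ultimately show "hexpF (mact matY \<tau>) = hexpF \<tau> + zeta6 ^ 2 * hexpS"
      using hexpF_translate[of "\<tau> / (\<tau> + 1)"] hexpF_L[OF \<tau>] zeta6_nonzero
      by (simp add: distrib_left power2_eq_square)
  qed
qed (simp add: matY_eq)

lemma hexp_shift_exists:
  assumes "U \<in> PSL2Z'"
  shows "\<exists>s. hexp_shift U s"
  using assms unfolding PSL2Z'_eq HXY_def
proof (induction rule: generate.induct)
  case one
  show ?case using hexp_shift_one by blast
next
  case (incl h)
  then show ?case using hexp_shift_pX hexp_shift_pY by blast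
next
  case (inv h)
  then show ?case using hexp_shift_inv[OF hexp_shift_pX] hexp_shift_inv[OF hexp_shift_pY] by blast
next
  case (eng h1 h2)
  then show ?case using hexp_shift_mult by blast
qed

text \<open>Translations commute, so the shifts in a commutator cancel.\<close>

lemma hexp_shift_derived2:
  assumes "U \<in> PSL2Z''"
  shows "hexp_shift U 0"
proof -
  have comm: "hexp_shift h 0" if "h \<in> derived_set PSL2Z PSL2Z'" for h
  proof -
    have "\<exists>h1\<in>PSL2Z'. \<exists>h2\<in>PSL2Z'. h = h1 \<otimes>\<^bsub>PSL2Z\<^esub> h2 \<otimes>\<^bsub>PSL2Z\<^esub> inv\<^bsub>PSL2Z\<^esub> h1 \<otimes>\<^bsub>PSL2Z\<^esub> inv\<^bsub>PSL2Z\<^esub> h2"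
      using that by simp
    then obtain h1 h2 where h: "h1 \<in> PSL2Z'" "h2 \<in> PSL2Z'"
      "h = h1 \<otimes>\<^bsub>PSL2Z\<^esub> h2 \<otimes>\<^bsub>PSL2Z\<^esub> inv\<^bsub>PSL2Z\<^esub> h1 \<otimes>\<^bsub>PSL2Z\<^esub> inv\<^bsub>PSL2Z\<^esub> h2"
      by blast
    obtain s where s: "hexp_shift h1 s" using hexp_shift_exists[OF h(1)] ..
    obtain t where t: "hexp_shift h2 t" using hexp_shift_exists[OF h(2)] ..
    have "hexp_shift h (s + t + - s + - t)"
      unfolding h(3) by (intro hexp_shift_mult hexp_shift_inv s t)
    then show ?thesis by simp
  qed
  show ?thesis using assms unfolding PSL2Z''_def derived_def
  proof (induction rule: generate.induct)
    case one
    show ?case by (rule hexp_shift_one)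
  next
    case (incl h)
    then show ?case by (rule comm)
  next
    case (inv h)
    from hexp_shift_inv[OF comm[OF inv]] show ?case by simp
  next
    case (eng h1 h2)
    from hexp_shift_mult[OF eng.IH] show ?case by simp
  qed
qed

lemma hexp_shift_congruent:
  assumes "det A = 1" "congruent_XY A m n"
  shows "hexp_shift (psl_class A) (of_int m * (zeta6 * hexpS) + of_int n * (zeta6 ^ 2 * hexpS))"
proof -
  define W where "W = (pX [^]\<^bsub>PSL2Z\<^esub> m) \<otimes>\<^bsub>PSL2Z\<^esub> (pY [^]\<^bsub>PSL2Z\<^esub> n)"
  have one: "\<one>\<^bsub>PSL2Z\<^esub> \<in> PSL2Z''" unfolding PSL2Z''_def derived_def by (rule generate.one)
  have "\<one>\<^bsub>PSL2Z\<^esub> \<otimes>\<^bsub>PSL2Z\<^esub> psl_class A \<in> PSL2Z'' #>\<^bsub>PSL2Z\<^esub> psl_class A" using one unfolding r_coset_def by blast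
  then have "psl_class A \<in> PSL2Z'' #>\<^bsub>PSL2Z\<^esub> W"
    using assms(2) assms(1) unfolding congruent_XY_def W_def pX_def pY_def by simp
  then obtain k where k: "k \<in> PSL2Z''" "psl_class A = k \<otimes>\<^bsub>PSL2Z\<^esub> W" unfolding r_coset_def by blast
  have "hexp_shift W (of_int m * (zeta6 * hexpS) + of_int n * (zeta6 ^ 2 * hexpS))"
    unfolding W_def by (intro hexp_shift_mult hexp_shift_int_pow hexp_shift_pX hexp_shift_pY)
  from hexp_shift_mult[OF hexp_shift_derived2[OF k(1)] this] show ?thesis unfolding k(2) by simp
qed

text \<open>\<open>hexpS\<close> points in the direction \<open>-i\<close>; rotations by
  \<open>pi/3\<close> and \<open>2 pi/3\<close> give the angles \<open>- pi/6\<close> and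
  \<open>pi/6\<close>.\<close>

lemma hexpS_zeta6:
  "zeta6 * hexpS = of_real abs_omega0 * exp (- \<i> * of_real pi / 6)"
  "zeta6 ^ 2 * hexpS = of_real abs_omega0 * exp (\<i> * of_real pi / 6)"
proof -
  have e: "- \<i> = cis (- pi / 2)" by (simp add: complex_eq_iff)
  have z: "zeta6 = cis (pi / 3)" by (simp add: zeta6_def cis_conv_exp)
  have "zeta6 * - \<i> = cis (- pi / 6)" unfolding e z cis_mult by (simp add: field_simps)
  moreover have "zeta6 ^ 2 * - \<i> = cis (pi / 6)" unfolding e z power2_eq_square cis_mult by (simp add: field_simps)
  moreover have "cis (- pi / 6) = exp (- \<i> * of_real pi / 6)" "cis (pi / 6) = exp (\<i> * of_real pi / 6)"
    by (simp_all add: cis_conv_exp)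
  moreover have "zeta6 * hexpS = of_real abs_omega0 * (zeta6 * - \<i>)" "zeta6 ^ 2 * hexpS = of_real abs_omega0 * (zeta6 ^ 2 * - \<i>)"
    unfolding hexpS_eq by (simp_all only: mult_ac)
  ultimately show "zeta6 * hexpS = of_real abs_omega0 * exp (- \<i> * of_real pi / 6)"
    "zeta6 ^ 2 * hexpS = of_real abs_omega0 * exp (\<i> * of_real pi / 6)" by simp_all
qed

section \<open>Approach to the cusps\<close>

lemma Im_of_int_ratio [simp]: "Im (of_int a / of_int c) = 0"
  by (metis Im_complex_of_real of_real_divide of_real_of_int_eq)

definition cusp_height :: "int \<Rightarrow> int \<Rightarrow> complex \<Rightarrow> real" where
  "cusp_height a c \<tau> = Im \<tau> / (cmod (of_int c * \<tau> - of_int a))\<^sup>2"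

lemma at_cusp_eq: "at_cusp a c = filtercomap (cusp_height a c) at_top"
  by (simp add: at_cusp_def cusp_height_def[abs_def])

lemma filterlim_cusp_height: "filterlim (cusp_height a c) at_top (at_cusp a c)"
  unfolding at_cusp_eq by (rule filterlim_filtercomap)

lemma cusp_height_vertical:
  assumes "c \<noteq> 0" "y > 0"
  shows "cusp_height a c (of_int a / of_int c + \<i> * of_real y) = 1 / (of_int c ^ 2 * y)"
proof -
  have "of_int c * (of_int a / of_int c + \<i> * of_real y) - of_int a = \<i> * complex_of_real (of_int c * y)"
    using assms by (simp add: distrib_left)
  moreover have "Im (of_int a / of_int c + \<i> * of_real y) = y" by simp
  ultimately show ?thesis
    using assms by (simp add: cusp_height_def norm_mult power_mult_distrib power2_eq_square)
qed

text \<open>Makes limits along the filter unique, so that \<open>Lim\<close> returns them. For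
  \<open>c \<noteq> 0\<close> the vertical line at \<open>a/c\<close> contains points of any
  positive height; for \<open>c = 0\<close> coprimality gives \<open>|a| = 1\<close>.\<close>

lemma at_cusp_neq_bot:
  assumes "coprime a c"
  shows "at_cusp a c \<noteq> bot"
  unfolding at_cusp_eq
proof (rule filtercomap_neq_bot)
  fix P :: "real \<Rightarrow> bool" assume "eventually P at_top"
  then have "eventually (\<lambda>y. P y \<and> y > 0) at_top" by (rule eventually_conj[OF _ eventually_gt_at_top])
  then obtain y where y: "P y" "y > 0" by (auto dest: eventually_happens)
  show "\<exists>\<tau>. P (cusp_height a c \<tau>)"
  proof (cases "c = 0")
    case True
    then have "\<bar>a\<bar> = 1" using assms by simp
    then have "(cmod (of_int a))\<^sup>2 = 1" by (metis norm_of_int of_int_1 of_int_abs one_power2)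
    then have "cusp_height a c (\<i> * of_real y) = y" using True by (simp add: cusp_height_def)
    then show ?thesis using y(1) by metis
  next
    case False
    have "cusp_height a c (of_int a / of_int c + \<i> * of_real (1 / (of_int c ^ 2 * y))) = 1 / (of_int c ^ 2 * (1 / (of_int c ^ 2 * y)))"
      by (rule cusp_height_vertical) (use False y in auto)
    also have "\<dots> = y" using False y by simp
    finally show ?thesis using y(1) by metis
  qed
qed

text \<open>A positive quotient with a square as denominator has a positive numerator; at
  \<open>\<tau> = a/c\<close> the height is 0 by division by zero.\<close>

lemma eventually_upper_at_cusp: "eventually (\<lambda>\<tau>. Im \<tau> > 0) (at_cusp a c)"
proof -
  have "eventually (\<lambda>\<tau>. cusp_height a c \<tau> > 0) (at_cusp a c)"
    using filterlim_cusp_height by (simp add: filterlim_at_top_dense)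
  then show ?thesis
    by (rule eventually_mono) (auto simp: cusp_height_def zero_less_divide_iff)
qed

lemma hexpF_at_infinity:
  assumes "a \<noteq> 0"
  shows "(hexpF \<longlongrightarrow> 0) (at_cusp a 0)"
proof -
  have "filterlim (\<lambda>\<tau>. (of_int a)\<^sup>2 * cusp_height a 0 \<tau>) at_top (at_cusp a 0)"
    by (rule filterlim_tendsto_pos_mult_at_top[OF tendsto_const _ filterlim_cusp_height]) (use assms in simp)
  then show ?thesis
    by (rule at_0_hexpF[of _ _ "\<lambda>\<tau>. \<tau>"]) (use assms in \<open>simp add: cusp_height_def\<close>)
qed

lemma hexp_integral:
  assumes "Im z > 0" "Im \<tau> > 0"
  shows "contour_integral (linepath z \<tau>) hexp_integrand = hexpF \<tau> - hexpF z"
proof -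
  have "(hexp_integrand has_contour_integral (hexpF (pathfinish (linepath z \<tau>)) - hexpF (pathstart (linepath z \<tau>)))) (linepath z \<tau>)"
  proof (rule contour_integral_primitive)
    show "(hexpF has_field_derivative hexp_integrand w) (at w within {z. Im z > 0})" if "w \<in> {z. Im z > 0}" for w
      by (rule has_field_derivative_at_within[OF hexpF_deriv]) (use that in simp)
    show "path_image (linepath z \<tau>) \<subseteq> {z. Im z > 0}"
      using closed_segment_subset[OF _ _ convex_upper, of z \<tau>] assms by simp
  qed simp
  then show ?thesis by (simp add: contour_integral_unique)
qed

lemma hexp_tendsto:
  assumes "Im \<tau> > 0"
  shows "((\<lambda>z. contour_integral (linepath z \<tau>) hexp_integrand) \<longlongrightarrow> hexpF \<tau>) (at_cusp 1 0)"
proof -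
  have "((\<lambda>z. hexpF \<tau> - hexpF z) \<longlongrightarrow> hexpF \<tau> - 0) (at_cusp 1 0)"
    by (intro tendsto_intros hexpF_at_infinity) simp
  moreover have "eventually (\<lambda>z. hexpF \<tau> - hexpF z = contour_integral (linepath z \<tau>) hexp_integrand) (at_cusp 1 0)"
    using eventually_upper_at_cusp by (rule eventually_mono) (use hexp_integral assms in simp)
  ultimately show ?thesis using tendsto_cong by force
qed

lemma hexp_eq: "Im \<tau> > 0 \<Longrightarrow> hexp \<tau> = hexpF \<tau>"
  unfolding hexp_def by (rule tendsto_Lim[OF at_cusp_neq_bot hexp_tendsto]) simp_all

text \<open>\<open>B\<close> is the inverse of \<open>A\<close> and carries the horoballs at
  \<open>a/c\<close> to half-planes at infinity, since \<open>Im (mact B \<tau>)\<close> is the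
  height. There the primitive tends to 0, and \<open>A\<close> adds \<open>s\<close>.\<close>

lemma hexp_tendsto_cusp:
  assumes det: "a * d - b * c = 1" and s: "hexp_shift (psl_class (mat2 a b c d)) s"
  shows "(hexp \<longlongrightarrow> s) (at_cusp a c)"
proof -
  define A where "A = mat2 a b c d"
  define B where "B = mat2 d (-b) (-c) a"
  have dA: "det A = 1" "det B = 1" "d * a - (- b) * (- c) = 1" using det by (simp_all add: A_def B_def algebra_simps)
  have ht: "Im (mact B \<tau>) = cusp_height a c \<tau>" for \<tau>
  proof -
    have "cmod (of_int (- c) * \<tau> + of_int a) = cmod (of_int c * \<tau> - of_int a)"
      by (metis norm_minus_commute diff_conv_add_uminus add.commute mult_minus_left of_int_minus)
    then show ?thesis unfolding B_def Im_mact[OF dA(3)] cusp_height_def by simp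
  qed
  have "((\<lambda>\<tau>. hexpF (mact B \<tau>)) \<longlongrightarrow> 0) (at_cusp a c)"
    by (rule at_0_hexpF[OF filterlim_cusp_height ht])
  then have "((\<lambda>\<tau>. hexpF (mact B \<tau>) + s) \<longlongrightarrow> 0 + s) (at_cusp a c)" by (intro tendsto_intros)
  moreover have "eventually (\<lambda>\<tau>. hexpF (mact B \<tau>) + s = hexp \<tau>) (at_cusp a c)"
    using eventually_upper_at_cusp
  proof (rule eventually_mono)
    fix \<tau> :: complex assume \<tau>: "Im \<tau> > 0"
    have "A ** B = mat 1" using det by (simp add: A_def B_def mat_1_eq algebra_simps)
    then have "mact A (mact B \<tau>) = \<tau>" using mact_mult[OF dA(2) \<tau>, of A] by (simp add: mat_1_eq)
    moreover have "hexpF (mact A (mact B \<tau>)) = hexpF (mact B \<tau>) + s"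
      using s mact_upper[OF dA(2) \<tau>] unfolding A_def[symmetric] hexp_shift_class[OF dA(1)] by blast
    ultimately show "hexpF (mact B \<tau>) + s = hexp \<tau>" using hexp_eq[OF \<tau>] by simp
  qed
  ultimately show ?thesis using tendsto_cong by force
qed

section \<open>The series at a finite cusp\<close>

definition cusp_coeff :: "int \<Rightarrow> int \<Rightarrow> nat \<Rightarrow> complex" where
  "cusp_coeff a c n = 12 * of_real C_hexp / (\<i> * of_real pi) *
     (of_int (psi n) / of_nat n * exp (\<i> * of_real pi / 12 * (of_int a / of_int c)) ^ n)"

lemma dhexp_term_eq: "c \<noteq> 0 \<Longrightarrow> dhexp_term a c k = cusp_coeff a c (Suc k)"
  by (simp only: dhexp_term_def cusp_coeff_def q24_cusp_def if_False exp_of_nat_mult[symmetric] mult.commute)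

lemma norm_q_cusp: "cmod (exp (\<i> * of_real pi / 12 * (of_int a / of_int c))) = 1"
  by simp

text \<open>The point at height \<open>y\<close> above \<open>a/c\<close> corresponds to the Abel
  mean with parameter \<open>e^(- pi y / 12)\<close>.\<close>

lemma hexpF_vertical:
  assumes "c \<noteq> 0" "y > 0"
  shows "(\<lambda>n. cusp_coeff a c n * of_real (exp (- (pi * y / 12))) ^ n) sums hexpF (of_int a / of_int c + \<i> * of_real y)"
proof -
  define w where "w = exp (\<i> * of_real pi / 12 * (of_int a / of_int c))"
  define \<tau> where "\<tau> = of_int a / of_int c + \<i> * complex_of_real y"
  have \<tau>: "Im \<tau> > 0" using assms by (simp add: \<tau>_def)
  have exponent: "2 * of_real pi * \<i> * (r + \<i> * of_real y) / 24 = \<i> * of_real pi / 12 * r + of_real (- (pi * y / 12))" for r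
    by (simp add: field_simps)
  have t: "tau24 \<tau> = w * of_real (exp (- (pi * y / 12)))"
    unfolding tau24_def w_def \<tau>_def exp_of_real[symmetric] exp_add[symmetric]
    by (simp only: exponent)
  have "(\<lambda>n. of_int (psi n) / of_nat n * tau24 \<tau> ^ n) sums hexp_series (tau24 \<tau>)"
    unfolding hexp_series_def by (rule summable_sums[OF hexp_series_summable[OF tau24_bounds(1)[OF \<tau>]]])
  from sums_mult[OF this, of "12 * of_real C_hexp / (\<i> * of_real pi)"]
  have "(\<lambda>n. 12 * of_real C_hexp / (\<i> * of_real pi) * (of_int (psi n) / of_nat n * tau24 \<tau> ^ n)) sums hexpF \<tau>"
    by (simp only: hexpF_def)
  moreover have "12 * of_real C_hexp / (\<i> * of_real pi) * (of_int (psi n) / of_nat n * tau24 \<tau> ^ n)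
      = cusp_coeff a c n * of_real (exp (- (pi * y / 12))) ^ n" for n
    unfolding t cusp_coeff_def w_def[symmetric] power_mult_distrib by (simp only: mult.assoc)
  ultimately show ?thesis by (simp only: \<tau>_def)
qed

text \<open>The limit at the cusp, taken vertically, is the Abel limit. As \<open>n\<close> times
  the coefficient is a constant times \<open>psi n * w^n\<close> with a root of unity
  \<open>w\<close>, \<open>psi_twisted_sum_small\<close> supplies the remaining hypothesis of
  Tauber's second theorem.\<close>

theorem cusp_coeff_sums:
  assumes c: "c \<noteq> 0" and lim: "(hexp \<longlongrightarrow> s) (at_cusp a c)"
  shows "cusp_coeff a c sums s"
proof (rule tauber_second)
  define w where "w = exp (\<i> * of_real pi / 12 * (of_int a / of_int c))"
  \<comment> \<open>The height at which the Abel parameter \<open>e^(- pi y / 12)\<close> equals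
    \<open>x\<close>.\<close>
  define y where "y = (\<lambda>x::real. - (12 * ln x / pi))"
  have y: "y x > 0" "exp (- (pi * y x / 12)) = x" if "0 < x" "x < 1" for x
    using that by (simp_all add: y_def divide_neg_pos)
  have ser: "(\<lambda>n. cusp_coeff a c n * of_real x ^ n) sums hexpF (of_int a / of_int c + \<i> * of_real (y x))"
    if "0 < x" "x < 1" for x :: real
    using hexpF_vertical[OF c y(1)[OF that], of a] unfolding y(2)[OF that] .
  show "summable (\<lambda>n. cusp_coeff a c n * of_real x ^ n)" if "0 < x" "x < 1" for x :: real
    using ser[OF that] by (rule sums_summable)
  have ev: "eventually (\<lambda>x::real. 0 < x \<and> x < 1) (at_left 1)"
    by (rule eventually_at_leftI[of 0]) auto
  have "(y \<longlongrightarrow> - (12 * ln 1 / pi)) (at_left 1)" unfolding y_def by (intro tendsto_intros) auto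
  then have "((\<lambda>x. of_int c ^ 2 * y x) \<longlongrightarrow> of_int c ^ 2 * 0) (at_left 1)" by (intro tendsto_intros) simp
  then have "((\<lambda>x. of_int c ^ 2 * y x) \<longlongrightarrow> 0) (at_left 1)" by simp
  moreover have "eventually (\<lambda>x. 0 < of_int c ^ 2 * y x) (at_left 1)"
    using ev by (rule eventually_mono) (use c y in auto)
  ultimately have inv: "filterlim (\<lambda>x. inverse (of_int c ^ 2 * y x)) at_top (at_left 1)"
    by (rule filterlim_inverse_at_top)
  have "filterlim (\<lambda>x. of_int a / of_int c + \<i> * of_real (y x)) (at_cusp a c) (at_left 1)"
    unfolding at_cusp_eq filterlim_filtercomap_iff o_def
  proof (rule filterlim_cong[OF refl refl, THEN iffD2, OF _ inv])
    show "eventually (\<lambda>x. cusp_height a c (of_int a / of_int c + \<i> * of_real (y x)) = inverse (of_int c ^ 2 * y x)) (at_left 1)"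
      using ev by (rule eventually_mono) (use cusp_height_vertical[OF c y(1)] in \<open>simp add: inverse_eq_divide\<close>)
  qed
  from filterlim_compose[OF lim this]
  have "((\<lambda>x. hexp (of_int a / of_int c + \<i> * of_real (y x))) \<longlongrightarrow> s) (at_left 1)" .
  moreover have "eventually (\<lambda>x. hexp (of_int a / of_int c + \<i> * of_real (y x)) = suminf (\<lambda>n. cusp_coeff a c n * of_real x ^ n)) (at_left 1)"
    using ev
  proof (rule eventually_mono)
    fix x :: real assume x: "0 < x \<and> x < 1"
    have "hexp (of_int a / of_int c + \<i> * of_real (y x)) = hexpF (of_int a / of_int c + \<i> * of_real (y x))"
      by (rule hexp_eq) (use y(1) x in simp)
    then show "hexp (of_int a / of_int c + \<i> * of_real (y x)) = suminf (\<lambda>n. cusp_coeff a c n * of_real x ^ n)"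
      using sums_unique[OF ser] x by simp
  qed
  ultimately show "((\<lambda>x. suminf (\<lambda>n. cusp_coeff a c n * of_real x ^ n)) \<longlongrightarrow> s) (at_left (1::real))"
    by (rule Lim_transform_eventually)
  define K where "K = 12 * of_real C_hexp / (\<i> * complex_of_real pi)"
  \<comment> \<open>\<open>w\<close> is \<open>exp (2 pi i a / (24 c))\<close>; the factor 24 also
    makes \<open>Q\<close> divisible by 12.\<close>
  define Q where "Q = 24 * nat \<bar>c\<bar>"
  have "w ^ Q = 1"
  proof -
    have "w ^ Q = exp (of_nat Q * (\<i> * of_real pi / 12 * (of_int a / of_int c)))"
      unfolding w_def by (rule exp_of_nat_mult[symmetric])
    also have "of_nat Q = (24 * of_int \<bar>c\<bar> :: complex)" by (simp add: Q_def)
    also have "of_int \<bar>c\<bar> = (of_int (sgn c) * of_int c :: complex)" by (simp flip: of_int_mult add: abs_sgn mult.commute)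
    also have "24 * (of_int (sgn c) * of_int c) * (\<i> * of_real pi / 12 * (of_int a / of_int c)) = \<i> * (of_int (2 * (sgn c * a)) * of_real pi)"
      using c by simp
    also have "exp \<dots> = 1"
      using exp_integer_2pi[of "of_int (sgn c * a)"] by (simp add: mult_ac)
    finally show ?thesis .
  qed
  then have "(\<lambda>N. (\<Sum>n\<le>N. of_int (psi n) * w ^ n) / of_nat N) \<longlonglongrightarrow> 0"
    by (rule psi_twisted_sum_small) (use c in \<open>auto simp: Q_def\<close>)
  then have "(\<lambda>N. K * ((\<Sum>n\<le>N. of_int (psi n) * w ^ n) / of_nat N)) \<longlonglongrightarrow> 0"
    by (rule tendsto_mult_right_zero)
  moreover have "of_nat n * cusp_coeff a c n = K * (of_int (psi n) * w ^ n)" for n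
    by (cases "n = 0") (simp_all add: cusp_coeff_def w_def K_def psi_0)
  ultimately show "(\<lambda>N. (\<Sum>n\<le>N. of_nat n * cusp_coeff a c n) / of_nat N) \<longlonglongrightarrow> 0"
    by (simp add: sum_distrib_left)
qed

lemma hexpS_nonzero: "hexpS \<noteq> 0"
  by (simp add: hexpS_eq abs_omega0_def)

text \<open>Absolute convergence would bound \<open>hexpF\<close> on the upper half-plane, but \<open>matX\<close> acts on it by a nonzero translation.\<close>
theorem cusp_coeff_not_absolutely_summable:
  shows "\<not> summable (\<lambda>n. norm (cusp_coeff a c n))"
proof
  assume sm: "summable (\<lambda>n. norm (cusp_coeff a c n))"
  define K where "K = 12 * of_real C_hexp / (\<i> * complex_of_real pi)"
  have nc: "norm (cusp_coeff a c n) = norm (K * (of_int (psi n) / of_nat n))" for n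
    unfolding cusp_coeff_def K_def norm_mult norm_power norm_q_cusp by simp
  define B where "B = suminf (\<lambda>n. norm (cusp_coeff a c n))"
  have bd: "cmod (hexpF \<tau>) \<le> B" if \<tau>: "Im \<tau> > 0" for \<tau>
  proof -
    have t: "cmod (tau24 \<tau>) < 1" by (rule tau24_bounds(1)[OF \<tau>])
    define f where "f = (\<lambda>n. K * (of_int (psi n) / of_nat n * tau24 \<tau> ^ n))"
    have fb: "norm (f n) \<le> norm (cusp_coeff a c n)" for n
    proof -
      have "cmod (tau24 \<tau>) ^ n \<le> 1" using t by (intro power_le_one) auto
      then have "norm (K * (of_int (psi n) / of_nat n)) * cmod (tau24 \<tau>) ^ n \<le> norm (K * (of_int (psi n) / of_nat n)) * 1"
        by (intro mult_left_mono) auto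
      then show ?thesis unfolding nc f_def by (simp add: norm_mult norm_power norm_divide)
    qed
    have "hexpF \<tau> = suminf f"
      unfolding hexpF_def hexp_series_def f_def K_def by (rule suminf_mult[symmetric, OF hexp_series_summable[OF t]])
    also have "cmod \<dots> \<le> B" unfolding B_def by (rule norm_suminf_le[OF fb sm])
    finally show ?thesis .
  qed
  have "of_nat k * cmod hexpS \<le> 2 * B" for k :: nat
  proof -
    have sh: "hexp_shift (pX [^]\<^bsub>PSL2Z\<^esub> k) (of_nat k * (zeta6 * hexpS))"
      by (rule hexp_shift_nat_pow[OF hexp_shift_pX])
    then obtain A where A: "pX [^]\<^bsub>PSL2Z\<^esub> k = psl_class A" "det A = 1" by (auto simp: hexp_shift_def carrier_PSL2Z)
    have "hexpF (mact A \<i>) = hexpF \<i> + of_nat k * (zeta6 * hexpS)"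
      using sh unfolding A(1) hexp_shift_class[OF A(2)] by simp
    then have e: "of_nat k * (zeta6 * hexpS) = hexpF (mact A \<i>) - hexpF \<i>" by simp
    have "cmod zeta6 = 1" by (simp add: zeta6_def)
    then have "of_nat k * cmod hexpS = cmod (of_nat k * (zeta6 * hexpS))" by (simp add: norm_mult)
    also have "\<dots> \<le> B + B" unfolding e
      by (rule order_trans[OF norm_triangle_ineq4 add_mono]) (auto intro!: bd mact_upper A(2))
    finally show ?thesis by simp
  qed
  moreover obtain k :: nat where "2 * B < of_nat k * cmod hexpS"
    using reals_Archimedean3[of "cmod hexpS"] hexpS_nonzero by auto
  ultimately show False by (metis not_le)
qed

text \<open>For \<open>c = 0\<close> all terms of the series vanish, so the failure of absolute
  convergence is asserted for \<open>c \<noteq> 0\<close>.\<close>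

theorem theorem4p2:
  fixes a c :: int
  assumes "coprime a c"
  shows
    "(\<exists>b d. mat2 a b c d \<in> carrier SL2Z \<and> psl_class (mat2 a b c d) \<in> PSL2Z') \<and>
     (\<forall>\<tau>. Im \<tau> > 0 \<longrightarrow>
        ((\<lambda>z. contour_integral (linepath z \<tau>) hexp_integrand) \<longlongrightarrow> hexp \<tau>) (at_cusp 1 0)) \<and>
     (hexp \<longlongrightarrow> dhexp a c) (at_cusp a c) \<and>
     dhexp_term a c sums dhexp a c \<and>
     (c \<noteq> 0 \<longrightarrow> \<not> summable (\<lambda>k. norm (dhexp_term a c k))) \<and>
     (\<forall>b d. mat2 a b c d \<in> carrier SL2Z \<and> psl_class (mat2 a b c d) \<in> PSL2Z' \<longrightarrow>
        (\<exists>m n. congruent_XY (mat2 a b c d) m n) \<and>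
        (\<forall>m n. congruent_XY (mat2 a b c d) m n \<longrightarrow>
           dhexp a c = of_real abs_omega0 *
             (of_int m * exp (- \<i> * of_real pi / 6) + of_int n * exp (\<i> * of_real pi / 6))))"
proof -
  have ex: "\<exists>b d. mat2 a b c d \<in> carrier SL2Z \<and> psl_class (mat2 a b c d) \<in> PSL2Z'"
    by (rule derived_column_exists[OF assms])
  \<comment> \<open>Any second column with a known shift determines the limit, and limits along the
    filter are unique, so all choices give the same value.\<close>
  have lim: "(hexp \<longlongrightarrow> s) (at_cusp a c)" and dh: "dhexp a c = s"
    if "det (mat2 a b c d) = 1" "hexp_shift (psl_class (mat2 a b c d)) s" for b d s
  proof -
    show "(hexp \<longlongrightarrow> s) (at_cusp a c)" by (rule hexp_tendsto_cusp) (use that in auto)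
    then show "dhexp a c = s" unfolding dhexp_def by (rule tendsto_Lim[OF at_cusp_neq_bot[OF assms]])
  qed
  have L: "(hexp \<longlongrightarrow> dhexp a c) (at_cusp a c)"
  proof -
    obtain b d where bd: "det (mat2 a b c d) = 1" "psl_class (mat2 a b c d) \<in> PSL2Z'" using ex by auto
    obtain s where "hexp_shift (psl_class (mat2 a b c d)) s" using hexp_shift_exists[OF bd(2)] ..
    then show ?thesis using lim[OF bd(1)] dh[OF bd(1)] by simp
  qed
  have S: "dhexp_term a c sums dhexp a c"
  proof (cases "c = 0")
    \<comment> \<open>At infinity every term of the series is 0, and so is the limit of the
      primitive.\<close>
    case True
    then have "a \<noteq> 0" using assms by auto
    have "eventually (\<lambda>\<tau>. hexpF \<tau> = hexp \<tau>) (at_cusp a 0)"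
      using eventually_upper_at_cusp by (rule eventually_mono) (simp add: hexp_eq)
    then have "(hexp \<longlongrightarrow> 0) (at_cusp a 0)"
      using hexpF_at_infinity[OF \<open>a \<noteq> 0\<close>] by (rule Lim_transform_eventually[rotated])
    then have "dhexp a c = 0" using tendsto_unique[OF at_cusp_neq_bot[OF assms] L] True by simp
    moreover have "dhexp_term a c = (\<lambda>k. 0)" by (rule ext) (simp add: dhexp_term_def q24_cusp_def True)
    ultimately show ?thesis by simp
  next
    case False
    have "(\<lambda>k. cusp_coeff a c (Suc k)) sums (dhexp a c - cusp_coeff a c 0)"
      using cusp_coeff_sums[OF False L] by (simp add: sums_Suc_iff)
    moreover have "cusp_coeff a c 0 = 0" by (simp add: cusp_coeff_def)
    ultimately show ?thesis by (simp add: dhexp_term_eq[OF False, abs_def])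
  qed
  have NA: "\<not> summable (\<lambda>k. norm (dhexp_term a c k))" if "c \<noteq> 0"
    using cusp_coeff_not_absolutely_summable[of a c] summable_Suc_iff[of "\<lambda>n. norm (cusp_coeff a c n)"]
    by (simp add: dhexp_term_eq[OF that])
  have V: "dhexp a c = of_real abs_omega0 * (of_int m * exp (- \<i> * of_real pi / 6) + of_int n * exp (\<i> * of_real pi / 6))"
    if "det (mat2 a b c d) = 1" "congruent_XY (mat2 a b c d) m n" for b d m n
  proof -
    have "dhexp a c = of_int m * (zeta6 * hexpS) + of_int n * (zeta6 ^ 2 * hexpS)"
      by (rule dh[OF that(1) hexp_shift_congruent[OF that]])
    then show ?thesis unfolding hexpS_zeta6 by (simp only: distrib_left mult.left_commute)
  qed
  show ?thesis
  proof (intro conjI allI impI)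
    fix \<tau> :: complex assume "Im \<tau> > 0"
    then show "((\<lambda>z. contour_integral (linepath z \<tau>) hexp_integrand) \<longlongrightarrow> hexp \<tau>) (at_cusp 1 0)"
      using hexp_tendsto hexp_eq by simp
  next
    fix b d assume "mat2 a b c d \<in> carrier SL2Z \<and> psl_class (mat2 a b c d) \<in> PSL2Z'"
    then show "\<exists>m n. congruent_XY (mat2 a b c d) m n" by (intro congruent_XY_exists) simp
  next
    fix b d m n
    assume "mat2 a b c d \<in> carrier SL2Z \<and> psl_class (mat2 a b c d) \<in> PSL2Z'" "congruent_XY (mat2 a b c d) m n"
    then show "dhexp a c = of_real abs_omega0 * (of_int m * exp (- \<i> * of_real pi / 6) + of_int n * exp (\<i> * of_real pi / 6))"
      by (intro V) auto
  qed (use ex L S NA in auto)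
qed

end
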